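(* Let $(\Omega,\mathcal E,\mathbb P)$ be a probability space, $\mathcal F\subset\mathcal E$ a sub-$\sigma$-algebra, $\mathscr X$ a model module (see context), and $\rho:\mathscr X\to L^0(\mathcal F)$ a conditional risk measure. Then $\rho$ is representable, i.e. $$\rho(x)=\sup\{\mathbb E_{\mathbb P}[xy|\mathcal F]-\rho^\#(y): y\in\mathscr X^\#,\ y\le 0,\ \mathbb E_{\mathbb P}[y|\mathcal F]=-1\}\quad\text{for all }x\in\mathscr X,$$ if and only if $\rho$ is lower semicontinuous w.r.t. $\sigma_s(\mathscr X,\mathscr X^\#)$. In that case, the following are equivalent: 1. $\rho$ attains its representation, i.e. for every $x\in\mathscr X$ there exists $y\in\mathscr X^\#$ with $y\le0$ and $\mathbb E_{\mathbb P}[y|\mathcal F]=-1$ such that $\rho(x)=\mathbb E_{\mathbb P}[xy|\mathcal F]-\rho^\#(y)$; 2. $\rho$ has the Lebesgue property; 3. $\rho^\#$ is stably inf-compact w.r.t. $\sigma_s(\mathscr X^\#,\mathscr X)$.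
   Context: $L^0(\mathcal E)$ is the space of real-valued $\mathcal E$-measurable random variables modulo a.s. equality; $x\le y$, $x<y$ are understood a.s. $L^0(\mathcal F)$ is defined likewise; $L^0_{++}(\mathcal F)$ and $\overline{L^0}(\mathcal F)$ are the (classes of) $\mathcal F$-measurable random variables with values in $(0,\infty)$ and $[-\infty,\infty]$. Suprema of families in $\overline{L^0}(\mathcal F)$ are essential suprema. $\bar{\mathcal F}$ is the Boolean algebra of events of $\mathcal F$ modulo null sets, $I$ its unity (class of $\Omega$), $p(I)$ the set of (countable) partitions of $I$ in $\bar{\mathcal F}$; for $a\in\bar{\mathcal F}$, $1_a$ is the class of the characteristic function of a representative of $a$. For $(a_k)_{k\in\mathbb N}\in p(I)$ and a sequence $(x_k)$, $\sum1_{a_k}x_k:=\lim_k\sum_{i=1}^k1_{a_i}x_i$ a.s. The extended conditional expectation is $\mathbb E_{\mathbb P}[x|\mathcal F]:=\lim_n\mathbb E_{\mathbb P}[x^+\wedge n|\mathcal F]-\lim_n\mathbb E_{\mathbb P}[x^-\wedge n|\mathcal F]\in\overline{L^0}(\mathcal F)$ whenever at least one of the limits is finite. $L^1_{\mathcal F}(\mathcal E):=\{x\in L^0(\mathcal E):\mathbb E_{\mathbb P}[|x||\mathcal F]<\infty\}$. A *model module* is an $L^0(\mathcal F)$-submodule $\mathscr X$ of $L^0(\mathcal E)$ that is solid ($y\in\mathscr X$, $|x|\le|y|$ imply $x\in\mathscr X$), is contained in $L^1_{\mathcal F}(\mathcal E)$, contains $L^0(\mathcal F)$, and is stable ($\sum1_{a_k}x_k\in\mathscr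 X$ for $(a_k)\in p(I)$, $(x_k)\subset\mathscr X$). A *conditional risk measure* is $\rho:\mathscr X\to L^0(\mathcal F)$ with: $\rho(\eta x+(1-\eta)y)\le\eta\rho(x)+(1-\eta)\rho(y)$ for $\eta\in L^0(\mathcal F)$, $0\le\eta\le1$, $x,y\in\mathscr X$; $x\le y$ implies $\rho(y)\le\rho(x)$; $\rho(x+\eta)=\rho(x)-\eta$ for $\eta\in L^0(\mathcal F)$, $x\in\mathscr X$. Köthe dual module: $\mathscr X^\#:=\{y\in L^0(\mathcal E):xy\in L^1_{\mathcal F}(\mathcal E)\ \forall x\in\mathscr X\}$. Fenchel transform: $\rho^\#(y):=\sup\{\mathbb E_{\mathbb P}[xy|\mathcal F]-\rho(x):x\in\mathscr X\}\in\overline{L^0}(\mathcal F)$ for $y\in\mathscr X^\#$. Lebesgue property: $\lim_nx_n=x$ a.s. ($x_n,x\in\mathscr X$), $y\in\mathscr X$, $|x_n|\le y$ for all $n$ imply $\lim_n\rho(x_n)=\rho(x)$ a.s. Stable weak topology $\sigma_s(\mathscr X,\mathscr X^\#)$ on $\mathscr X$: it has as base the sets $x+U_{(F_k),(a_k),\varepsilon}$, $x\in\mathscr X$, $(a_k)\in p(I)$, $F_k\subset\mathscr X^\#$ non-empty finite, $\varepsilon\in L^0_{++}(\mathcal F)$, where $U_{(F_k),(a_k),\varepsilon}:=\{x\in\mathscr X:\sum1_{a_k}\sup_{y\in F_k}|\mathbb E_{\mathbb P}[xy|\mathcal F]|<\varepsilon\}$. $\sigma_s(\mathscr X^\#,\mathscr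 X)$ on $\mathscr X^\#$ is defined analogously with the roles of $\mathscr X$ and $\mathscr X^\#$ exchanged. Sublevel sets: $V_\eta(f):=\{x:f(x)\le\eta\}$, $\eta\in L^0(\mathcal F)$. $\rho$ is lower semicontinuous w.r.t. $\sigma_s(\mathscr X,\mathscr X^\#)$ if $V_\eta(\rho)$ is closed for every $\eta\in L^0(\mathcal F)$. A non-empty $S\subset L^0(\mathcal E)$ is stable if $\sum1_{a_k}x_k\in S$ for all $(x_k)\subset S$, $(a_k)\in p(I)$. A collection $\mathscr B$ of non-empty subsets of $L^0(\mathcal E)$ is stable if $\sum1_{a_k}S_k:=\{\sum1_{a_k}x_k:x_k\in S_k\ \forall k\}\in\mathscr B$ for all sequences $(S_k)$ in $\mathscr B$ and $(a_k)\in p(I)$. A stable filter base is a filter base that is a stable collection consisting of stable sets. A non-empty set $S$ is stably compact if it is stable and every stable filter base on $S$ has a cluster point in $S$. $\rho^\#$ is stably inf-compact w.r.t. $\sigma_s(\mathscr X^\#,\mathscr X)$ if $V_\eta(\rho^\#)$ is stably compact w.r.t. this topology for every $\eta\in L^0(\mathcal F)$ with $V_\eta(\rho^\#)\ne\emptyset$. *)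

theory Defs
  imports "HOL-Probability.Probability"
begin

text \<open>
  Elements of \<open>L\<^sup>0\<close> are handled through representatives: a class of random variables is given
  by a measurable function, and all equalities, inequalities and limits are required almost
  everywhere with respect to the ambient measure \<open>M\<close>, whose \<open>\<sigma>\<close>-algebra is \<open>\<E>\<close>. The
  sub-\<open>\<sigma>\<close>-algebra \<open>\<F>\<close> is given by a measure \<open>F\<close> with \<open>subalgebra M F\<close>.
  A set of classes corresponds to a set of functions that is closed under a.e. equality;
  every stable set in the sense of \<open>stable_set\<close> below has this closure property, because any
  version of a countable concatenation has to belong to it.
\<close>

abbreviation L0 :: "'a measure \<Rightarrow> ('a \<Rightarrow> real) set" where
  "L0 M \<equiv> borel_measurable M"

definition cond_exp_ext :: "'a measure \<Rightarrow> 'a measure \<Rightarrow> ('a \<Rightarrow> real) \<Rightarrow> 'a \<Rightarrow> ereal" where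
  "cond_exp_ext M F x = (\<lambda>\<omega>.
     lim (\<lambda>n. ereal (real_cond_exp M F (\<lambda>\<omega>. min (max (x \<omega>) 0) (real n)) \<omega>))
   - lim (\<lambda>n. ereal (real_cond_exp M F (\<lambda>\<omega>. min (max (- x \<omega>) 0) (real n)) \<omega>)))"

definition L1_cond :: "'a measure \<Rightarrow> 'a measure \<Rightarrow> ('a \<Rightarrow> real) set" where
  "L1_cond M F = {x \<in> L0 M. AE \<omega> in M. cond_exp_ext M F (\<lambda>\<omega>. \<bar>x \<omega>\<bar>) \<omega> < \<infinity>}"

definition is_ess_sup ::
  "'a measure \<Rightarrow> 'a measure \<Rightarrow> ('a \<Rightarrow> ereal) set \<Rightarrow> ('a \<Rightarrow> ereal) \<Rightarrow> bool" where
  "is_ess_sup M F A s \<longleftrightarrow>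
     s \<in> borel_measurable F \<and>
     (\<forall>f\<in>A. AE \<omega> in M. f \<omega> \<le> s \<omega>) \<and>
     (\<forall>t\<in>borel_measurable F. (\<forall>f\<in>A. AE \<omega> in M. f \<omega> \<le> t \<omega>) \<longrightarrow> (AE \<omega> in M. s \<omega> \<le> t \<omega>))"

definition ess_sup :: "'a measure \<Rightarrow> 'a measure \<Rightarrow> ('a \<Rightarrow> ereal) set \<Rightarrow> 'a \<Rightarrow> ereal" where
  "ess_sup M F A = (SOME s. is_ess_sup M F A s)"

text \<open>
  Representatives of a countable partition of unity in the Boolean algebra of \<open>\<F>\<close>-events modulo
  null sets; members may be null, so finite partitions are included.
\<close>

definition event_partition :: "'a measure \<Rightarrow> 'a measure \<Rightarrow> (nat \<Rightarrow> 'a set) \<Rightarrow> bool" where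
  "event_partition M F a \<longleftrightarrow> (\<forall>k. a k \<in> sets F) \<and> (AE \<omega> in M. \<exists>!k. \<omega> \<in> a k)"

text \<open>\<open>is_concat M a x z\<close>: \<open>z\<close> is a version of \<open>\<Sum>k. 1\<^bsub>a k\<^esub> x k\<close>.\<close>

definition is_concat ::
  "'a measure \<Rightarrow> (nat \<Rightarrow> 'a set) \<Rightarrow> (nat \<Rightarrow> 'a \<Rightarrow> real) \<Rightarrow> ('a \<Rightarrow> real) \<Rightarrow> bool" where
  "is_concat M a x z \<longleftrightarrow>
     z \<in> L0 M \<and> (AE \<omega> in M. (\<lambda>n. \<Sum>k<n. indicator (a k) \<omega> * x k \<omega>) \<longlonglongrightarrow> z \<omega>)"

definition stable_set :: "'a measure \<Rightarrow> 'a measure \<Rightarrow> ('a \<Rightarrow> real) set \<Rightarrow> bool" where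
  "stable_set M F S \<longleftrightarrow>
     S \<noteq> {} \<and> S \<subseteq> L0 M \<and>
     (\<forall>a x z. event_partition M F a \<and> (\<forall>k. x k \<in> S) \<and> is_concat M a x z \<longrightarrow> z \<in> S)"

definition concat_sets ::
  "'a measure \<Rightarrow> (nat \<Rightarrow> 'a set) \<Rightarrow> (nat \<Rightarrow> ('a \<Rightarrow> real) set) \<Rightarrow> ('a \<Rightarrow> real) set" where
  "concat_sets M a S = {z. \<exists>x. (\<forall>k. x k \<in> S k) \<and> is_concat M a x z}"

definition stable_collection :: "'a measure \<Rightarrow> 'a measure \<Rightarrow> ('a \<Rightarrow> real) set set \<Rightarrow> bool" where
  "stable_collection M F \<B> \<longleftrightarrow>
     (\<forall>S\<in>\<B>. S \<noteq> {} \<and> S \<subseteq> L0 M) \<and>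
     (\<forall>a S. event_partition M F a \<and> (\<forall>k. S k \<in> \<B>) \<longrightarrow> concat_sets M a S \<in> \<B>)"

definition filter_base_on :: "'b set \<Rightarrow> 'b set set \<Rightarrow> bool" where
  "filter_base_on S \<B> \<longleftrightarrow>
     \<B> \<noteq> {} \<and> (\<forall>B\<in>\<B>. B \<noteq> {} \<and> B \<subseteq> S) \<and> (\<forall>B\<in>\<B>. \<forall>C\<in>\<B>. \<exists>D\<in>\<B>. D \<subseteq> B \<inter> C)"

definition stable_filter_base_on ::
  "'a measure \<Rightarrow> 'a measure \<Rightarrow> ('a \<Rightarrow> real) set \<Rightarrow> ('a \<Rightarrow> real) set set \<Rightarrow> bool" where
  "stable_filter_base_on M F S \<B> \<longleftrightarrow>
     filter_base_on S \<B> \<and> stable_collection M F \<B> \<and> (\<forall>B\<in>\<B>. stable_set M F B)"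

definition cluster_point :: "'b topology \<Rightarrow> 'b set set \<Rightarrow> 'b \<Rightarrow> bool" where
  "cluster_point T \<B> x \<longleftrightarrow> (\<forall>B\<in>\<B>. x \<in> T closure_of B)"

definition stably_compact ::
  "'a measure \<Rightarrow> 'a measure \<Rightarrow> ('a \<Rightarrow> real) topology \<Rightarrow> ('a \<Rightarrow> real) set \<Rightarrow> bool" where
  "stably_compact M F T S \<longleftrightarrow>
     stable_set M F S \<and>
     (\<forall>\<B>. stable_filter_base_on M F S \<B> \<longrightarrow> (\<exists>x\<in>S. cluster_point T \<B> x))"

definition model_module :: "'a measure \<Rightarrow> 'a measure \<Rightarrow> ('a \<Rightarrow> real) set \<Rightarrow> bool" where
  "model_module M F X \<longleftrightarrow>
     (\<forall>x\<in>X. \<forall>y\<in>X. (\<lambda>\<omega>. x \<omega> + y \<omega>) \<in> X) \<and>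
     (\<forall>\<eta>\<in>L0 F. \<forall>x\<in>X. (\<lambda>\<omega>. \<eta> \<omega> * x \<omega>) \<in> X) \<and>
     (\<forall>y\<in>X. \<forall>x\<in>L0 M. (AE \<omega> in M. \<bar>x \<omega>\<bar> \<le> \<bar>y \<omega>\<bar>) \<longrightarrow> x \<in> X) \<and>
     X \<subseteq> L1_cond M F \<and>
     L0 F \<subseteq> X \<and>
     stable_set M F X"

text \<open>Compatibility of \<open>\<rho>\<close> with a.e. equality is a consequence of monotonicity.\<close>

definition cond_risk_measure ::
  "'a measure \<Rightarrow> 'a measure \<Rightarrow> ('a \<Rightarrow> real) set \<Rightarrow> (('a \<Rightarrow> real) \<Rightarrow> 'a \<Rightarrow> real) \<Rightarrow> bool" where
  "cond_risk_measure M F X \<rho> \<longleftrightarrow>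
     (\<forall>x\<in>X. \<rho> x \<in> L0 F) \<and>
     (\<forall>\<eta>\<in>L0 F. \<forall>x\<in>X. \<forall>y\<in>X. (AE \<omega> in M. 0 \<le> \<eta> \<omega> \<and> \<eta> \<omega> \<le> 1) \<longrightarrow>
        (AE \<omega> in M. \<rho> (\<lambda>\<omega>. \<eta> \<omega> * x \<omega> + (1 - \<eta> \<omega>) * y \<omega>) \<omega> \<le> \<eta> \<omega> * \<rho> x \<omega> + (1 - \<eta> \<omega>) * \<rho> y \<omega>)) \<and>
     (\<forall>x\<in>X. \<forall>y\<in>X. (AE \<omega> in M. x \<omega> \<le> y \<omega>) \<longrightarrow> (AE \<omega> in M. \<rho> y \<omega> \<le> \<rho> x \<omega>)) \<and>
     (\<forall>\<eta>\<in>L0 F. \<forall>x\<in>X. AE \<omega> in M. \<rho> (\<lambda>\<omega>. x \<omega> + \<eta> \<omega>) \<omega> = \<rho> x \<omega> - \<eta> \<omega>)"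

definition koethe_dual :: "'a measure \<Rightarrow> 'a measure \<Rightarrow> ('a \<Rightarrow> real) set \<Rightarrow> ('a \<Rightarrow> real) set" where
  "koethe_dual M F X = {y \<in> L0 M. \<forall>x\<in>X. (\<lambda>\<omega>. x \<omega> * y \<omega>) \<in> L1_cond M F}"

definition fenchel ::
  "'a measure \<Rightarrow> 'a measure \<Rightarrow> ('a \<Rightarrow> real) set \<Rightarrow> (('a \<Rightarrow> real) \<Rightarrow> 'a \<Rightarrow> real)
    \<Rightarrow> ('a \<Rightarrow> real) \<Rightarrow> 'a \<Rightarrow> ereal" where
  "fenchel M F X \<rho> y =
     ess_sup M F {(\<lambda>\<omega>. cond_exp_ext M F (\<lambda>\<omega>. x \<omega> * y \<omega>) \<omega> - ereal (\<rho> x \<omega>)) | x. x \<in> X}"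

text \<open>
  In \<open>stable_weak_nbhd\<close> and \<open>stable_weak_topology\<close>, the set \<open>X\<close> carries the topology and \<open>Y\<close>
  contains the test elements, so that \<open>\<sigma>\<^sub>s(X, X\<^sup>#)\<close> and \<open>\<sigma>\<^sub>s(X\<^sup>#, X)\<close> are both instances.
  As each \<open>Fs k\<close> is finite, the pointwise supremum is the essential one.
\<close>

definition stable_weak_nbhd ::
  "'a measure \<Rightarrow> 'a measure \<Rightarrow> ('a \<Rightarrow> real) set \<Rightarrow> (nat \<Rightarrow> ('a \<Rightarrow> real) set) \<Rightarrow> (nat \<Rightarrow> 'a set)
    \<Rightarrow> ('a \<Rightarrow> real) \<Rightarrow> ('a \<Rightarrow> real) set" where
  "stable_weak_nbhd M F X Fs a \<epsilon> =
     {x \<in> X. AE \<omega> in M.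
        lim (\<lambda>n. \<Sum>k<n. indicator (a k) \<omega> *
               (SUP y\<in>Fs k. \<bar>cond_exp_ext M F (\<lambda>\<omega>. x \<omega> * y \<omega>) \<omega>\<bar>)) < ereal (\<epsilon> \<omega>)}"

definition stable_weak_topology ::
  "'a measure \<Rightarrow> 'a measure \<Rightarrow> ('a \<Rightarrow> real) set \<Rightarrow> ('a \<Rightarrow> real) set \<Rightarrow> ('a \<Rightarrow> real) topology" where
  "stable_weak_topology M F X Y =
     topology_generated_by
       {(\<lambda>u \<omega>. x \<omega> + u \<omega>) ` stable_weak_nbhd M F X Fs a \<epsilon> | x Fs a \<epsilon>.
          x \<in> X \<and> (\<forall>k. finite (Fs k) \<and> Fs k \<noteq> {} \<and> Fs k \<subseteq> Y) \<and> event_partition M F a \<and>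
          \<epsilon> \<in> L0 F \<and> (AE \<omega> in M. 0 < \<epsilon> \<omega>)}"

definition sublevel ::
  "'a measure \<Rightarrow> ('a \<Rightarrow> real) set \<Rightarrow> (('a \<Rightarrow> real) \<Rightarrow> 'a \<Rightarrow> ereal) \<Rightarrow> ('a \<Rightarrow> real)
    \<Rightarrow> ('a \<Rightarrow> real) set" where
  "sublevel M X f \<eta> = {x \<in> X. AE \<omega> in M. f x \<omega> \<le> ereal (\<eta> \<omega>)}"

definition lower_semicont ::
  "'a measure \<Rightarrow> 'a measure \<Rightarrow> ('a \<Rightarrow> real) set \<Rightarrow> ('a \<Rightarrow> real) topology
    \<Rightarrow> (('a \<Rightarrow> real) \<Rightarrow> 'a \<Rightarrow> ereal) \<Rightarrow> bool" where
  "lower_semicont M F X T f \<longleftrightarrow> (\<forall>\<eta>\<in>L0 F. closedin T (sublevel M X f \<eta>))"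

definition stably_inf_compact ::
  "'a measure \<Rightarrow> 'a measure \<Rightarrow> ('a \<Rightarrow> real) set \<Rightarrow> ('a \<Rightarrow> real) topology
    \<Rightarrow> (('a \<Rightarrow> real) \<Rightarrow> 'a \<Rightarrow> ereal) \<Rightarrow> bool" where
  "stably_inf_compact M F X T f \<longleftrightarrow>
     (\<forall>\<eta>\<in>L0 F. sublevel M X f \<eta> \<noteq> {} \<longrightarrow> stably_compact M F T (sublevel M X f \<eta>))"

definition dual_densities :: "'a measure \<Rightarrow> 'a measure \<Rightarrow> ('a \<Rightarrow> real) set \<Rightarrow> ('a \<Rightarrow> real) set" where
  "dual_densities M F X =
     {y \<in> koethe_dual M F X. (AE \<omega> in M. y \<omega> \<le> 0) \<and> (AE \<omega> in M. cond_exp_ext M F y \<omega> = -1)}"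

definition representable ::
  "'a measure \<Rightarrow> 'a measure \<Rightarrow> ('a \<Rightarrow> real) set \<Rightarrow> (('a \<Rightarrow> real) \<Rightarrow> 'a \<Rightarrow> real) \<Rightarrow> bool" where
  "representable M F X \<rho> \<longleftrightarrow>
     (\<forall>x\<in>X. AE \<omega> in M. ereal (\<rho> x \<omega>) =
        ess_sup M F {(\<lambda>\<omega>. cond_exp_ext M F (\<lambda>\<omega>. x \<omega> * y \<omega>) \<omega> - fenchel M F X \<rho> y \<omega>) | y.
                       y \<in> dual_densities M F X} \<omega>)"

definition attains_representation ::
  "'a measure \<Rightarrow> 'a measure \<Rightarrow> ('a \<Rightarrow> real) set \<Rightarrow> (('a \<Rightarrow> real) \<Rightarrow> 'a \<Rightarrow> real) \<Rightarrow> bool" where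
  "attains_representation M F X \<rho> \<longleftrightarrow>
     (\<forall>x\<in>X. \<exists>y\<in>dual_densities M F X. AE \<omega> in M. ereal (\<rho> x \<omega>) =
        cond_exp_ext M F (\<lambda>\<omega>. x \<omega> * y \<omega>) \<omega> - fenchel M F X \<rho> y \<omega>)"

definition lebesgue_property ::
  "'a measure \<Rightarrow> ('a \<Rightarrow> real) set \<Rightarrow> (('a \<Rightarrow> real) \<Rightarrow> 'a \<Rightarrow> real) \<Rightarrow> bool" where
  "lebesgue_property M X \<rho> \<longleftrightarrow>
     (\<forall>xs x y. (\<forall>n. xs n \<in> X) \<and> x \<in> X \<and> y \<in> X \<and>
        (AE \<omega> in M. (\<lambda>n. xs n \<omega>) \<longlonglongrightarrow> x \<omega>) \<and> (\<forall>n. AE \<omega> in M. \<bar>xs n \<omega>\<bar> \<le> y \<omega>) \<longrightarrow>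
        (AE \<omega> in M. (\<lambda>n. \<rho> (xs n) \<omega>) \<longlonglongrightarrow> \<rho> x \<omega>))"

end

theory Submission
  imports Defs
begin

text \<open>
  Separating a point from the acceptance set \<open>{\<rho> \<le> 0}\<close> by a stable weak neighbourhood involves only
  finitely many functionals on each member of a partition. Separation thus takes place in a
  conditional Euclidean space, where the separating functional points to an element of minimal norm;
  after a sign and a normalization argument it becomes a dual density.

  If the representation is attained, then \<open>u \<mapsto> \<rho> (x - u)\<close> has a subgradient in the dual at every
  point. Integrated against a suitable weight in \<open>L\<^sup>0(\<F>)\<close>, this map satisfies the assumptions of
  Simons' argument for James' theorem, which yields continuity from below. The other half of the
  Lebesgue property follows from \<open>2 \<rho> x \<le> \<rho> (x - u) + \<rho> (x + u)\<close>.

  Along a maximal stable filter on a sublevel set of the conjugate, all \<open>E[x y | \<F>]\<close> converge. The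
  limit is \<open>L\<^sup>0(\<F>)\<close>-linear in \<open>x\<close>, continuous along decreasing sequences by the Lebesgue property, and
  therefore represented by a Radon-Nikodym density, which is the required cluster point.

  Conversely, the \<open>\<epsilon>\<close>-maximizers \<open>y\<close> of the representation at \<open>x\<close> form a stable filter base, which lies
  in one sublevel set because testing the conjugate at \<open>2 x\<close> gives \<open>E[x y | \<F>] \<le> \<rho> (2 x) - \<rho> x + \<epsilon>\<close>. A cluster
  point attains the representation.
\<close>

subsection \<open>Extended conditional expectation\<close>

text \<open>Statements hold only up to null sets and the families are uncountable, so an outcome
  cannot be fixed once and for all. Two devices replace that. Stability glues countably many locally
  good choices along a partition, so that one element approximates an essential supremum with a
  random tolerance. Estimates at a fixed outcome use countably many parameters only, such as t =
  1/(k+1), so that their null sets can be united.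

  Elements of \<open>L1_cond\<close> need not be integrable. A strictly positive
  \<open>F\<close>-weight makes them so, which reduces the calculus of conditional expectations to
  the integrable case.

  The complement of a stable set is in general not stable, so a maximal stable filter has no
  ultrafilter dichotomy. Its limits are found in advance, as essential infima of essential suprema;
  the sets of elements near such a limit refine the filter and therefore belong to it.

  The implications from attainment to the Lebesgue property, to compactness and back to attainment
  form a cycle. Representability enters in the last one, where it supplies the
  near-maximizers.\<close>

context finite_measure_subalgebra
begin

abbreviation ce :: "('a \<Rightarrow> real) \<Rightarrow> 'a \<Rightarrow> real" where
  "ce \<equiv> real_cond_exp M F"

lemma L0_subalgebra: "f \<in> borel_measurable F \<Longrightarrow> f \<in> borel_measurable M"
  by (rule measurable_from_subalg[OF subalg])

lemma sets_subalgebra: "A \<in> sets F \<Longrightarrow> A \<in> sets M"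
  using subalg by (auto simp: subalgebra_def)

lemma space_subalgebra: "space F = space M"
  using subalg by (auto simp: subalgebra_def)

text \<open>Both sides are \<open>F\<close>-measurable, so integrals over \<open>F\<close>-events
  decide. Ordinary monotone convergence applies there before and after conditioning; after
  conditioning the sequence increases only almost everywhere.\<close>

lemma nn_cond_exp_monotone_convergence:
  assumes [measurable]: "\<And>n. U n \<in> borel_measurable M" and inc: "\<And>n x. U n x \<le> U (Suc n) x"
  shows "AE x in M. (SUP n. nn_cond_exp M F (U n) x) = nn_cond_exp M F (\<lambda>x. SUP n. U n x) x"
proof (rule nn_cond_exp_charact)
  fix A assume A: "A \<in> sets F"
  have [measurable]: "A \<in> sets M" "A \<in> sets F" using A sets_subalgebra by auto
  have "\<And>n. AE x in M. nn_cond_exp M F (U n) x \<le> nn_cond_exp M F (U (Suc n)) x"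
    by (rule nn_cond_exp_mono) (auto simp: inc)
  then have inc': "AE x in M. \<forall>n. nn_cond_exp M F (U n) x \<le> nn_cond_exp M F (U (Suc n)) x"
    by (simp add: AE_all_countable)
  have "(\<integral>\<^sup>+x\<in>A. (SUP n. nn_cond_exp M F (U n) x) \<partial>M)
      = (\<integral>\<^sup>+x. (SUP n. nn_cond_exp M F (U n) x * indicator A x) \<partial>M)"
    by (intro nn_integral_cong) (simp add: SUP_mult_right_ennreal)
  also have "\<dots> = (SUP n. \<integral>\<^sup>+x. nn_cond_exp M F (U n) x * indicator A x \<partial>M)"
  proof (rule nn_integral_monotone_convergence_SUP_AE)
    show "AE x in M. nn_cond_exp M F (U n) x * indicator A x \<le> nn_cond_exp M F (U (Suc n)) x * indicator A x" for n
      using inc' by eventually_elim (auto intro: mult_right_mono)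
  qed auto
  also have "\<dots> = (SUP n. \<integral>\<^sup>+x. indicator A x * U n x \<partial>M)"
    by (subst mult.commute) (simp add: nn_cond_exp_intg)
  also have "\<dots> = (\<integral>\<^sup>+x. (SUP n. indicator A x * U n x) \<partial>M)"
    by (rule nn_integral_monotone_convergence_SUP[symmetric])
       (auto simp: incseq_Suc_iff le_fun_def intro!: mult_left_mono inc)
  also have "\<dots> = (\<integral>\<^sup>+x\<in>A. (SUP n. U n x) \<partial>M)"
    by (intro nn_integral_cong) (metis SUP_mult_left_ennreal mult.commute)
  finally show "(\<integral>\<^sup>+x\<in>A. (SUP n. U n x) \<partial>M) = (\<integral>\<^sup>+x\<in>A. (SUP n. nn_cond_exp M F (U n) x) \<partial>M)" ..
qed auto

lemma nn_cond_exp_const_0: "AE x in M. nn_cond_exp M F (\<lambda>_. 0) x = 0"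
  using AE_symmetric[OF nn_cond_exp_F_meas[of "\<lambda>_. 0"]] by simp

text \<open>Translates the truncation limits of \<open>cond_exp_ext\<close> into
  \<open>nn_cond_exp\<close>. A truncation at n has conditional expectation at most n, so
  \<open>ce\<close> loses nothing by passing to the reals; conditional monotone convergence does the
  rest. The coercion \<open>ennreal\<close> already cuts off the negative part.\<close>

lemma lim_truncated_cond_exp:
  assumes [measurable]: "f \<in> borel_measurable M"
  shows "AE x in M. lim (\<lambda>n. ereal (ce (\<lambda>\<omega>. min (max (f \<omega>) 0) (real n)) x))
    = enn2ereal (nn_cond_exp M F (\<lambda>\<omega>. ennreal (f \<omega>)) x)"
proof -
  define U where "U n \<omega> = ennreal (min (max (f \<omega>) 0) (real n))" for n \<omega>
  have [measurable]: "\<And>n. U n \<in> borel_measurable M" unfolding U_def by measurable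
  have inc: "U n x \<le> U (Suc n) x" for n x unfolding U_def by (auto intro!: ennreal_leI)
  have sup: "(SUP n. U n x) = ennreal (f x)" for x
  proof -
    obtain N where N: "f x \<le> real N" using real_arch_simple by blast
    have "U N x = ennreal (f x)" using N unfolding U_def
      by (auto simp: min_def max_def ennreal_neg)
    moreover have "U n x \<le> ennreal (f x)" for n unfolding U_def
      by (cases "f x \<ge> 0") (auto intro!: ennreal_leI simp: max_def)
    ultimately show ?thesis by (metis (mono_tags, lifting) SUP_upper UNIV_I antisym SUP_least)
  qed
  have 1: "AE x in M. ereal (ce (\<lambda>\<omega>. min (max (f \<omega>) 0) (real n)) x) = enn2ereal (nn_cond_exp M F (U n) x)" for n
  proof -
    have "AE x in M. nn_cond_exp M F (\<lambda>\<omega>. ennreal (- min (max (f \<omega>) 0) (real n))) x = 0"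
    proof -
      have "(\<lambda>\<omega>. ennreal (- min (max (f \<omega>) 0) (real n))) = (\<lambda>_. 0)"
        by (auto simp: ennreal_neg)
      then show ?thesis using nn_cond_exp_const_0 by simp
    qed
    moreover have "AE x in M. nn_cond_exp M F (U n) x \<le> nn_cond_exp M F (\<lambda>_. ennreal (real n)) x"
      by (rule nn_cond_exp_mono) (auto simp: U_def intro!: ennreal_leI)
    moreover have "AE x in M. ennreal (real n) = nn_cond_exp M F (\<lambda>_. ennreal (real n)) x"
      by (rule nn_cond_exp_F_meas) auto
    ultimately show ?thesis
    proof eventually_elim
      case (elim x)
      then have "nn_cond_exp M F (U n) x \<le> ennreal (real n)" by simp
      then have "nn_cond_exp M F (U n) x < top" by (simp add: le_less_trans)
      moreover have "ce (\<lambda>\<omega>. min (max (f \<omega>) 0) (real n)) x = enn2real (nn_cond_exp M F (U n) x)"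
        using elim unfolding real_cond_exp_def U_def by simp
      ultimately show ?case
        by (metis ennreal_enn2real enn2real_nonneg enn2ereal_ennreal)
    qed
  qed
  have "AE x in M. \<forall>n. ereal (ce (\<lambda>\<omega>. min (max (f \<omega>) 0) (real n)) x) = enn2ereal (nn_cond_exp M F (U n) x)"
    using 1 by (simp add: AE_all_countable)
  moreover have "\<And>n. AE x in M. nn_cond_exp M F (U n) x \<le> nn_cond_exp M F (U (Suc n)) x"
    by (rule nn_cond_exp_mono) (auto simp: inc)
  then have "AE x in M. \<forall>n. nn_cond_exp M F (U n) x \<le> nn_cond_exp M F (U (Suc n)) x"
    by (simp add: AE_all_countable)
  moreover have "AE x in M. (SUP n. nn_cond_exp M F (U n) x) = nn_cond_exp M F (\<lambda>\<omega>. ennreal (f \<omega>)) x"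
    using nn_cond_exp_monotone_convergence[of U] inc sup by simp
  ultimately show ?thesis
  proof eventually_elim
    case (elim x)
    have "(\<lambda>n. nn_cond_exp M F (U n) x) \<longlonglongrightarrow> nn_cond_exp M F (\<lambda>\<omega>. ennreal (f \<omega>)) x"
      using LIMSEQ_SUP[of "\<lambda>n. nn_cond_exp M F (U n) x"] elim by (simp add: incseq_SucI)
    then have "(\<lambda>n. enn2ereal (nn_cond_exp M F (U n) x)) \<longlonglongrightarrow> enn2ereal (nn_cond_exp M F (\<lambda>\<omega>. ennreal (f \<omega>)) x)"
      by (simp add: tendsto_enn2erealI)
    then show ?case using elim by (simp add: limI)
  qed
qed

lemma cond_exp_ext_nn_cond_exp:
  assumes [measurable]: "f \<in> borel_measurable M"
  shows "AE x in M. cond_exp_ext M F f x = enn2ereal (nn_cond_exp M F (\<lambda>\<omega>. ennreal (f \<omega>)) x)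
    - enn2ereal (nn_cond_exp M F (\<lambda>\<omega>. ennreal (- f \<omega>)) x)"
proof -
  have "(\<lambda>x. - f x) \<in> borel_measurable M" by measurable
  from lim_truncated_cond_exp[OF assms] lim_truncated_cond_exp[OF this] show ?thesis
    unfolding cond_exp_ext_def by eventually_elim (simp only:)
qed

lemma cond_exp_ext_measurable [measurable]: "cond_exp_ext M F f \<in> borel_measurable F"
  unfolding cond_exp_ext_def by measurable

section \<open>The conditional L1 space\<close>

lemma L1_cond_iff:
  "f \<in> L1_cond M F \<longleftrightarrow> f \<in> borel_measurable M \<and> (AE x in M. nn_cond_exp M F (\<lambda>\<omega>. ennreal \<bar>f \<omega>\<bar>) x < \<infinity>)"
proof -
  have 1: "AE x in M. cond_exp_ext M F (\<lambda>\<omega>. \<bar>f \<omega>\<bar>) x = enn2ereal (nn_cond_exp M F (\<lambda>\<omega>. ennreal \<bar>f \<omega>\<bar>) x)"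
    if [measurable]: "f \<in> borel_measurable M"
  proof -
    have *: "(\<lambda>\<omega>. ennreal (- \<bar>f \<omega>\<bar>)) = (\<lambda>_. 0)" by (auto simp: ennreal_neg)
    have "(\<lambda>\<omega>. \<bar>f \<omega>\<bar>) \<in> borel_measurable M" by measurable
    from cond_exp_ext_nn_cond_exp[OF this] nn_cond_exp_const_0 show ?thesis
      unfolding * by eventually_elim (simp add: zero_ennreal.rep_eq)
  qed
  have 2: "enn2ereal u < \<infinity> \<longleftrightarrow> u < \<infinity>" for u
    unfolding infinity_ennreal_def less_ennreal.rep_eq by (simp add: top_ennreal.rep_eq top_ereal_def)
  have "AE x in M. cond_exp_ext M F (\<lambda>\<omega>. \<bar>f \<omega>\<bar>) x < \<infinity>
      \<longleftrightarrow> nn_cond_exp M F (\<lambda>\<omega>. ennreal \<bar>f \<omega>\<bar>) x < \<infinity>" if "f \<in> borel_measurable M"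
    using 1[OF that] by eventually_elim (simp only: 2)
  from eventually_subst[OF this] show ?thesis unfolding L1_cond_def by blast
qed

lemma L1_condD [measurable_dest]: "f \<in> L1_cond M F \<Longrightarrow> f \<in> borel_measurable M"
  by (simp add: L1_cond_iff)

text \<open>The weight 1 / (1 + E[|f| | F]) brings the conditional expectation of c |f| below 1.
  This reduces statements about \<open>L1_cond\<close> to integrable functions; the bound by 1 lets
  weights be multiplied.\<close>

lemma L1_cond_weight:
  assumes "f \<in> L1_cond M F"
  obtains c where "c \<in> borel_measurable F" "\<And>x. 0 < c x" "\<And>x. c x \<le> 1" "integrable M (\<lambda>x. c x * f x)"
proof
  define g where "g = nn_cond_exp M F (\<lambda>\<omega>. ennreal \<bar>f \<omega>\<bar>)"
  define c where "c x = 1 / (1 + enn2real (g x))" for x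
  have [measurable]: "g \<in> borel_measurable F" unfolding g_def by measurable
  have [measurable]: "f \<in> borel_measurable M" using assms by (simp add: L1_cond_iff)
  show c: "c \<in> borel_measurable F" unfolding c_def by measurable
  have [measurable]: "c \<in> borel_measurable M" by (rule L0_subalgebra[OF c])
  show pos: "0 < c x" for x unfolding c_def by (simp add: add_pos_nonneg)
  show "c x \<le> 1" for x unfolding c_def by (simp add: divide_le_eq_1 add_pos_nonneg)
  show "integrable M (\<lambda>x. c x * f x)"
  proof (rule integrableI_bounded)
    have "(\<integral>\<^sup>+ x. norm (c x * f x) \<partial>M) = (\<integral>\<^sup>+ x. ennreal (c x) * ennreal \<bar>f x\<bar> \<partial>M)"
      by (intro nn_integral_cong) (use pos in \<open>simp add: abs_mult ennreal_mult less_imp_le abs_of_pos\<close>)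
    also have "\<dots> = (\<integral>\<^sup>+ x. ennreal (c x) * g x \<partial>M)"
      unfolding g_def by (rule nn_cond_exp_intg[symmetric]) (use c in auto)
    also have "\<dots> \<le> (\<integral>\<^sup>+ x. 1 \<partial>M)"
    proof (rule nn_integral_mono_AE)
      have "AE x in M. g x < \<infinity>" using assms unfolding L1_cond_iff g_def by simp
      then show "AE x in M. ennreal (c x) * g x \<le> 1"
      proof eventually_elim
        case (elim x)
        define r where "r = enn2real (g x)"
        have r: "g x = ennreal r" "r \<ge> 0" using elim unfolding r_def by auto
        have "ennreal (c x) * g x = ennreal (c x * r)" using r pos[of x] by (simp add: ennreal_mult less_imp_le)
        also have "c x * r \<le> 1" using r unfolding c_def r_def[symmetric] by simp
        then have "ennreal (c x * r) \<le> 1" by (metis ennreal_1 ennreal_leI)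
        finally show ?case .
      qed
    qed
    also have "\<dots> < \<infinity>" using finite_emeasure_space by (simp add: less_top[symmetric])
    finally show "(\<integral>\<^sup>+ x. norm (c x * f x) \<partial>M) < \<infinity>" .
  qed measurable
qed

text \<open>A finite integral makes the conditional expectation of c |f| finite almost everywhere,
  and a positive factor from \<open>F\<close> does not affect finiteness.\<close>

lemma L1_condI_weight:
  assumes c: "c \<in> borel_measurable F" "\<And>x. 0 < c x" and int: "integrable M (\<lambda>x. c x * f x)"
    and [measurable]: "f \<in> borel_measurable M"
  shows "f \<in> L1_cond M F"
proof -
  have [measurable]: "c \<in> borel_measurable M" by (rule L0_subalgebra[OF c(1)])
  define g where "g = nn_cond_exp M F (\<lambda>\<omega>. ennreal \<bar>f \<omega>\<bar>)"
  have [measurable]: "g \<in> borel_measurable M" unfolding g_def by measurable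
  have "(\<integral>\<^sup>+ x. ennreal (c x) * g x \<partial>M) = (\<integral>\<^sup>+ x. ennreal (c x) * ennreal \<bar>f x\<bar> \<partial>M)"
    unfolding g_def by (rule nn_cond_exp_intg) (use c in auto)
  also have "\<dots> = (\<integral>\<^sup>+ x. norm (c x * f x) \<partial>M)"
    by (intro nn_integral_cong) (use c in \<open>simp add: abs_mult ennreal_mult less_imp_le abs_of_pos\<close>)
  also have "\<dots> < \<infinity>" using int by (simp add: integrable_iff_bounded)
  finally have "AE x in M. ennreal (c x) * g x \<noteq> \<infinity>"
    by (intro nn_integral_PInf_AE) auto
  then have "AE x in M. g x < \<infinity>"
  proof eventually_elim
    case (elim x)
    then show ?case using c(2)[of x] by (auto simp: ennreal_mult_eq_top_iff less_top)
  qed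
  then show ?thesis unfolding L1_cond_iff g_def by simp
qed

text \<open>The positive and the negative part both have finite conditional expectation, so the
  extended difference is the real one. This allows later computations to stay with the real-valued
  \<open>ce\<close>.\<close>

lemma cond_exp_ext_eq_ce:
  assumes "f \<in> L1_cond M F"
  shows "AE x in M. cond_exp_ext M F f x = ereal (ce f x)"
proof -
  have [measurable]: "f \<in> borel_measurable M" using assms by (simp add: L1_cond_iff)
  have "AE x in M. nn_cond_exp M F (\<lambda>\<omega>. ennreal (f \<omega>)) x \<le> nn_cond_exp M F (\<lambda>\<omega>. ennreal \<bar>f \<omega>\<bar>) x"
    by (rule nn_cond_exp_mono) (auto intro!: ennreal_leI)
  moreover have "AE x in M. nn_cond_exp M F (\<lambda>\<omega>. ennreal (- f \<omega>)) x \<le> nn_cond_exp M F (\<lambda>\<omega>. ennreal \<bar>f \<omega>\<bar>) x"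
    by (rule nn_cond_exp_mono) (auto intro!: ennreal_leI)
  moreover have "AE x in M. nn_cond_exp M F (\<lambda>\<omega>. ennreal \<bar>f \<omega>\<bar>) x < \<infinity>"
    using assms by (simp add: L1_cond_iff)
  ultimately show ?thesis using cond_exp_ext_nn_cond_exp[OF \<open>f \<in> borel_measurable M\<close>]
  proof eventually_elim
    case (elim x)
    then have "nn_cond_exp M F (\<lambda>\<omega>. ennreal (f \<omega>)) x < top" "nn_cond_exp M F (\<lambda>\<omega>. ennreal (- f \<omega>)) x < top"
      by auto
    then obtain r s where "nn_cond_exp M F (\<lambda>\<omega>. ennreal (f \<omega>)) x = ennreal r" "r \<ge> 0"
        "nn_cond_exp M F (\<lambda>\<omega>. ennreal (- f \<omega>)) x = ennreal s" "s \<ge> 0"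
      by (metis ennreal_cases less_irrefl)
    then show ?case using elim(4) unfolding real_cond_exp_def by (simp add: enn2ereal_ennreal)
  qed
qed

text \<open>The product of the two weights serves both functions: each factor is at most 1 and
  preserves the integrability gained from the other.\<close>

lemma L1_cond_common_weight:
  assumes "f \<in> L1_cond M F" "g \<in> L1_cond M F"
  obtains c where "c \<in> borel_measurable F" "\<And>x. 0 < c x" "\<And>x. c x \<le> 1"
    "integrable M (\<lambda>x. c x * f x)" "integrable M (\<lambda>x. c x * g x)"
proof -
  obtain c where c: "c \<in> borel_measurable F" "\<And>x. 0 < c x" "\<And>x. c x \<le> 1" "integrable M (\<lambda>x. c x * f x)"
    using L1_cond_weight[OF assms(1)] by blast
  obtain d where d: "d \<in> borel_measurable F" "\<And>x. 0 < d x" "\<And>x. d x \<le> 1" "integrable M (\<lambda>x. d x * g x)"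
    using L1_cond_weight[OF assms(2)] by blast
  have [measurable]: "c \<in> borel_measurable M" "d \<in> borel_measurable M"
    using c(1) d(1) by (auto intro: L0_subalgebra)
  show ?thesis
  proof
    show "(\<lambda>x. c x * d x) \<in> borel_measurable F" using c d by measurable
    show "0 < c x * d x" for x using c d by simp
    show "c x * d x \<le> 1" for x using c(2,3)[of x] d(2,3)[of x] by (simp add: mult_le_one less_imp_le)
    show "integrable M (\<lambda>x. c x * d x * f x)"
    proof (rule Bochner_Integration.integrable_bound[OF c(4)])
      show "AE x in M. norm (c x * d x * f x) \<le> norm (c x * f x)"
      proof (rule AE_I2)
        fix x
        have "\<bar>c x * f x\<bar> * d x \<le> \<bar>c x * f x\<bar> * 1" using d(3)[of x] by (intro mult_left_mono) auto
        then show "norm (c x * d x * f x) \<le> norm (c x * f x)"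
          using d(2)[of x] by (simp add: abs_mult mult_ac)
      qed
    qed (use assms in measurable)
    show "integrable M (\<lambda>x. c x * d x * g x)"
    proof (rule Bochner_Integration.integrable_bound[OF d(4)])
      show "AE x in M. norm (c x * d x * g x) \<le> norm (d x * g x)"
      proof (rule AE_I2)
        fix x
        have "\<bar>d x * g x\<bar> * c x \<le> \<bar>d x * g x\<bar> * 1" using c(3)[of x] by (intro mult_left_mono) auto
        then show "norm (c x * d x * g x) \<le> norm (d x * g x)"
          using c(2)[of x] by (simp add: abs_mult mult_ac)
      qed
    qed (use assms in measurable)
  qed
qed

lemma L1_cond_integrable: "integrable M f \<Longrightarrow> f \<in> L1_cond M F"
  by (rule L1_condI_weight[of "\<lambda>_. 1"]) auto

lemma L1_cond_add:
  assumes "f \<in> L1_cond M F" "g \<in> L1_cond M F"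
  shows "(\<lambda>x. f x + g x) \<in> L1_cond M F"
proof -
  obtain c where c: "c \<in> borel_measurable F" "\<And>x. 0 < c x" "\<And>x. c x \<le> 1"
    "integrable M (\<lambda>x. c x * f x)" "integrable M (\<lambda>x. c x * g x)"
    using L1_cond_common_weight[OF assms] by blast
  have "integrable M (\<lambda>x. c x * (f x + g x))"
    using Bochner_Integration.integrable_add[OF c(4,5)] by (simp add: algebra_simps)
  then show ?thesis using c assms by (intro L1_condI_weight[of c]) (auto dest: L1_condD)
qed

lemma L1_cond_mult:
  assumes f: "f \<in> L1_cond M F" and h: "h \<in> borel_measurable F"
  shows "(\<lambda>x. h x * f x) \<in> L1_cond M F"
proof -
  obtain c where c: "c \<in> borel_measurable F" "\<And>x. 0 < c x" "\<And>x. c x \<le> 1" "integrable M (\<lambda>x. c x * f x)"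
    using L1_cond_weight[OF f] by blast
  have [measurable]: "c \<in> borel_measurable M" "h \<in> borel_measurable M" "f \<in> borel_measurable M"
    using c f h L0_subalgebra L1_condD by auto
  have "integrable M (\<lambda>x. c x / (1 + \<bar>h x\<bar>) * (h x * f x))"
  proof (rule Bochner_Integration.integrable_bound[OF c(4)])
    show "AE x in M. norm (c x / (1 + \<bar>h x\<bar>) * (h x * f x)) \<le> norm (c x * f x)"
    proof (rule AE_I2)
      fix x
      have "\<bar>c x * f x\<bar> * (\<bar>h x\<bar> / (1 + \<bar>h x\<bar>)) \<le> \<bar>c x * f x\<bar> * 1"
        by (intro mult_left_mono) auto
      then show "norm (c x / (1 + \<bar>h x\<bar>) * (h x * f x)) \<le> norm (c x * f x)"
        by (simp add: abs_mult mult_ac)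
    qed
  qed measurable
  then show ?thesis
    by (rule L1_condI_weight[rotated 2]) (use c h in \<open>auto simp: add_pos_nonneg\<close>)
qed

lemma L1_cond_F: "h \<in> borel_measurable F \<Longrightarrow> h \<in> L1_cond M F"
  using L1_cond_mult[of "\<lambda>_. 1" h] L1_cond_integrable[of "\<lambda>_. 1"] by simp

lemma L1_cond_uminus: "f \<in> L1_cond M F \<Longrightarrow> (\<lambda>x. - f x) \<in> L1_cond M F"
  using L1_cond_mult[of f "\<lambda>_. -1"] by simp

lemma L1_cond_sum:
  assumes "\<And>i. i \<in> I \<Longrightarrow> f i \<in> L1_cond M F"
  shows "(\<lambda>x. \<Sum>i\<in>I. f i x) \<in> L1_cond M F"
proof (cases "finite I")
  case True
  then show ?thesis using assms
    by (induction I) (auto intro!: L1_cond_add intro: L1_cond_F[of "\<lambda>_. 0"])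
qed (simp add: L1_cond_F)

text \<open>The weighted functions are integrable, where additivity is known; the weight then leaves
  the conditional expectation as a factor and is cancelled. \<open>ce_mult\<close> follows the same
  pattern with a weight common to f and h f.\<close>

lemma ce_add:
  assumes "f \<in> L1_cond M F" "g \<in> L1_cond M F"
  shows "AE x in M. ce (\<lambda>x. f x + g x) x = ce f x + ce g x"
proof -
  obtain c where c: "c \<in> borel_measurable F" "\<And>x. 0 < c x" "\<And>x. c x \<le> 1"
    "integrable M (\<lambda>x. c x * f x)" "integrable M (\<lambda>x. c x * g x)"
    using L1_cond_common_weight[OF assms] by blast
  have i: "integrable M (\<lambda>x. c x * (f x + g x))"
    using Bochner_Integration.integrable_add[OF c(4,5)] by (simp add: algebra_simps)
  have "AE x in M. ce (\<lambda>x. c x * f x + c x * g x) x = ce (\<lambda>x. c x * f x) x + ce (\<lambda>x. c x * g x) x"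
    by (rule real_cond_exp_add) (use c in auto)
  moreover have "AE x in M. ce (\<lambda>x. c x * f x) x = c x * ce f x"
    by (rule real_cond_exp_mult) (use c assms in \<open>auto dest: L1_condD\<close>)
  moreover have "AE x in M. ce (\<lambda>x. c x * g x) x = c x * ce g x"
    by (rule real_cond_exp_mult) (use c assms in \<open>auto dest: L1_condD\<close>)
  moreover have "AE x in M. ce (\<lambda>x. c x * (f x + g x)) x = c x * ce (\<lambda>x. f x + g x) x"
    by (rule real_cond_exp_mult) (use c assms i in \<open>auto dest: L1_condD\<close>)
  ultimately show ?thesis
  proof eventually_elim
    case (elim x)
    then have "c x * ce (\<lambda>x. f x + g x) x = c x * (ce f x + ce g x)"
      by (simp add: algebra_simps)
    then show ?case using c(2)[of x] by simp
  qed
qed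

lemma ce_mult:
  assumes f: "f \<in> L1_cond M F" and h: "h \<in> borel_measurable F"
  shows "AE x in M. ce (\<lambda>x. h x * f x) x = h x * ce f x"
proof -
  obtain c where c: "c \<in> borel_measurable F" "\<And>x. 0 < c x" "\<And>x. c x \<le> 1"
    "integrable M (\<lambda>x. c x * f x)" "integrable M (\<lambda>x. c x * (h x * f x))"
    using L1_cond_common_weight[OF f L1_cond_mult[OF f h]] by blast
  have [measurable]: "h \<in> borel_measurable M" "f \<in> borel_measurable M" using h L0_subalgebra f L1_condD by auto
  have "AE x in M. ce (\<lambda>x. c x * (h x * f x)) x = c x * ce (\<lambda>x. h x * f x) x"
    by (rule real_cond_exp_mult) (use c in auto)
  moreover have "AE x in M. ce (\<lambda>x. (c x * h x) * f x) x = (c x * h x) * ce f x"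
    by (rule real_cond_exp_mult) (use c h in \<open>auto simp: mult.assoc\<close>)
  ultimately show ?thesis
  proof eventually_elim
    case (elim x)
    then have "c x * ce (\<lambda>x. h x * f x) x = c x * (h x * ce f x)"
      by (simp add: mult.assoc)
    then show ?case using c(2)[of x] by simp
  qed
qed

lemma ce_F: "h \<in> borel_measurable F \<Longrightarrow> AE x in M. ce h x = h x"
proof -
  assume h: "h \<in> borel_measurable F"
  have "AE x in M. ce (\<lambda>x. h x * 1) x = h x * ce (\<lambda>_. 1) x"
    by (rule ce_mult) (auto intro: L1_cond_F h)
  moreover have "AE x in M. ce (\<lambda>_. 1) x = 1" by (rule real_cond_exp_F_meas) auto
  ultimately show ?thesis by eventually_elim simp
qed

lemma ce_uminus: "f \<in> L1_cond M F \<Longrightarrow> AE x in M. ce (\<lambda>x. - f x) x = - ce f x"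
  using ce_mult[of f "\<lambda>_. -1"] by simp

lemma ce_diff:
  assumes "f \<in> L1_cond M F" "g \<in> L1_cond M F"
  shows "AE x in M. ce (\<lambda>x. f x - g x) x = ce f x - ce g x"
  using ce_add[OF assms(1) L1_cond_uminus[OF assms(2)]] ce_uminus[OF assms(2)] by auto

lemma ce_mono:
  assumes "f \<in> L1_cond M F" "g \<in> L1_cond M F" "AE x in M. f x \<le> g x"
  shows "AE x in M. ce f x \<le> ce g x"
proof -
  have "AE x in M. 0 \<le> ce (\<lambda>x. g x - f x) x"
    by (rule real_cond_exp_pos) (use assms L1_condD in auto)
  then show ?thesis using ce_diff[OF assms(2,1)] by auto
qed

text \<open>The indicator of an \<open>F\<close>-event passes through the conditional expectation.
  Locality of the pairing, and through it of the conjugate, rests on this.\<close>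

lemma ce_cong_on:
  assumes f: "f \<in> L1_cond M F" and g: "g \<in> L1_cond M F" and A: "A \<in> sets F"
    and eq: "AE x in M. x \<in> A \<longrightarrow> f x = g x"
  shows "AE x in M. x \<in> A \<longrightarrow> ce f x = ce g x"
proof -
  have [measurable]: "A \<in> sets F" "A \<in> sets M" "f \<in> borel_measurable M" "g \<in> borel_measurable M"
    using A sets_subalgebra f g L1_condD by auto
  have "AE x in M. ce (\<lambda>x. indicator A x * f x) x = ce (\<lambda>x. indicator A x * g x) x"
    by (rule real_cond_exp_cong) (use eq in \<open>auto simp: indicator_def\<close>)
  then show ?thesis
    using ce_mult[OF f, of "indicator A"] ce_mult[OF g, of "indicator A"]
    by (auto simp: indicator_def elim!: eventually_rev_mp)
qed

lemma ce_sum: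
  assumes "\<And>i. i \<in> I \<Longrightarrow> f i \<in> L1_cond M F"
  shows "AE x in M. ce (\<lambda>x. \<Sum>i\<in>I. f i x) x = (\<Sum>i\<in>I. ce (f i) x)"
proof (cases "finite I")
  case True
  then show ?thesis using assms
  proof (induction I)
    case empty
    show ?case using ce_F[of "\<lambda>_. 0"] by simp
  next
    case (insert i I)
    have "AE x in M. ce (\<lambda>x. f i x + (\<Sum>i\<in>I. f i x)) x = ce (f i) x + ce (\<lambda>x. \<Sum>i\<in>I. f i x) x"
      by (rule ce_add) (use insert in \<open>auto intro: L1_cond_sum\<close>)
    moreover have "AE x in M. ce (\<lambda>x. \<Sum>i\<in>I. f i x) x = (\<Sum>i\<in>I. ce (f i) x)"
      using insert by auto
    ultimately show ?case using insert(1,2) by auto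
  qed
qed (use ce_F[of "\<lambda>_. 0"] in simp)

text \<open>Against a positive weight restricted to \<open>B\<close>, \<open>f\<close> and its
  conditional expectation have the same integral, which is nonpositive; a nonnegative integrand then
  vanishes. With p the indicator of a sign set, information on E[p y | F] thus becomes a pointwise
  sign of y.\<close>

lemma ce_nonpos_imp_zero_on:
  assumes f: "f \<in> L1_cond M F" and nn: "AE \<omega> in M. 0 \<le> f \<omega>" and B: "B \<in> sets F"
    and le: "AE \<omega> in M. \<omega> \<in> B \<longrightarrow> ce f \<omega> \<le> 0"
  shows "AE \<omega> in M. \<omega> \<in> B \<longrightarrow> f \<omega> = 0"
proof -
  obtain c where c: "c \<in> borel_measurable F" "\<And>x. 0 < c x" "\<And>x. c x \<le> 1" "integrable M (\<lambda>\<omega>. c \<omega> * f \<omega>)"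
    using L1_cond_weight[OF f] by blast
  have [measurable]: "c \<in> borel_measurable F" "f \<in> borel_measurable M" "B \<in> sets F"
    using c(1) f L1_condD B by auto
  define d where "d \<omega> = indicator B \<omega> * c \<omega>" for \<omega>
  have dF: "d \<in> borel_measurable F" unfolding d_def by measurable
  have "integrable M (\<lambda>\<omega>. indicator B \<omega> *\<^sub>R (c \<omega> * f \<omega>))"
    by (rule integrable_mult_indicator[OF sets_subalgebra[OF B] c(4)])
  then have int: "integrable M (\<lambda>\<omega>. d \<omega> * f \<omega>)" by (simp add: d_def mult.assoc)
  have d0: "0 \<le> d \<omega>" for \<omega> using c(2)[of \<omega>] by (simp add: d_def indicator_def)
  have 1: "(\<integral>\<omega>. d \<omega> * f \<omega> \<partial>M) = (\<integral>\<omega>. d \<omega> * ce f \<omega> \<partial>M)"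
    by (rule real_cond_exp_intg(2)[symmetric]) (use int dF in auto)
  from le have "AE \<omega> in M. 0 \<le> - (d \<omega> * ce f \<omega>)"
    by eventually_elim (use c(2) in \<open>auto simp: d_def indicator_def mult_nonneg_nonpos less_imp_le\<close>)
  from integral_nonneg_AE[OF this] have 2: "(\<integral>\<omega>. d \<omega> * ce f \<omega> \<partial>M) \<le> 0" by simp
  from nn have 3: "AE \<omega> in M. 0 \<le> d \<omega> * f \<omega>" by eventually_elim (simp add: d0)
  have "(\<integral>\<omega>. d \<omega> * f \<omega> \<partial>M) = 0"
    using 1 2 integral_nonneg_AE[OF 3] by linarith
  then have "AE \<omega> in M. d \<omega> * f \<omega> = 0"
    using integral_nonneg_eq_0_iff_AE[OF int 3] by simp
  then show ?thesis
  proof eventually_elim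
    case (elim \<omega>)
    then show ?case using c(2)[of \<omega>] by (auto simp: d_def)
  qed
qed

lemma nn_cond_exp_eq_ce:
  assumes f: "f \<in> L1_cond M F" and nn: "AE \<omega> in M. 0 \<le> f \<omega>"
  shows "AE \<omega> in M. nn_cond_exp M F (\<lambda>\<omega>. ennreal (f \<omega>)) \<omega> = ennreal (ce f \<omega>)"
proof -
  have [measurable]: "f \<in> borel_measurable M" by (rule L1_condD[OF f])
  from nn have "AE \<omega> in M. ennreal (- f \<omega>) = 0" by eventually_elim (simp add: ennreal_neg)
  then have "AE \<omega> in M. nn_cond_exp M F (\<lambda>\<omega>. ennreal (- f \<omega>)) \<omega> = nn_cond_exp M F (\<lambda>_. 0) \<omega>"
    by (rule nn_cond_exp_cong) measurable
  moreover have "AE \<omega> in M. nn_cond_exp M F (\<lambda>\<omega>. ennreal (f \<omega>)) \<omega> \<le> nn_cond_exp M F (\<lambda>\<omega>. ennreal \<bar>f \<omega>\<bar>) \<omega>"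
    by (rule nn_cond_exp_mono) (auto intro!: ennreal_leI)
  moreover have "AE \<omega> in M. nn_cond_exp M F (\<lambda>\<omega>. ennreal \<bar>f \<omega>\<bar>) \<omega> < \<infinity>"
    using f by (simp add: L1_cond_iff)
  ultimately show ?thesis using nn_cond_exp_const_0
  proof eventually_elim
    case (elim \<omega>)
    then have "nn_cond_exp M F (\<lambda>\<omega>. ennreal (f \<omega>)) \<omega> < top" by auto
    then show ?case using elim(1,4) unfolding real_cond_exp_def by simp
  qed
qed

text \<open>The integral of c f equals that of c E[f | F], which is bounded. In the Simons argument
  this gives the subgradients their integrability.\<close>

lemma integrable_weight_ce:
  assumes f: "f \<in> L1_cond M F" and nn: "AE \<omega> in M. 0 \<le> f \<omega>"
    and c: "c \<in> borel_measurable F" "\<And>\<omega>. 0 \<le> c \<omega>" and le: "AE \<omega> in M. c \<omega> * ce f \<omega> \<le> C"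
  shows "integrable M (\<lambda>\<omega>. c \<omega> * f \<omega>)"
proof (rule integrableI_bounded)
  have [measurable]: "f \<in> borel_measurable M" "c \<in> borel_measurable F" "c \<in> borel_measurable M"
    using L1_condD[OF f] c L0_subalgebra by auto
  show "(\<lambda>\<omega>. c \<omega> * f \<omega>) \<in> borel_measurable M" by measurable
  have "(\<integral>\<^sup>+ \<omega>. norm (c \<omega> * f \<omega>) \<partial>M) = (\<integral>\<^sup>+ \<omega>. ennreal (c \<omega>) * ennreal (f \<omega>) \<partial>M)"
  proof (rule nn_integral_cong_AE)
    from nn show "AE \<omega> in M. ennreal (norm (c \<omega> * f \<omega>)) = ennreal (c \<omega>) * ennreal (f \<omega>)"
      by eventually_elim (use c(2) in \<open>simp add: abs_mult ennreal_mult\<close>)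
  qed
  also have "\<dots> = (\<integral>\<^sup>+ \<omega>. ennreal (c \<omega>) * nn_cond_exp M F (\<lambda>\<omega>. ennreal (f \<omega>)) \<omega> \<partial>M)"
    by (rule nn_cond_exp_intg[symmetric]) measurable
  also have "\<dots> \<le> (\<integral>\<^sup>+ \<omega>. ennreal C \<partial>M)"
  proof (rule nn_integral_mono_AE)
    from nn_cond_exp_eq_ce[OF f nn] le real_cond_exp_pos[OF nn \<open>f \<in> borel_measurable M\<close>]
    show "AE \<omega> in M. ennreal (c \<omega>) * nn_cond_exp M F (\<lambda>\<omega>. ennreal (f \<omega>)) \<omega> \<le> ennreal C"
    proof eventually_elim
      case (elim \<omega>)
      then show ?case using c(2)[of \<omega>] by (simp add: ennreal_mult[symmetric] ennreal_leI)
    qed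
  qed
  also have "\<dots> < \<infinity>" by (simp add: ennreal_mult_eq_top_iff less_top[symmetric])
  finally show "(\<integral>\<^sup>+ \<omega>. norm (c \<omega> * f \<omega>) \<partial>M) < \<infinity>" .
qed

end

subsection \<open>Countable concatenations and essential suprema\<close>

text \<open>Lets extended random variables be compared through finite integrals: if one dominates
  another and the images have equal integrals, both agree almost everywhere.\<close>

lemma ereal_squash:
  obtains \<psi> :: "ereal \<Rightarrow> real" where "\<psi> \<in> borel_measurable borel" "strict_mono \<psi>" "\<And>x. \<bar>\<psi> x\<bar> \<le> 2"
proof
  define \<psi> where "\<psi> x = (if x = \<infinity> then 2 else if x = -\<infinity> then -2 else arctan (real_of_ereal x))" for x
  \<comment> \<open>Since pi < 4, the values -2 and 2 at the infinities lie strictly outside the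
    range of arctan and keep the map strictly increasing.\<close>
  have b: "\<bar>arctan r\<bar> < 2" for r using arctan_lbound[of r] arctan_ubound[of r] pi_less_4 by auto
  show "\<psi> \<in> borel_measurable borel" unfolding \<psi>_def by measurable
  show "\<bar>\<psi> x\<bar> \<le> 2" for x using b[of "real_of_ereal x"] unfolding \<psi>_def by auto
  show "strict_mono \<psi>"
  proof
    fix x y :: ereal assume "x < y"
    then show "\<psi> x < \<psi> y"
      using b[of "real_of_ereal x"] b[of "real_of_ereal y"]
      by (cases rule: ereal2_cases[of x y]) (auto simp: \<psi>_def arctan_less_iff)
  qed
qed

context finite_measure_subalgebra
begin

text \<open>Exhaustion: some countable subfamily maximizes the integral of the squashed supremum.
  Adjoining a further member cannot increase that integral, so the supremum of the subfamily
  dominates every member almost everywhere.\<close>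

lemma is_ess_sup_countable:
  assumes ne: "A \<noteq> {}" and meas: "A \<subseteq> borel_measurable F"
  obtains f :: "nat \<Rightarrow> 'a \<Rightarrow> ereal" where "range f \<subseteq> A" "is_ess_sup M F A (\<lambda>x. SUP n. f n x)"
proof -
  obtain \<psi> :: "ereal \<Rightarrow> real" where psi [measurable]: "\<psi> \<in> borel_measurable borel"
    and mono: "strict_mono \<psi>" and bound: "\<And>x. \<bar>\<psi> x\<bar> \<le> 2"
    using ereal_squash by blast
  define T where "T = {f :: nat \<Rightarrow> 'a \<Rightarrow> ereal. range f \<subseteq> A}"
  define I where "I f = (\<integral>x. \<psi> (SUP n. f n x) \<partial>M)" for f :: "nat \<Rightarrow> 'a \<Rightarrow> ereal"
  have TF: "f n \<in> borel_measurable F" if "f \<in> T" for f n using that meas unfolding T_def by auto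
  then have TM: "f n \<in> borel_measurable M" if "f \<in> T" for f n using that L0_subalgebra by blast
  have intg: "integrable M (\<lambda>x. \<psi> (SUP n. f n x))" if "f \<in> T" for f
  proof (rule integrable_const_bound[of _ 2])
    have [measurable]: "\<And>n. f n \<in> borel_measurable M" using TM[OF that] .
    show "(\<lambda>x. \<psi> (SUP n. f n x)) \<in> borel_measurable M" by measurable
  qed (use bound in auto)
  have Ib: "I f \<le> 2 * measure M (space M)" if "f \<in> T" for f
  proof -
    have "I f \<le> (\<integral>x. 2 \<partial>M)" unfolding I_def
      by (intro integral_mono intg that) (use bound abs_le_D1 in auto)
    then show ?thesis by (simp add: mult.commute)
  qed
  define v where "v = Sup (I ` T)"
  have bdd: "bdd_above (I ` T)" using Ib by (auto intro!: bdd_aboveI2)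
  have Tne: "T \<noteq> {}" using ne unfolding T_def by (auto intro: exI[of _ "\<lambda>_. _"])
  have "\<exists>f\<in>T. v - 1 / real (Suc m) < I f" for m
  proof -
    have "v - 1 / real (Suc m) < Sup (I ` T)" unfolding v_def by simp
    then show ?thesis using less_cSup_iff[OF _ bdd] Tne by auto
  qed
  then obtain g where g: "\<And>m. g m \<in> T" "\<And>m. v - 1 / real (Suc m) < I (g m)" by metis
  \<comment> \<open>Merges the near-optimal sequences into one by pairing indices, so that the
    maximum is attained.\<close>
  define f where "f n = g (fst (prod_decode n)) (snd (prod_decode n))" for n
  have fT: "f \<in> T" using g(1) unfolding f_def T_def by auto
  have le: "(SUP n. g m n x) \<le> (SUP n. f n x)" for m x
  proof (rule SUP_least)
    fix n
    have "g m n x = f (prod_encode (m, n)) x" unfolding f_def by simp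
    then show "g m n x \<le> (SUP n. f n x)" by (metis SUP_upper UNIV_I)
  qed
  have Ige: "I (g m) \<le> I f" for m unfolding I_def
    by (intro integral_mono intg g fT) (use le mono in \<open>auto simp: strict_mono_less_eq\<close>)
  have v: "v \<le> I f"
  proof (rule field_le_epsilon)
    fix e :: real assume "0 < e"
    then obtain m where "1 / real (Suc m) < e" using nat_approx_posE by metis
    then show "v \<le> I f + e" using g(2)[of m] Ige[of m] by linarith
  qed
  have upper: "AE x in M. h x \<le> (SUP n. f n x)" if "h \<in> A" for h
  proof -
    \<comment> \<open>Prepending \<open>h\<close> gives a competitor; equality of the integrals
      forces equality of the suprema.\<close>
    define k where "k n = (case n of 0 \<Rightarrow> h | Suc n \<Rightarrow> f n)" for n
    have kT: "k \<in> T" using that fT unfolding T_def k_def by (auto split: nat.splits simp: subset_iff)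
    have le: "(SUP n. f n x) \<le> (SUP n. k n x)" "h x \<le> (SUP n. k n x)" for x
    proof -
      have "f n x \<le> (SUP n. k n x)" for n
        using SUP_upper[of "Suc n" UNIV "\<lambda>n. k n x"] by (simp add: k_def)
      then show "(SUP n. f n x) \<le> (SUP n. k n x)" by (rule SUP_least)
      show "h x \<le> (SUP n. k n x)"
        using SUP_upper[of 0 UNIV "\<lambda>n. k n x"] by (simp add: k_def)
    qed
    have "I k \<le> v" unfolding v_def by (rule cSUP_upper[OF kT bdd])
    moreover have "I f \<le> I k" unfolding I_def
      by (intro integral_mono intg kT fT) (use le mono in \<open>auto simp: strict_mono_less_eq\<close>)
    ultimately have "I k = I f" using v by simp
    then have "(\<integral>x. \<psi> (SUP n. k n x) - \<psi> (SUP n. f n x) \<partial>M) = 0"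
      unfolding I_def using intg[OF kT] intg[OF fT] by simp
    moreover have "integrable M (\<lambda>x. \<psi> (SUP n. k n x) - \<psi> (SUP n. f n x))"
      using intg[OF kT] intg[OF fT] by simp
    moreover have "AE x in M. 0 \<le> \<psi> (SUP n. k n x) - \<psi> (SUP n. f n x)"
      using le mono by (auto simp: strict_mono_less_eq)
    ultimately have "AE x in M. \<psi> (SUP n. k n x) - \<psi> (SUP n. f n x) = 0"
      using integral_nonneg_eq_0_iff_AE by blast
    then show ?thesis
    proof eventually_elim
      case (elim x)
      then have "(SUP n. k n x) = (SUP n. f n x)" using mono by (simp add: strict_mono_eq)
      then show ?case using le(2)[of x] by simp
    qed
  qed
  have "is_ess_sup M F A (\<lambda>x. SUP n. f n x)"
    unfolding is_ess_sup_def
  proof (intro conjI ballI impI)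
    have [measurable]: "\<And>n. f n \<in> borel_measurable F" using TF[OF fT] .
    show "(\<lambda>x. SUP n. f n x) \<in> borel_measurable F" by measurable
    fix t assume "t \<in> borel_measurable F" "\<forall>h\<in>A. AE x in M. h x \<le> t x"
    moreover have "\<And>n. f n \<in> A" using fT unfolding T_def by auto
    ultimately have "\<And>n. AE x in M. f n x \<le> t x" by blast
    then have "AE x in M. \<forall>n. f n x \<le> t x" by (simp add: AE_all_countable)
    then show "AE x in M. (SUP n. f n x) \<le> t x" by eventually_elim (auto intro: SUP_least)
  qed (rule upper)
  then show ?thesis using fT that unfolding T_def by blast
qed

lemma is_ess_sup_ess_sup:
  assumes "A \<subseteq> borel_measurable F"
  shows "is_ess_sup M F A (ess_sup M F A)"
  unfolding ess_sup_def
proof (rule someI_ex[where P = "is_ess_sup M F A"])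
  show "\<exists>s. is_ess_sup M F A s"
  proof (cases "A = {}")
    case True
    then have "is_ess_sup M F A (\<lambda>_. -\<infinity>)" unfolding is_ess_sup_def by simp
    then show ?thesis by blast
  next
    case False
    then show ?thesis using is_ess_sup_countable[OF False assms] by metis
  qed
qed

lemma ess_sup_measurable: "A \<subseteq> borel_measurable F \<Longrightarrow> ess_sup M F A \<in> borel_measurable F"
  using is_ess_sup_ess_sup unfolding is_ess_sup_def by blast

lemma ess_sup_upper: "A \<subseteq> borel_measurable F \<Longrightarrow> f \<in> A \<Longrightarrow> AE x in M. f x \<le> ess_sup M F A x"
  using is_ess_sup_ess_sup unfolding is_ess_sup_def by blast

text \<open>Outside \<open>B\<close> the bound is raised to infinity, where it holds trivially;
  minimality of the essential supremum is then applied globally.\<close>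

lemma ess_sup_least_on:
  assumes A: "A \<subseteq> borel_measurable F" and [measurable]: "t \<in> borel_measurable F" "B \<in> sets F"
    and le: "\<And>f. f \<in> A \<Longrightarrow> AE x in M. x \<in> B \<longrightarrow> f x \<le> t x"
  shows "AE x in M. x \<in> B \<longrightarrow> ess_sup M F A x \<le> t x"
proof -
  define t' where "t' x = (if x \<in> B then t x else \<infinity>)" for x
  have "t' \<in> borel_measurable F" unfolding t'_def by measurable
  moreover have "\<forall>f\<in>A. AE x in M. f x \<le> t' x" using le unfolding t'_def by (auto elim!: eventually_mono)
  ultimately have "AE x in M. ess_sup M F A x \<le> t' x"
    using is_ess_sup_ess_sup[OF A] unfolding is_ess_sup_def by blast
  then show ?thesis by eventually_elim (auto simp: t'_def)
qed

lemma ess_sup_least: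
  assumes A: "A \<subseteq> borel_measurable F" and t: "t \<in> borel_measurable F"
    and le: "\<And>f. f \<in> A \<Longrightarrow> AE x in M. f x \<le> t x"
  shows "AE x in M. ess_sup M F A x \<le> t x"
  using is_ess_sup_ess_sup[OF A] t le unfolding is_ess_sup_def by blast

section \<open>Partitions and gluing\<close>

lemma partition_sets: "event_partition M F a \<Longrightarrow> a k \<in> sets F"
  unfolding event_partition_def by blast

lemma partition_AE:
  assumes a: "event_partition M F a" and P: "\<And>k. AE x in M. x \<in> a k \<longrightarrow> P x"
  shows "AE x in M. P x"
proof -
  have "AE x in M. \<forall>k. x \<in> a k \<longrightarrow> P x" using P unfolding AE_all_countable by blast
  moreover have "AE x in M. \<exists>!k. x \<in> a k" using a unfolding event_partition_def by blast
  ultimately show ?thesis by eventually_elim blast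
qed

lemma partition_disjointed:
  assumes A: "\<And>n. A n \<in> sets F" and cover: "AE x in M. \<exists>n. x \<in> A n"
  shows "event_partition M F (disjointed A)"
  unfolding event_partition_def
proof
  show "\<forall>k. disjointed A k \<in> sets F" using A
    by (metis image_subset_iff sets.range_disjointed_sets UNIV_I)
  from cover show "AE x in M. \<exists>!k. x \<in> disjointed A k"
  proof eventually_elim
    case (elim x)
    then obtain k where "x \<in> disjointed A k" using UN_disjointed_eq[of A] by blast
    moreover have "j = k" if "x \<in> disjointed A j" for j
      using that calculation disjoint_family_disjointed[of A] unfolding disjoint_family_on_def by blast
    ultimately show ?case by blast
  qed
qed

lemma partition_two:
  assumes "A \<in> sets F"
  shows "event_partition M F (\<lambda>k. if k = 0 then A else if k = 1 then space M - A else {})"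
  unfolding event_partition_def
proof
  have "space M - A \<in> sets F" using assms sets.compl_sets[OF assms] by (simp add: space_subalgebra)
  then show "\<forall>k. (if k = 0 then A else if k = 1 then space M - A else {}) \<in> sets F"
    using assms by auto
  show "AE x in M. \<exists>!k::nat. x \<in> (if k = 0 then A else if k = 1 then space M - A else {})"
  proof (rule AE_I2)
    fix x assume x: "x \<in> space M"
    show "\<exists>!k::nat. x \<in> (if k = 0 then A else if k = 1 then space M - A else {})"
      by (rule ex1I[of _ "if x \<in> A then 0 else 1"]) (use x in \<open>auto split: if_splits\<close>)
  qed
qed

definition trivial_partition :: "nat \<Rightarrow> 'a set" where
  "trivial_partition k = (if k = 0 then space M else {})"

lemma partition_trivial: "event_partition M F trivial_partition"
proof -
  have "space M \<in> sets F" using sets.top[of F] by (simp only: space_subalgebra)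
  from partition_two[OF this]
  have *: "event_partition M F (\<lambda>k. if k = 0 then space M else if k = 1 then space M - space M else {})" .
  have eq: "(\<lambda>k. if k = 0 then space M else if k = 1 then space M - space M else {}) = trivial_partition"
    unfolding trivial_partition_def by (simp add: fun_eq_iff)
  show ?thesis using * unfolding eq .
qed

text \<open>The second partition may depend on the member of the first. Pairs of indices are coded
  by natural numbers, which index all partitions.\<close>

lemma partition_refine:
  assumes a: "event_partition M F a" and b: "\<And>k. event_partition M F (b k)"
  shows "event_partition M F (\<lambda>n. a (fst (prod_decode n)) \<inter> b (fst (prod_decode n)) (snd (prod_decode n)))"
  unfolding event_partition_def
proof
  show "\<forall>n. a (fst (prod_decode n)) \<inter> b (fst (prod_decode n)) (snd (prod_decode n)) \<in> sets F"
    using partition_sets[OF a] partition_sets[OF b] by auto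
  have "AE x in M. \<exists>!k. x \<in> a k" using a unfolding event_partition_def by blast
  moreover have "AE x in M. \<forall>k. \<exists>!j. x \<in> b k j"
    using b unfolding event_partition_def by (simp add: AE_all_countable)
  ultimately show "AE x in M. \<exists>!n. x \<in> a (fst (prod_decode n)) \<inter> b (fst (prod_decode n)) (snd (prod_decode n))"
  proof eventually_elim
    case (elim x)
    then obtain k j where kj: "x \<in> a k" "x \<in> b k j" by blast
    show ?case
    proof (rule ex1I[of _ "prod_encode (k, j)"])
      fix n assume n: "x \<in> a (fst (prod_decode n)) \<inter> b (fst (prod_decode n)) (snd (prod_decode n))"
      then have "fst (prod_decode n) = k" using elim kj by blast
      moreover from this n have "snd (prod_decode n) = j" using elim kj by blast
      ultimately have "prod_decode n = (k, j)" by (simp add: prod_eq_iff)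
      then show "n = prod_encode (k, j)" by (metis prod_decode_inverse)
    qed (use kj in simp)
  qed
qed

text \<open>A series makes measurability immediate for \<open>M\<close> and for \<open>F\<close>
  alike; almost everywhere at most one term is nonzero.\<close>

definition glue :: "(nat \<Rightarrow> 'a set) \<Rightarrow> (nat \<Rightarrow> 'a \<Rightarrow> real) \<Rightarrow> 'a \<Rightarrow> real" where
  "glue a x \<omega> = (\<Sum>k. indicator (a k) \<omega> * x k \<omega>)"

lemma glue_measurable_F:
  assumes "event_partition M F a" "\<And>k. x k \<in> borel_measurable F"
  shows "glue a x \<in> borel_measurable F"
  using assms partition_sets[OF assms(1)] unfolding glue_def by measurable

lemma glue_measurable_M:
  assumes "event_partition M F a" "\<And>k. x k \<in> borel_measurable M"
  shows "glue a x \<in> borel_measurable M"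
proof -
  have [measurable]: "\<And>k. a k \<in> sets M" using assms(1) partition_sets sets_subalgebra by blast
  show ?thesis unfolding glue_def using assms(2) by measurable
qed

lemma glue_eq_pointwise:
  assumes "\<exists>!k. \<omega> \<in> a k" "\<omega> \<in> a k"
  shows "glue a x \<omega> = x k \<omega>"
proof -
  have "\<omega> \<in> a j \<longleftrightarrow> j = k" for j using assms by blast
  then have "(\<lambda>j. indicator (a j) \<omega> * x j \<omega>) = (\<lambda>j. if j = k then x k \<omega> else 0)"
    by (simp add: indicator_def fun_eq_iff)
  then show ?thesis unfolding glue_def by (simp add: sums_unique[OF sums_single, symmetric])
qed

lemma glue_eq:
  assumes "event_partition M F a"
  shows "AE \<omega> in M. \<omega> \<in> a k \<longrightarrow> glue a x \<omega> = x k \<omega>"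
proof -
  have "AE \<omega> in M. \<exists>!k. \<omega> \<in> a k" using assms unfolding event_partition_def by blast
  then show ?thesis by eventually_elim (blast intro: glue_eq_pointwise)
qed

text \<open>Replaces a limit of partial sums by equality on each member of the partition, the form
  used from here on. Partial sums are eventually constant at points lying in exactly one
  member.\<close>

lemma is_concat_iff:
  assumes a: "event_partition M F a"
  shows "is_concat M a x z \<longleftrightarrow> z \<in> borel_measurable M \<and> (\<forall>k. AE \<omega> in M. \<omega> \<in> a k \<longrightarrow> z \<omega> = x k \<omega>)"
proof -
  have lim: "(\<lambda>n. \<Sum>k<n. indicator (a k) \<omega> * x k \<omega>) \<longlonglongrightarrow> x j \<omega>" if "\<exists>!k. \<omega> \<in> a k" "\<omega> \<in> a j" for \<omega> j
  proof -
    have "\<omega> \<in> a i \<longleftrightarrow> i = j" for i using that by blast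
    then have "(\<lambda>j. indicator (a j) \<omega> * x j \<omega>) = (\<lambda>i. if i = j then x j \<omega> else 0)"
      by (simp add: indicator_def fun_eq_iff)
    then have "(\<lambda>k. indicator (a k) \<omega> * x k \<omega>) sums x j \<omega>" using sums_single[of j "\<lambda>_. x j \<omega>"] by simp
    then show ?thesis unfolding sums_def .
  qed
  have ex: "AE \<omega> in M. \<exists>!k. \<omega> \<in> a k" using a unfolding event_partition_def by blast
  have "(AE \<omega> in M. (\<lambda>n. \<Sum>k<n. indicator (a k) \<omega> * x k \<omega>) \<longlonglongrightarrow> z \<omega>)
      \<longleftrightarrow> (AE \<omega> in M. \<forall>k. \<omega> \<in> a k \<longrightarrow> z \<omega> = x k \<omega>)"
  proof (rule eventually_subst)
    from ex show "AE \<omega> in M. ((\<lambda>n. \<Sum>k<n. indicator (a k) \<omega> * x k \<omega>) \<longlonglongrightarrow> z \<omega>) = (\<forall>k. \<omega> \<in> a k \<longrightarrow> z \<omega> = x k \<omega>)"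
    proof eventually_elim
      case (elim \<omega>)
      then obtain j where j: "\<omega> \<in> a j" by blast
      with elim have u: "\<omega> \<in> a k \<Longrightarrow> k = j" for k by blast
      show ?case
      proof
        assume "(\<lambda>n. \<Sum>k<n. indicator (a k) \<omega> * x k \<omega>) \<longlonglongrightarrow> z \<omega>"
        from LIMSEQ_unique[OF this lim[OF elim j]] show "\<forall>k. \<omega> \<in> a k \<longrightarrow> z \<omega> = x k \<omega>"
          using u by blast
      next
        assume "\<forall>k. \<omega> \<in> a k \<longrightarrow> z \<omega> = x k \<omega>"
        with j have "z \<omega> = x j \<omega>" by blast
        with lim[OF elim j] show "(\<lambda>n. \<Sum>k<n. indicator (a k) \<omega> * x k \<omega>) \<longlonglongrightarrow> z \<omega>" by (simp only:)
      qed
    qed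
  qed
  then show ?thesis unfolding is_concat_def by (simp add: AE_all_countable)
qed

lemma stable_setD:
  assumes "stable_set M F S" "event_partition M F a" "\<And>k. x k \<in> S" "z \<in> borel_measurable M"
    "\<And>k. AE \<omega> in M. \<omega> \<in> a k \<longrightarrow> z \<omega> = x k \<omega>"
  shows "z \<in> S"
  using assms is_concat_iff[of a x z] unfolding stable_set_def by blast

lemma stable_setI:
  assumes "S \<noteq> {}" "S \<subseteq> borel_measurable M"
    "\<And>a x z. event_partition M F a \<Longrightarrow> (\<And>k. x k \<in> S) \<Longrightarrow> z \<in> borel_measurable M
      \<Longrightarrow> (\<And>k. AE \<omega> in M. \<omega> \<in> a k \<longrightarrow> z \<omega> = x k \<omega>) \<Longrightarrow> z \<in> S"
  shows "stable_set M F S"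
  using assms is_concat_iff unfolding stable_set_def by blast

lemma stable_set_two:
  assumes S: "stable_set M F S" and A: "A \<in> sets F" and "x \<in> S" "y \<in> S" "z \<in> borel_measurable M"
    and "AE \<omega> in M. \<omega> \<in> A \<longrightarrow> z \<omega> = x \<omega>" "AE \<omega> in M. \<omega> \<notin> A \<longrightarrow> z \<omega> = y \<omega>"
  shows "z \<in> S"
proof (rule stable_setD[OF S partition_two[OF A], where x = "\<lambda>k. if k = 0 then x else y"])
  show "AE \<omega> in M. \<omega> \<in> (if k = 0 then A else if k = 1 then space M - A else {})
      \<longrightarrow> z \<omega> = (if k = 0 then x else y) \<omega>" for k :: nat
    using assms(6,7) by eventually_elim auto
qed (use assms in auto)

text \<open>At every point, take the first member of a maximizing sequence that exceeds \<open>\<gamma>\<close>.\<close>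

lemma less_ess_sup_glue:
  fixes h :: "'i \<Rightarrow> 'a \<Rightarrow> ereal"
  assumes ne: "I \<noteq> {}" and meas: "\<And>i. i \<in> I \<Longrightarrow> h i \<in> borel_measurable F"
    and glue: "\<And>a j. event_partition M F a \<Longrightarrow> (\<And>k. j k \<in> I)
        \<Longrightarrow> \<exists>i\<in>I. \<forall>k. AE \<omega> in M. \<omega> \<in> a k \<longrightarrow> h (j k) \<omega> \<le> h i \<omega>"
    and [measurable]: "\<gamma> \<in> borel_measurable F"
    and less: "AE \<omega> in M. \<gamma> \<omega> < ess_sup M F (h ` I) \<omega>"
  obtains i where "i \<in> I" "AE \<omega> in M. \<gamma> \<omega> < h i \<omega>"
proof -
  have m: "h ` I \<subseteq> borel_measurable F" and ne': "h ` I \<noteq> {}" using meas ne by auto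
  obtain f :: "nat \<Rightarrow> 'a \<Rightarrow> ereal" where f: "range f \<subseteq> h ` I" "is_ess_sup M F (h ` I) (\<lambda>x. SUP n. f n x)"
    using is_ess_sup_countable[OF ne' m] by blast
  have "\<exists>i\<in>I. f n = h i" for n using f(1) rangeI[of f n] by blast
  then obtain j where j: "\<And>n. j n \<in> I" "\<And>n. f n = h (j n)" by metis
  have [measurable]: "f n \<in> borel_measurable F" for n unfolding j(2) by (rule meas[OF j(1)])
  have "AE \<omega> in M. ess_sup M F (h ` I) \<omega> \<le> (SUP n. f n \<omega>)"
  proof (rule ess_sup_least[OF m])
    show "(\<lambda>\<omega>. SUP n. f n \<omega>) \<in> borel_measurable F" by measurable
    show "AE \<omega> in M. g \<omega> \<le> (SUP n. f n \<omega>)" if "g \<in> h ` I" for g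
      using f(2) that unfolding is_ess_sup_def by (elim conjE) (erule (1) bspec)
  qed
  with less have ex: "AE \<omega> in M. \<exists>n. \<gamma> \<omega> < f n \<omega>"
  proof eventually_elim
    case (elim \<omega>)
    then have "\<gamma> \<omega> < (SUP n. f n \<omega>)" by (rule less_le_trans)
    then show ?case by (simp add: less_SUP_iff)
  qed
  define A where "A n = {\<omega> \<in> space F. \<gamma> \<omega> < f n \<omega>}" for n
  have A: "A n \<in> sets F" for n unfolding A_def by measurable
  have "AE \<omega> in M. \<exists>n. \<omega> \<in> A n"
    using ex AE_space by eventually_elim (auto simp: A_def space_subalgebra)
  from partition_disjointed[OF A this] have part: "event_partition M F (disjointed A)" .
  from glue[OF this, of j] j obtain i where i: "i \<in> I"
    "\<And>k. AE \<omega> in M. \<omega> \<in> disjointed A k \<longrightarrow> h (j k) \<omega> \<le> h i \<omega>" by blast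
  have "AE \<omega> in M. \<gamma> \<omega> < h i \<omega>"
  proof (rule partition_AE[OF part])
    fix k
    from i(2)[of k] show "AE \<omega> in M. \<omega> \<in> disjointed A k \<longrightarrow> \<gamma> \<omega> < h i \<omega>"
    proof eventually_elim
      case (elim \<omega>)
      then show ?case using disjointed_subset[of A k] j(2)[of k] unfolding A_def
        by (auto intro: less_le_trans)
    qed
  qed
  with i(1) show ?thesis by (rule that)
qed

text \<open>Finiteness of the conditional expectation can be checked on each member, because the
  indicator of an \<open>F\<close>-event passes through \<open>nn_cond_exp\<close>. This makes the
  Koethe dual stable.\<close>

lemma L1_cond_local:
  assumes part: "event_partition M F a" and x: "\<And>k. x k \<in> L1_cond M F" and z: "z \<in> borel_measurable M"
    and eq: "\<And>k. AE \<omega> in M. \<omega> \<in> a k \<longrightarrow> z \<omega> = x k \<omega>"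
  shows "z \<in> L1_cond M F"
  unfolding L1_cond_iff
proof
  show "AE \<omega> in M. nn_cond_exp M F (\<lambda>\<omega>. ennreal \<bar>z \<omega>\<bar>) \<omega> < \<infinity>"
  proof (rule partition_AE[OF part])
    fix k
    have [measurable]: "a k \<in> sets F" "a k \<in> sets M" "x k \<in> borel_measurable M" "z \<in> borel_measurable M"
      using partition_sets[OF part] sets_subalgebra L1_condD[OF x] z by auto
    have "AE \<omega> in M. nn_cond_exp M F (\<lambda>\<omega>. indicator (a k) \<omega> * ennreal \<bar>z \<omega>\<bar>) \<omega>
        = nn_cond_exp M F (\<lambda>\<omega>. indicator (a k) \<omega> * ennreal \<bar>x k \<omega>\<bar>) \<omega>"
    proof (rule nn_cond_exp_cong)
      from eq[of k] show "AE \<omega> in M. indicator (a k) \<omega> * ennreal \<bar>z \<omega>\<bar> = indicator (a k) \<omega> * ennreal \<bar>x k \<omega>\<bar>"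
        by eventually_elim (auto simp: indicator_def)
    qed measurable
    moreover have "AE \<omega> in M. indicator (a k) \<omega> * nn_cond_exp M F (\<lambda>\<omega>. ennreal \<bar>z \<omega>\<bar>) \<omega>
        = nn_cond_exp M F (\<lambda>\<omega>. indicator (a k) \<omega> * ennreal \<bar>z \<omega>\<bar>) \<omega>"
      by (rule nn_cond_exp_prod) measurable
    moreover have "AE \<omega> in M. indicator (a k) \<omega> * nn_cond_exp M F (\<lambda>\<omega>. ennreal \<bar>x k \<omega>\<bar>) \<omega>
        = nn_cond_exp M F (\<lambda>\<omega>. indicator (a k) \<omega> * ennreal \<bar>x k \<omega>\<bar>) \<omega>"
      by (rule nn_cond_exp_prod) measurable
    moreover have "AE \<omega> in M. nn_cond_exp M F (\<lambda>\<omega>. ennreal \<bar>x k \<omega>\<bar>) \<omega> < \<infinity>"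
      using x[of k] unfolding L1_cond_iff by blast
    ultimately show "AE \<omega> in M. \<omega> \<in> a k \<longrightarrow> nn_cond_exp M F (\<lambda>\<omega>. ennreal \<bar>z \<omega>\<bar>) \<omega> < \<infinity>"
    proof eventually_elim
      case (elim \<omega>)
      show ?case
      proof
        assume "\<omega> \<in> a k"
        then have "nn_cond_exp M F (\<lambda>\<omega>. ennreal \<bar>z \<omega>\<bar>) \<omega> = nn_cond_exp M F (\<lambda>\<omega>. ennreal \<bar>x k \<omega>\<bar>) \<omega>"
          using elim(1-3) by simp
        then show "nn_cond_exp M F (\<lambda>\<omega>. ennreal \<bar>z \<omega>\<bar>) \<omega> < \<infinity>" using elim(4) by simp
      qed
    qed
  qed
qed (rule z)

text \<open>The infimum of the sequence has integral 0 and vanishes; monotonicity makes it the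
  limit. Convergence of integrals becomes convergence almost everywhere without passing to a
  subsequence.\<close>

lemma decreasing_AE_tendsto_0:
  fixes f :: "nat \<Rightarrow> 'a \<Rightarrow> real"
  assumes int: "\<And>n. integrable M (f n)" and nonneg: "\<And>n. AE x in M. 0 \<le> f n x"
    and dec: "\<And>n. AE x in M. f (Suc n) x \<le> f n x" and lim: "(\<lambda>n. \<integral>x. f n x \<partial>M) \<longlonglongrightarrow> 0"
  shows "AE x in M. (\<lambda>n. f n x) \<longlonglongrightarrow> 0"
proof -
  have [measurable]: "\<And>n. f n \<in> borel_measurable M" using int by auto
  define g where "g x = (INF n. ennreal (f n x))" for x
  have [measurable]: "g \<in> borel_measurable M" unfolding g_def by measurable
  have "(\<integral>\<^sup>+x. g x \<partial>M) \<le> ennreal (\<integral>x. f n x \<partial>M)" for n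
  proof -
    have "(\<integral>\<^sup>+x. g x \<partial>M) \<le> (\<integral>\<^sup>+x. ennreal (f n x) \<partial>M)"
      by (intro nn_integral_mono) (auto simp: g_def intro: INF_lower)
    then show ?thesis using nn_integral_eq_integral[OF int nonneg] by simp
  qed
  moreover have "(\<lambda>n. ennreal (\<integral>x. f n x \<partial>M)) \<longlonglongrightarrow> 0"
    using tendsto_ennrealI[OF lim] by simp
  ultimately have "(\<integral>\<^sup>+x. g x \<partial>M) \<le> 0" by (intro LIMSEQ_le_const) auto
  then have "AE x in M. g x = 0"
    using nn_integral_0_iff_AE[of g M] by simp
  moreover have "AE x in M. \<forall>n. 0 \<le> f n x" "AE x in M. \<forall>n. f (Suc n) x \<le> f n x"
    using nonneg dec by (simp_all add: AE_all_countable)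
  ultimately show ?thesis
  proof eventually_elim
    case (elim x)
    have "(\<lambda>n. ennreal (f n x)) \<longlonglongrightarrow> (INF n. ennreal (f n x))"
      by (intro LIMSEQ_INF) (use elim in \<open>auto intro!: decseq_SucI ennreal_leI\<close>)
    then have "(\<lambda>n. ennreal (f n x)) \<longlonglongrightarrow> ennreal 0" using elim by (simp add: g_def)
    then show ?case using elim by (subst (asm) tendsto_ennreal_iff) auto
  qed
qed

section \<open>Local conditions and concatenations of sets\<close>

definition local_on :: "('a \<Rightarrow> real) set \<Rightarrow> (('a \<Rightarrow> real) \<Rightarrow> 'a \<Rightarrow> bool) \<Rightarrow> bool" where
  "local_on S P \<longleftrightarrow> (\<forall>x\<in>S. \<forall>z\<in>S. \<forall>A\<in>sets F. (AE \<omega> in M. \<omega> \<in> A \<longrightarrow> x \<omega> = z \<omega>)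
     \<longrightarrow> (AE \<omega> in M. \<omega> \<in> A \<longrightarrow> P x \<omega> \<longrightarrow> P z \<omega>))"

lemma local_onD:
  assumes "local_on S P" "x \<in> S" "z \<in> S" "A \<in> sets F" "AE \<omega> in M. \<omega> \<in> A \<longrightarrow> x \<omega> = z \<omega>"
  shows "AE \<omega> in M. \<omega> \<in> A \<longrightarrow> P x \<omega> \<longrightarrow> P z \<omega>"
  using assms unfolding local_on_def by blast

lemma local_on_subset: "local_on S P \<Longrightarrow> S' \<subseteq> S \<Longrightarrow> local_on S' P"
  unfolding local_on_def by blast

text \<open>A condition is local if its truth on an \<open>F\<close>-event depends only on the
  element there. Such conditions pass to glued elements; sublevel sets of the conjugate and sets of
  near-maximizers are stable for this reason.\<close>

lemma stable_set_Collect: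
  assumes S: "stable_set M F S" and P: "local_on S P" and ne: "{x \<in> S. AE \<omega> in M. P x \<omega>} \<noteq> {}"
  shows "stable_set M F {x \<in> S. AE \<omega> in M. P x \<omega>}"
proof (rule stable_setI[OF ne])
  show "{x \<in> S. AE \<omega> in M. P x \<omega>} \<subseteq> borel_measurable M" using S unfolding stable_set_def by blast
  fix a x z
  assume a: "event_partition M F a" and x: "\<And>k. x k \<in> {x \<in> S. AE \<omega> in M. P x \<omega>}" and z: "z \<in> borel_measurable M"
    and eq: "\<And>k. AE \<omega> in M. \<omega> \<in> a k \<longrightarrow> z \<omega> = x k \<omega>"
  have xS: "x k \<in> S" and xP: "AE \<omega> in M. P (x k) \<omega>" for k using x[of k] by auto
  have zS: "z \<in> S" by (rule stable_setD[OF S a xS z eq])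
  have "AE \<omega> in M. P z \<omega>"
  proof (rule partition_AE[OF a])
    fix k
    from eq[of k] have eq': "AE \<omega> in M. \<omega> \<in> a k \<longrightarrow> x k \<omega> = z \<omega>" by eventually_elim simp
    from local_onD[OF P xS zS partition_sets[OF a] eq'] xP[of k]
    show "AE \<omega> in M. \<omega> \<in> a k \<longrightarrow> P z \<omega>" by eventually_elim blast
  qed
  with zS show "z \<in> {x \<in> S. AE \<omega> in M. P x \<omega>}" by blast
qed

lemma concat_sets_iff:
  assumes a: "event_partition M F a" 
  shows "z \<in> concat_sets M a S \<longleftrightarrow>
    z \<in> borel_measurable M \<and> (\<exists>x. (\<forall>k. x k \<in> S k) \<and> (\<forall>k. AE \<omega> in M. \<omega> \<in> a k \<longrightarrow> z \<omega> = x k \<omega>))"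
  unfolding concat_sets_def using is_concat_iff[OF a] by blast

text \<open>Serves to recognize a concatenation of members of a filter base as a member again: the
  conditions differ in a parameter, and gluing the parameters gives the condition
  \<open>Q\<close>.\<close>

lemma concat_sets_Collect:
  assumes S: "stable_set M F S" and a: "event_partition M F a"
    and P: "\<And>k. local_on S (P k)" and Q: "local_on S Q"
    and PQ: "\<And>k x. x \<in> S \<Longrightarrow> AE \<omega> in M. \<omega> \<in> a k \<longrightarrow> P k x \<omega> = Q x \<omega>"
    and ne: "\<And>k. {x \<in> S. AE \<omega> in M. P k x \<omega>} \<noteq> {}"
  shows "concat_sets M a (\<lambda>k. {x \<in> S. AE \<omega> in M. P k x \<omega>}) = {x \<in> S. AE \<omega> in M. Q x \<omega>}"
proof (intro set_eqI iffI)
  fix z assume "z \<in> concat_sets M a (\<lambda>k. {x \<in> S. AE \<omega> in M. P k x \<omega>})"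
  then have "\<exists>x. (\<forall>k. x k \<in> {x \<in> S. AE \<omega> in M. P k x \<omega>}) \<and> (\<forall>k. AE \<omega> in M. \<omega> \<in> a k \<longrightarrow> z \<omega> = x k \<omega>)"
    and z: "z \<in> borel_measurable M"
    unfolding concat_sets_iff[OF a] by blast+
  then obtain x where x: "\<forall>k. x k \<in> {x \<in> S. AE \<omega> in M. P k x \<omega>}"
    and eq': "\<forall>k. AE \<omega> in M. \<omega> \<in> a k \<longrightarrow> z \<omega> = x k \<omega>" by (elim exE conjE) (rule that)
  have eq: "AE \<omega> in M. \<omega> \<in> a k \<longrightarrow> z \<omega> = x k \<omega>" for k using eq' by blast
  have xS: "x k \<in> S" and xP: "AE \<omega> in M. P k (x k) \<omega>" for k using x[THEN spec, of k] by auto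
  have zS: "z \<in> S" by (rule stable_setD[OF S a xS z eq])
  have "AE \<omega> in M. Q z \<omega>"
  proof (rule partition_AE[OF a])
    fix k
    from eq[of k] have eq': "AE \<omega> in M. \<omega> \<in> a k \<longrightarrow> x k \<omega> = z \<omega>" by eventually_elim simp
    from local_onD[OF P xS zS partition_sets[OF a] eq', of k] xP[of k] PQ[OF zS, of k]
    show "AE \<omega> in M. \<omega> \<in> a k \<longrightarrow> Q z \<omega>" by eventually_elim blast
  qed
  with zS show "z \<in> {x \<in> S. AE \<omega> in M. Q x \<omega>}" by blast
next
  fix z assume z: "z \<in> {x \<in> S. AE \<omega> in M. Q x \<omega>}"
  then have zS: "z \<in> S" and zQ: "AE \<omega> in M. Q z \<omega>" by auto
  have SM: "x \<in> borel_measurable M" if "x \<in> S" for x using S that unfolding stable_set_def by blast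
  have "\<exists>y. y \<in> {x \<in> S. AE \<omega> in M. P k x \<omega>} \<and> (AE \<omega> in M. \<omega> \<in> a k \<longrightarrow> z \<omega> = y \<omega>)" for k
  proof -
    \<comment> \<open>A member of the set with index \<open>k\<close> has to satisfy
      \<open>P k\<close> outside \<open>a k\<close> as well; there \<open>z\<close> is replaced by a
      witness of nonemptiness.\<close>
    obtain w where wS: "w \<in> S" and wP: "AE \<omega> in M. P k w \<omega>" using ne[of k] by blast
    have ak: "a k \<in> sets F" by (rule partition_sets[OF a])
    then have ak': "space M - a k \<in> sets F" using sets.compl_sets[OF ak] by (simp add: space_subalgebra)
    have [measurable]: "a k \<in> sets M" "z \<in> borel_measurable M" "w \<in> borel_measurable M"
      using sets_subalgebra[OF ak] SM zS wS by auto
    define y where "y \<omega> = (if \<omega> \<in> a k then z \<omega> else w \<omega>)" for \<omega>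
    have yM: "y \<in> borel_measurable M" unfolding y_def by measurable
    have y1: "AE \<omega> in M. \<omega> \<in> a k \<longrightarrow> z \<omega> = y \<omega>" and y2: "AE \<omega> in M. \<omega> \<in> space M - a k \<longrightarrow> w \<omega> = y \<omega>"
      by (simp_all add: y_def)
    have yS: "y \<in> S" by (rule stable_set_two[OF S ak zS wS yM]) (simp_all add: y_def)
    from local_onD[OF P zS yS ak y1, of k] local_onD[OF P wS yS ak' y2, of k] zQ wP PQ[OF zS, of k] AE_space
    have "AE \<omega> in M. P k y \<omega>" by eventually_elim blast
    with yS y1 show ?thesis by blast
  qed
  from choice[OF allI[OF this]] obtain y
    where "\<forall>k. y k \<in> {x \<in> S. AE \<omega> in M. P k x \<omega>} \<and> (AE \<omega> in M. \<omega> \<in> a k \<longrightarrow> z \<omega> = y k \<omega>)" ..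
  then have "\<forall>k. y k \<in> {x \<in> S. AE \<omega> in M. P k x \<omega>}" "\<forall>k. AE \<omega> in M. \<omega> \<in> a k \<longrightarrow> z \<omega> = y k \<omega>"
    by blast+
  with SM[OF zS] show "z \<in> concat_sets M a (\<lambda>k. {x \<in> S. AE \<omega> in M. P k x \<omega>})"
    unfolding concat_sets_iff[OF a] by blast
qed

lemma concat_setsE:
  assumes "event_partition M F a" "z \<in> concat_sets M a S"
  obtains x where "z \<in> borel_measurable M" "\<And>k. x k \<in> S k" "\<And>k. AE \<omega> in M. \<omega> \<in> a k \<longrightarrow> z \<omega> = x k \<omega>"
proof -
  have *: "z \<in> borel_measurable M \<and> (\<exists>x. (\<forall>k. x k \<in> S k) \<and> (\<forall>k. AE \<omega> in M. \<omega> \<in> a k \<longrightarrow> z \<omega> = x k \<omega>))"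
    using assms concat_sets_iff by blast
  then obtain x where x: "(\<forall>k. x k \<in> S k) \<and> (\<forall>k. AE \<omega> in M. \<omega> \<in> a k \<longrightarrow> z \<omega> = x k \<omega>)" by (elim conjE exE) (rule that, rule conjI)
  show ?thesis
    by (rule that[OF *[THEN conjunct1] x[THEN conjunct1, THEN spec] x[THEN conjunct2, THEN spec]])
qed

lemma concat_setsI:
  assumes "event_partition M F a" "z \<in> borel_measurable M" "\<And>k. x k \<in> S k"
    "\<And>k. AE \<omega> in M. \<omega> \<in> a k \<longrightarrow> z \<omega> = x k \<omega>"
  shows "z \<in> concat_sets M a S"
  unfolding concat_sets_iff[OF assms(1)] using assms(2-4) by blast

text \<open>The values \<open>r i j\<close> sit on the intersections of \<open>a i\<close> and
  \<open>b i j\<close>. When the inner sets all equal one stable set, the inner concatenation is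
  absorbed by it.\<close>

lemma concat_sets_refine:
  assumes a: "event_partition M F a" and b: "\<And>i. event_partition M F (b i)"
    and r: "\<And>i j. r i j \<in> G i j" "\<And>i j. r i j \<in> borel_measurable M" and z: "z \<in> borel_measurable M"
    and eq: "\<And>i j. AE \<omega> in M. \<omega> \<in> a i \<and> \<omega> \<in> b i j \<longrightarrow> z \<omega> = r i j \<omega>"
  shows "z \<in> concat_sets M a (\<lambda>i. concat_sets M (b i) (G i))"
proof (rule concat_setsI[OF a z])
  fix i
  have ri: "AE \<omega> in M. \<omega> \<in> b i j \<longrightarrow> glue (b i) (r i) \<omega> = r i j \<omega>" for j by (rule glue_eq[OF b])
  show "glue (b i) (r i) \<in> concat_sets M (b i) (G i)"
    by (rule concat_setsI[OF b glue_measurable_M[OF b r(2)] r(1) ri])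
  show "AE \<omega> in M. \<omega> \<in> a i \<longrightarrow> z \<omega> = glue (b i) (r i) \<omega>"
  proof (rule partition_AE[OF b])
    fix j
    from eq[of i j] ri[of j] show "AE \<omega> in M. \<omega> \<in> b i j \<longrightarrow> \<omega> \<in> a i \<longrightarrow> z \<omega> = glue (b i) (r i) \<omega>"
      by eventually_elim auto
  qed
qed

lemma concat_sets_mono: "(\<And>k. G k \<subseteq> H k) \<Longrightarrow> concat_sets M a G \<subseteq> concat_sets M a H"
  unfolding concat_sets_def subset_iff by (rule allI, simp) (meson)

lemma stable_setM: "stable_set M F S \<Longrightarrow> x \<in> S \<Longrightarrow> x \<in> borel_measurable M"
  unfolding stable_set_def by blast

lemma stable_set_nonempty: "stable_set M F S \<Longrightarrow> S \<noteq> {}"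
  unfolding stable_set_def by blast

lemma concat_sets_subset:
  assumes a: "event_partition M F a" and S: "stable_set M F S" and sub: "\<And>k. G k \<subseteq> S"
  shows "concat_sets M a G \<subseteq> S"
proof
  fix z assume "z \<in> concat_sets M a G"
  from concat_setsE[OF a this] obtain x where x: "z \<in> borel_measurable M" "\<And>k. x k \<in> G k"
    "\<And>k. AE \<omega> in M. \<omega> \<in> a k \<longrightarrow> z \<omega> = x k \<omega>" by metis
  show "z \<in> S" by (rule stable_setD[OF S a _ x(1) x(3)]) (use x(2) sub in blast)
qed

lemma concat_sets_stable:
  assumes a: "event_partition M F a" and G: "\<And>k. stable_set M F (G k)"
  shows "stable_set M F (concat_sets M a G)"
proof (rule stable_setI)
  have "\<exists>x. x \<in> G k" for k using stable_set_nonempty[OF G] by blast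
  then obtain x where x: "\<And>k. x k \<in> G k" by metis
  have "glue a x \<in> concat_sets M a G"
    by (rule concat_setsI[OF a glue_measurable_M[OF a stable_setM[OF G x]] x glue_eq[OF a]])
  then show "concat_sets M a G \<noteq> {}" by blast
  show "concat_sets M a G \<subseteq> borel_measurable M" unfolding concat_sets_iff[OF a] subset_iff by blast
  fix b w z
  assume b: "event_partition M F b" and w: "\<And>j. w j \<in> concat_sets M a G" and z: "z \<in> borel_measurable M"
    and eq: "\<And>j. AE \<omega> in M. \<omega> \<in> b j \<longrightarrow> z \<omega> = w j \<omega>"
  have "\<exists>x. (\<forall>k. x k \<in> G k) \<and> (\<forall>k. AE \<omega> in M. \<omega> \<in> a k \<longrightarrow> w j \<omega> = x k \<omega>)" for j
    using w[of j] unfolding concat_sets_iff[OF a] by (rule conjunct2)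
  from choice[OF allI[OF this]] obtain x
    where x': "\<forall>j. (\<forall>k. x j k \<in> G k) \<and> (\<forall>k. AE \<omega> in M. \<omega> \<in> a k \<longrightarrow> w j \<omega> = x j k \<omega>)" ..
  have x: "x j k \<in> G k" for j k using x'[THEN spec, THEN conjunct1, THEN spec] .
  have xw: "AE \<omega> in M. \<omega> \<in> a k \<longrightarrow> w j \<omega> = x j k \<omega>" for j k using x'[THEN spec, THEN conjunct2, THEN spec] .
  \<comment> \<open>The partitions are taken in the other order: the pieces \<open>x j k\<close> on
    \<open>a k\<close> all come from \<open>G k\<close>, which is stable and absorbs the
    concatenation along \<open>b\<close>.\<close>
  have "z \<in> concat_sets M a (\<lambda>k. concat_sets M b (\<lambda>_. G k))"
  proof (rule concat_sets_refine[OF a b, of "\<lambda>k j. x j k"])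
    show "AE \<omega> in M. \<omega> \<in> a k \<and> \<omega> \<in> b j \<longrightarrow> z \<omega> = x j k \<omega>" for k j
      using eq[of j] xw[of k j] by eventually_elim auto
  qed (use x stable_setM[OF G] z in auto)
  moreover have "concat_sets M b (\<lambda>_. G k) \<subseteq> G k" for k by (rule concat_sets_subset[OF b G]) simp
  ultimately show "z \<in> concat_sets M a G" unfolding concat_sets_def by blast
qed

end

subsection \<open>The stable weak topology\<close>

lemma lim_partition_sum_ereal:
  fixes v :: "nat \<Rightarrow> ereal"
  assumes "\<exists>!k. \<omega> \<in> a k" "\<omega> \<in> a j"
  shows "lim (\<lambda>n. \<Sum>k<n. indicator (a k) \<omega> * v k) = v j"
proof -
  have *: "\<omega> \<in> a k \<longleftrightarrow> k = j" for k using assms by blast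
  have "(\<Sum>k<n. indicator (a k) \<omega> * v k) = v j" if "n > j" for n
  proof -
    have "(\<Sum>k<n. indicator (a k) \<omega> * v k) = (\<Sum>k<n. if k = j then v k else 0)"
      by (intro sum.cong) (auto simp: * indicator_def)
    then show ?thesis using that by simp
  qed
  then have "eventually (\<lambda>n. (\<Sum>k<n. indicator (a k) \<omega> * v k) = v j) sequentially"
    by (rule eventually_mono[OF eventually_gt_at_top[of j]])
  then show ?thesis by (intro limI tendsto_eventually)
qed

text \<open>Abstract roles allow the topology to be analysed once and used on both sides of the
  pairing. The carrier \<open>X\<close> is closed under translations by its elements, while
  \<open>Y\<close> supplies the test elements.\<close>

locale conditional_pairing = finite_measure_subalgebra M F for M F :: "'a measure" +
  fixes X Y :: "('a \<Rightarrow> real) set"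
  assumes X_measurable: "x \<in> X \<Longrightarrow> x \<in> borel_measurable M"
    and pair_L1: "x \<in> X \<Longrightarrow> y \<in> Y \<Longrightarrow> (\<lambda>\<omega>. x \<omega> * y \<omega>) \<in> L1_cond M F"
    and X_add: "x \<in> X \<Longrightarrow> x' \<in> X \<Longrightarrow> (\<lambda>\<omega>. x \<omega> + x' \<omega>) \<in> X"
    and X_diff: "x \<in> X \<Longrightarrow> x' \<in> X \<Longrightarrow> (\<lambda>\<omega>. x \<omega> - x' \<omega>) \<in> X"
begin

abbreviation pr :: "('a \<Rightarrow> real) \<Rightarrow> ('a \<Rightarrow> real) \<Rightarrow> 'a \<Rightarrow> real" where
  "pr x y \<equiv> ce (\<lambda>\<omega>. x \<omega> * y \<omega>)"

definition weak_data :: "(nat \<Rightarrow> ('a \<Rightarrow> real) set) \<Rightarrow> (nat \<Rightarrow> 'a set) \<Rightarrow> ('a \<Rightarrow> real) \<Rightarrow> bool" where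
  "weak_data Fs a \<epsilon> \<longleftrightarrow> (\<forall>k. finite (Fs k) \<and> Fs k \<noteq> {} \<and> Fs k \<subseteq> Y) \<and> event_partition M F a \<and>
     \<epsilon> \<in> L0 F \<and> (AE \<omega> in M. 0 < \<epsilon> \<omega>)"

text \<open>Membership of z' in the basic neighbourhood of z, with the countably many conditions
  pulled out of the almost-everywhere quantifier. Pairing the difference z' - z lets
  \<open>close_inter\<close> hold for arbitrary functions.\<close>

definition close :: "(nat \<Rightarrow> ('a \<Rightarrow> real) set) \<Rightarrow> (nat \<Rightarrow> 'a set) \<Rightarrow> ('a \<Rightarrow> real)
    \<Rightarrow> ('a \<Rightarrow> real) \<Rightarrow> ('a \<Rightarrow> real) \<Rightarrow> bool" where
  "close Fs a \<epsilon> z z' \<longleftrightarrow> (\<forall>k. \<forall>y\<in>Fs k. AE \<omega> in M. \<omega> \<in> a k \<longrightarrow> \<bar>pr (\<lambda>\<omega>. z' \<omega> - z \<omega>) y \<omega>\<bar> < \<epsilon> \<omega>)"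

lemma pr_diff:
  assumes "x \<in> X" "x' \<in> X" "y \<in> Y"
  shows "AE \<omega> in M. pr (\<lambda>\<omega>. x \<omega> - x' \<omega>) y \<omega> = pr x y \<omega> - pr x' y \<omega>"
  using ce_diff[OF pair_L1[OF assms(1,3)] pair_L1[OF assms(2,3)]] by (simp add: left_diff_distrib)

lemma close_iff:
  assumes W: "weak_data Fs a \<epsilon>" and "z \<in> X" "z' \<in> X"
  shows "close Fs a \<epsilon> z z' \<longleftrightarrow> (\<forall>k. \<forall>y\<in>Fs k. AE \<omega> in M. \<omega> \<in> a k \<longrightarrow> \<bar>pr z' y \<omega> - pr z y \<omega>\<bar> < \<epsilon> \<omega>)"
proof -
  have "(AE \<omega> in M. \<omega> \<in> a k \<longrightarrow> \<bar>pr (\<lambda>\<omega>. z' \<omega> - z \<omega>) y \<omega>\<bar> < \<epsilon> \<omega>) \<longleftrightarrow>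
      (AE \<omega> in M. \<omega> \<in> a k \<longrightarrow> \<bar>pr z' y \<omega> - pr z y \<omega>\<bar> < \<epsilon> \<omega>)" if "y \<in> Fs k" for k y
  proof (rule eventually_subst)
    have "y \<in> Y" using W that unfolding weak_data_def by blast
    from pr_diff[OF assms(3,2) this]
    show "AE \<omega> in M. (\<omega> \<in> a k \<longrightarrow> \<bar>pr (\<lambda>\<omega>. z' \<omega> - z \<omega>) y \<omega>\<bar> < \<epsilon> \<omega>) =
      (\<omega> \<in> a k \<longrightarrow> \<bar>pr z' y \<omega> - pr z y \<omega>\<bar> < \<epsilon> \<omega>)" by eventually_elim simp
  qed
  then show ?thesis unfolding close_def by blast
qed

text \<open>Almost everywhere a single summand survives, and a finite supremum lies below a bound
  iff all its terms do. There are countably many conditions, so they can be separated.\<close>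

lemma stable_weak_nbhd_iff:
  assumes W: "weak_data Fs a \<epsilon>"
  shows "u \<in> stable_weak_nbhd M F X Fs a \<epsilon> \<longleftrightarrow>
    u \<in> X \<and> (\<forall>k. \<forall>y\<in>Fs k. AE \<omega> in M. \<omega> \<in> a k \<longrightarrow> \<bar>pr u y \<omega>\<bar> < \<epsilon> \<omega>)"
proof (cases "u \<in> X")
  case True
  have Fs: "finite (Fs k)" "Fs k \<noteq> {}" "Fs k \<subseteq> Y" for k using W unfolding weak_data_def by auto
  have a: "event_partition M F a" using W unfolding weak_data_def by auto
  have "AE \<omega> in M. \<forall>y\<in>Fs k. cond_exp_ext M F (\<lambda>\<omega>. u \<omega> * y \<omega>) \<omega> = ereal (pr u y \<omega>)" for k
    unfolding AE_ball_countable[OF countable_finite[OF Fs(1)]]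
    using cond_exp_ext_eq_ce[OF pair_L1[OF True]] Fs(3) by blast
  then have "AE \<omega> in M. \<forall>k. \<forall>y\<in>Fs k. cond_exp_ext M F (\<lambda>\<omega>. u \<omega> * y \<omega>) \<omega> = ereal (pr u y \<omega>)"
    unfolding AE_all_countable by blast
  moreover have "AE \<omega> in M. \<exists>!k. \<omega> \<in> a k" using a unfolding event_partition_def by blast
  ultimately have *: "AE \<omega> in M. (lim (\<lambda>n. \<Sum>k<n. indicator (a k) \<omega> *
               (SUP y\<in>Fs k. \<bar>cond_exp_ext M F (\<lambda>\<omega>. u \<omega> * y \<omega>) \<omega>\<bar>)) < ereal (\<epsilon> \<omega>)) \<longleftrightarrow>
      (\<forall>k. \<forall>y\<in>Fs k. \<omega> \<in> a k \<longrightarrow> \<bar>pr u y \<omega>\<bar> < \<epsilon> \<omega>)"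
  proof eventually_elim
    case (elim \<omega>)
    then obtain j where j: "\<omega> \<in> a j" by blast
    with elim have u: "\<omega> \<in> a k \<longleftrightarrow> k = j" for k by blast
    have "(SUP y\<in>Fs j. \<bar>cond_exp_ext M F (\<lambda>\<omega>. u \<omega> * y \<omega>) \<omega>\<bar>) < ereal (\<epsilon> \<omega>) \<longleftrightarrow>
        (\<forall>y\<in>Fs j. \<bar>cond_exp_ext M F (\<lambda>\<omega>. u \<omega> * y \<omega>) \<omega>\<bar> < ereal (\<epsilon> \<omega>))"
      using Fs(1,2)[of j] by (subst finite_Sup_less_iff) auto
    also have "\<dots> \<longleftrightarrow> (\<forall>y\<in>Fs j. \<bar>pr u y \<omega>\<bar> < \<epsilon> \<omega>)" using elim(1) by simp
    finally show ?case
      unfolding lim_partition_sum_ereal[of \<omega> a, OF elim(2) j] using u by auto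
  qed
  have "(AE \<omega> in M. lim (\<lambda>n. \<Sum>k<n. indicator (a k) \<omega> *
               (SUP y\<in>Fs k. \<bar>cond_exp_ext M F (\<lambda>\<omega>. u \<omega> * y \<omega>) \<omega>\<bar>)) < ereal (\<epsilon> \<omega>)) \<longleftrightarrow>
      (AE \<omega> in M. \<forall>k. \<forall>y\<in>Fs k. \<omega> \<in> a k \<longrightarrow> \<bar>pr u y \<omega>\<bar> < \<epsilon> \<omega>)"
    by (rule eventually_subst[OF *])
  also have "\<dots> \<longleftrightarrow> (\<forall>k. \<forall>y\<in>Fs k. AE \<omega> in M. \<omega> \<in> a k \<longrightarrow> \<bar>pr u y \<omega>\<bar> < \<epsilon> \<omega>)"
    unfolding AE_all_countable AE_ball_countable[OF countable_finite[OF Fs(1)]] ..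
  finally show ?thesis using True unfolding stable_weak_nbhd_def by simp
qed (simp add: stable_weak_nbhd_def)

lemma stable_weak_nbhd_translate:
  assumes W: "weak_data Fs a \<epsilon>" and x: "x \<in> X"
  shows "(\<lambda>u \<omega>. x \<omega> + u \<omega>) ` stable_weak_nbhd M F X Fs a \<epsilon> = {z \<in> X. close Fs a \<epsilon> x z}"
proof (intro set_eqI iffI)
  fix z assume "z \<in> (\<lambda>u \<omega>. x \<omega> + u \<omega>) ` stable_weak_nbhd M F X Fs a \<epsilon>"
  then obtain u where u: "u \<in> stable_weak_nbhd M F X Fs a \<epsilon>" "z = (\<lambda>\<omega>. x \<omega> + u \<omega>)" by blast
  then show "z \<in> {z \<in> X. close Fs a \<epsilon> x z}"
    using X_add[OF x] unfolding stable_weak_nbhd_iff[OF W] close_def by simp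
next
  fix z assume z: "z \<in> {z \<in> X. close Fs a \<epsilon> x z}"
  then have "(\<lambda>\<omega>. z \<omega> - x \<omega>) \<in> stable_weak_nbhd M F X Fs a \<epsilon>"
    using X_diff[OF _ x] unfolding stable_weak_nbhd_iff[OF W] close_def by simp
  then show "z \<in> (\<lambda>u \<omega>. x \<omega> + u \<omega>) ` stable_weak_nbhd M F X Fs a \<epsilon>"
    by (rule rev_image_eqI) simp
qed

lemma stable_weak_topology_eq:
  "stable_weak_topology M F X Y =
    topology_generated_by {{z \<in> X. close Fs a \<epsilon> x z} | x Fs a \<epsilon>. x \<in> X \<and> weak_data Fs a \<epsilon>}"
proof -
  have "{(\<lambda>u \<omega>. x \<omega> + u \<omega>) ` stable_weak_nbhd M F X Fs a \<epsilon> | x Fs a \<epsilon>.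
          x \<in> X \<and> (\<forall>k. finite (Fs k) \<and> Fs k \<noteq> {} \<and> Fs k \<subseteq> Y) \<and> event_partition M F a \<and>
          \<epsilon> \<in> L0 F \<and> (AE \<omega> in M. 0 < \<epsilon> \<omega>)} =
     {(\<lambda>u \<omega>. x \<omega> + u \<omega>) ` stable_weak_nbhd M F X Fs a \<epsilon> | x Fs a \<epsilon>. x \<in> X \<and> weak_data Fs a \<epsilon>}"
    unfolding weak_data_def by blast
  also have "\<dots> = {{z \<in> X. close Fs a \<epsilon> x z} | x Fs a \<epsilon>. x \<in> X \<and> weak_data Fs a \<epsilon>}"
    using stable_weak_nbhd_translate by blast
  finally show ?thesis unfolding stable_weak_topology_def by simp
qed

lemma close_refl:
  assumes "weak_data Fs a \<epsilon>"
  shows "close Fs a \<epsilon> z z"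
proof -
  have "AE \<omega> in M. 0 < \<epsilon> \<omega>" using assms unfolding weak_data_def by blast
  moreover have "AE \<omega> in M. ce (\<lambda>_. 0) \<omega> = 0" using ce_F[of "\<lambda>_. 0"] by simp
  ultimately have "AE \<omega> in M. \<bar>ce (\<lambda>_. 0) \<omega>\<bar> < \<epsilon> \<omega>" by eventually_elim simp
  then show ?thesis unfolding close_def by (auto elim: eventually_mono)
qed

text \<open>Supplies one random radius for all test elements of a finite set, on one member of a
  partition.\<close>

lemma finite_positive_minorant:
  assumes "finite G" "\<And>y. y \<in> G \<Longrightarrow> f y \<in> borel_measurable F" "\<And>y. y \<in> G \<Longrightarrow> AE \<omega> in M. \<omega> \<in> A \<longrightarrow> (0::real) < f y \<omega>"
  shows "\<exists>\<epsilon>\<in>borel_measurable F. (\<forall>y\<in>G. AE \<omega> in M. \<omega> \<in> A \<longrightarrow> \<epsilon> \<omega> \<le> f y \<omega>) \<and> (AE \<omega> in M. \<omega> \<in> A \<longrightarrow> 0 < \<epsilon> \<omega>)"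
  using assms
proof (induction G)
  case empty
  then show ?case by (intro bexI[of _ "\<lambda>_. 1"]) auto
next
  case (insert y G)
  then obtain \<epsilon> where e [measurable]: "\<epsilon> \<in> borel_measurable F" and e1: "\<And>y. y \<in> G \<Longrightarrow> AE \<omega> in M. \<omega> \<in> A \<longrightarrow> \<epsilon> \<omega> \<le> f y \<omega>"
    and e2: "AE \<omega> in M. \<omega> \<in> A \<longrightarrow> 0 < \<epsilon> \<omega>" by auto
  have [measurable]: "f y \<in> borel_measurable F" using insert by auto
  have "AE \<omega> in M. \<omega> \<in> A \<longrightarrow> 0 < f y \<omega>" using insert by auto
  with e2 have "AE \<omega> in M. \<omega> \<in> A \<longrightarrow> 0 < min (\<epsilon> \<omega>) (f y \<omega>)" by eventually_elim auto
  moreover have "AE \<omega> in M. \<omega> \<in> A \<longrightarrow> min (\<epsilon> \<omega>) (f y \<omega>) \<le> f z \<omega>" if "z \<in> insert y G" for z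
  proof (cases "z = y")
    case False
    then have "z \<in> G" using that by simp
    from e1[OF this] show ?thesis by eventually_elim auto
  qed auto
  ultimately show ?case by (intro bexI[of _ "\<lambda>\<omega>. min (\<epsilon> \<omega>) (f y \<omega>)"]) auto
qed

text \<open>Recentres a basic neighbourhood at z. For each test element the margin left at z is
  positive; finite minima of these margins are taken on every member and glued to one
  radius.\<close>

lemma close_shrink:
  assumes W: "weak_data Fs a \<epsilon>" and x: "x \<in> X" and z: "z \<in> X" and c: "close Fs a \<epsilon> x z"
  shows "\<exists>\<delta>. weak_data Fs a \<delta> \<and> (\<forall>z'\<in>X. close Fs a \<delta> z z' \<longrightarrow> close Fs a \<epsilon> x z')"
proof -
  have Fs: "finite (Fs k)" "Fs k \<noteq> {}" "Fs k \<subseteq> Y" for k using W unfolding weak_data_def by auto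
  have a: "event_partition M F a" and [measurable]: "\<epsilon> \<in> borel_measurable F" using W unfolding weak_data_def by auto
  define P where "P k \<delta> \<longleftrightarrow> (\<forall>y\<in>Fs k. AE \<omega> in M. \<omega> \<in> a k \<longrightarrow> \<delta> \<omega> \<le> \<epsilon> \<omega> - \<bar>pr z y \<omega> - pr x y \<omega>\<bar>) \<and>
      (AE \<omega> in M. \<omega> \<in> a k \<longrightarrow> 0 < \<delta> \<omega>)" for k \<delta>
  have "\<exists>\<delta>\<in>borel_measurable F. P k \<delta>" for k unfolding P_def
  proof (rule finite_positive_minorant[OF Fs(1)])
    fix y assume y: "y \<in> Fs k"
    show "(\<lambda>\<omega>. \<epsilon> \<omega> - \<bar>pr z y \<omega> - pr x y \<omega>\<bar>) \<in> borel_measurable F" by measurable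
    have "AE \<omega> in M. \<omega> \<in> a k \<longrightarrow> \<bar>pr z y \<omega> - pr x y \<omega>\<bar> < \<epsilon> \<omega>"
      using c y unfolding close_iff[OF W x z] by blast
    then show "AE \<omega> in M. \<omega> \<in> a k \<longrightarrow> 0 < \<epsilon> \<omega> - \<bar>pr z y \<omega> - pr x y \<omega>\<bar>"
      by eventually_elim simp
  qed
  then obtain d where d0: "\<And>k. d k \<in> borel_measurable F" "\<And>k. P k (d k)" by metis
  note d = d0(1) conjunct1[OF d0(2)[unfolded P_def], rule_format] conjunct2[OF d0(2)[unfolded P_def]]
  define \<delta> where "\<delta> = glue a d"
  have pos: "AE \<omega> in M. 0 < \<delta> \<omega>"
  proof (rule partition_AE[OF a])
    show "AE \<omega> in M. \<omega> \<in> a k \<longrightarrow> 0 < \<delta> \<omega>" for k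
      using glue_eq[OF a, of k d] d(3)[of k] unfolding \<delta>_def by eventually_elim auto
  qed
  have W': "weak_data Fs a \<delta>" unfolding weak_data_def
    using Fs a pos glue_measurable_F[OF a d(1)] unfolding \<delta>_def by auto
  moreover have "close Fs a \<epsilon> x z'" if z': "z' \<in> X" and cl: "close Fs a \<delta> z z'" for z'
    unfolding close_iff[OF W x z']
  proof (intro allI ballI)
    fix k y assume y: "y \<in> Fs k"
    have "AE \<omega> in M. \<omega> \<in> a k \<longrightarrow> \<bar>pr z' y \<omega> - pr z y \<omega>\<bar> < \<delta> \<omega>"
      using cl y unfolding close_iff[OF W' z z'] by blast
    with glue_eq[OF a, of k d] d(2)[OF y]
    show "AE \<omega> in M. \<omega> \<in> a k \<longrightarrow> \<bar>pr z' y \<omega> - pr x y \<omega>\<bar> < \<epsilon> \<omega>"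
      unfolding \<delta>_def by eventually_elim auto
  qed
  ultimately show ?thesis by blast
qed

text \<open>On the common refinement of the partitions, the union of the two test sets and the
  smaller radius serve both neighbourhoods.\<close>

lemma close_inter:
  assumes W: "weak_data Fs a \<epsilon>" and W': "weak_data Fs' a' \<epsilon>'"
  shows "\<exists>Gs b \<delta>. weak_data Gs b \<delta> \<and> (\<forall>z z'. close Gs b \<delta> z z' \<longrightarrow> close Fs a \<epsilon> z z' \<and> close Fs' a' \<epsilon>' z z')"
proof -
  have a: "event_partition M F a" "event_partition M F a'" using W W' unfolding weak_data_def by auto
  define Gs where "Gs n = Fs (fst (prod_decode n)) \<union> Fs' (snd (prod_decode n))" for n
  define b where "b n = a (fst (prod_decode n)) \<inter> a' (snd (prod_decode n))" for n
  define \<delta> where "\<delta> \<omega> = min (\<epsilon> \<omega>) (\<epsilon>' \<omega>)" for \<omega>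
  have b: "event_partition M F b" using partition_refine[OF a(1), of "\<lambda>_. a'"] a(2) unfolding b_def by simp
  have pos: "AE \<omega> in M. 0 < \<epsilon> \<omega>" "AE \<omega> in M. 0 < \<epsilon>' \<omega>" using W W' unfolding weak_data_def by auto
  then have "AE \<omega> in M. 0 < \<delta> \<omega>" unfolding \<delta>_def by eventually_elim simp
  moreover have "\<delta> \<in> borel_measurable F" using W W' unfolding weak_data_def \<delta>_def by auto
  ultimately have "weak_data Gs b \<delta>" using W W' b unfolding weak_data_def Gs_def by auto
  moreover have "close Fs a \<epsilon> z z'" if c: "close Gs b \<delta> z z'" for z z'
    unfolding close_def
  proof (intro allI ballI)
    fix k y assume y: "y \<in> Fs k"
    show "AE \<omega> in M. \<omega> \<in> a k \<longrightarrow> \<bar>pr (\<lambda>\<omega>. z' \<omega> - z \<omega>) y \<omega>\<bar> < \<epsilon> \<omega>"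
    proof (rule partition_AE[OF a(2)])
      fix j
      have "y \<in> Gs (prod_encode (k, j))" using y unfolding Gs_def by simp
      with c have "AE \<omega> in M. \<omega> \<in> b (prod_encode (k, j)) \<longrightarrow> \<bar>pr (\<lambda>\<omega>. z' \<omega> - z \<omega>) y \<omega>\<bar> < \<delta> \<omega>"
        unfolding close_def by blast
      then show "AE \<omega> in M. \<omega> \<in> a' j \<longrightarrow> \<omega> \<in> a k \<longrightarrow> \<bar>pr (\<lambda>\<omega>. z' \<omega> - z \<omega>) y \<omega>\<bar> < \<epsilon> \<omega>"
        unfolding b_def \<delta>_def by eventually_elim auto
    qed
  qed
  moreover have "close Fs' a' \<epsilon>' z z'" if c: "close Gs b \<delta> z z'" for z z'
    unfolding close_def
  proof (intro allI ballI)
    fix k y assume y: "y \<in> Fs' k"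
    show "AE \<omega> in M. \<omega> \<in> a' k \<longrightarrow> \<bar>pr (\<lambda>\<omega>. z' \<omega> - z \<omega>) y \<omega>\<bar> < \<epsilon>' \<omega>"
    proof (rule partition_AE[OF a(1)])
      fix j
      have "y \<in> Gs (prod_encode (j, k))" using y unfolding Gs_def by simp
      with c have "AE \<omega> in M. \<omega> \<in> b (prod_encode (j, k)) \<longrightarrow> \<bar>pr (\<lambda>\<omega>. z' \<omega> - z \<omega>) y \<omega>\<bar> < \<delta> \<omega>"
        unfolding close_def by blast
      then show "AE \<omega> in M. \<omega> \<in> a j \<longrightarrow> \<omega> \<in> a' k \<longrightarrow> \<bar>pr (\<lambda>\<omega>. z' \<omega> - z \<omega>) y \<omega>\<bar> < \<epsilon>' \<omega>"
        unfolding b_def \<delta>_def by eventually_elim auto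
    qed
  qed
  ultimately show ?thesis by blast
qed

text \<open>The topology is only generated by the basic sets; this shows that they form a base.
  \<open>close_inter\<close> handles intersections and \<open>close_shrink\<close> recentres a basic
  set at any of its points.\<close>

lemma open_contains_basic:
  assumes "openin (stable_weak_topology M F X Y) W" "z \<in> W"
  shows "\<exists>Fs a \<epsilon>. weak_data Fs a \<epsilon> \<and> (\<forall>z'\<in>X. close Fs a \<epsilon> z z' \<longrightarrow> z' \<in> W)"
proof -
  have "generate_topology_on {{z \<in> X. close Fs a \<epsilon> x z} | x Fs a \<epsilon>. x \<in> X \<and> weak_data Fs a \<epsilon>} W"
    using assms(1) unfolding stable_weak_topology_eq by (rule openin_topology_generated_by)
  then have "\<forall>z\<in>W. \<exists>Fs a \<epsilon>. weak_data Fs a \<epsilon> \<and> (\<forall>z'\<in>X. close Fs a \<epsilon> z z' \<longrightarrow> z' \<in> W)"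
  proof induction
    case Empty
    then show ?case by simp
  next
    case (Int U V)
    show ?case
    proof
      fix z assume z: "z \<in> U \<inter> V"
      obtain Fs a \<epsilon> where 1: "weak_data Fs a \<epsilon>" "\<forall>z'\<in>X. close Fs a \<epsilon> z z' \<longrightarrow> z' \<in> U"
        using Int.IH(1) z by (meson IntD1)
      obtain Fs' a' \<epsilon>' where 2: "weak_data Fs' a' \<epsilon>'" "\<forall>z'\<in>X. close Fs' a' \<epsilon>' z z' \<longrightarrow> z' \<in> V"
        using Int.IH(2) z by (meson IntD2)
      obtain Gs b \<delta> where 3: "weak_data Gs b \<delta>"
        "\<And>z z'. close Gs b \<delta> z z' \<Longrightarrow> close Fs a \<epsilon> z z' \<and> close Fs' a' \<epsilon>' z z'"
        using close_inter[OF 1(1) 2(1)] by metis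
      have "\<forall>z'\<in>X. close Gs b \<delta> z z' \<longrightarrow> z' \<in> U \<inter> V" using 1(2) 2(2) 3(2) by blast
      with 3(1) show "\<exists>Fs a \<epsilon>. weak_data Fs a \<epsilon> \<and> (\<forall>z'\<in>X. close Fs a \<epsilon> z z' \<longrightarrow> z' \<in> U \<inter> V)" by blast
    qed
  next
    case (UN K)
    show ?case
    proof
      fix z assume "z \<in> \<Union>K"
      then obtain k where k: "k \<in> K" "z \<in> k" by blast
      then obtain Fs a \<epsilon> where 1: "weak_data Fs a \<epsilon>" "\<forall>z'\<in>X. close Fs a \<epsilon> z z' \<longrightarrow> z' \<in> k"
        using UN.IH[OF k(1)] by meson
      then have "\<forall>z'\<in>X. close Fs a \<epsilon> z z' \<longrightarrow> z' \<in> \<Union>K" using k(1) by blast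
      with 1(1) show "\<exists>Fs a \<epsilon>. weak_data Fs a \<epsilon> \<and> (\<forall>z'\<in>X. close Fs a \<epsilon> z z' \<longrightarrow> z' \<in> \<Union>K)" by blast
    qed
  next
    case (Basis s)
    then obtain x Fs a \<epsilon> where s: "s = {z \<in> X. close Fs a \<epsilon> x z}" "x \<in> X" "weak_data Fs a \<epsilon>" by blast
    show ?case
    proof
      fix z assume z: "z \<in> s"
      then obtain \<delta> where "weak_data Fs a \<delta>" "\<forall>z'\<in>X. close Fs a \<delta> z z' \<longrightarrow> close Fs a \<epsilon> x z'"
        using close_shrink[OF s(3,2)] s(1) by blast
      then show "\<exists>Fs a \<epsilon>. weak_data Fs a \<epsilon> \<and> (\<forall>z'\<in>X. close Fs a \<epsilon> z z' \<longrightarrow> z' \<in> s)"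
        using s(1) by blast
    qed
  qed
  with assms(2) show ?thesis by blast
qed

lemma openin_basic:
  "x \<in> X \<Longrightarrow> weak_data Fs a \<epsilon> \<Longrightarrow> openin (stable_weak_topology M F X Y) {z \<in> X. close Fs a \<epsilon> x z}"
  unfolding stable_weak_topology_eq openin_topology_generated_by_iff
  by (rule generate_topology_on.Basis) blast

lemma openinI_basic:
  assumes WX: "W \<subseteq> X"
    and basic: "\<And>z. z \<in> W \<Longrightarrow> \<exists>Fs a \<epsilon>. weak_data Fs a \<epsilon> \<and> (\<forall>z'\<in>X. close Fs a \<epsilon> z z' \<longrightarrow> z' \<in> W)"
  shows "openin (stable_weak_topology M F X Y) W"
proof (subst openin_subopen, intro ballI)
  fix z assume z: "z \<in> W"
  then obtain Fs a \<epsilon> where *: "weak_data Fs a \<epsilon>" "\<forall>z'\<in>X. close Fs a \<epsilon> z z' \<longrightarrow> z' \<in> W"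
    using basic by blast
  show "\<exists>T. openin (stable_weak_topology M F X Y) T \<and> z \<in> T \<and> T \<subseteq> W"
    by (rule exI[of _ "{z' \<in> X. close Fs a \<epsilon> z z'}"]) (use * z WX openin_basic[of z] close_refl in blast)
qed

lemma weak_data_single:
  assumes "finite G" "G \<noteq> {}" "G \<subseteq> Y" "\<epsilon> \<in> borel_measurable F" "AE \<omega> in M. 0 < \<epsilon> \<omega>"
  shows "weak_data (\<lambda>_. G) trivial_partition \<epsilon>"
  using assms partition_trivial unfolding weak_data_def by simp

lemma close_singleD:
  assumes "close (\<lambda>_. G) trivial_partition \<epsilon> z z'"
    and "y \<in> G" "z \<in> X" "z' \<in> X" "y \<in> Y"
  shows "AE \<omega> in M. \<bar>pr z' y \<omega> - pr z y \<omega>\<bar> < \<epsilon> \<omega>"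
proof -
  have "AE \<omega> in M. \<omega> \<in> space M \<longrightarrow> \<bar>pr (\<lambda>\<omega>. z' \<omega> - z \<omega>) y \<omega>\<bar> < \<epsilon> \<omega>"
    using assms(1,2) unfolding close_def trivial_partition_def by force
  with AE_space pr_diff[OF assms(4,3,5)] show ?thesis by eventually_elim simp
qed

text \<open>A test element guarantees that basic sets exist; without any, the generated topology
  would have an empty carrier.\<close>

lemma topspace_stable_weak:
  assumes "Y \<noteq> {}"
  shows "topspace (stable_weak_topology M F X Y) = X"
proof
  show "topspace (stable_weak_topology M F X Y) \<subseteq> X" unfolding stable_weak_topology_eq by auto
  obtain y where "y \<in> Y" using assms by blast
  then have "openin (stable_weak_topology M F X Y) X"
    using weak_data_single[of "{y}" "\<lambda>_. 1"] by (intro openinI_basic) auto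
  then show "X \<subseteq> topspace (stable_weak_topology M F X Y)" by (rule openin_subset)
qed

lemma closure_of_imp_close:
  assumes cl: "z \<in> stable_weak_topology M F X Y closure_of B" and z: "z \<in> X" and W: "weak_data Fs a \<epsilon>"
  obtains b where "b \<in> B" "close Fs a \<epsilon> z b"
proof -
  have "z \<in> {z' \<in> X. close Fs a \<epsilon> z z'}" using z close_refl[OF W] by simp
  moreover have "openin (stable_weak_topology M F X Y) {z' \<in> X. close Fs a \<epsilon> z z'}" by (rule openin_basic[OF z W])
  ultimately have "\<exists>b. b \<in> B \<and> b \<in> {z' \<in> X. close Fs a \<epsilon> z z'}"
    using cl[unfolded in_closure_of, THEN conjunct2, THEN spec, of "{z' \<in> X. close Fs a \<epsilon> z z'}"] by (elim mp) (rule conjI)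
  then show ?thesis using that by auto
qed

end

subsection \<open>Conditional risk measures and their conjugates\<close>

locale conditional_risk = finite_measure_subalgebra M F for M F :: "'a measure" +
  fixes X :: "('a \<Rightarrow> real) set" and \<rho> :: "('a \<Rightarrow> real) \<Rightarrow> 'a \<Rightarrow> real"
  assumes model: "model_module M F X" and risk: "cond_risk_measure M F X \<rho>"
begin

abbreviation Y :: "('a \<Rightarrow> real) set" where "Y \<equiv> koethe_dual M F X"
abbreviation D :: "('a \<Rightarrow> real) set" where "D \<equiv> dual_densities M F X"
abbreviation \<alpha> :: "('a \<Rightarrow> real) \<Rightarrow> 'a \<Rightarrow> ereal" where "\<alpha> \<equiv> fenchel M F X \<rho>"

lemma X_add: "x \<in> X \<Longrightarrow> y \<in> X \<Longrightarrow> (\<lambda>\<omega>. x \<omega> + y \<omega>) \<in> X"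
  and X_mult: "\<eta> \<in> borel_measurable F \<Longrightarrow> x \<in> X \<Longrightarrow> (\<lambda>\<omega>. \<eta> \<omega> * x \<omega>) \<in> X"
  and X_solid: "y \<in> X \<Longrightarrow> x \<in> borel_measurable M \<Longrightarrow> AE \<omega> in M. \<bar>x \<omega>\<bar> \<le> \<bar>y \<omega>\<bar> \<Longrightarrow> x \<in> X"
  and X_L1: "x \<in> X \<Longrightarrow> x \<in> L1_cond M F"
  and X_F: "\<eta> \<in> borel_measurable F \<Longrightarrow> \<eta> \<in> X"
  and X_stable: "stable_set M F X"
  using model unfolding model_module_def by blast+

lemma X_measurable: "x \<in> X \<Longrightarrow> x \<in> borel_measurable M"
  using X_L1 L1_condD by blast

lemma X_cmult: "x \<in> X \<Longrightarrow> (\<lambda>\<omega>. c * x \<omega>) \<in> X" for c :: real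
  using X_mult[of "\<lambda>_. c"] by simp

lemma X_diff: "x \<in> X \<Longrightarrow> y \<in> X \<Longrightarrow> (\<lambda>\<omega>. x \<omega> - y \<omega>) \<in> X"
  using X_add[OF _ X_cmult[of y "-1"]] by simp

lemma X_comb:
  assumes "\<eta> \<in> borel_measurable F" "x \<in> X" "y \<in> X"
  shows "(\<lambda>\<omega>. \<eta> \<omega> * x \<omega> + (1 - \<eta> \<omega>) * y \<omega>) \<in> X"
  by (intro X_add X_mult assms borel_measurable_diff borel_measurable_const)

lemma Y_measurable: "y \<in> Y \<Longrightarrow> y \<in> borel_measurable M"
  unfolding koethe_dual_def by blast

lemma XY_L1: "x \<in> X \<Longrightarrow> y \<in> Y \<Longrightarrow> (\<lambda>\<omega>. x \<omega> * y \<omega>) \<in> L1_cond M F"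
  unfolding koethe_dual_def by blast

lemma YX_L1: "x \<in> X \<Longrightarrow> y \<in> Y \<Longrightarrow> (\<lambda>\<omega>. y \<omega> * x \<omega>) \<in> L1_cond M F"
  using XY_L1 by (simp add: mult.commute)

lemma Y_L1: "y \<in> Y \<Longrightarrow> y \<in> L1_cond M F"
  using XY_L1[OF X_F[of "\<lambda>_. 1"]] by simp

lemma Y_add: "y \<in> Y \<Longrightarrow> z \<in> Y \<Longrightarrow> (\<lambda>\<omega>. y \<omega> + z \<omega>) \<in> Y"
proof -
  assume y: "y \<in> Y" and z: "z \<in> Y"
  have "(\<lambda>\<omega>. x \<omega> * (y \<omega> + z \<omega>)) \<in> L1_cond M F" if "x \<in> X" for x
    using L1_cond_add[OF XY_L1[OF that y] XY_L1[OF that z]] by (simp add: distrib_left)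
  moreover have "(\<lambda>\<omega>. y \<omega> + z \<omega>) \<in> borel_measurable M"
    using Y_measurable[OF y] Y_measurable[OF z] by measurable
  ultimately show ?thesis unfolding koethe_dual_def by blast
qed

lemma Y_mult: "\<eta> \<in> borel_measurable F \<Longrightarrow> y \<in> Y \<Longrightarrow> (\<lambda>\<omega>. \<eta> \<omega> * y \<omega>) \<in> Y"
proof -
  assume \<eta>: "\<eta> \<in> borel_measurable F" and y: "y \<in> Y"
  have "(\<lambda>\<omega>. x \<omega> * (\<eta> \<omega> * y \<omega>)) \<in> L1_cond M F" if "x \<in> X" for x
    using L1_cond_mult[OF XY_L1[OF that y] \<eta>] by (simp add: mult.left_commute)
  moreover have "(\<lambda>\<omega>. \<eta> \<omega> * y \<omega>) \<in> borel_measurable M"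
    using Y_measurable[OF y] L0_subalgebra[OF \<eta>] by measurable
  ultimately show ?thesis unfolding koethe_dual_def by blast
qed

lemma Y_diff: "y \<in> Y \<Longrightarrow> z \<in> Y \<Longrightarrow> (\<lambda>\<omega>. y \<omega> - z \<omega>) \<in> Y"
  using Y_add[OF _ Y_mult[of "\<lambda>_. -1" z]] by simp

lemma Y_F: "\<eta> \<in> borel_measurable F \<Longrightarrow> \<eta> \<in> Y"
proof -
  assume \<eta>: "\<eta> \<in> borel_measurable F"
  have "(\<lambda>\<omega>. x \<omega> * \<eta> \<omega>) \<in> L1_cond M F" if "x \<in> X" for x
    using L1_cond_mult[OF X_L1[OF that] \<eta>] by (simp add: mult.commute)
  with L0_subalgebra[OF \<eta>] show ?thesis unfolding koethe_dual_def by blast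
qed

lemma Y_local:
  assumes part: "event_partition M F a" and x: "\<And>k. x k \<in> Y" and z: "z \<in> borel_measurable M"
    and eq: "\<And>k. AE \<omega> in M. \<omega> \<in> a k \<longrightarrow> z \<omega> = x k \<omega>"
  shows "z \<in> Y"
  unfolding koethe_dual_def
proof (intro CollectI conjI ballI z)
  fix u assume u: "u \<in> X"
  show "(\<lambda>\<omega>. u \<omega> * z \<omega>) \<in> L1_cond M F"
  proof (rule L1_cond_local[OF part])
    show "(\<lambda>\<omega>. u \<omega> * x k \<omega>) \<in> L1_cond M F" for k by (rule XY_L1[OF u x])
    show "(\<lambda>\<omega>. u \<omega> * z \<omega>) \<in> borel_measurable M" using X_measurable[OF u] z by measurable
    show "AE \<omega> in M. \<omega> \<in> a k \<longrightarrow> u \<omega> * z \<omega> = u \<omega> * x k \<omega>" for k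
      using eq[of k] by eventually_elim simp
  qed
qed

sublocale XY: conditional_pairing M F X Y
  by unfold_locales (auto intro: X_measurable XY_L1 X_add X_diff)

sublocale YX: conditional_pairing M F Y X
  by unfold_locales (auto intro: Y_measurable YX_L1 Y_add Y_diff)

abbreviation pr :: "('a \<Rightarrow> real) \<Rightarrow> ('a \<Rightarrow> real) \<Rightarrow> 'a \<Rightarrow> real" where
  "pr x y \<equiv> ce (\<lambda>\<omega>. x \<omega> * y \<omega>)"

lemma pr_local:
  assumes "x \<in> X" "x' \<in> X" "y \<in> Y" "y' \<in> Y" "A \<in> sets F"
    and "AE \<omega> in M. \<omega> \<in> A \<longrightarrow> x \<omega> = x' \<omega>" "AE \<omega> in M. \<omega> \<in> A \<longrightarrow> y \<omega> = y' \<omega>"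
  shows "AE \<omega> in M. \<omega> \<in> A \<longrightarrow> pr x y \<omega> = pr x' y' \<omega>"
proof (rule ce_cong_on[OF XY_L1[OF assms(1,3)] XY_L1[OF assms(2,4)] assms(5)])
  from assms(6,7) show "AE \<omega> in M. \<omega> \<in> A \<longrightarrow> x \<omega> * y \<omega> = x' \<omega> * y' \<omega>" by eventually_elim simp
qed

lemma pr_add: "x \<in> X \<Longrightarrow> x' \<in> X \<Longrightarrow> y \<in> Y \<Longrightarrow> AE \<omega> in M. pr (\<lambda>\<omega>. x \<omega> + x' \<omega>) y \<omega> = pr x y \<omega> + pr x' y \<omega>"
  using ce_add[OF XY_L1 XY_L1] by (simp add: distrib_right)

lemma pr_mult: "\<eta> \<in> borel_measurable F \<Longrightarrow> x \<in> X \<Longrightarrow> y \<in> Y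
    \<Longrightarrow> AE \<omega> in M. pr (\<lambda>\<omega>. \<eta> \<omega> * x \<omega>) y \<omega> = \<eta> \<omega> * pr x y \<omega>"
  using ce_mult[OF XY_L1, of x y \<eta>] by (simp add: mult.assoc)

lemma pr_cmult: "x \<in> X \<Longrightarrow> y \<in> Y \<Longrightarrow> AE \<omega> in M. pr (\<lambda>\<omega>. c * x \<omega>) y \<omega> = c * pr x y \<omega>" for c :: real
  using pr_mult[of "\<lambda>_. c"] by simp

lemma pr_F: "\<eta> \<in> borel_measurable F \<Longrightarrow> y \<in> Y \<Longrightarrow> AE \<omega> in M. pr \<eta> y \<omega> = \<eta> \<omega> * ce y \<omega>"
  using ce_mult[OF Y_L1] by simp

section \<open>Locality of the risk measure\<close>

lemma \<rho>_F: "x \<in> X \<Longrightarrow> \<rho> x \<in> borel_measurable F"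
  and \<rho>_convex: "\<eta> \<in> borel_measurable F \<Longrightarrow> x \<in> X \<Longrightarrow> y \<in> X \<Longrightarrow> AE \<omega> in M. 0 \<le> \<eta> \<omega> \<and> \<eta> \<omega> \<le> 1 \<Longrightarrow>
        AE \<omega> in M. \<rho> (\<lambda>\<omega>. \<eta> \<omega> * x \<omega> + (1 - \<eta> \<omega>) * y \<omega>) \<omega> \<le> \<eta> \<omega> * \<rho> x \<omega> + (1 - \<eta> \<omega>) * \<rho> y \<omega>"
  and \<rho>_mono: "x \<in> X \<Longrightarrow> y \<in> X \<Longrightarrow> AE \<omega> in M. x \<omega> \<le> y \<omega> \<Longrightarrow> AE \<omega> in M. \<rho> y \<omega> \<le> \<rho> x \<omega>"
  and \<rho>_shift: "\<eta> \<in> borel_measurable F \<Longrightarrow> x \<in> X \<Longrightarrow> AE \<omega> in M. \<rho> (\<lambda>\<omega>. x \<omega> + \<eta> \<omega>) \<omega> = \<rho> x \<omega> - \<eta> \<omega>"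
  using risk unfolding cond_risk_measure_def by blast+

lemma \<rho>_cong:
  assumes "x \<in> X" "z \<in> X" "AE \<omega> in M. x \<omega> = z \<omega>"
  shows "AE \<omega> in M. \<rho> x \<omega> = \<rho> z \<omega>"
proof -
  have "AE \<omega> in M. x \<omega> \<le> z \<omega>" "AE \<omega> in M. z \<omega> \<le> x \<omega>" using assms(3) by (auto elim: eventually_mono)
  from \<rho>_mono[OF assms(1,2) this(1)] \<rho>_mono[OF assms(2,1) this(2)] show ?thesis
    by eventually_elim simp
qed

text \<open>Conditional convexity with the indicator of \<open>A\<close> as coefficient: on
  \<open>A\<close> the upper bound is \<rho> x, while the combination \<open>w\<close> equals z
  almost everywhere.\<close>

lemma \<rho>_local_le:
  assumes x: "x \<in> X" and z: "z \<in> X" and A: "A \<in> sets F" and eq: "AE \<omega> in M. \<omega> \<in> A \<longrightarrow> x \<omega> = z \<omega>"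
  shows "AE \<omega> in M. \<omega> \<in> A \<longrightarrow> \<rho> z \<omega> \<le> \<rho> x \<omega>"
proof -
  define \<eta> where "\<eta> = (indicator A :: 'a \<Rightarrow> real)"
  have \<eta>: "\<eta> \<in> borel_measurable F" unfolding \<eta>_def using A by measurable
  define w where "w \<omega> = \<eta> \<omega> * x \<omega> + (1 - \<eta> \<omega>) * z \<omega>" for \<omega>
  have w: "w \<in> X" unfolding w_def by (rule X_comb[OF \<eta> x z])
  have "AE \<omega> in M. w \<omega> = z \<omega>" using eq by eventually_elim (auto simp: w_def \<eta>_def indicator_def)
  from \<rho>_cong[OF w z this]
  have "AE \<omega> in M. \<rho> w \<omega> = \<rho> z \<omega>" .
  moreover have "AE \<omega> in M. \<rho> w \<omega> \<le> \<eta> \<omega> * \<rho> x \<omega> + (1 - \<eta> \<omega>) * \<rho> z \<omega>"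
    unfolding w_def by (rule \<rho>_convex[OF \<eta> x z]) (auto simp: \<eta>_def indicator_def)
  ultimately show ?thesis by eventually_elim (auto simp: \<eta>_def)
qed

lemma \<rho>_local:
  assumes x: "x \<in> X" and z: "z \<in> X" and A: "A \<in> sets F" and eq: "AE \<omega> in M. \<omega> \<in> A \<longrightarrow> x \<omega> = z \<omega>"
  shows "AE \<omega> in M. \<omega> \<in> A \<longrightarrow> \<rho> x \<omega> = \<rho> z \<omega>"
proof -
  have eq': "AE \<omega> in M. \<omega> \<in> A \<longrightarrow> z \<omega> = x \<omega>" using eq by eventually_elim simp
  from \<rho>_local_le[OF x z A eq] \<rho>_local_le[OF z x A eq'] show ?thesis by eventually_elim auto
qed

section \<open>The conjugate and the dual densities\<close>

lemma fenchel_eq: "\<alpha> y = ess_sup M F ((\<lambda>x \<omega>. cond_exp_ext M F (\<lambda>\<omega>. x \<omega> * y \<omega>) \<omega> - ereal (\<rho> x \<omega>)) ` X)"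
  unfolding fenchel_def by (simp add: Setcompr_eq_image)

lemma fenchel_family_F: "(\<lambda>x \<omega>. cond_exp_ext M F (\<lambda>\<omega>. x \<omega> * y \<omega>) \<omega> - ereal (\<rho> x \<omega>)) ` X \<subseteq> borel_measurable F"
proof (intro image_subsetI)
  fix x assume "x \<in> X"
  then have [measurable]: "\<rho> x \<in> borel_measurable F" by (rule \<rho>_F)
  show "(\<lambda>\<omega>. cond_exp_ext M F (\<lambda>\<omega>. x \<omega> * y \<omega>) \<omega> - ereal (\<rho> x \<omega>)) \<in> borel_measurable F" by measurable
qed

lemma \<alpha>_F: "\<alpha> y \<in> borel_measurable F"
  unfolding fenchel_eq by (rule ess_sup_measurable[OF fenchel_family_F])

lemma cond_exp_ext_pr: "x \<in> X \<Longrightarrow> y \<in> Y \<Longrightarrow> AE \<omega> in M. cond_exp_ext M F (\<lambda>\<omega>. x \<omega> * y \<omega>) \<omega> = ereal (pr x y \<omega>)"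
  by (rule cond_exp_ext_eq_ce[OF XY_L1])

lemma young:
  assumes "x \<in> X" "y \<in> Y"
  shows "AE \<omega> in M. ereal (pr x y \<omega> - \<rho> x \<omega>) \<le> \<alpha> y \<omega>"
proof -
  have "AE \<omega> in M. cond_exp_ext M F (\<lambda>\<omega>. x \<omega> * y \<omega>) \<omega> - ereal (\<rho> x \<omega>) \<le> \<alpha> y \<omega>"
    unfolding fenchel_eq by (rule ess_sup_upper[OF fenchel_family_F]) (use assms in blast)
  with cond_exp_ext_pr[OF assms] show ?thesis by eventually_elim simp
qed

lemma \<alpha>_least_on:
  assumes "y \<in> Y" "t \<in> borel_measurable F" "B \<in> sets F"
    and le: "\<And>x. x \<in> X \<Longrightarrow> AE \<omega> in M. \<omega> \<in> B \<longrightarrow> ereal (pr x y \<omega> - \<rho> x \<omega>) \<le> t \<omega>"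
  shows "AE \<omega> in M. \<omega> \<in> B \<longrightarrow> \<alpha> y \<omega> \<le> t \<omega>"
  unfolding fenchel_eq
proof (rule ess_sup_least_on[OF fenchel_family_F assms(2,3)])
  fix f assume "f \<in> (\<lambda>x \<omega>. cond_exp_ext M F (\<lambda>\<omega>. x \<omega> * y \<omega>) \<omega> - ereal (\<rho> x \<omega>)) ` X"
  then obtain x where x: "x \<in> X" "f = (\<lambda>\<omega>. cond_exp_ext M F (\<lambda>\<omega>. x \<omega> * y \<omega>) \<omega> - ereal (\<rho> x \<omega>))" by blast
  from le[OF x(1)] cond_exp_ext_pr[OF x(1) assms(1)] show "AE \<omega> in M. \<omega> \<in> B \<longrightarrow> f \<omega> \<le> t \<omega>"
    unfolding x(2) by eventually_elim simp
qed

lemma \<alpha>_least: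
  assumes "y \<in> Y" "t \<in> borel_measurable F"
    and le: "\<And>x. x \<in> X \<Longrightarrow> AE \<omega> in M. ereal (pr x y \<omega> - \<rho> x \<omega>) \<le> t \<omega>"
  shows "AE \<omega> in M. \<alpha> y \<omega> \<le> t \<omega>"
proof -
  have "AE \<omega> in M. \<omega> \<in> space F \<longrightarrow> \<alpha> y \<omega> \<le> t \<omega>"
  proof (rule \<alpha>_least_on[OF assms(1,2) sets.top])
    fix x assume "x \<in> X"
    from le[OF this] show "AE \<omega> in M. \<omega> \<in> space F \<longrightarrow> ereal (pr x y \<omega> - \<rho> x \<omega>) \<le> t \<omega>"
      by eventually_elim simp
  qed
  with AE_space show ?thesis by eventually_elim (simp add: space_subalgebra)
qed

lemma \<alpha>_local:
  assumes y: "y \<in> Y" "y' \<in> Y" and A: "A \<in> sets F" and eq: "AE \<omega> in M. \<omega> \<in> A \<longrightarrow> y \<omega> = y' \<omega>"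
  shows "AE \<omega> in M. \<omega> \<in> A \<longrightarrow> \<alpha> y \<omega> = \<alpha> y' \<omega>"
proof -
  have le: "AE \<omega> in M. \<omega> \<in> A \<longrightarrow> \<alpha> y \<omega> \<le> \<alpha> y' \<omega>"
    if y: "y \<in> Y" "y' \<in> Y" and eq: "AE \<omega> in M. \<omega> \<in> A \<longrightarrow> y \<omega> = y' \<omega>" for y y'
  proof (rule \<alpha>_least_on[OF y(1) \<alpha>_F A])
    fix x assume x: "x \<in> X"
    have "AE \<omega> in M. \<omega> \<in> A \<longrightarrow> pr x y \<omega> = pr x y' \<omega>"
      by (rule pr_local[OF x x y A _ eq]) simp
    with young[OF x y(2)] show "AE \<omega> in M. \<omega> \<in> A \<longrightarrow> ereal (pr x y \<omega> - \<rho> x \<omega>) \<le> \<alpha> y' \<omega>"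
      by eventually_elim auto
  qed
  have eq': "AE \<omega> in M. \<omega> \<in> A \<longrightarrow> y' \<omega> = y \<omega>" using eq by eventually_elim simp
  from le[OF y eq] le[OF y(2,1) eq'] show ?thesis by eventually_elim auto
qed

lemma \<alpha>_not_MInf: "y \<in> Y \<Longrightarrow> AE \<omega> in M. - \<infinity> < \<alpha> y \<omega>"
  using young[OF X_F[of "\<lambda>_. 0"], of y] by (auto elim: eventually_mono)

lemma D_iff: "y \<in> D \<longleftrightarrow> y \<in> Y \<and> (AE \<omega> in M. y \<omega> \<le> 0) \<and> (AE \<omega> in M. ce y \<omega> = -1)"
proof -
  have "(AE \<omega> in M. cond_exp_ext M F y \<omega> = -1) \<longleftrightarrow> (AE \<omega> in M. ce y \<omega> = -1)" if "y \<in> Y"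
  proof (rule eventually_subst)
    from cond_exp_ext_eq_ce[OF Y_L1[OF that]]
    show "AE \<omega> in M. (cond_exp_ext M F y \<omega> = -1) = (ce y \<omega> = -1)"
      by eventually_elim (simp add: one_ereal_def)
  qed
  then show ?thesis unfolding dual_densities_def by blast
qed

lemma D_Y: "y \<in> D \<Longrightarrow> y \<in> Y" by (simp add: D_iff)

lemma D_stable: "stable_set M F D"
proof (rule stable_setI)
  have "(\<lambda>_. -1) \<in> D" using ce_F[of "\<lambda>_. -1"] Y_F[of "\<lambda>_. -1"] by (simp add: D_iff)
  then show "D \<noteq> {}" by blast
  show "D \<subseteq> borel_measurable M" using D_Y Y_measurable by blast
  fix a x z
  assume a: "event_partition M F a" and x: "\<And>k. x k \<in> D" and z: "z \<in> borel_measurable M"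
    and eq: "\<And>k. AE \<omega> in M. \<omega> \<in> a k \<longrightarrow> z \<omega> = x k \<omega>"
  have zY: "z \<in> Y" by (rule Y_local[OF a D_Y[OF x] z eq])
  moreover have "AE \<omega> in M. z \<omega> \<le> 0"
  proof (rule partition_AE[OF a])
    fix k
    have "AE \<omega> in M. x k \<omega> \<le> 0" using x by (simp add: D_iff)
    with eq[of k] show "AE \<omega> in M. \<omega> \<in> a k \<longrightarrow> z \<omega> \<le> 0" by eventually_elim simp
  qed
  moreover have "AE \<omega> in M. ce z \<omega> = -1"
  proof (rule partition_AE[OF a])
    fix k
    have "AE \<omega> in M. ce (x k) \<omega> = -1" using x by (simp add: D_iff)
    with ce_cong_on[OF Y_L1[OF zY] Y_L1[OF D_Y[OF x]] partition_sets[OF a] eq, of k]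
    show "AE \<omega> in M. \<omega> \<in> a k \<longrightarrow> ce z \<omega> = -1" by eventually_elim simp
  qed
  ultimately show "z \<in> D" by (simp add: D_iff)
qed

text \<open>The conjugate is unbounded along rays unless y is a dual density. A positive direction p
  contributes n E[p y | F] while \<rho> does not increase; constants contribute n (E[y | F] + 1) by
  cash invariance, for both signs of n.\<close>

lemma \<alpha>_finite_imp_D:
  assumes y: "y \<in> Y" and fin: "AE \<omega> in M. \<alpha> y \<omega> \<le> ereal (\<eta> \<omega>)"
  shows "y \<in> D"
proof -
  have [measurable]: "y \<in> borel_measurable M" by (rule Y_measurable[OF y])
  have bound: "AE \<omega> in M. pr x y \<omega> \<le> \<eta> \<omega> + \<rho> x \<omega>" if "x \<in> X" for x
    using young[OF that y] fin
  proof eventually_elim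
    case (elim \<omega>)
    then have "ereal (pr x y \<omega> - \<rho> x \<omega>) \<le> ereal (\<eta> \<omega>)" by (rule order_trans)
    then show ?case by simp
  qed
  \<comment> \<open>The indicator of the set where \<open>y\<close> is positive.\<close>
  define p where "p \<omega> = max 0 (sgn (y \<omega>))" for \<omega>
  have [measurable]: "p \<in> borel_measurable M" unfolding p_def by measurable
  have p01: "0 \<le> p \<omega>" "p \<omega> \<le> 1" for \<omega> unfolding p_def by (auto simp: sgn_if)
  have one: "(\<lambda>_. 1) \<in> X" by (rule X_F) simp
  have p: "p \<in> X" by (rule X_solid[OF one]) (use p01 in auto)
  have zero: "(\<lambda>_. 0) \<in> X" by (rule X_F) simp
  have "AE \<omega> in M. n * pr p y \<omega> \<le> \<eta> \<omega> + \<rho> (\<lambda>_. 0) \<omega>" if "n \<ge> 0" for n :: real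
  proof -
    have np: "(\<lambda>\<omega>. n * p \<omega>) \<in> X" by (rule X_cmult[OF p])
    have "AE \<omega> in M. \<rho> (\<lambda>\<omega>. n * p \<omega>) \<omega> \<le> \<rho> (\<lambda>_. 0) \<omega>"
      by (rule \<rho>_mono[OF zero np]) (use that p01 in auto)
    with bound[OF np] pr_cmult[OF p y, of n] show ?thesis by eventually_elim simp
  qed
  then have "AE \<omega> in M. \<forall>n::nat. real n * pr p y \<omega> \<le> \<eta> \<omega> + \<rho> (\<lambda>_. 0) \<omega>"
    unfolding AE_all_countable by simp
  then have le0: "AE \<omega> in M. pr p y \<omega> \<le> 0"
  proof eventually_elim
    case (elim \<omega>)
    show ?case
    proof (rule ccontr)
      assume "\<not> pr p y \<omega> \<le> 0"
      then obtain n :: nat where "\<eta> \<omega> + \<rho> (\<lambda>_. 0) \<omega> < real n * pr p y \<omega>"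
        using reals_Archimedean3[of "pr p y \<omega>"] by auto
      then show False using elim by (meson not_le)
    qed
  qed
  have "AE \<omega> in M. \<omega> \<in> space F \<longrightarrow> p \<omega> * y \<omega> = 0"
  proof (rule ce_nonpos_imp_zero_on[OF XY_L1[OF p y] _ sets.top])
    show "AE \<omega> in M. 0 \<le> p \<omega> * y \<omega>" by (auto simp: p_def sgn_if)
    from le0 show "AE \<omega> in M. \<omega> \<in> space F \<longrightarrow> pr p y \<omega> \<le> 0" by eventually_elim simp
  qed
  with AE_space have neg: "AE \<omega> in M. y \<omega> \<le> 0"
  proof eventually_elim
    case (elim \<omega>)
    then show ?case by (auto simp: p_def sgn_if space_subalgebra split: if_splits)
  qed
  have shift: "AE \<omega> in M. n * (ce y \<omega> + 1) \<le> \<eta> \<omega> + \<rho> (\<lambda>_. 0) \<omega>" for n :: real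
  proof -
    have nX: "(\<lambda>_. n) \<in> X" by (rule X_F) simp
    have "AE \<omega> in M. \<rho> (\<lambda>\<omega>. 0 + n) \<omega> = \<rho> (\<lambda>_. 0) \<omega> - n" by (rule \<rho>_shift[OF _ zero]) simp
    with bound[OF nX] pr_F[OF _ y, of "\<lambda>_. n"] show ?thesis by (auto simp: algebra_simps elim!: eventually_elim2)
  qed
  \<comment> \<open>Integer multiples of both signs keep the null sets countable and are enough for
    the Archimedean argument.\<close>
  have "AE \<omega> in M. \<forall>n::nat. real n * (ce y \<omega> + 1) \<le> \<eta> \<omega> + \<rho> (\<lambda>_. 0) \<omega>"
    "AE \<omega> in M. \<forall>n::nat. - real n * (ce y \<omega> + 1) \<le> \<eta> \<omega> + \<rho> (\<lambda>_. 0) \<omega>"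
    unfolding AE_all_countable using shift by blast+
  then have "AE \<omega> in M. ce y \<omega> = -1"
  proof eventually_elim
    case (elim \<omega>)
    show ?case
    proof (rule ccontr)
      assume "ce y \<omega> \<noteq> -1"
      then have "0 < \<bar>ce y \<omega> + 1\<bar>" by simp
      then obtain n :: nat where "\<eta> \<omega> + \<rho> (\<lambda>_. 0) \<omega> < real n * \<bar>ce y \<omega> + 1\<bar>"
        using reals_Archimedean3 by blast
      moreover have "real n * \<bar>ce y \<omega> + 1\<bar> = real n * (ce y \<omega> + 1) \<or> real n * \<bar>ce y \<omega> + 1\<bar> = - real n * (ce y \<omega> + 1)"
        by (auto simp: abs_if algebra_simps)
      ultimately show False using elim by (metis not_le)
    qed
  qed
  with y neg show ?thesis by (simp add: D_iff)
qed

section \<open>The representation\<close>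

abbreviation rep_family :: "('a \<Rightarrow> real) \<Rightarrow> ('a \<Rightarrow> real) \<Rightarrow> 'a \<Rightarrow> ereal" where
  "rep_family x y \<omega> \<equiv> cond_exp_ext M F (\<lambda>\<omega>. x \<omega> * y \<omega>) \<omega> - \<alpha> y \<omega>"

lemma rep_family_F: "rep_family x ` D \<subseteq> borel_measurable F"
  using \<alpha>_F by (intro image_subsetI) measurable

lemma rep_family_eq:
  "x \<in> X \<Longrightarrow> y \<in> Y \<Longrightarrow> AE \<omega> in M. rep_family x y \<omega> = ereal (pr x y \<omega>) - \<alpha> y \<omega>"
proof -
  assume "x \<in> X" "y \<in> Y"
  from cond_exp_ext_pr[OF this] show ?thesis by eventually_elim (simp only:)
qed

lemma rep_family_le:
  assumes "x \<in> X" "y \<in> Y"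
  shows "AE \<omega> in M. rep_family x y \<omega> \<le> ereal (\<rho> x \<omega>)"
  using rep_family_eq[OF assms] young[OF assms]
proof eventually_elim
  case (elim \<omega>)
  then show ?case by (cases "\<alpha> y \<omega>") auto
qed

text \<open>Young's inequality always gives one half of the representation, so its content lies in
  the other one.\<close>

lemma representable_iff:
  "representable M F X \<rho> \<longleftrightarrow> (\<forall>x\<in>X. AE \<omega> in M. ereal (\<rho> x \<omega>) \<le> ess_sup M F (rep_family x ` D) \<omega>)"
proof -
  have "(AE \<omega> in M. ereal (\<rho> x \<omega>) = ess_sup M F (rep_family x ` D) \<omega>) \<longleftrightarrow>
      (AE \<omega> in M. ereal (\<rho> x \<omega>) \<le> ess_sup M F (rep_family x ` D) \<omega>)" if x: "x \<in> X" for x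
  proof (rule eventually_subst)
    have [measurable]: "\<rho> x \<in> borel_measurable F" by (rule \<rho>_F[OF x])
    have "AE \<omega> in M. ess_sup M F (rep_family x ` D) \<omega> \<le> ereal (\<rho> x \<omega>)"
      by (rule ess_sup_least[OF rep_family_F]) (use rep_family_le[OF x] D_Y in auto)
    then show "AE \<omega> in M. (ereal (\<rho> x \<omega>) = ess_sup M F (rep_family x ` D) \<omega>) =
        (ereal (\<rho> x \<omega>) \<le> ess_sup M F (rep_family x ` D) \<omega>)" by eventually_elim auto
  qed
  then show ?thesis unfolding representable_def by (simp add: Setcompr_eq_image)
qed

text \<open>If \<rho> x exceeds \<eta> on a non-null event, so does a single member of the
  representing family. A neighbourhood of x that tests only this y then stays outside the sublevel
  set.\<close>

lemma representable_imp_lower_semicont: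
  assumes rep: "representable M F X \<rho>"
  shows "lower_semicont M F X (stable_weak_topology M F X Y) (\<lambda>x \<omega>. ereal (\<rho> x \<omega>))"
  unfolding lower_semicont_def
proof
  fix \<eta> :: "'a \<Rightarrow> real" assume \<eta> [measurable]: "\<eta> \<in> borel_measurable F"
  define S where "S = sublevel M X (\<lambda>x \<omega>. ereal (\<rho> x \<omega>)) \<eta>"
  have S: "S = {x \<in> X. AE \<omega> in M. \<rho> x \<omega> \<le> \<eta> \<omega>}" unfolding S_def sublevel_def by simp
  have Yne: "Y \<noteq> {}" using Y_F[of "\<lambda>_. 0"] by auto
  have "openin (stable_weak_topology M F X Y) (X - S)"
  proof (rule XY.openinI_basic)
    fix x assume "x \<in> X - S"
    then have x: "x \<in> X" and nle: "\<not> (AE \<omega> in M. \<rho> x \<omega> \<le> \<eta> \<omega>)" unfolding S by auto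
    have "\<exists>y\<in>D. \<not> (AE \<omega> in M. rep_family x y \<omega> \<le> ereal (\<eta> \<omega>))"
    proof (rule ccontr)
      assume "\<not> (\<exists>y\<in>D. \<not> (AE \<omega> in M. rep_family x y \<omega> \<le> ereal (\<eta> \<omega>)))"
      then have "AE \<omega> in M. ess_sup M F (rep_family x ` D) \<omega> \<le> ereal (\<eta> \<omega>)"
        by (intro ess_sup_least[OF rep_family_F]) auto
      moreover have "AE \<omega> in M. ereal (\<rho> x \<omega>) \<le> ess_sup M F (rep_family x ` D) \<omega>"
        using rep x unfolding representable_iff by blast
      ultimately have "AE \<omega> in M. \<rho> x \<omega> \<le> \<eta> \<omega>"
      proof eventually_elim
        case (elim \<omega>)
        then have "ereal (\<rho> x \<omega>) \<le> ereal (\<eta> \<omega>)" by (rule order_trans[rotated])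
        then show ?case by simp
      qed
      with nle show False by simp
    qed
    then obtain y where y: "y \<in> D" "\<not> (AE \<omega> in M. rep_family x y \<omega> \<le> ereal (\<eta> \<omega>))" by blast
    have yY: "y \<in> Y" by (rule D_Y[OF y(1)])
    have [measurable]: "\<alpha> y \<in> borel_measurable F" by (rule \<alpha>_F)
    \<comment> \<open>The radius is the excess of the affine function at x over \<eta> where this is
      positive and finite, and 1 elsewhere to stay positive. An element of the sublevel set within
      this radius would leave no excess.\<close>
    define \<epsilon> where "\<epsilon> \<omega> = (if ereal (\<eta> \<omega>) < ereal (pr x y \<omega>) - \<alpha> y \<omega> \<and> \<bar>\<alpha> y \<omega>\<bar> \<noteq> \<infinity>
        then pr x y \<omega> - \<eta> \<omega> - real_of_ereal (\<alpha> y \<omega>) else 1)" for \<omega>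
    have \<epsilon>F: "\<epsilon> \<in> borel_measurable F" unfolding \<epsilon>_def by measurable
    have pos: "0 < \<epsilon> \<omega>" for \<omega> unfolding \<epsilon>_def by (cases "\<alpha> y \<omega>") auto
    have W: "XY.weak_data (\<lambda>_. {y}) trivial_partition \<epsilon>"
      by (rule XY.weak_data_single) (use yY \<epsilon>F pos in auto)
    moreover have "z \<in> X - S" if z: "z \<in> X"
      and cl: "XY.close (\<lambda>_. {y}) trivial_partition \<epsilon> x z" for z
    proof (rule ccontr)
      assume "z \<notin> X - S"
      then have "AE \<omega> in M. \<rho> z \<omega> \<le> \<eta> \<omega>" using z unfolding S by simp
      moreover have "AE \<omega> in M. \<bar>pr z y \<omega> - pr x y \<omega>\<bar> < \<epsilon> \<omega>"
        by (rule XY.close_singleD[OF cl _ x z yY]) simp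
      ultimately have "AE \<omega> in M. rep_family x y \<omega> \<le> ereal (\<eta> \<omega>)"
        using young[OF z yY] rep_family_eq[OF x yY] \<alpha>_not_MInf[OF yY]
      proof eventually_elim
        case (elim \<omega>)
        show ?case
        proof (cases "\<alpha> y \<omega>")
          case (real r)
          show ?thesis
          proof (rule ccontr)
            assume "\<not> rep_family x y \<omega> \<le> ereal (\<eta> \<omega>)"
            then have "\<epsilon> \<omega> = pr x y \<omega> - \<eta> \<omega> - r" using real elim(4) unfolding \<epsilon>_def by simp
            then show False using elim(1-3) real by simp
          qed
        qed (use elim in auto)
      qed
      with y(2) show False by simp
    qed
    ultimately show "\<exists>Fs a \<epsilon>. XY.weak_data Fs a \<epsilon> \<and> (\<forall>z'\<in>X. XY.close Fs a \<epsilon> x z' \<longrightarrow> z' \<in> X - S)" by blast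
  qed blast
  then show "closedin (stable_weak_topology M F X Y) (sublevel M X (\<lambda>x \<omega>. ereal (\<rho> x \<omega>)) \<eta>)"
    unfolding S_def[symmetric] closedin_def XY.topspace_stable_weak[OF Yne] by (simp add: S)
qed

end

subsection \<open>Separation from the acceptance set\<close>

text \<open>Projection onto a convex set in Euclidean space, for a fixed outcome. The parallelogram
  identity makes a minimizing sequence Cauchy. Moving towards u by t = 1/(k+1), dividing by t and
  letting k grow gives the variational inequality. Only countably many inequalities are assumed, so
  they can all hold almost everywhere.\<close>

lemma minimizing_sequence_limit:
  fixes w :: "nat \<Rightarrow> 'g \<Rightarrow> real" and d :: real
  assumes fin: "finite G"
    and upper: "\<And>n. (\<Sum>g\<in>G. (w n g)\<^sup>2) \<le> d + 1 / real (Suc n)"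
    and mid: "\<And>n m. d \<le> (\<Sum>g\<in>G. (1/2 * w n g + (1 - 1/2) * w m g)\<^sup>2)"
  shows "g \<in> G \<Longrightarrow> convergent (\<lambda>n. w n g)"
    and "(\<And>n k. d \<le> (\<Sum>g\<in>G. (1 / real (Suc k) * u g + (1 - 1 / real (Suc k)) * w n g)\<^sup>2))
      \<Longrightarrow> d \<le> (\<Sum>g\<in>G. lim (\<lambda>n. w n g) * u g)"
proof -
  have lin: "a \<le> a' \<Longrightarrow> b \<le> b' \<Longrightarrow> c' \<le> c \<Longrightarrow> 2 * a + 2 * b - 4 * c \<le> 2 * a' + 2 * b' - 4 * c'"
    for a a' b b' c c' :: real by linarith
  have par: "(w n g - w m g)\<^sup>2 \<le> 2 / real (Suc n) + 2 / real (Suc m)" if g: "g \<in> G" for n m g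
  proof -
    have "(w n g - w m g)\<^sup>2 \<le> (\<Sum>g\<in>G. (w n g - w m g)\<^sup>2)"
      by (rule member_le_sum[OF g]) (use fin in auto)
    also have "\<dots> = (\<Sum>g\<in>G. 2 * (w n g)\<^sup>2 + 2 * (w m g)\<^sup>2 - 4 * (1/2 * w n g + (1 - 1/2) * w m g)\<^sup>2)"
      by (intro sum.cong) (auto simp: power2_eq_square algebra_simps)
    also have "\<dots> = 2 * (\<Sum>g\<in>G. (w n g)\<^sup>2) + 2 * (\<Sum>g\<in>G. (w m g)\<^sup>2) - 4 * (\<Sum>g\<in>G. (1/2 * w n g + (1 - 1/2) * w m g)\<^sup>2)"
      by (simp only: sum_subtractf sum.distrib sum_distrib_left)
    also have "\<dots> \<le> 2 * (d + 1 / real (Suc n)) + 2 * (d + 1 / real (Suc m)) - 4 * d"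
      by (rule lin[OF upper upper mid])
    also have "\<dots> = 2 / real (Suc n) + 2 / real (Suc m)" by simp
    finally show ?thesis .
  qed
  show conv: "convergent (\<lambda>n. w n g)" if g: "g \<in> G" for g
  proof (rule Cauchy_convergent, rule CauchyI)
    fix e :: real assume e: "0 < e"
    \<comment> \<open>The tolerance is matched to the sum of the two errors 2/(n+1) and
      2/(m+1).\<close>
    then obtain N where N: "1 / real (Suc N) < e\<^sup>2 / 4" using nat_approx_posE[of "e\<^sup>2 / 4"] by auto
    show "\<exists>N. \<forall>m\<ge>N. \<forall>n\<ge>N. norm (w m g - w n g) < e"
    proof (intro exI allI impI)
      fix m n assume mn: "m \<ge> N" "n \<ge> N"
      have "1 / real (Suc m) \<le> 1 / real (Suc N)" "1 / real (Suc n) \<le> 1 / real (Suc N)"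
        using mn by (auto simp: field_simps)
      moreover have "(w m g - w n g)\<^sup>2 \<le> 2 * (1 / real (Suc m)) + 2 * (1 / real (Suc n))"
        using par[OF g, of m n] by simp
      ultimately have "(w m g - w n g)\<^sup>2 < e\<^sup>2" using N by linarith
      then have "\<bar>w m g - w n g\<bar> < e" using e by (metis less_imp_le power2_abs power2_less_imp_less)
      then show "norm (w m g - w n g) < e" by simp
    qed
  qed
  assume inc: "\<And>n k. d \<le> (\<Sum>g\<in>G. (1 / real (Suc k) * u g + (1 - 1 / real (Suc k)) * w n g)\<^sup>2)"
  define v where "v g = lim (\<lambda>n. w n g)" for g
  have v: "(\<lambda>n. w n g) \<longlonglongrightarrow> v g" if "g \<in> G" for g
    using conv[OF that] unfolding v_def by (simp add: convergent_LIMSEQ_iff)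
  define V U P where "V = (\<Sum>g\<in>G. (v g)\<^sup>2)" and "U = (\<Sum>g\<in>G. (u g)\<^sup>2)" and "P = (\<Sum>g\<in>G. v g * u g)"
  have "(\<lambda>n. d + 1 / real (Suc n)) \<longlonglongrightarrow> d + 0" by (intro tendsto_intros LIMSEQ_Suc[OF lim_1_over_n])
  moreover have "(\<lambda>n. \<Sum>g\<in>G. (w n g)\<^sup>2) \<longlonglongrightarrow> V" unfolding V_def by (intro tendsto_intros v)
  ultimately have V: "V \<le> d" using upper LIMSEQ_le[of "\<lambda>n. \<Sum>g\<in>G. (w n g)\<^sup>2" V "\<lambda>n. d + 1 / real (Suc n)" d] by auto
  have k: "(2 - 1 / real (Suc k)) * d \<le> 2 * (1 - 1 / real (Suc k)) * P + 1 / real (Suc k) * U" for k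
  proof -
    define t where "t = 1 / real (Suc k)"
    have t: "0 < t" "t \<le> 1" unfolding t_def by auto
    have "(\<lambda>n. \<Sum>g\<in>G. (t * u g + (1 - t) * w n g)\<^sup>2) \<longlonglongrightarrow> (\<Sum>g\<in>G. (t * u g + (1 - t) * v g)\<^sup>2)"
      by (intro tendsto_intros v)
    then have "d \<le> (\<Sum>g\<in>G. (t * u g + (1 - t) * v g)\<^sup>2)"
      by (rule LIMSEQ_le_const) (use inc[of k] in \<open>auto simp: t_def\<close>)
    also have "\<dots> = (\<Sum>g\<in>G. t\<^sup>2 * (u g)\<^sup>2 + 2 * t * (1 - t) * (v g * u g) + (1 - t)\<^sup>2 * (v g)\<^sup>2)"
      by (intro sum.cong) (auto simp: power2_eq_square algebra_simps)
    also have "\<dots> = t\<^sup>2 * U + 2 * t * (1 - t) * P + (1 - t)\<^sup>2 * V"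
      unfolding U_def P_def V_def by (simp only: sum.distrib sum_distrib_left)
    also have "\<dots> \<le> t\<^sup>2 * U + 2 * t * (1 - t) * P + (1 - t)\<^sup>2 * d"
      using V by (intro add_left_mono mult_left_mono) auto
    \<comment> \<open>Subtracting (1 - t)^2 d leaves a factor t on both sides.\<close>
    finally have "t * ((2 - t) * d) \<le> t * (2 * (1 - t) * P + t * U)"
      by (simp add: power2_eq_square algebra_simps)
    then show ?thesis using t unfolding t_def by (simp only: mult_le_cancel_left_pos)
  qed
  have "(\<lambda>k. (2 - 1 / real (Suc k)) * d) \<longlonglongrightarrow> (2 - 0) * d"
    by (intro tendsto_intros LIMSEQ_Suc[OF lim_1_over_n])
  moreover have "(\<lambda>k. 2 * (1 - 1 / real (Suc k)) * P + 1 / real (Suc k) * U) \<longlonglongrightarrow> 2 * (1 - 0) * P + 0 * U"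
    by (intro tendsto_intros LIMSEQ_Suc[OF lim_1_over_n])
  ultimately have "(2 - 0) * d \<le> 2 * (1 - 0) * P + 0 * U"
    by (rule LIMSEQ_le) (use k in auto)
  then show "d \<le> (\<Sum>g\<in>G. lim (\<lambda>n. w n g) * u g)" unfolding P_def v_def by simp
qed

context conditional_risk
begin

lemma pr_comb:
  fixes t :: real
  assumes "x \<in> X" "y \<in> X" "g \<in> Y"
  shows "AE \<omega> in M. pr (\<lambda>\<omega>. t * x \<omega> + (1 - t) * y \<omega>) g \<omega> = t * pr x g \<omega> + (1 - t) * pr y g \<omega>"
  using pr_add[OF X_cmult[OF assms(1), of t] X_cmult[OF assms(2), of "1 - t"] assms(3)]
    pr_cmult[OF assms(1,3), of t] pr_cmult[OF assms(2,3), of "1 - t"]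
  by eventually_elim simp

text \<open>The squared Euclidean distance between the images of z and x0 under the map given by the
  functionals in \<open>G\<close>.\<close>

definition sqdist :: "('a \<Rightarrow> real) set \<Rightarrow> ('a \<Rightarrow> real) \<Rightarrow> ('a \<Rightarrow> real) \<Rightarrow> 'a \<Rightarrow> real" where
  "sqdist G x0 z \<omega> = (\<Sum>g\<in>G. (pr z g \<omega> - pr x0 g \<omega>)\<^sup>2)"

lemma sqdist_F [measurable]: "sqdist G x0 z \<in> borel_measurable F"
  unfolding sqdist_def by measurable

lemma sqdist_nonneg: "0 \<le> sqdist G x0 z \<omega>"
  unfolding sqdist_def by (intro sum_nonneg) simp

lemma sqdist_local:
  assumes G: "finite G" "G \<subseteq> Y" and "x \<in> X" "z \<in> X" "A \<in> sets F" "AE \<omega> in M. \<omega> \<in> A \<longrightarrow> x \<omega> = z \<omega>"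
  shows "AE \<omega> in M. \<omega> \<in> A \<longrightarrow> sqdist G x0 x \<omega> = sqdist G x0 z \<omega>"
proof -
  have "AE \<omega> in M. \<omega> \<in> A \<longrightarrow> pr x g \<omega> = pr z g \<omega>" if "g \<in> G" for g
    by (rule pr_local) (use assms that in auto)
  then have "AE \<omega> in M. \<forall>g\<in>G. \<omega> \<in> A \<longrightarrow> pr x g \<omega> = pr z g \<omega>"
    unfolding AE_ball_countable[OF countable_finite[OF G(1)]] by blast
  then show ?thesis unfolding sqdist_def by eventually_elim (auto intro!: sum.cong)
qed

text \<open>Stability of \<open>K\<close> turns a strict bound below the essential supremum into a
  bound for one member; the sign makes this a nearly minimal distance.\<close>

lemma sqdist_approx:
  assumes K: "stable_set M F K" "K \<subseteq> X" and G: "finite G" "G \<subseteq> Y" and [measurable]: "\<gamma> \<in> borel_measurable F"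
    and less: "AE \<omega> in M. \<gamma> \<omega> < ess_sup M F ((\<lambda>z \<omega>. ereal (- sqdist G x0 z \<omega>)) ` K) \<omega>"
  shows "\<exists>z\<in>K. AE \<omega> in M. \<gamma> \<omega> < ereal (- sqdist G x0 z \<omega>)"
proof -
  have Kne: "K \<noteq> {}" using K unfolding stable_set_def by blast
  obtain z where "z \<in> K" "AE \<omega> in M. \<gamma> \<omega> < ereal (- sqdist G x0 z \<omega>)"
  proof (rule less_ess_sup_glue[of K "\<lambda>z \<omega>. ereal (- sqdist G x0 z \<omega>)" \<gamma>])
    fix a and j :: "nat \<Rightarrow> 'a \<Rightarrow> real"
    assume a: "event_partition M F a" and j: "\<And>k. j k \<in> K"
    have jX: "j k \<in> X" and jM: "j k \<in> borel_measurable M" for k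
      using j[of k] K(2) X_measurable by auto
    define z where "z = glue a j"
    have zM: "z \<in> borel_measurable M" unfolding z_def by (rule glue_measurable_M[OF a jM])
    have z: "z \<in> K"
      by (rule stable_setD[OF K(1) a j zM]) (use glue_eq[OF a] in \<open>simp add: z_def\<close>)
    have "AE \<omega> in M. \<omega> \<in> a k \<longrightarrow> ereal (- sqdist G x0 (j k) \<omega>) \<le> ereal (- sqdist G x0 z \<omega>)" for k
    proof -
      have "AE \<omega> in M. \<omega> \<in> a k \<longrightarrow> z \<omega> = j k \<omega>" unfolding z_def by (rule glue_eq[OF a])
      from sqdist_local[OF G _ jX partition_sets[OF a] this] z K(2)
      have "AE \<omega> in M. \<omega> \<in> a k \<longrightarrow> sqdist G x0 z \<omega> = sqdist G x0 (j k) \<omega>" by blast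
      then show ?thesis by eventually_elim simp
    qed
    with z show "\<exists>i\<in>K. \<forall>k. AE \<omega> in M. \<omega> \<in> a k \<longrightarrow> ereal (- sqdist G x0 (j k) \<omega>) \<le> ereal (- sqdist G x0 i \<omega>)"
      by blast
  qed (use Kne less in auto)
  then show ?thesis by blast
qed

text \<open>Finitely many functionals reduce separation to a conditional Euclidean space, where the
  separating functional is the difference to a point of minimal norm.\<close>

lemma finite_dimensional_separation:
  assumes K: "stable_set M F K" "K \<subseteq> X"
    and conv: "\<And>x y t. x \<in> K \<Longrightarrow> y \<in> K \<Longrightarrow> 0 \<le> t \<Longrightarrow> t \<le> (1::real) \<Longrightarrow> (\<lambda>\<omega>. t * x \<omega> + (1 - t) * y \<omega>) \<in> K"
    and G: "finite G" "G \<subseteq> Y" and x0: "x0 \<in> X" and B: "B \<in> sets F" and e [measurable]: "e \<in> borel_measurable F"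
    and apart: "\<And>z. z \<in> K \<Longrightarrow> AE \<omega> in M. \<omega> \<in> B \<longrightarrow> e \<omega> \<le> sqdist G x0 z \<omega>"
  shows "\<exists>v. (\<forall>g\<in>G. v g \<in> borel_measurable F) \<and>
    (\<forall>z\<in>K. AE \<omega> in M. \<omega> \<in> B \<longrightarrow> e \<omega> \<le> (\<Sum>g\<in>G. v g \<omega> * (pr z g \<omega> - pr x0 g \<omega>)))"
proof -
  define H where "H = (\<lambda>z \<omega>. ereal (- sqdist G x0 z \<omega>)) ` K"
  define s where "s = ess_sup M F H"
  have HF: "H \<subseteq> borel_measurable F" unfolding H_def by auto
  have sF [measurable]: "s \<in> borel_measurable F" unfolding s_def by (rule ess_sup_measurable[OF HF])
  obtain z0 where z0: "z0 \<in> K" using K unfolding stable_set_def by blast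
  have up: "AE \<omega> in M. ereal (- sqdist G x0 z \<omega>) \<le> s \<omega>" if "z \<in> K" for z
    unfolding s_def by (rule ess_sup_upper[OF HF]) (use that in \<open>auto simp: H_def\<close>)
  have s0: "AE \<omega> in M. s \<omega> \<le> 0"
    unfolding s_def by (rule ess_sup_least[OF HF]) (auto simp: H_def sqdist_nonneg)
  \<comment> \<open>\<open>d\<close> is the conditional squared distance from x0 to
    \<open>K\<close>, finite because \<open>s\<close> lies between the value at \<open>z0\<close>
    and 0.\<close>
  define d where "d \<omega> = - real_of_ereal (s \<omega>)" for \<omega>
  have dF [measurable]: "d \<in> borel_measurable F" unfolding d_def by measurable
  have sd: "AE \<omega> in M. s \<omega> = ereal (- d \<omega>)"
    using up[OF z0] s0
  proof eventually_elim
    case (elim \<omega>)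
    then show ?case unfolding d_def by (cases "s \<omega>") auto
  qed
  have dle: "AE \<omega> in M. d \<omega> \<le> sqdist G x0 z \<omega>" if "z \<in> K" for z
    using up[OF that] sd by eventually_elim simp
  have "AE \<omega> in M. \<omega> \<in> B \<longrightarrow> s \<omega> \<le> ereal (- e \<omega>)"
    unfolding s_def
  proof (rule ess_sup_least_on[OF HF _ B])
    fix f assume "f \<in> H"
    then obtain z where z: "z \<in> K" "f = (\<lambda>\<omega>. ereal (- sqdist G x0 z \<omega>))" unfolding H_def by blast
    from apart[OF z(1)] show "AE \<omega> in M. \<omega> \<in> B \<longrightarrow> f \<omega> \<le> ereal (- e \<omega>)"
      unfolding z(2) by eventually_elim simp
  qed measurable
  with sd have ed: "AE \<omega> in M. \<omega> \<in> B \<longrightarrow> e \<omega> \<le> d \<omega>" by eventually_elim simp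
  \<comment> \<open>For each n a single member of \<open>K\<close> is minimal up to 1/(n+1) at
    almost every outcome.\<close>
  have "\<exists>z\<in>K. AE \<omega> in M. ereal (- d \<omega> - 1 / real (Suc n)) < ereal (- sqdist G x0 z \<omega>)" for n
  proof (rule sqdist_approx[OF K G])
    from sd show "AE \<omega> in M. ereal (- d \<omega> - 1 / real (Suc n)) < ess_sup M F ((\<lambda>z \<omega>. ereal (- sqdist G x0 z \<omega>)) ` K) \<omega>"
      unfolding s_def H_def by eventually_elim simp
  qed measurable
  then have "\<exists>z. z \<in> K \<and> (AE \<omega> in M. sqdist G x0 z \<omega> < d \<omega> + 1 / real (Suc n))" for n
  proof -
    obtain z where "z \<in> K" "AE \<omega> in M. ereal (- d \<omega> - 1 / real (Suc n)) < ereal (- sqdist G x0 z \<omega>)"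
      using \<open>\<And>n. \<exists>z\<in>K. AE \<omega> in M. ereal (- d \<omega> - 1 / real (Suc n)) < ereal (- sqdist G x0 z \<omega>)\<close>[of n] by blast
    moreover from this(2) have "AE \<omega> in M. sqdist G x0 z \<omega> < d \<omega> + 1 / real (Suc n)" by eventually_elim simp
    ultimately show ?thesis by blast
  qed
  from choice[OF allI[OF this]] obtain b
    where b': "\<forall>n. b n \<in> K \<and> (AE \<omega> in M. sqdist G x0 (b n) \<omega> < d \<omega> + 1 / real (Suc n))" ..
  note b = b'[THEN spec, THEN conjunct1] b'[THEN spec, THEN conjunct2]
  define w where "w n g \<omega> = pr (b n) g \<omega> - pr x0 g \<omega>" for n g \<omega>
  have wF [measurable]: "w n g \<in> borel_measurable F" for n g unfolding w_def by measurable
  define v where "v g \<omega> = lim (\<lambda>n. w n g \<omega>)" for g \<omega>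
  have vF: "v g \<in> borel_measurable F" for g unfolding v_def by (rule borel_measurable_lim_metric) measurable
  have upper: "AE \<omega> in M. \<forall>n. (\<Sum>g\<in>G. (w n g \<omega>)\<^sup>2) \<le> d \<omega> + 1 / real (Suc n)"
    unfolding AE_all_countable
  proof
    fix n from b(2)[of n] show "AE \<omega> in M. (\<Sum>g\<in>G. (w n g \<omega>)\<^sup>2) \<le> d \<omega> + 1 / real (Suc n)"
      unfolding sqdist_def w_def by eventually_elim simp
  qed
  \<comment> \<open>Convex combinations with the minimizing sequence stay in \<open>K\<close>, so
    \<open>d\<close> bounds their squared distance from below.\<close>
  have comb: "AE \<omega> in M. d \<omega> \<le> (\<Sum>g\<in>G. (t * (pr z g \<omega> - pr x0 g \<omega>) + (1 - t) * w n g \<omega>)\<^sup>2)"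
    if z: "z \<in> K" and t: "0 \<le> t" "t \<le> 1" for z t n
  proof -
    have "AE \<omega> in M. pr (\<lambda>\<omega>. t * z \<omega> + (1 - t) * b n \<omega>) g \<omega> = t * pr z g \<omega> + (1 - t) * pr (b n) g \<omega>" if "g \<in> G" for g
      by (rule pr_comb) (use z b(1) K(2) G(2) that in auto)
    then have "AE \<omega> in M. \<forall>g\<in>G. pr (\<lambda>\<omega>. t * z \<omega> + (1 - t) * b n \<omega>) g \<omega> = t * pr z g \<omega> + (1 - t) * pr (b n) g \<omega>"
      unfolding AE_ball_countable[OF countable_finite[OF G(1)]] by blast
    with dle[OF conv[OF z b(1)[of n] t]] show ?thesis
    proof eventually_elim
      case (elim \<omega>)
      have "sqdist G x0 (\<lambda>\<omega>. t * z \<omega> + (1 - t) * b n \<omega>) \<omega>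
          = (\<Sum>g\<in>G. (t * (pr z g \<omega> - pr x0 g \<omega>) + (1 - t) * w n g \<omega>)\<^sup>2)"
        unfolding sqdist_def w_def
      proof (rule sum.cong[OF refl])
        fix g assume g: "g \<in> G"
        show "(pr (\<lambda>\<omega>. t * z \<omega> + (1 - t) * b n \<omega>) g \<omega> - pr x0 g \<omega>)\<^sup>2 =
            (t * (pr z g \<omega> - pr x0 g \<omega>) + (1 - t) * (pr (b n) g \<omega> - pr x0 g \<omega>))\<^sup>2"
          unfolding elim(2)[rule_format, OF g] by (simp add: algebra_simps)
      qed
      with elim(1) show ?case by simp
    qed
  qed
  have mid: "AE \<omega> in M. \<forall>n m. d \<omega> \<le> (\<Sum>g\<in>G. (1/2 * w n g \<omega> + (1 - 1/2) * w m g \<omega>)\<^sup>2)"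
    unfolding AE_all_countable
  proof (intro allI)
    fix n m
    show "AE \<omega> in M. d \<omega> \<le> (\<Sum>g\<in>G. (1/2 * w n g \<omega> + (1 - 1/2) * w m g \<omega>)\<^sup>2)"
      using comb[OF b(1)[of n], of "1/2" m] unfolding w_def by simp
  qed
  have "AE \<omega> in M. \<omega> \<in> B \<longrightarrow> e \<omega> \<le> (\<Sum>g\<in>G. v g \<omega> * (pr z g \<omega> - pr x0 g \<omega>))" if z: "z \<in> K" for z
  proof -
    have "AE \<omega> in M. \<forall>n k. d \<omega> \<le> (\<Sum>g\<in>G. (1 / real (Suc k) * (pr z g \<omega> - pr x0 g \<omega>) + (1 - 1 / real (Suc k)) * w n g \<omega>)\<^sup>2)"
      unfolding AE_all_countable by (intro allI comb[OF z]) auto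
    with upper mid ed show ?thesis
    proof eventually_elim
      case (elim \<omega>)
      have "d \<omega> \<le> (\<Sum>g\<in>G. lim (\<lambda>n. w n g \<omega>) * (pr z g \<omega> - pr x0 g \<omega>))"
        by (rule minimizing_sequence_limit(2)[OF G(1), of "\<lambda>n g. w n g \<omega>"]) (use elim in blast)+
      with elim(3) show ?case unfolding v_def by auto
    qed
  qed
  with vF show ?thesis by blast
qed

lemma Y_sum:
  assumes "finite G" "\<And>g. g \<in> G \<Longrightarrow> f g \<in> Y"
  shows "(\<lambda>\<omega>. \<Sum>g\<in>G. f g \<omega>) \<in> Y"
  using assms
proof (induction G)
  case (insert g G)
  have "(\<lambda>\<omega>. f g \<omega> + (\<Sum>g\<in>G. f g \<omega>)) \<in> Y" by (rule Y_add) (use insert in auto)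
  with insert(1,2) show ?case by simp
qed (use Y_F[of "\<lambda>_. 0"] in simp)

lemma acceptance_set_stable: "stable_set M F {x \<in> X. AE \<omega> in M. \<rho> x \<omega> \<le> 0}"
proof (rule stable_setI)
  have zero: "(\<lambda>_. 0) \<in> X" by (rule X_F) simp
  have "(\<lambda>\<omega>. 0 + \<rho> (\<lambda>_. 0) \<omega>) \<in> X" by (rule X_add[OF zero X_F[OF \<rho>_F[OF zero]]])
  moreover from \<rho>_shift[OF \<rho>_F[OF zero] zero]
  have "AE \<omega> in M. \<rho> (\<lambda>\<omega>. 0 + \<rho> (\<lambda>_. 0) \<omega>) \<omega> \<le> 0" by eventually_elim simp
  ultimately show "{x \<in> X. AE \<omega> in M. \<rho> x \<omega> \<le> 0} \<noteq> {}" by blast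
  show "{x \<in> X. AE \<omega> in M. \<rho> x \<omega> \<le> 0} \<subseteq> borel_measurable M" using X_measurable by blast
  fix a x z
  assume a: "event_partition M F a" and x: "\<And>k. x k \<in> {x \<in> X. AE \<omega> in M. \<rho> x \<omega> \<le> 0}"
    and z: "z \<in> borel_measurable M" and eq: "\<And>k. AE \<omega> in M. \<omega> \<in> a k \<longrightarrow> z \<omega> = x k \<omega>"
  have zX: "z \<in> X" by (rule stable_setD[OF X_stable a _ z eq]) (use x in blast)
  moreover have "AE \<omega> in M. \<rho> z \<omega> \<le> 0"
  proof (rule partition_AE[OF a])
    fix k
    have xk: "x k \<in> X" "AE \<omega> in M. \<rho> (x k) \<omega> \<le> 0" using x[of k] by auto
    from \<rho>_local[OF zX xk(1) partition_sets[OF a] eq] xk(2)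
    show "AE \<omega> in M. \<omega> \<in> a k \<longrightarrow> \<rho> z \<omega> \<le> 0" by eventually_elim simp
  qed
  ultimately show "z \<in> {x \<in> X. AE \<omega> in M. \<rho> x \<omega> \<le> 0}" by blast
qed

lemma acceptance_set_convex:
  fixes t :: real
  assumes x: "x \<in> {x \<in> X. AE \<omega> in M. \<rho> x \<omega> \<le> 0}" and y: "y \<in> {x \<in> X. AE \<omega> in M. \<rho> x \<omega> \<le> 0}" and t: "0 \<le> t" "t \<le> 1"
  shows "(\<lambda>\<omega>. t * x \<omega> + (1 - t) * y \<omega>) \<in> {x \<in> X. AE \<omega> in M. \<rho> x \<omega> \<le> 0}"
proof -
  have X: "x \<in> X" "y \<in> X" and le: "AE \<omega> in M. \<rho> x \<omega> \<le> 0" "AE \<omega> in M. \<rho> y \<omega> \<le> 0" using x y by auto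
  have tF: "(\<lambda>_. t) \<in> borel_measurable F" by simp
  have "AE \<omega> in M. \<rho> (\<lambda>\<omega>. t * x \<omega> + (1 - t) * y \<omega>) \<omega> \<le> t * \<rho> x \<omega> + (1 - t) * \<rho> y \<omega>"
    by (rule \<rho>_convex[OF tF X]) (use t in simp)
  with le have "AE \<omega> in M. \<rho> (\<lambda>\<omega>. t * x \<omega> + (1 - t) * y \<omega>) \<omega> \<le> 0"
  proof eventually_elim
    case (elim \<omega>)
    have "t * \<rho> x \<omega> \<le> 0" "(1 - t) * \<rho> y \<omega> \<le> 0"
      using elim(1,2) t by (auto intro!: mult_nonneg_nonpos)
    with elim(3) show ?case by linarith
  qed
  with X_comb[OF tF X] show ?thesis by blast
qed

text \<open>Separation is local. If on every member of the partition some element of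
  \<open>K\<close> came within the radius of x0, gluing would put an element of \<open>K\<close>
  into a neighbourhood that misses it. Hence the distance stays at least the radius on a non-null
  part of some member, where only finitely many functionals are tested.\<close>

lemma closed_acceptance_set_separation:
  assumes closed: "closedin (stable_weak_topology M F X Y) {x \<in> X. AE \<omega> in M. \<rho> x \<omega> \<le> 0}"
    and x0: "x0 \<in> X" "\<not> (AE \<omega> in M. \<rho> x0 \<omega> \<le> 0)"
  shows "\<exists>B y e. B \<in> sets F \<and> \<not> (AE \<omega> in M. \<omega> \<notin> B) \<and> y \<in> Y \<and> e \<in> borel_measurable F \<and> (AE \<omega> in M. 0 < e \<omega>) \<and>
    (\<forall>z\<in>{x \<in> X. AE \<omega> in M. \<rho> x \<omega> \<le> 0}. AE \<omega> in M. \<omega> \<in> B \<longrightarrow> pr x0 y \<omega> + e \<omega> \<le> pr z y \<omega>)"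
proof -
  define K where "K = {x \<in> X. AE \<omega> in M. \<rho> x \<omega> \<le> 0}"
  have K: "stable_set M F K" "K \<subseteq> X" unfolding K_def using acceptance_set_stable by auto
  have conv: "(\<lambda>\<omega>. t * x \<omega> + (1 - t) * y \<omega>) \<in> K" if "x \<in> K" "y \<in> K" "0 \<le> t" "t \<le> 1" for x y and t :: real
    using acceptance_set_convex that unfolding K_def by blast
  have Yne: "Y \<noteq> {}" using Y_F[of "\<lambda>_. 0"] by auto
  have "openin (stable_weak_topology M F X Y) (X - K)"
    using closed unfolding closedin_def XY.topspace_stable_weak[OF Yne] K_def by blast
  moreover have "x0 \<in> X - K" using x0 unfolding K_def by blast
  ultimately obtain Fs a \<epsilon> where W: "XY.weak_data Fs a \<epsilon>"
    and far': "\<forall>z\<in>X. XY.close Fs a \<epsilon> x0 z \<longrightarrow> z \<in> X - K"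
    using XY.open_contains_basic[of "X - K" x0] by metis
  note far = far'[THEN bspec, THEN mp]
  have Fs: "finite (Fs k)" "Fs k \<subseteq> Y" for k using W unfolding XY.weak_data_def by auto
  have a: "event_partition M F a" and eF [measurable]: "\<epsilon> \<in> borel_measurable F" and epos: "AE \<omega> in M. 0 < \<epsilon> \<omega>"
    using W unfolding XY.weak_data_def by auto
  have [measurable]: "a k \<in> sets F" for k by (rule partition_sets[OF a])
  define H where "H k = (\<lambda>z \<omega>. ereal (- sqdist (Fs k) x0 z \<omega>)) ` K" for k
  have HF: "H k \<subseteq> borel_measurable F" for k unfolding H_def by auto
  define s where "s k = ess_sup M F (H k)" for k
  have sF [measurable]: "s k \<in> borel_measurable F" for k unfolding s_def by (rule ess_sup_measurable[OF HF])
  have up: "AE \<omega> in M. ereal (- sqdist (Fs k) x0 z \<omega>) \<le> s k \<omega>" if "z \<in> K" for z k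
    unfolding s_def by (rule ess_sup_upper[OF HF]) (use that in \<open>auto simp: H_def\<close>)
  obtain z0 where z0: "z0 \<in> K" using K unfolding stable_set_def by blast
  \<comment> \<open>The part of \<open>a k\<close> where the conditional squared distance is at
    least the squared radius.\<close>
  define B where "B k = {\<omega> \<in> space F. \<omega> \<in> a k \<and> s k \<omega> \<le> ereal (- (\<epsilon> \<omega>)\<^sup>2)}" for k
  have BF: "B k \<in> sets F" for k unfolding B_def by measurable
  have "\<exists>k. \<not> (AE \<omega> in M. \<omega> \<notin> B k)"
  proof (rule ccontr)
    assume "\<not> (\<exists>k. \<not> (AE \<omega> in M. \<omega> \<notin> B k))"
    then have null: "AE \<omega> in M. \<omega> \<notin> B k" for k by blast
    have "\<exists>z. z \<in> K \<and> (AE \<omega> in M. \<omega> \<in> a k \<longrightarrow> sqdist (Fs k) x0 z \<omega> < (\<epsilon> \<omega>)\<^sup>2)" for k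
    proof -
      \<comment> \<open>Outside \<open>a k\<close> nothing is demanded; minus infinity makes the
        strict inequality hold there.\<close>
      define \<gamma> where "\<gamma> \<omega> = (if \<omega> \<in> a k then ereal (- (\<epsilon> \<omega>)\<^sup>2) else - \<infinity>)" for \<omega>
      have \<gamma>: "\<gamma> \<in> borel_measurable F" unfolding \<gamma>_def by measurable
      have "AE \<omega> in M. \<gamma> \<omega> < s k \<omega>"
        using null[of k] AE_space up[OF z0, of k]
      proof eventually_elim
        case (elim \<omega>)
        have "- \<infinity> < s k \<omega>" using elim(3) by (cases "s k \<omega>") auto
        with elim(1,2) show ?case unfolding \<gamma>_def B_def by (auto simp: space_subalgebra not_le)
      qed
      then have "\<exists>z\<in>K. AE \<omega> in M. \<gamma> \<omega> < ereal (- sqdist (Fs k) x0 z \<omega>)"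
        unfolding s_def H_def by (rule sqdist_approx[OF K Fs \<gamma>])
      then obtain z where z: "z \<in> K" "AE \<omega> in M. \<gamma> \<omega> < ereal (- sqdist (Fs k) x0 z \<omega>)" by blast
      from z(2) have "AE \<omega> in M. \<omega> \<in> a k \<longrightarrow> sqdist (Fs k) x0 z \<omega> < (\<epsilon> \<omega>)\<^sup>2"
        by eventually_elim (auto simp: \<gamma>_def)
      with z(1) show ?thesis by blast
    qed
    from choice[OF allI[OF this]] obtain b
      where b': "\<forall>k. b k \<in> K \<and> (AE \<omega> in M. \<omega> \<in> a k \<longrightarrow> sqdist (Fs k) x0 (b k) \<omega> < (\<epsilon> \<omega>)\<^sup>2)" ..
    note b = b'[THEN spec, THEN conjunct1] b'[THEN spec, THEN conjunct2]
    have bX: "b k \<in> X" and bM: "b k \<in> borel_measurable M" for k using b(1)[of k] K(2) X_measurable by auto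
    define z where "z = glue a b"
    have zM: "z \<in> borel_measurable M" unfolding z_def by (rule glue_measurable_M[OF a bM])
    have zb: "AE \<omega> in M. \<omega> \<in> a k \<longrightarrow> z \<omega> = b k \<omega>" for k unfolding z_def by (rule glue_eq[OF a])
    have zK: "z \<in> K" by (rule stable_setD[OF K(1) a b(1) zM zb])
    then have zX: "z \<in> X" using K(2) by blast
    have "XY.close Fs a \<epsilon> x0 z"
      unfolding XY.close_iff[OF W x0(1) zX]
    proof (intro allI ballI)
      fix k g assume g: "g \<in> Fs k"
      from sqdist_local[OF Fs(1)[of k] Fs(2)[of k] zX bX[of k] partition_sets[OF a, of k] zb[of k], of x0]
        b(2)[of k] epos
      show "AE \<omega> in M. \<omega> \<in> a k \<longrightarrow> \<bar>pr z g \<omega> - pr x0 g \<omega>\<bar> < \<epsilon> \<omega>"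
      proof eventually_elim
        case (elim \<omega>)
        show ?case
        proof
          assume \<omega>: "\<omega> \<in> a k"
          have "(pr z g \<omega> - pr x0 g \<omega>)\<^sup>2 \<le> sqdist (Fs k) x0 z \<omega>"
            unfolding sqdist_def by (rule member_le_sum[OF g]) (use Fs(1) in auto)
          also have "\<dots> < (\<epsilon> \<omega>)\<^sup>2" using elim \<omega> by simp
          finally have "\<bar>pr z g \<omega> - pr x0 g \<omega>\<bar>\<^sup>2 < (\<epsilon> \<omega>)\<^sup>2" by simp
          then show "\<bar>pr z g \<omega> - pr x0 g \<omega>\<bar> < \<epsilon> \<omega>"
            by (rule power2_less_imp_less) (use elim(3) in simp)
        qed
      qed
    qed
    with far[OF zX] zK show False by blast
  qed
  then obtain k where k: "\<not> (AE \<omega> in M. \<omega> \<notin> B k)" by blast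
  define e where "e \<omega> = (\<epsilon> \<omega>)\<^sup>2" for \<omega>
  have eF' [measurable]: "e \<in> borel_measurable F" unfolding e_def by measurable
  have "AE \<omega> in M. \<omega> \<in> B k \<longrightarrow> e \<omega> \<le> sqdist (Fs k) x0 z \<omega>" if "z \<in> K" for z
    using up[OF that, of k]
  proof eventually_elim
    case (elim \<omega>)
    show ?case
    proof
      assume "\<omega> \<in> B k"
      then have "s k \<omega> \<le> ereal (- (\<epsilon> \<omega>)\<^sup>2)" unfolding B_def by simp
      with elim have "ereal (- sqdist (Fs k) x0 z \<omega>) \<le> ereal (- (\<epsilon> \<omega>)\<^sup>2)" by (rule order_trans)
      then show "e \<omega> \<le> sqdist (Fs k) x0 z \<omega>" by (simp add: e_def)
    qed
  qed
  from finite_dimensional_separation[OF K conv Fs x0(1) BF eF' this]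
  obtain v where vF: "\<And>g. g \<in> Fs k \<Longrightarrow> v g \<in> borel_measurable F"
    and v: "\<And>z. z \<in> K \<Longrightarrow> AE \<omega> in M. \<omega> \<in> B k \<longrightarrow> e \<omega> \<le> (\<Sum>g\<in>Fs k. v g \<omega> * (pr z g \<omega> - pr x0 g \<omega>))"
    by blast
  define y where "y \<omega> = (\<Sum>g\<in>Fs k. v g \<omega> * g \<omega>)" for \<omega>
  have vg: "(\<lambda>\<omega>. v g \<omega> * g \<omega>) \<in> Y" if "g \<in> Fs k" for g
    by (rule Y_mult[OF vF[OF that]]) (use Fs that in blast)
  have yY: "y \<in> Y"
    unfolding y_def by (rule Y_sum[OF Fs(1) vg])
  have pry: "AE \<omega> in M. pr x y \<omega> = (\<Sum>g\<in>Fs k. v g \<omega> * pr x g \<omega>)" if x: "x \<in> X" for x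
  proof -
    have L: "(\<lambda>\<omega>. x \<omega> * (v g \<omega> * g \<omega>)) \<in> L1_cond M F" if "g \<in> Fs k" for g
      by (rule XY_L1[OF x vg[OF that]])
    have "AE \<omega> in M. ce (\<lambda>\<omega>. \<Sum>g\<in>Fs k. x \<omega> * (v g \<omega> * g \<omega>)) \<omega> = (\<Sum>g\<in>Fs k. ce (\<lambda>\<omega>. x \<omega> * (v g \<omega> * g \<omega>)) \<omega>)"
      by (rule ce_sum[OF L])
    moreover have "AE \<omega> in M. ce (\<lambda>\<omega>. x \<omega> * (v g \<omega> * g \<omega>)) \<omega> = v g \<omega> * pr x g \<omega>" if "g \<in> Fs k" for g
      using ce_mult[OF XY_L1[OF x] vF[OF that], of g] Fs that by (auto simp: mult.left_commute)
    then have "AE \<omega> in M. \<forall>g\<in>Fs k. ce (\<lambda>\<omega>. x \<omega> * (v g \<omega> * g \<omega>)) \<omega> = v g \<omega> * pr x g \<omega>"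
      unfolding AE_ball_countable[OF countable_finite[OF Fs(1)]] by blast
    ultimately show ?thesis
      unfolding y_def sum_distrib_left by eventually_elim (simp cong: sum.cong)
  qed
  have "AE \<omega> in M. \<omega> \<in> B k \<longrightarrow> pr x0 y \<omega> + e \<omega> \<le> pr z y \<omega>" if z: "z \<in> K" for z
  proof -
    have "z \<in> X" using z K(2) by blast
    from pry[OF this] pry[OF x0(1)] v[OF z] show ?thesis
      by eventually_elim (auto simp: right_diff_distrib sum_subtractf)
  qed
  moreover from epos have "AE \<omega> in M. 0 < e \<omega>" by eventually_elim (simp add: e_def)
  ultimately show ?thesis using BF k yY eF' unfolding K_def by blast
qed

text \<open>If the representation falls short of \<rho> x on \<open>A\<close>, shifting x by a level
  \<beta> strictly in between gives a non-acceptable x0. The functional separating x0 from the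
  acceptance set, normalized to a dual density, yields a member of the representing family above
  \<beta> on a non-null part of \<open>A\<close>.\<close>

lemma lower_semicont_imp_representable:
  assumes lsc: "lower_semicont M F X (stable_weak_topology M F X Y) (\<lambda>x \<omega>. ereal (\<rho> x \<omega>))"
  shows "representable M F X \<rho>"
proof (rule ccontr)
  assume "\<not> representable M F X \<rho>"
  then obtain x where x: "x \<in> X" and nle: "\<not> (AE \<omega> in M. ereal (\<rho> x \<omega>) \<le> ess_sup M F (rep_family x ` D) \<omega>)"
    unfolding representable_iff by blast
  define K where "K = {x \<in> X. AE \<omega> in M. \<rho> x \<omega> \<le> 0}"
  have rF [measurable]: "\<rho> x \<in> borel_measurable F" by (rule \<rho>_F[OF x])
  define s where "s = ess_sup M F (rep_family x ` D)"
  have sF [measurable]: "s \<in> borel_measurable F" unfolding s_def by (rule ess_sup_measurable[OF rep_family_F])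
  define A where "A = {\<omega> \<in> space F. s \<omega> < ereal (\<rho> x \<omega>)}"
  have AF [measurable]: "A \<in> sets F" unfolding A_def by measurable
  \<comment> \<open>The midpoint of \<open>s\<close> and \<rho> x on \<open>A\<close>, or \<rho> x -
    1 where \<open>s\<close> is minus infinity. Off \<open>A\<close> the value \<rho> x makes \<rho>
    x0 equal to 0.\<close>
  define \<beta> where "\<beta> \<omega> = (if \<omega> \<in> A then (if s \<omega> = - \<infinity> then \<rho> x \<omega> - 1 else (real_of_ereal (s \<omega>) + \<rho> x \<omega>) / 2) else \<rho> x \<omega>)" for \<omega>
  have \<beta>F [measurable]: "\<beta> \<in> borel_measurable F" unfolding \<beta>_def by measurable
  have \<beta>A: "s \<omega> < ereal (\<beta> \<omega>) \<and> \<beta> \<omega> < \<rho> x \<omega>" if "\<omega> \<in> A" for \<omega>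
    using that by (cases "s \<omega>") (auto simp: \<beta>_def A_def)
  define x0 where "x0 \<omega> = x \<omega> + \<beta> \<omega>" for \<omega>
  have x0: "x0 \<in> X" unfolding x0_def by (rule X_add[OF x X_F[OF \<beta>F]])
  have \<rho>x0: "AE \<omega> in M. \<rho> x0 \<omega> = \<rho> x \<omega> - \<beta> \<omega>" unfolding x0_def by (rule \<rho>_shift[OF \<beta>F x])
  have nacc: "\<not> (AE \<omega> in M. \<rho> x0 \<omega> \<le> 0)"
  proof
    assume "AE \<omega> in M. \<rho> x0 \<omega> \<le> 0"
    with \<rho>x0 AE_space have "AE \<omega> in M. ereal (\<rho> x \<omega>) \<le> s \<omega>"
    proof eventually_elim
      case (elim \<omega>)
      show ?case
      proof (rule ccontr)
        assume "\<not> ereal (\<rho> x \<omega>) \<le> s \<omega>"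
        then have "\<omega> \<in> A" using elim(2) by (simp add: A_def space_subalgebra)
        from \<beta>A[OF this] elim show False by simp
      qed
    qed
    with nle show False unfolding s_def by blast
  qed
  have cl: "closedin (stable_weak_topology M F X Y) {x \<in> X. AE \<omega> in M. \<rho> x \<omega> \<le> 0}"
  proof -
    have "(\<lambda>_. 0) \<in> borel_measurable F" by simp
    then have "closedin (stable_weak_topology M F X Y) (sublevel M X (\<lambda>x \<omega>. ereal (\<rho> x \<omega>)) (\<lambda>_. 0))"
      using lsc unfolding lower_semicont_def by blast
    then show ?thesis unfolding sublevel_def by simp
  qed
  from closed_acceptance_set_separation[OF cl x0 nacc, folded K_def] obtain B y e where B: "B \<in> sets F" "\<not> (AE \<omega> in M. \<omega> \<notin> B)" and y: "y \<in> Y"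
    and eF [measurable]: "e \<in> borel_measurable F" and epos: "AE \<omega> in M. 0 < e \<omega>"
    and sep': "\<forall>z\<in>K. AE \<omega> in M. \<omega> \<in> B \<longrightarrow> pr x0 y \<omega> + e \<omega> \<le> pr z y \<omega>"
    by (elim exE conjE) (rule that)
  note sep = sep'[THEN bspec]
  have [measurable]: "B \<in> sets F" "B \<in> sets M" "y \<in> borel_measurable M"
    using B sets_subalgebra Y_measurable[OF y] by auto
  have accept: "(\<lambda>\<omega>. u \<omega> + \<rho> u \<omega>) \<in> K" if u: "u \<in> X" for u
  proof -
    have "(\<lambda>\<omega>. u \<omega> + \<rho> u \<omega>) \<in> X" by (rule X_add[OF u X_F[OF \<rho>_F[OF u]]])
    moreover from \<rho>_shift[OF \<rho>_F[OF u] u] have "AE \<omega> in M. \<rho> (\<lambda>\<omega>. u \<omega> + \<rho> u \<omega>) \<omega> \<le> 0" by eventually_elim simp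
    ultimately show ?thesis unfolding K_def by blast
  qed
  have pr_accept: "AE \<omega> in M. pr (\<lambda>\<omega>. u \<omega> + \<eta> \<omega>) y \<omega> = pr u y \<omega> + \<eta> \<omega> * ce y \<omega>"
    if "u \<in> X" "\<eta> \<in> borel_measurable F" for u \<eta>
    using pr_add[OF that(1) X_F[OF that(2)] y] pr_F[OF that(2) y] by eventually_elim simp
  have prx0: "AE \<omega> in M. pr x0 y \<omega> = pr x y \<omega> + \<beta> \<omega> * ce y \<omega>"
    unfolding x0_def by (rule pr_accept[OF x \<beta>F])
  \<comment> \<open>The acceptable element x + \<rho> x gives e \<le> (\<rho> x - \<beta>) E[y | F]
    on \<open>B\<close>, which forces \<beta> to differ from \<rho> x and E[y | F] to be
    positive.\<close>
  have BA: "AE \<omega> in M. \<omega> \<in> B \<longrightarrow> \<omega> \<in> A \<and> 0 < ce y \<omega>"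
    using sep[OF accept[OF x]] pr_accept[OF x rF] prx0 epos
  proof eventually_elim
    case (elim \<omega>)
    show ?case
    proof
      assume "\<omega> \<in> B"
      then have *: "e \<omega> \<le> (\<rho> x \<omega> - \<beta> \<omega>) * ce y \<omega>" using elim by (simp add: algebra_simps)
      have A: "\<omega> \<in> A"
      proof (rule ccontr)
        assume "\<omega> \<notin> A"
        then show False using * elim(4) by (simp add: \<beta>_def)
      qed
      from \<beta>A[OF A] have "0 < \<rho> x \<omega> - \<beta> \<omega>" by simp
      moreover have "0 < (\<rho> x \<omega> - \<beta> \<omega>) * ce y \<omega>" using * elim(4) by linarith
      ultimately show "\<omega> \<in> A \<and> 0 < ce y \<omega>" using A by (simp add: zero_less_mult_iff)
    qed
  qed
  \<comment> \<open>The indicator of the set where \<open>y\<close> is negative. Adding multiples of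
    it preserves acceptability, which forces E[p y | F] to be nonnegative on
    \<open>B\<close>.\<close>
  define p where "p \<omega> = max 0 (sgn (- y \<omega>))" for \<omega>
  have [measurable]: "p \<in> borel_measurable M" unfolding p_def by measurable
  have p01: "0 \<le> p \<omega>" "p \<omega> \<le> 1" for \<omega> unfolding p_def by (auto simp: sgn_if)
  have one: "(\<lambda>_. 1) \<in> X" by (rule X_F) simp
  have pX: "p \<in> X" by (rule X_solid[OF one]) (use p01 in auto)
  obtain z0 where z0: "z0 \<in> K" using accept[OF x] by blast
  then have z0X: "z0 \<in> X" unfolding K_def by blast
  have "AE \<omega> in M. \<omega> \<in> B \<longrightarrow> pr x0 y \<omega> + e \<omega> \<le> pr z0 y \<omega> + real n * pr p y \<omega>" for n :: nat
  proof -
    have npX: "(\<lambda>\<omega>. real n * p \<omega>) \<in> X" by (rule X_cmult[OF pX])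
    have zX: "(\<lambda>\<omega>. z0 \<omega> + real n * p \<omega>) \<in> X" by (rule X_add[OF z0X npX])
    have "AE \<omega> in M. \<rho> (\<lambda>\<omega>. z0 \<omega> + real n * p \<omega>) \<omega> \<le> \<rho> z0 \<omega>"
      by (rule \<rho>_mono[OF z0X zX]) (use p01 in auto)
    moreover have "AE \<omega> in M. \<rho> z0 \<omega> \<le> 0" using z0 unfolding K_def by blast
    ultimately have "AE \<omega> in M. \<rho> (\<lambda>\<omega>. z0 \<omega> + real n * p \<omega>) \<omega> \<le> 0" by eventually_elim simp
    with zX have "(\<lambda>\<omega>. z0 \<omega> + real n * p \<omega>) \<in> K" unfolding K_def by blast
    from sep[OF this] pr_add[OF z0X npX y] pr_cmult[OF pX y, of "real n"] show ?thesis
      by eventually_elim simp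
  qed
  then have "AE \<omega> in M. \<forall>n::nat. \<omega> \<in> B \<longrightarrow> pr x0 y \<omega> + e \<omega> \<le> pr z0 y \<omega> + real n * pr p y \<omega>"
    unfolding AE_all_countable by blast
  then have prp: "AE \<omega> in M. \<omega> \<in> B \<longrightarrow> 0 \<le> pr p y \<omega>"
  proof eventually_elim
    case (elim \<omega>)
    show ?case
    proof (intro impI, rule ccontr)
      assume "\<omega> \<in> B" "\<not> 0 \<le> pr p y \<omega>"
      then obtain n :: nat where "pr z0 y \<omega> - pr x0 y \<omega> - e \<omega> < real n * (- pr p y \<omega>)"
        using reals_Archimedean3[of "- pr p y \<omega>"] by auto
      moreover have "pr x0 y \<omega> + e \<omega> \<le> pr z0 y \<omega> + real n * pr p y \<omega>" using elim \<open>\<omega> \<in> B\<close> by blast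
      ultimately show False by simp
    qed
  qed
  have L1: "(\<lambda>\<omega>. p \<omega> * y \<omega>) \<in> L1_cond M F" by (rule XY_L1[OF pX y])
  have "AE \<omega> in M. \<omega> \<in> B \<longrightarrow> - (p \<omega> * y \<omega>) = 0"
  proof (rule ce_nonpos_imp_zero_on[OF L1_cond_uminus[OF L1] _ B(1)])
    show "AE \<omega> in M. 0 \<le> - (p \<omega> * y \<omega>)" by (auto simp: p_def sgn_if)
    from prp ce_uminus[OF L1] show "AE \<omega> in M. \<omega> \<in> B \<longrightarrow> ce (\<lambda>\<omega>. - (p \<omega> * y \<omega>)) \<omega> \<le> 0" by eventually_elim simp
  qed
  then have ypos: "AE \<omega> in M. \<omega> \<in> B \<longrightarrow> 0 \<le> y \<omega>"
    by eventually_elim (auto simp: p_def sgn_if split: if_splits)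
  \<comment> \<open>On \<open>B\<close> the functional is scaled to conditional mean -1; off
    \<open>B\<close> it is replaced by the constant -1, so that \<open>q\<close> is a dual density
    on the whole space.\<close>
  define \<eta> where "\<eta> \<omega> = (if \<omega> \<in> B \<and> 0 < ce y \<omega> then - 1 / ce y \<omega> else 0)" for \<omega>
  define \<zeta> where "\<zeta> \<omega> = (if \<omega> \<in> B then 0 else - 1 :: real)" for \<omega>
  have \<eta>F [measurable]: "\<eta> \<in> borel_measurable F" unfolding \<eta>_def by measurable
  have \<zeta>F [measurable]: "\<zeta> \<in> borel_measurable F" unfolding \<zeta>_def by measurable
  define q where "q \<omega> = \<eta> \<omega> * y \<omega> + \<zeta> \<omega>" for \<omega>
  have \<eta>y: "(\<lambda>\<omega>. \<eta> \<omega> * y \<omega>) \<in> Y" by (rule Y_mult[OF \<eta>F y])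
  have qY: "q \<in> Y" unfolding q_def by (rule Y_add[OF \<eta>y Y_F[OF \<zeta>F]])
  have prq: "AE \<omega> in M. pr u q \<omega> = \<eta> \<omega> * pr u y \<omega> + \<zeta> \<omega> * ce u \<omega>" if u: "u \<in> X" for u
  proof -
    have "AE \<omega> in M. ce (\<lambda>\<omega>. \<eta> \<omega> * (u \<omega> * y \<omega>) + \<zeta> \<omega> * u \<omega>) \<omega> = ce (\<lambda>\<omega>. \<eta> \<omega> * (u \<omega> * y \<omega>)) \<omega> + ce (\<lambda>\<omega>. \<zeta> \<omega> * u \<omega>) \<omega>"
      by (intro ce_add L1_cond_mult XY_L1 X_L1 u y \<eta>F \<zeta>F)
    with ce_mult[OF XY_L1[OF u y] \<eta>F] ce_mult[OF X_L1[OF u] \<zeta>F] show ?thesis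
      unfolding q_def by eventually_elim (simp add: algebra_simps)
  qed
  have ce1: "AE \<omega> in M. ce (\<lambda>_. 1) \<omega> = 1" by (rule ce_F) simp
  have ceq: "AE \<omega> in M. ce q \<omega> = - 1"
    using prq[OF one] BA ce1 by eventually_elim (auto simp: \<eta>_def \<zeta>_def)
  have "AE \<omega> in M. q \<omega> \<le> 0"
    using ypos by eventually_elim (auto simp: q_def \<eta>_def \<zeta>_def divide_nonneg_pos)
  with qY ceq have qD: "q \<in> D" by (simp add: D_iff)
  \<comment> \<open>The separation inequality for the acceptable u + \<rho> u, divided by E[y | F],
    bounds every term of the conjugate. The negative summand
    \<open>\<eta> \<omega> * e \<omega>\<close> carries the strict gap.\<close>
  have "AE \<omega> in M. \<omega> \<in> B \<longrightarrow> \<alpha> q \<omega> \<le> ereal (pr x0 q \<omega> + \<eta> \<omega> * e \<omega>)"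
  proof (rule \<alpha>_least_on[OF qY _ B(1)])
    fix u assume u: "u \<in> X"
    from sep[OF accept[OF u]] pr_accept[OF u \<rho>_F[OF u]] prq[OF u] prq[OF x0] BA
    show "AE \<omega> in M. \<omega> \<in> B \<longrightarrow> ereal (pr u q \<omega> - \<rho> u \<omega>) \<le> ereal (pr x0 q \<omega> + \<eta> \<omega> * e \<omega>)"
    proof eventually_elim
      case (elim \<omega>)
      show ?case
      proof
        assume \<omega>: "\<omega> \<in> B"
        then have c: "0 < ce y \<omega>" using elim by blast
        have "(pr x0 y \<omega> + e \<omega>) / ce y \<omega> \<le> (pr u y \<omega> + \<rho> u \<omega> * ce y \<omega>) / ce y \<omega>"
          using elim(1,2) \<omega> c by (intro divide_right_mono) auto
        then show "ereal (pr u q \<omega> - \<rho> u \<omega>) \<le> ereal (pr x0 q \<omega> + \<eta> \<omega> * e \<omega>)"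
          unfolding elim(3,4) using \<omega> c by (simp add: \<eta>_def \<zeta>_def add_divide_distrib)
      qed
    qed
  qed measurable
  moreover have "AE \<omega> in M. rep_family x q \<omega> \<le> s \<omega>"
    unfolding s_def by (rule ess_sup_upper[OF rep_family_F]) (use qD in blast)
  moreover have "AE \<omega> in M. pr x0 q \<omega> = pr x q \<omega> - \<beta> \<omega>"
    unfolding x0_def using pr_add[OF x X_F[OF \<beta>F] qY] pr_F[OF \<beta>F qY] ceq by eventually_elim simp
  \<comment> \<open>On \<open>B\<close> the bound puts the family member of \<open>q\<close> above
    \<beta>, whereas the supremum \<open>s\<close> lies below \<beta> on \<open>A\<close>.\<close>
  ultimately have "AE \<omega> in M. \<omega> \<notin> B"
    using rep_family_eq[OF x qY] \<alpha>_not_MInf[OF qY] BA epos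
  proof eventually_elim
    case (elim \<omega>)
    show ?case
    proof
      assume \<omega>: "\<omega> \<in> B"
      then have A: "\<omega> \<in> A" and c: "0 < ce y \<omega>" using elim by auto
      have neg: "\<eta> \<omega> * e \<omega> < 0" using \<omega> c elim(7) by (simp add: \<eta>_def)
      obtain r where r: "\<alpha> q \<omega> = ereal r" using elim(1,5) \<omega> by (cases "\<alpha> q \<omega>") auto
      then have "ereal (pr x q \<omega> - r) \<le> s \<omega>" using elim(2,4) by simp
      also have "s \<omega> < ereal (\<beta> \<omega>)" using \<beta>A[OF A] by blast
      finally have "pr x q \<omega> - r < \<beta> \<omega>" by simp
      moreover have "r \<le> pr x q \<omega> - \<beta> \<omega> + \<eta> \<omega> * e \<omega>" using elim(1,3) \<omega> r by simp
      ultimately show False using neg by linarith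
    qed
  qed
  with B(2) show False by blast
qed

end

subsection \<open>Attained representation implies the Lebesgue property\<close>

text \<open>Simons' argument for James' theorem. For a decreasing sequence every convex combination of
  members dominates some later member, so monotonicity replaces the infimum over convex hulls.\<close>

lemma simons_decreasing:
  fixes M :: "'a measure" and u :: "nat \<Rightarrow> 'a \<Rightarrow> real" and \<Phi> :: "('a \<Rightarrow> real) \<Rightarrow> real"
  defines "U \<equiv> {v \<in> borel_measurable M. \<forall>\<omega>. 0 \<le> v \<omega> \<and> v \<omega> \<le> 2 * u 0 \<omega>}"
  assumes meas [measurable]: "\<And>n. u n \<in> borel_measurable M"
    and dec: "\<And>m n \<omega>. m \<le> n \<Longrightarrow> u n \<omega> \<le> u m \<omega>" and nn: "\<And>n \<omega>. 0 \<le> u n \<omega>"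
    and lim: "\<And>\<omega>. (\<lambda>n. u n \<omega>) \<longlonglongrightarrow> 0"
    and mono: "\<And>v v'. v \<in> U \<Longrightarrow> v' \<in> U \<Longrightarrow> (\<And>\<omega>. v \<omega> \<le> v' \<omega>) \<Longrightarrow> \<Phi> v \<le> \<Phi> v'"
    and convex: "\<And>v v' t. v \<in> U \<Longrightarrow> v' \<in> U \<Longrightarrow> 0 \<le> t \<Longrightarrow> t \<le> 1 \<Longrightarrow>
      \<Phi> (\<lambda>\<omega>. t * v \<omega> + (1 - t) * v' \<omega>) \<le> t * \<Phi> v + (1 - t) * \<Phi> v'"
    and subgradient: "\<And>w. w \<in> U \<Longrightarrow> (\<And>\<omega>. w \<omega> \<le> u 0 \<omega>) \<Longrightarrow>
      \<exists>q\<in>borel_measurable M. (AE \<omega> in M. 0 \<le> q \<omega>) \<and> integrable M (\<lambda>\<omega>. q \<omega> * u 0 \<omega>) \<and>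
        (\<forall>v\<in>U. \<Phi> w + (\<integral>\<omega>. q \<omega> * (v \<omega> - w \<omega>) \<partial>M) \<le> \<Phi> v)"
    and \<eta>: "0 < \<eta>"
  shows "\<exists>n. \<Phi> (u n) \<le> \<Phi> (\<lambda>_. 0) + \<eta>"
proof -
  have UI: "v \<in> U" if "v \<in> borel_measurable M" "\<And>\<omega>. 0 \<le> v \<omega>" "\<And>\<omega>. v \<omega> \<le> 2 * u 0 \<omega>" for v
    using that unfolding U_def by blast
  have average: "(1 / (1+t)) * a + (1 - 1 / (1+t)) * b = (a + t * b) / (1+t)" if "0 < t" for t a b :: real
  proof -
    have "1 - 1 / (1+t) = t / (1+t)" using that by (simp add: field_simps)
    then show ?thesis by (simp add: add_divide_distrib)
  qed
  have zero: "(\<lambda>_. 0) \<in> U" by (rule UI) (use nn in auto)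
  \<comment> \<open>Passing from \<open>a 0\<close> to \<open>2^n * a n\<close> accumulates the
    errors 2^n e n; with this choice they sum to \<eta>/2.\<close>
  define e where "e n = \<eta> / 4 ^ Suc n" for n
  have epos: "0 < e n" for n using \<eta> unfolding e_def by simp
  \<comment> \<open>\<open>K\<close> nearly minimizes \<Phi> (w + 2^-n u_j) over j. Taking K > n
    ensures that the tail of the series after stage n is at most 2^-n u_n.\<close>
  define good where "good n w K \<longleftrightarrow> n < K \<and>
    (\<forall>k. \<Phi> (\<lambda>\<omega>. w \<omega> + (1/2)^n * u K \<omega>) \<le> \<Phi> (\<lambda>\<omega>. w \<omega> + (1/2)^n * u k \<omega>) + e n)" for n w K
  define \<kappa> where "\<kappa> n w = (SOME K. good n w K)" for n w
  \<comment> \<open>Partial sums with weights 2^-(n+1); the next index is chosen only after the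
    current sum is known. The weights add up to 1, so the limit is an infinite convex
    combination.\<close>
  define W where "W = rec_nat (\<lambda>_. 0) (\<lambda>n w \<omega>. w \<omega> + (1/2)^Suc n * u (\<kappa> n w) \<omega>)"
  define k where "k n = \<kappa> n (W n)" for n
  have W0: "W 0 = (\<lambda>_. 0)" unfolding W_def by simp
  have WSuc: "W (Suc n) \<omega> = W n \<omega> + (1/2)^Suc n * u (k n) \<omega>" for n \<omega>
    unfolding W_def k_def by simp
  have WM [measurable]: "W n \<in> borel_measurable M" for n
  proof (induction n)
    case (Suc n)
    have "W (Suc n) = (\<lambda>\<omega>. W n \<omega> + (1/2)^Suc n * u (k n) \<omega>)" using WSuc by blast
    then show ?case using Suc by simp
  qed (simp add: W0)
  have Wnn: "0 \<le> W n \<omega>" for n \<omega> by (induction n) (auto simp: W0 WSuc nn)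
  \<comment> \<open>The increments from n to n+j have total weight 2^-n (1 - 2^-j), and all of them
    use indices from i on.\<close>
  have Wdiff: "W (n + j) \<omega> - W n \<omega> \<le> (1/2)^n * (1 - (1/2)^j) * u i \<omega>" if "\<And>l. n \<le> l \<Longrightarrow> i \<le> k l" for n j i \<omega>
  proof (induction j)
    case (Suc j)
    have "(1/2)^Suc (n+j) * u (k (n+j)) \<omega> \<le> (1/2)^Suc (n+j) * u i \<omega>"
      by (intro mult_left_mono dec that) auto
    moreover have "W (n + Suc j) \<omega> = W (n + j) \<omega> + (1/2)^Suc (n+j) * u (k (n+j)) \<omega>"
      using WSuc[of "n+j" \<omega>] by simp
    moreover have "(1/2)^n * (1 - (1/2)^Suc j) * u i \<omega> = (1/2)^n * (1 - (1/2)^j) * u i \<omega> + (1/2)^Suc (n+j) * u i \<omega>"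
      by (simp add: power_add algebra_simps)
    ultimately show ?case using Suc by linarith
  qed simp
  have Wle: "W n \<omega> \<le> (1 - (1/2)^n) * u 0 \<omega>" for n \<omega>
    using Wdiff[of 0 0 n \<omega>] by (simp add: W0)
  have Wle': "W n \<omega> + (1/2)^n * u 0 \<omega> \<le> u 0 \<omega>" for n \<omega>
    using Wle[of n \<omega>] by (simp add: left_diff_distrib)
  have goodk: "good n (W n) (k n)" for n
  proof -
    define f where "f j = \<Phi> (\<lambda>\<omega>. W n \<omega> + (1/2)^n * u j \<omega>)" for j
    have inU: "(\<lambda>\<omega>. W n \<omega> + (1/2)^n * u j \<omega>) \<in> U" for j
    proof (rule UI)
      show "0 \<le> W n \<omega> + (1/2)^n * u j \<omega>" for \<omega> using Wnn nn by simp
      show "W n \<omega> + (1/2)^n * u j \<omega> \<le> 2 * u 0 \<omega>" for \<omega>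
      proof -
        have "(1/2)^n * u j \<omega> \<le> (1/2)^n * u 0 \<omega>" by (intro mult_left_mono dec) auto
        then show ?thesis using Wle'[of n \<omega>] nn[of 0 \<omega>] by linarith
      qed
    qed measurable
    have fdec: "f j \<le> f i" if "i \<le> j" for i j
      unfolding f_def by (intro mono inU add_left_mono mult_left_mono dec that) auto
    have flow: "\<Phi> (\<lambda>_. 0) \<le> f j" for j
      unfolding f_def by (intro mono inU zero) (use Wnn nn in auto)
    have "\<exists>K. n < K \<and> (\<forall>j. f K \<le> f j + e n)"
    proof -
      have bdd: "bdd_below (range f)" using flow by (intro bdd_belowI2)
      have "Inf (range f) < Inf (range f) + e n" using epos by simp
      then obtain j where j: "f j < Inf (range f) + e n"
        using cInf_less_iff[OF _ bdd, of "Inf (range f) + e n"] by auto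
      have "f (max j (Suc n)) \<le> f i + e n" for i
        using fdec[of j "max j (Suc n)"] j cInf_lower[OF rangeI[of f i] bdd] by simp
      then show ?thesis by (intro exI[of _ "max j (Suc n)"]) auto
    qed
    then have "\<exists>K. good n (W n) K" unfolding good_def f_def .
    then show ?thesis unfolding k_def \<kappa>_def by (rule someI_ex)
  qed
  then have kn: "n < k n" for n unfolding good_def by blast
  define w where "w \<omega> = (\<Sum>i. (1/2)^Suc i * u (k i) \<omega>)" for \<omega>
  have summ: "summable (\<lambda>i. (1/2)^Suc i * u (k i) \<omega>)" for \<omega>
  proof (rule summable_comparison_test')
    have "summable (\<lambda>i. (1/2::real)^i)" by (rule summable_geometric) simp
    then have "summable (\<lambda>i. (1/2::real)^Suc i)" by (simp only: summable_Suc_iff)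
    then show "summable (\<lambda>i. (1/2)^Suc i * u 0 \<omega>)" by (rule summable_mult2)
    show "norm ((1/2)^Suc i * u (k i) \<omega>) \<le> (1/2)^Suc i * u 0 \<omega>" for i
      using nn dec[of 0 "k i" \<omega>] by (simp add: mult_left_mono)
  qed
  have Wsum: "W n \<omega> = (\<Sum>i<n. (1/2)^Suc i * u (k i) \<omega>)" for n \<omega>
    by (induction n) (auto simp: W0 WSuc)
  have Wlim: "(\<lambda>n. W n \<omega>) \<longlonglongrightarrow> w \<omega>" for \<omega>
    unfolding Wsum w_def by (rule summable_LIMSEQ[OF summ])
  have wM [measurable]: "w \<in> borel_measurable M" unfolding w_def by measurable
  have Wmono: "W n \<omega> \<le> W (n + j) \<omega>" for n j \<omega>
    by (induction j) (auto simp: WSuc nn intro: order_trans)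
  have Ww: "W n \<omega> \<le> w \<omega>" for n \<omega>
    by (rule LIMSEQ_le_const[OF Wlim]) (use Wmono in \<open>metis le_Suc_ex\<close>)
  have wW: "w \<omega> - W n \<omega> \<le> (1/2)^n * u n \<omega>" for n \<omega>
  proof (rule LIMSEQ_le_const2)
    show "(\<lambda>m. W m \<omega> - W n \<omega>) \<longlonglongrightarrow> w \<omega> - W n \<omega>" by (intro tendsto_intros Wlim)
    have "W (n + j) \<omega> - W n \<omega> \<le> (1/2)^n * u n \<omega>" for j
    proof -
      have "n \<le> k l" if "n \<le> l" for l using kn[of l] that by simp
      from Wdiff[OF this] have "W (n + j) \<omega> - W n \<omega> \<le> (1/2)^n * (1 - (1/2)^j) * u n \<omega>" .
      also have "\<dots> \<le> (1/2)^n * 1 * u n \<omega>" by (intro mult_right_mono mult_left_mono nn) auto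
      finally show ?thesis by simp
    qed
    then show "\<exists>N. \<forall>m\<ge>N. W m \<omega> - W n \<omega> \<le> (1/2)^n * u n \<omega>" by (metis le_Suc_ex)
  qed
  have wu: "w \<omega> \<le> u 0 \<omega>" for \<omega> using wW[of \<omega> 0] by (simp add: W0)
  have wnn: "0 \<le> w \<omega>" for \<omega> using Ww[of 0 \<omega>] by (simp add: W0)
  have wU: "w \<in> U" by (rule UI) (use wu wnn nn order_trans[OF wu] in \<open>auto simp: order_trans[OF wu]\<close>)
  have u2U: "(\<lambda>\<omega>. 2 * u 0 \<omega>) \<in> U" by (rule UI) (use nn in auto)
  \<comment> \<open>The rest of the series after stage n is 2^-n times a convex combination of later
    members. Its first N terms miss the weight t = 2^-N, which convexity supplies from the point f +
    2 g; the influence of this point vanishes as N grows.\<close>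
  have key: "\<Phi> (\<lambda>\<omega>. W n \<omega> + (1/2)^n * u (k n) \<omega>) \<le> \<Phi> w + e n" for n
  proof -
    define c where "c = \<Phi> (\<lambda>\<omega>. W n \<omega> + (1/2)^n * u (k n) \<omega>) - e n"
    have step: "(1 + (1/2)^N) * c \<le> \<Phi> w + (1/2)^N * \<Phi> (\<lambda>\<omega>. 2 * u 0 \<omega>)" for N
    proof -
      define t :: real where "t = (1/2)^N"
      have t: "0 < t" "t \<le> 1" unfolding t_def by (auto simp: power_le_one)
      \<comment> \<open>A member below all those used before stage n+N.\<close>
      define K where "K = Max (insert 0 (k ` {..<n+N}))"
      have K: "k i \<le> K" if "i < n + N" for i unfolding K_def by (rule Max_ge) (use that in auto)
      define f where "f = W n"
      define g where "g \<omega> = (1/2)^n * u K \<omega>" for \<omega>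
      have [measurable]: "f \<in> borel_measurable M" "g \<in> borel_measurable M" unfolding f_def g_def by measurable
      have fn: "0 \<le> f \<omega>" "0 \<le> g \<omega>" for \<omega> unfolding f_def g_def using Wnn nn by auto
      have fg: "f \<omega> + 2 * g \<omega> \<le> 2 * u 0 \<omega>" for \<omega>
      proof -
        have "g \<omega> \<le> (1/2)^n * u 0 \<omega>" unfolding g_def by (intro mult_left_mono dec) auto
        moreover have "(1/2)^n * u 0 \<omega> \<le> 1 * u 0 \<omega>" by (intro mult_right_mono nn) (simp add: power_le_one)
        ultimately show ?thesis using Wle'[of n \<omega>] unfolding f_def by linarith
      qed
      have tg: "t * g \<omega> \<le> g \<omega>" for \<omega> using t fn[of \<omega>] by (simp add: mult_left_le_one_le)
      have 1: "(\<lambda>\<omega>. f \<omega> + (1 - t) * g \<omega>) \<in> U"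
      proof (rule UI)
        show "0 \<le> f \<omega> + (1 - t) * g \<omega>" for \<omega> using fn[of \<omega>] t by simp
        show "f \<omega> + (1 - t) * g \<omega> \<le> 2 * u 0 \<omega>" for \<omega>
        proof -
          have "(1 - t) * g \<omega> \<le> 1 * g \<omega>" using fn[of \<omega>] t by (intro mult_right_mono) auto
          then show ?thesis using fg[of \<omega>] fn[of \<omega>] by simp
        qed
      qed measurable
      have 2: "(\<lambda>\<omega>. f \<omega> + 2 * g \<omega>) \<in> U" by (rule UI) (use fn fg in auto)
      have "c \<le> \<Phi> (\<lambda>\<omega>. f \<omega> + g \<omega>)"
        using goodk[of n] unfolding good_def c_def f_def g_def by (simp add: diff_le_eq)
      \<comment> \<open>f + g combines f + (1-t) g and f + 2 g with weights 1/(1+t) and t/(1+t). The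
        second point is only bounded by 2 u_0, the bound built into \<open>U\<close>.\<close>
      also have "(\<lambda>\<omega>. f \<omega> + g \<omega>) = (\<lambda>\<omega>. (1 / (1+t)) * (f \<omega> + (1 - t) * g \<omega>) + (1 - 1 / (1+t)) * (f \<omega> + 2 * g \<omega>))"
      proof
        fix \<omega>
        have "(f \<omega> + (1 - t) * g \<omega>) + t * (f \<omega> + 2 * g \<omega>) = (1 + t) * (f \<omega> + g \<omega>)"
          by (simp add: algebra_simps)
        then show "f \<omega> + g \<omega> = (1 / (1+t)) * (f \<omega> + (1 - t) * g \<omega>) + (1 - 1 / (1+t)) * (f \<omega> + 2 * g \<omega>)"
          unfolding average[OF t(1)] using t by simp
      qed
      also have "\<Phi> \<dots> \<le> (1 / (1+t)) * \<Phi> (\<lambda>\<omega>. f \<omega> + (1 - t) * g \<omega>) + (1 - 1 / (1+t)) * \<Phi> (\<lambda>\<omega>. f \<omega> + 2 * g \<omega>)"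
        by (rule convex[OF 1 2]) (use t in auto)
      also have "1 - 1 / (1+t) = t / (1+t)" using t by (simp add: field_simps)
      finally have "(1+t) * c \<le> (1+t) * ((1 / (1+t)) * \<Phi> (\<lambda>\<omega>. f \<omega> + (1 - t) * g \<omega>) + t / (1+t) * \<Phi> (\<lambda>\<omega>. f \<omega> + 2 * g \<omega>))"
        using t by (intro mult_left_mono) auto
      also have "\<dots> = \<Phi> (\<lambda>\<omega>. f \<omega> + (1 - t) * g \<omega>) + t * \<Phi> (\<lambda>\<omega>. f \<omega> + 2 * g \<omega>)"
        using t by (simp add: distrib_left)
      also have "\<Phi> (\<lambda>\<omega>. f \<omega> + (1 - t) * g \<omega>) \<le> \<Phi> w"
      proof (rule mono[OF 1 wU])
        fix \<omega>
        have "(1/2)^n * (1 - (1/2)^j) * u K \<omega> \<le> W (n + j) \<omega> - W n \<omega>" if "j \<le> N" for j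
          using that
        proof (induction j)
          case (Suc j)
          have "(1/2)^Suc (n+j) * u K \<omega> \<le> (1/2)^Suc (n+j) * u (k (n+j)) \<omega>"
            by (intro mult_left_mono dec K) (use Suc in auto)
          moreover have "W (n + Suc j) \<omega> = W (n + j) \<omega> + (1/2)^Suc (n+j) * u (k (n+j)) \<omega>"
            using WSuc[of "n+j" \<omega>] by simp
          moreover have "(1/2)^n * (1 - (1/2)^Suc j) * u K \<omega> = (1/2)^n * (1 - (1/2)^j) * u K \<omega> + (1/2)^Suc (n+j) * u K \<omega>"
            by (simp add: power_add algebra_simps)
          ultimately show ?case using Suc by linarith
        qed simp
        from this[of N] Ww[of "n+N" \<omega>] show "f \<omega> + (1 - t) * g \<omega> \<le> w \<omega>"
          unfolding f_def g_def t_def by (simp add: algebra_simps)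
      qed
      also have "\<Phi> (\<lambda>\<omega>. f \<omega> + 2 * g \<omega>) \<le> \<Phi> (\<lambda>\<omega>. 2 * u 0 \<omega>)" by (rule mono[OF 2 u2U fg])
      finally show ?thesis using t unfolding t_def by (simp add: mult_left_mono)
    qed
    have p: "(\<lambda>N. (1/2::real)^N) \<longlonglongrightarrow> 0" by (rule LIMSEQ_power_zero) simp
    have "(\<lambda>N. (1 + (1/2)^N) * c) \<longlonglongrightarrow> (1 + 0) * c" by (intro tendsto_intros p)
    moreover have "(\<lambda>N. \<Phi> w + (1/2)^N * \<Phi> (\<lambda>\<omega>. 2 * u 0 \<omega>)) \<longlonglongrightarrow> \<Phi> w + 0 * \<Phi> (\<lambda>\<omega>. 2 * u 0 \<omega>)"
      by (intro tendsto_intros p)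
    ultimately have "(1 + 0) * c \<le> \<Phi> w + 0 * \<Phi> (\<lambda>\<omega>. 2 * u 0 \<omega>)"
      by (rule LIMSEQ_le) (use step in auto)
    then show ?thesis unfolding c_def by simp
  qed
  \<comment> \<open>Attainment enters here, as a subgradient at the limit w.\<close>
  obtain q where q [measurable]: "q \<in> borel_measurable M" and qnn: "AE \<omega> in M. 0 \<le> q \<omega>"
    and qint: "integrable M (\<lambda>\<omega>. q \<omega> * u 0 \<omega>)"
    and sub: "\<And>v. v \<in> U \<Longrightarrow> \<Phi> w + (\<integral>\<omega>. q \<omega> * (v \<omega> - w \<omega>) \<partial>M) \<le> \<Phi> v"
    using subgradient[OF wU wu] by blast
  have qi: "integrable M (\<lambda>\<omega>. q \<omega> * v \<omega>)" if [measurable]: "v \<in> borel_measurable M" and b: "\<And>\<omega>. \<bar>v \<omega>\<bar> \<le> u 0 \<omega>" for v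
  proof (rule Bochner_Integration.integrable_bound[OF qint])
    show "AE \<omega> in M. norm (q \<omega> * v \<omega>) \<le> norm (q \<omega> * u 0 \<omega>)"
      using b nn by (intro AE_I2) (auto simp: abs_mult intro!: mult_left_mono order_trans[OF b])
  qed measurable
  have qu: "integrable M (\<lambda>\<omega>. q \<omega> * u n \<omega>)" for n by (rule qi) (use nn dec[of 0 n] in auto)
  have qw: "integrable M (\<lambda>\<omega>. q \<omega> * (w \<omega> - W n \<omega>))" for n
  proof (rule qi)
    show "\<bar>w \<omega> - W n \<omega>\<bar> \<le> u 0 \<omega>" for \<omega> using Ww[of n \<omega>] wu[of \<omega>] Wnn[of n \<omega>] by simp
  qed measurable
  define a where "a n = (\<integral>\<omega>. q \<omega> * (w \<omega> - W n \<omega>) \<partial>M)" for n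
  \<comment> \<open>The increment of \<open>W\<close> is half of 2^-n u_(k n), hence W n + 2^-n u_(k
    n) - w = (w - W n) - 2 (w - W (n+1)). The subgradient inequality at that point is combined with
    \<open>key\<close>.\<close>
  have a1: "a n \<le> 2 * a (Suc n) + e n" for n
  proof -
    have vU: "(\<lambda>\<omega>. W n \<omega> + (1/2)^n * u (k n) \<omega>) \<in> U"
    proof (rule UI)
      show "0 \<le> W n \<omega> + (1/2)^n * u (k n) \<omega>" for \<omega> using Wnn nn by simp
      show "W n \<omega> + (1/2)^n * u (k n) \<omega> \<le> 2 * u 0 \<omega>" for \<omega>
      proof -
        have "(1/2)^n * u (k n) \<omega> \<le> (1/2)^n * u 0 \<omega>" by (intro mult_left_mono dec) auto
        then show ?thesis using Wle'[of n \<omega>] nn[of 0 \<omega>] by linarith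
      qed
    qed measurable
    have "q \<omega> * (W n \<omega> + (1/2)^n * u (k n) \<omega> - w \<omega>) = q \<omega> * (w \<omega> - W n \<omega>) - 2 * (q \<omega> * (w \<omega> - W (Suc n) \<omega>))" for \<omega>
      unfolding WSuc by (simp add: algebra_simps)
    then have "(\<integral>\<omega>. q \<omega> * (W n \<omega> + (1/2)^n * u (k n) \<omega> - w \<omega>) \<partial>M) = a n - 2 * a (Suc n)"
      using qw[of n] qw[of "Suc n"] unfolding a_def by simp
    with sub[OF vU] key[of n] show ?thesis by simp
  qed
  have a2: "a 0 \<le> 2^n * a n + \<eta> / 2 * (1 - (1/2)^n)" for n
  proof (induction n)
    case (Suc n)
    have "2^n * a n \<le> 2^n * (2 * a (Suc n) + e n)" by (intro mult_left_mono a1) auto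
    also have "\<dots> = 2^Suc n * a (Suc n) + \<eta> / 4 * (1/2)^n"
    proof -
      have "(4::real)^n = 2^n * 2^n" by (simp flip: power_mult_distrib)
      then show ?thesis unfolding e_def by (simp add: field_simps power_divide)
    qed
    finally show ?case using Suc by (simp add: algebra_simps)
  qed simp
  \<comment> \<open>2^n (w - W n) lies below u_n, whose integrals against q tend to 0.\<close>
  have "a 0 \<le> (\<integral>\<omega>. q \<omega> * u n \<omega> \<partial>M) + \<eta> / 2" for n
  proof -
    have "2^n * a n = (\<integral>\<omega>. 2^n * (q \<omega> * (w \<omega> - W n \<omega>)) \<partial>M)" unfolding a_def by simp
    also have "\<dots> \<le> (\<integral>\<omega>. q \<omega> * u n \<omega> \<partial>M)"
    proof (rule integral_mono_AE)
      show "integrable M (\<lambda>\<omega>. 2^n * (q \<omega> * (w \<omega> - W n \<omega>)))" using qw by simp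
      show "AE \<omega> in M. 2^n * (q \<omega> * (w \<omega> - W n \<omega>)) \<le> q \<omega> * u n \<omega>"
        using qnn
      proof eventually_elim
        case (elim \<omega>)
        have "q \<omega> * (2^n * (w \<omega> - W n \<omega>)) \<le> q \<omega> * (2^n * ((1/2)^n * u n \<omega>))"
          using elim by (intro mult_left_mono wW) auto
        also have "2^n * ((1/2)^n * u n \<omega>) = u n \<omega>" by (simp add: power_divide)
        finally show ?case by (simp add: mult.left_commute)
      qed
    qed (rule qu)
    finally have "2^n * a n \<le> (\<integral>\<omega>. q \<omega> * u n \<omega> \<partial>M)" .
    moreover have "\<eta> / 2 * (1 - (1/2)^n) \<le> \<eta> / 2 * 1" using \<eta> by (intro mult_left_mono) auto
    ultimately show ?thesis using a2[of n] by simp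
  qed
  moreover have "(\<lambda>n. (\<integral>\<omega>. q \<omega> * u n \<omega> \<partial>M) + \<eta> / 2) \<longlonglongrightarrow> 0 + \<eta> / 2"
  proof (intro tendsto_intros)
    have "(\<lambda>n. \<integral>\<omega>. q \<omega> * u n \<omega> \<partial>M) \<longlonglongrightarrow> (\<integral>\<omega>. 0 \<partial>M)"
    proof (rule integral_dominated_convergence)
      show "integrable M (\<lambda>\<omega>. norm (q \<omega> * u 0 \<omega>))" using qint by (rule integrable_norm)
      show "AE \<omega> in M. (\<lambda>n. q \<omega> * u n \<omega>) \<longlonglongrightarrow> 0"
        by (intro AE_I2) (use tendsto_mult_right_zero[OF lim] in auto)
      show "AE \<omega> in M. norm (q \<omega> * u n \<omega>) \<le> norm (q \<omega> * u 0 \<omega>)" for n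
        using dec[of 0 n] nn by (intro AE_I2) (auto simp: abs_mult intro!: mult_left_mono)
    qed measurable
    then show "(\<lambda>n. \<integral>\<omega>. q \<omega> * u n \<omega> \<partial>M) \<longlonglongrightarrow> 0" by simp
  qed
  ultimately have "a 0 \<le> 0 + \<eta> / 2" by (intro LIMSEQ_le_const) auto
  \<comment> \<open>Testing the subgradient at 0 bounds \<Phi> w by \<Phi> 0 + \<eta>/2; stage 0 of
    \<open>key\<close> leads back from w to a member of the sequence.\<close>
  moreover have "(\<integral>\<omega>. q \<omega> * (0 - w \<omega>) \<partial>M) = - a 0" unfolding a_def by (simp add: W0)
  ultimately have "\<Phi> w \<le> \<Phi> (\<lambda>_. 0) + \<eta> / 2" using sub[OF zero] by simp
  moreover have "e 0 \<le> \<eta> / 2" using \<eta> unfolding e_def by simp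
  ultimately have "\<Phi> (u (k 0)) \<le> \<Phi> (\<lambda>_. 0) + \<eta>" using key[of 0] by (simp add: W0)
  then show ?thesis by blast
qed

context conditional_risk
begin

text \<open>Equality in the representation forces the conjugate at y to be finite; Young's
  inequality at z then becomes the subgradient inequality.\<close>

lemma attained_subgradient:
  assumes x: "x \<in> X" and y: "y \<in> D"
    and att: "AE \<omega> in M. ereal (\<rho> x \<omega>) = cond_exp_ext M F (\<lambda>\<omega>. x \<omega> * y \<omega>) \<omega> - \<alpha> y \<omega>"
    and z: "z \<in> X"
  shows "AE \<omega> in M. \<rho> x \<omega> + pr z y \<omega> - pr x y \<omega> \<le> \<rho> z \<omega>"
  using att cond_exp_ext_pr[OF x D_Y[OF y]] young[OF z D_Y[OF y]]
proof eventually_elim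
  case (elim \<omega>)
  have eq: "ereal (\<rho> x \<omega>) = ereal (pr x y \<omega>) - \<alpha> y \<omega>" using elim(1,2) by simp
  then obtain r where "\<alpha> y \<omega> = ereal r" by (cases "\<alpha> y \<omega>") auto
  with eq elim(3) show ?case by simp
qed

text \<open>Simons' argument concerns a real functional, so \<rho> (x - v) is integrated against an
  \<open>F\<close>-weight. Monotonicity in n afterwards turns the estimate of the integrals into
  convergence almost everywhere.\<close>

lemma attained_imp_continuous_from_below:
  assumes att: "attains_representation M F X \<rho>" and x: "x \<in> X"
    and u: "\<And>n. u n \<in> X" and dec: "\<And>m n \<omega>. m \<le> n \<Longrightarrow> u n \<omega> \<le> u m \<omega>" and nn: "\<And>n \<omega>. 0 \<le> u n \<omega>"
    and lim: "\<And>\<omega>. (\<lambda>n. u n \<omega>) \<longlonglongrightarrow> 0"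
  shows "AE \<omega> in M. (\<lambda>n. \<rho> (\<lambda>\<omega>. x \<omega> - u n \<omega>) \<omega>) \<longlonglongrightarrow> \<rho> x \<omega>"
proof -
  define \<phi> where "\<phi> v = \<rho> (\<lambda>\<omega>. x \<omega> - v \<omega>)" for v
  define U where "U = {v \<in> borel_measurable M. \<forall>\<omega>. 0 \<le> v \<omega> \<and> v \<omega> \<le> 2 * u 0 \<omega>}"
  have uM [measurable]: "u n \<in> borel_measurable M" for n by (rule X_measurable[OF u])
  have u2: "(\<lambda>\<omega>. 2 * u 0 \<omega>) \<in> X" by (rule X_cmult[OF u])
  have UX: "v \<in> X" if "v \<in> U" for v
  proof (rule X_solid[OF u2])
    show "v \<in> borel_measurable M" using that by (simp add: U_def)
    show "AE \<omega> in M. \<bar>v \<omega>\<bar> \<le> \<bar>2 * u 0 \<omega>\<bar>"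
    proof (rule AE_I2)
      fix \<omega>
      have "0 \<le> v \<omega>" "v \<omega> \<le> 2 * u 0 \<omega>" using that by (auto simp: U_def)
      then show "\<bar>v \<omega>\<bar> \<le> \<bar>2 * u 0 \<omega>\<bar>" by linarith
    qed
  qed
  have xv: "(\<lambda>\<omega>. x \<omega> - v \<omega>) \<in> X" if "v \<in> X" for v by (rule X_diff[OF x that])
  have \<phi>F: "\<phi> v \<in> borel_measurable F" if "v \<in> X" for v unfolding \<phi>_def by (rule \<rho>_F[OF xv[OF that]])
  have \<phi>mono: "AE \<omega> in M. \<phi> v \<omega> \<le> \<phi> v' \<omega>" if "v \<in> X" "v' \<in> X" "\<And>\<omega>. v \<omega> \<le> v' \<omega>" for v v'
    unfolding \<phi>_def by (rule \<rho>_mono[OF xv[OF that(2)] xv[OF that(1)]]) (use that(3) in auto)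
  have zero: "(\<lambda>_. 0) \<in> X" by (rule X_F) simp
  \<comment> \<open>Monotonicity places \<phi> v between its values at 0 and at 2 u_0 for every v in
    \<open>U\<close>, so that c \<phi> v lies in [-1, 1] and \<Phi> is finite.\<close>
  define b where "b \<omega> = 1 + \<bar>\<phi> (\<lambda>_. 0) \<omega>\<bar> + \<bar>\<phi> (\<lambda>\<omega>. 2 * u 0 \<omega>) \<omega>\<bar>" for \<omega>
  define c where "c \<omega> = 1 / b \<omega>" for \<omega>
  have b1: "1 \<le> b \<omega>" for \<omega> unfolding b_def by simp
  then have b0: "0 < b \<omega>" for \<omega> by (rule less_le_trans[OF zero_less_one])
  have c0: "0 < c \<omega>" for \<omega> unfolding c_def using b0 by simp
  have [measurable]: "\<phi> (\<lambda>_. 0) \<in> borel_measurable F" "\<phi> (\<lambda>\<omega>. 2 * u 0 \<omega>) \<in> borel_measurable F"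
    using \<phi>F zero u2 by auto
  have cF [measurable]: "c \<in> borel_measurable F" unfolding c_def b_def by measurable
  have cM [measurable]: "c \<in> borel_measurable M" by (rule L0_subalgebra[OF cF])
  have cle: "c \<omega> * r \<le> 1" if "r \<le> b \<omega>" for r \<omega> using that b0[of \<omega>] by (simp add: c_def)
  define \<Phi> where "\<Phi> v = (\<integral>\<omega>. c \<omega> * \<phi> v \<omega> \<partial>M)" for v
  have \<phi>M: "\<phi> v \<in> borel_measurable M" if "v \<in> X" for v by (rule L0_subalgebra[OF \<phi>F[OF that]])
  have int: "integrable M (\<lambda>\<omega>. c \<omega> * \<phi> v \<omega>)" if v: "v \<in> U" for v
  proof (rule integrable_const_bound[of _ 1])
    have "AE \<omega> in M. \<phi> (\<lambda>_. 0) \<omega> \<le> \<phi> v \<omega>" by (rule \<phi>mono[OF zero UX[OF v]]) (use v in \<open>auto simp: U_def\<close>)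
    moreover have "AE \<omega> in M. \<phi> v \<omega> \<le> \<phi> (\<lambda>\<omega>. 2 * u 0 \<omega>) \<omega>" by (rule \<phi>mono[OF UX[OF v] u2]) (use v in \<open>auto simp: U_def\<close>)
    ultimately show "AE \<omega> in M. norm (c \<omega> * \<phi> v \<omega>) \<le> 1"
    proof eventually_elim
      case (elim \<omega>)
      then have "\<bar>\<phi> v \<omega>\<bar> \<le> b \<omega>" unfolding b_def by linarith
      from cle[OF this] show ?case using c0[of \<omega>] by (simp add: abs_mult)
    qed
    show "(\<lambda>\<omega>. c \<omega> * \<phi> v \<omega>) \<in> borel_measurable M" using \<phi>M[OF UX[OF v]] by measurable
  qed
  have uU: "u n \<in> U" for n
    unfolding U_def using nn dec[of 0 n] by (auto intro: order_trans[OF dec[of 0 n]])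
  have zeroU: "(\<lambda>_. 0) \<in> U" unfolding U_def using nn by auto
  have simons: "\<exists>n. \<Phi> (u n) \<le> \<Phi> (\<lambda>_. 0) + \<eta>" if "0 < \<eta>" for \<eta>
  proof (rule simons_decreasing[OF uM dec nn lim _ _ _ that, folded U_def])
    show "\<Phi> v \<le> \<Phi> v'" if "v \<in> U" "v' \<in> U" "\<And>\<omega>. v \<omega> \<le> v' \<omega>" for v v'
      unfolding \<Phi>_def
    proof (rule integral_mono_AE[OF int[OF that(1)] int[OF that(2)]])
      from \<phi>mono[OF UX[OF that(1)] UX[OF that(2)] that(3)]
      show "AE \<omega> in M. c \<omega> * \<phi> v \<omega> \<le> c \<omega> * \<phi> v' \<omega>"
        by eventually_elim (use c0 in \<open>simp add: mult_left_mono less_imp_le\<close>)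
    qed
    show "\<Phi> (\<lambda>\<omega>. t * v \<omega> + (1 - t) * v' \<omega>) \<le> t * \<Phi> v + (1 - t) * \<Phi> v'"
      if v: "v \<in> U" "v' \<in> U" and t: "0 \<le> t" "t \<le> 1" for v v' t
    proof -
      have tF: "(\<lambda>_. t) \<in> borel_measurable F" by simp
      have "AE \<omega> in M. \<rho> (\<lambda>\<omega>. t * (x \<omega> - v \<omega>) + (1 - t) * (x \<omega> - v' \<omega>)) \<omega> \<le> t * \<phi> v \<omega> + (1 - t) * \<phi> v' \<omega>"
        unfolding \<phi>_def by (rule \<rho>_convex[OF tF xv[OF UX[OF v(1)]] xv[OF UX[OF v(2)]]]) (use t in auto)
      moreover have "(\<lambda>\<omega>. t * (x \<omega> - v \<omega>) + (1 - t) * (x \<omega> - v' \<omega>)) = (\<lambda>\<omega>. x \<omega> - (t * v \<omega> + (1 - t) * v' \<omega>))"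
        by (auto simp: algebra_simps)
      ultimately have le: "AE \<omega> in M. \<phi> (\<lambda>\<omega>. t * v \<omega> + (1 - t) * v' \<omega>) \<omega> \<le> t * \<phi> v \<omega> + (1 - t) * \<phi> v' \<omega>"
        unfolding \<phi>_def by simp
      have tv: "(\<lambda>\<omega>. t * v \<omega> + (1 - t) * v' \<omega>) \<in> U"
      proof -
        have "t * v \<omega> + (1 - t) * v' \<omega> \<le> t * (2 * u 0 \<omega>) + (1 - t) * (2 * u 0 \<omega>)" for \<omega>
          using v t unfolding U_def by (intro add_mono mult_left_mono) auto
        then have "t * v \<omega> + (1 - t) * v' \<omega> \<le> 2 * u 0 \<omega>" for \<omega> by (simp add: algebra_simps)
        then show ?thesis using v t unfolding U_def by auto
      qed
      have "\<Phi> (\<lambda>\<omega>. t * v \<omega> + (1 - t) * v' \<omega>) \<le> (\<integral>\<omega>. t * (c \<omega> * \<phi> v \<omega>) + (1 - t) * (c \<omega> * \<phi> v' \<omega>) \<partial>M)"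
        unfolding \<Phi>_def
      proof (rule integral_mono_AE[OF int[OF tv]])
        show "integrable M (\<lambda>\<omega>. t * (c \<omega> * \<phi> v \<omega>) + (1 - t) * (c \<omega> * \<phi> v' \<omega>))" using int v by simp
        from le show "AE \<omega> in M. c \<omega> * \<phi> (\<lambda>\<omega>. t * v \<omega> + (1 - t) * v' \<omega>) \<omega>
            \<le> t * (c \<omega> * \<phi> v \<omega>) + (1 - t) * (c \<omega> * \<phi> v' \<omega>)"
        proof eventually_elim
          case (elim \<omega>)
          have "c \<omega> * \<phi> (\<lambda>\<omega>. t * v \<omega> + (1 - t) * v' \<omega>) \<omega> \<le> c \<omega> * (t * \<phi> v \<omega> + (1 - t) * \<phi> v' \<omega>)"
            using elim c0[of \<omega>] by (intro mult_left_mono) auto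
          then show ?case by (simp add: algebra_simps)
        qed
      qed
      also have "\<dots> = t * \<Phi> v + (1 - t) * \<Phi> v'" unfolding \<Phi>_def using int v by simp
      finally show ?thesis .
    qed
    show "\<exists>q\<in>borel_measurable M. (AE \<omega> in M. 0 \<le> q \<omega>) \<and> integrable M (\<lambda>\<omega>. q \<omega> * u 0 \<omega>) \<and>
        (\<forall>v\<in>U. \<Phi> w + (\<integral>\<omega>. q \<omega> * (v \<omega> - w \<omega>) \<partial>M) \<le> \<Phi> v)"
      if w: "w \<in> U" and wu: "\<And>\<omega>. w \<omega> \<le> u 0 \<omega>" for w
    proof -
      have wX: "w \<in> X" by (rule UX[OF w])
      obtain y where y: "y \<in> D" and
        "AE \<omega> in M. ereal (\<rho> (\<lambda>\<omega>. x \<omega> - w \<omega>) \<omega>) = cond_exp_ext M F (\<lambda>\<omega>. (x \<omega> - w \<omega>) * y \<omega>) \<omega> - \<alpha> y \<omega>"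
        using att xv[OF wX] unfolding attains_representation_def by blast
      note att_y = attained_subgradient[OF xv[OF wX] this]
      have yY: "y \<in> Y" by (rule D_Y[OF y])
      have yneg: "AE \<omega> in M. y \<omega> \<le> 0" using y by (simp add: D_iff)
      have [measurable]: "y \<in> borel_measurable M" by (rule Y_measurable[OF yY])
      have sub: "AE \<omega> in M. \<phi> w \<omega> + ce (\<lambda>\<omega>. (v \<omega> - w \<omega>) * - y \<omega>) \<omega> \<le> \<phi> v \<omega>" if v: "v \<in> X" for v
      proof -
        have d: "AE \<omega> in M. pr (\<lambda>\<omega>. (x \<omega> - w \<omega>) - (x \<omega> - v \<omega>)) y \<omega> = pr (\<lambda>\<omega>. x \<omega> - w \<omega>) y \<omega> - pr (\<lambda>\<omega>. x \<omega> - v \<omega>) y \<omega>"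
          by (rule XY.pr_diff[OF xv[OF wX] xv[OF v] yY])
        have e: "(\<lambda>\<omega>. (x \<omega> - w \<omega> - (x \<omega> - v \<omega>)) * y \<omega>) = (\<lambda>\<omega>. - ((v \<omega> - w \<omega>) * - y \<omega>))"
          by (auto simp: algebra_simps)
        have "AE \<omega> in M. ce (\<lambda>\<omega>. - ((v \<omega> - w \<omega>) * - y \<omega>)) \<omega> = - ce (\<lambda>\<omega>. (v \<omega> - w \<omega>) * - y \<omega>) \<omega>"
          using L1_cond_uminus[OF XY_L1[OF X_diff[OF v wX] yY]] by (intro ce_uminus) simp
        with d[unfolded e] show ?thesis
          using att_y[OF xv[OF v]] unfolding \<phi>_def by eventually_elim linarith
      qed
      \<comment> \<open>Nonnegative because y is nonpositive; integrating the conditional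
        subgradient inequality against c makes it a subgradient of \<Phi>.\<close>
      define q where "q \<omega> = c \<omega> * - y \<omega>" for \<omega>
      have qM: "q \<in> borel_measurable M" unfolding q_def by measurable
      have qpos: "AE \<omega> in M. 0 \<le> q \<omega>"
        using yneg by eventually_elim (use c0 in \<open>simp add: q_def mult_nonneg_nonpos less_imp_le\<close>)
      have L1: "(\<lambda>\<omega>. v \<omega> * - y \<omega>) \<in> L1_cond M F" if "v \<in> X" for v
        using L1_cond_uminus[OF XY_L1[OF that yY]] by simp
      \<comment> \<open>The point w + u_0 stays below 2 u_0. The subgradient inequality there bounds
        E[-u_0 y | F] by \<open>b\<close>, which makes q u_0 integrable.\<close>
      have wuX: "(\<lambda>\<omega>. w \<omega> + u 0 \<omega>) \<in> X" by (rule X_add[OF wX u])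
      have "AE \<omega> in M. \<phi> (\<lambda>_. 0) \<omega> \<le> \<phi> w \<omega>"
        by (rule \<phi>mono[OF zero wX]) (use w in \<open>simp add: U_def\<close>)
      moreover have "AE \<omega> in M. \<phi> (\<lambda>\<omega>. w \<omega> + u 0 \<omega>) \<omega> \<le> \<phi> (\<lambda>\<omega>. 2 * u 0 \<omega>) \<omega>"
        by (rule \<phi>mono[OF wuX u2]) (use wu in simp)
      moreover have "AE \<omega> in M. \<phi> w \<omega> + ce (\<lambda>\<omega>. (w \<omega> + u 0 \<omega> - w \<omega>) * - y \<omega>) \<omega> \<le> \<phi> (\<lambda>\<omega>. w \<omega> + u 0 \<omega>) \<omega>"
        by (rule sub[OF wuX])
      ultimately have "AE \<omega> in M. c \<omega> * ce (\<lambda>\<omega>. u 0 \<omega> * - y \<omega>) \<omega> \<le> 1"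
      proof eventually_elim
        case (elim \<omega>)
        then have "ce (\<lambda>\<omega>. u 0 \<omega> * - y \<omega>) \<omega> \<le> b \<omega>" unfolding b_def by simp
        then show ?case by (rule cle)
      qed
      moreover have "AE \<omega> in M. 0 \<le> u 0 \<omega> * - y \<omega>"
        using yneg by eventually_elim (use nn in \<open>simp add: mult_nonneg_nonpos\<close>)
      ultimately have "integrable M (\<lambda>\<omega>. c \<omega> * (u 0 \<omega> * - y \<omega>))"
        using integrable_weight_ce[OF L1[OF u] _ cF] c0 less_imp_le by blast
      then have qint: "integrable M (\<lambda>\<omega>. q \<omega> * u 0 \<omega>)" by (simp add: q_def mult_ac)
      have "\<Phi> w + (\<integral>\<omega>. q \<omega> * (v \<omega> - w \<omega>) \<partial>M) \<le> \<Phi> v" if v: "v \<in> U" for v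
      proof -
        have vX: "v \<in> X" by (rule UX[OF v])
        have [measurable]: "v \<in> borel_measurable M" "w \<in> borel_measurable M" using v w unfolding U_def by auto
        have eq: "(\<lambda>\<omega>. c \<omega> * ((v \<omega> - w \<omega>) * - y \<omega>)) = (\<lambda>\<omega>. q \<omega> * (v \<omega> - w \<omega>))" by (auto simp: q_def)
        have "integrable M (\<lambda>\<omega>. q \<omega> * (v \<omega> - w \<omega>))"
        proof (rule Bochner_Integration.integrable_bound)
          show "integrable M (\<lambda>\<omega>. 2 * (q \<omega> * u 0 \<omega>))" using qint by simp
          show "AE \<omega> in M. norm (q \<omega> * (v \<omega> - w \<omega>)) \<le> norm (2 * (q \<omega> * u 0 \<omega>))"
          proof (rule AE_I2)
            fix \<omega>
            have "\<bar>v \<omega> - w \<omega>\<bar> \<le> 2 * u 0 \<omega>" using v w unfolding U_def by (auto simp: abs_le_iff) (smt (verit))+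
            then have "\<bar>q \<omega>\<bar> * \<bar>v \<omega> - w \<omega>\<bar> \<le> \<bar>q \<omega>\<bar> * (2 * u 0 \<omega>)" by (intro mult_left_mono) auto
            then show "norm (q \<omega> * (v \<omega> - w \<omega>)) \<le> norm (2 * (q \<omega> * u 0 \<omega>))"
              using nn[of 0 \<omega>] by (simp add: abs_mult)
          qed
        qed (use qM in measurable)
        then have i: "integrable M (\<lambda>\<omega>. c \<omega> * ((v \<omega> - w \<omega>) * - y \<omega>))" unfolding eq .
        have m: "(\<lambda>\<omega>. (v \<omega> - w \<omega>) * - y \<omega>) \<in> borel_measurable M" by measurable
        note ii = real_cond_exp_intg[OF i cF m]
        have "\<Phi> w + (\<integral>\<omega>. q \<omega> * (v \<omega> - w \<omega>) \<partial>M) = (\<integral>\<omega>. c \<omega> * \<phi> w \<omega> + c \<omega> * ce (\<lambda>\<omega>. (v \<omega> - w \<omega>) * - y \<omega>) \<omega> \<partial>M)"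
          unfolding \<Phi>_def eq[symmetric] ii(2)[symmetric]
          by (rule Bochner_Integration.integral_add[symmetric, OF int[OF w] ii(1)])
        also have "\<dots> \<le> \<Phi> v" unfolding \<Phi>_def
        proof (rule integral_mono_AE[OF Bochner_Integration.integrable_add[OF int[OF w] ii(1)] int[OF v]])
          from sub[OF vX] show "AE \<omega> in M. c \<omega> * \<phi> w \<omega> + c \<omega> * ce (\<lambda>\<omega>. (v \<omega> - w \<omega>) * - y \<omega>) \<omega> \<le> c \<omega> * \<phi> v \<omega>"
            by eventually_elim (use c0 in \<open>simp add: distrib_left[symmetric]\<close>)
        qed
        finally show ?thesis .
      qed
      with qM qpos qint show ?thesis by blast
    qed
  qed
  define g where "g n \<omega> = c \<omega> * \<phi> (u n) \<omega> - c \<omega> * \<phi> (\<lambda>_. 0) \<omega>" for n \<omega>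
  have gint: "integrable M (g n)" for n unfolding g_def using int uU zeroU by auto
  have gI: "(\<integral>\<omega>. g n \<omega> \<partial>M) = \<Phi> (u n) - \<Phi> (\<lambda>_. 0)" for n
    unfolding g_def \<Phi>_def using int uU zeroU by simp
  have g0: "AE \<omega> in M. 0 \<le> g n \<omega>" for n
    using \<phi>mono[OF zero u nn] by (rule eventually_mono) (use c0 in \<open>auto simp: g_def less_imp_le\<close>)
  have gdec: "AE \<omega> in M. g (Suc n) \<omega> \<le> g n \<omega>" for n
  proof -
    have "AE \<omega> in M. \<phi> (u (Suc n)) \<omega> \<le> \<phi> (u n) \<omega>" by (rule \<phi>mono[OF u u]) (simp add: dec)
    then show ?thesis by eventually_elim (use c0 in \<open>simp add: g_def less_imp_le mult_left_mono\<close>)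
  qed
  have "AE \<omega> in M. (\<lambda>n. g n \<omega>) \<longlonglongrightarrow> 0"
  proof (rule decreasing_AE_tendsto_0[of g, OF gint g0 gdec])
    have dec': "(\<integral>\<omega>. g m \<omega> \<partial>M) \<le> (\<integral>\<omega>. g n \<omega> \<partial>M)" if "n \<le> m" for m n
      using that by (rule lift_Suc_antimono_le[rotated]) (rule integral_mono_AE[OF gint gint gdec])
    have pos: "0 \<le> (\<integral>\<omega>. g n \<omega> \<partial>M)" for n by (rule integral_nonneg_AE[OF g0])
    show "(\<lambda>n. \<integral>\<omega>. g n \<omega> \<partial>M) \<longlonglongrightarrow> 0"
    proof (rule LIMSEQ_I)
      fix r :: real assume "0 < r"
      then obtain n where "\<Phi> (u n) \<le> \<Phi> (\<lambda>_. 0) + r / 2" using simons[of "r/2"] by auto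
      then have "(\<integral>\<omega>. g n \<omega> \<partial>M) < r" using \<open>0 < r\<close> unfolding gI by simp
      then show "\<exists>no. \<forall>n\<ge>no. norm ((\<integral>\<omega>. g n \<omega> \<partial>M) - 0) < r"
        using dec' pos by (intro exI[of _ n]) (auto intro: le_less_trans)
    qed
  qed
  then show ?thesis
  proof eventually_elim
    case (elim \<omega>)
    then have "(\<lambda>n. b \<omega> * g n \<omega> + \<phi> (\<lambda>_. 0) \<omega>) \<longlonglongrightarrow> b \<omega> * 0 + \<phi> (\<lambda>_. 0) \<omega>" by (intro tendsto_intros)
    moreover have "b \<omega> * g n \<omega> + \<phi> (\<lambda>_. 0) \<omega> = \<phi> (u n) \<omega>" for n
      using b0[of \<omega>] by (simp add: g_def c_def field_simps)
    ultimately show ?case unfolding \<phi>_def by simp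
  qed
qed

lemma attained_imp_lebesgue:
  assumes att: "attains_representation M F X \<rho>"
  shows "lebesgue_property M X \<rho>"
  unfolding lebesgue_property_def
proof (intro allI impI, elim conjE)
  fix xs x y
  assume xs': "\<forall>n. xs n \<in> X" and x: "x \<in> X" and y: "y \<in> X" and lim: "AE \<omega> in M. (\<lambda>n. xs n \<omega>) \<longlonglongrightarrow> x \<omega>"
    and bd: "\<forall>n. AE \<omega> in M. \<bar>xs n \<omega>\<bar> \<le> y \<omega>"
  have xs: "xs n \<in> X" for n using xs' by blast
  have [measurable]: "xs n \<in> borel_measurable M" "x \<in> borel_measurable M" "y \<in> borel_measurable M" for n
    using X_measurable xs x y by auto
  have "AE \<omega> in M. \<forall>n. \<bar>xs n \<omega>\<bar> \<le> y \<omega>" using bd unfolding AE_all_countable .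
  with lim have "AE \<omega> in M. (\<lambda>n. xs n \<omega>) \<longlonglongrightarrow> x \<omega> \<and> (\<forall>n. \<bar>xs n \<omega>\<bar> \<le> y \<omega>)" by eventually_elim simp
  from AE_E3[OF this] obtain N where N: 
    "\<And>\<omega>. \<omega> \<in> space M - N \<Longrightarrow> (\<lambda>n. xs n \<omega>) \<longlonglongrightarrow> x \<omega> \<and> (\<forall>n. \<bar>xs n \<omega>\<bar> \<le> y \<omega>)"
    "N \<in> null_sets M" by blast
  \<comment> \<open>Continuity from below is stated with bounds and limits at every point. On this
    set of full measure they hold; off it the errors are set to 0.\<close>
  define G where "G = space M - N"
  have [measurable]: "G \<in> sets M" unfolding G_def using N(2) by auto
  have AEG: "AE \<omega> in M. \<omega> \<in> G"
    using AE_not_in[OF N(2)] AE_space by eventually_elim (simp add: G_def)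
  have Glim: "(\<lambda>n. xs n \<omega>) \<longlonglongrightarrow> x \<omega>" and Gbd: "\<bar>xs n \<omega>\<bar> \<le> y \<omega>" if "\<omega> \<in> G" for \<omega> n
    using N(1)[of \<omega>] that unfolding G_def by auto
  have Gx: "\<bar>x \<omega>\<bar> \<le> y \<omega>" if "\<omega> \<in> G" for \<omega>
    by (rule LIMSEQ_le_const2[OF tendsto_rabs[OF Glim[OF that]]]) (use Gbd[OF that] in auto)
  define f where "f m \<omega> = indicator G \<omega> * \<bar>xs m \<omega> - x \<omega>\<bar>" for m \<omega>
  have f0: "0 \<le> f m \<omega>" for m \<omega> unfolding f_def by simp
  have fy: "f m \<omega> \<le> \<bar>2 * y \<omega>\<bar>" for m \<omega>
    using Gbd[of \<omega> m] Gx[of \<omega>] unfolding f_def by (cases "\<omega> \<in> G") auto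
  have [measurable]: "f m \<in> borel_measurable M" for m unfolding f_def by measurable
  have flim: "(\<lambda>m. f m \<omega>) \<longlonglongrightarrow> 0" for \<omega>
  proof (cases "\<omega> \<in> G")
    case True
    have "(\<lambda>m. \<bar>xs m \<omega> - x \<omega>\<bar>) \<longlonglongrightarrow> \<bar>x \<omega> - x \<omega>\<bar>" by (intro tendsto_intros Glim[OF True])
    then show ?thesis using True by (simp add: f_def)
  qed (simp add: f_def)
  \<comment> \<open>Suprema over tails turn the errors into a decreasing dominated sequence.\<close>
  define u where "u n \<omega> = (SUP m. f (n + m) \<omega>)" for n \<omega>
  have bdd: "bdd_above (range (\<lambda>m. f (n + m) \<omega>))" for n \<omega> using fy by (intro bdd_aboveI2)
  have fu: "f m \<omega> \<le> u n \<omega>" if "n \<le> m" for m n \<omega>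
    unfolding u_def using cSUP_upper[OF UNIV_I bdd, of n "m - n" \<omega>] that by simp
  have uM [measurable]: "u n \<in> borel_measurable M" for n
    unfolding u_def by (rule borel_measurable_cSUP) (use bdd in auto)
  have u0: "0 \<le> u n \<omega>" for n \<omega> using fu[of n n \<omega>] f0[of n \<omega>] by simp
  have uy: "u n \<omega> \<le> \<bar>2 * y \<omega>\<bar>" for n \<omega> unfolding u_def by (rule cSUP_least) (use fy in auto)
  have udec: "u n \<omega> \<le> u m \<omega>" if "m \<le> n" for m n \<omega>
    unfolding u_def[of n] by (rule cSUP_least) (use fu[of m] that in auto)
  have ulim: "(\<lambda>n. u n \<omega>) \<longlonglongrightarrow> 0" for \<omega>
  proof (rule LIMSEQ_I)
    fix r :: real assume r: "0 < r"
    then obtain no where no: "\<And>m. m \<ge> no \<Longrightarrow> f m \<omega> < r / 2"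
      using LIMSEQ_D[OF flim, of "r/2" \<omega>] f0 by auto
    have "u n \<omega> \<le> r / 2" if "n \<ge> no" for n
      unfolding u_def by (rule cSUP_least) (use no that in \<open>auto intro: less_imp_le\<close>)
    then have "norm (u n \<omega> - 0) < r" if "n \<ge> no" for n
      using that r u0[of n \<omega>] by fastforce
    then show "\<exists>no. \<forall>n\<ge>no. norm (u n \<omega> - 0) < r" by blast
  qed
  have uX: "u n \<in> X" for n
    by (rule X_solid[OF X_cmult[OF y, of 2]]) (use u0 uy in auto)
  have lower: "AE \<omega> in M. 2 * \<rho> x \<omega> - \<rho> (\<lambda>\<omega>. x \<omega> - u n \<omega>) \<omega> \<le> \<rho> (xs n) \<omega>" for n
  proof -
    have xp: "(\<lambda>\<omega>. x \<omega> + u n \<omega>) \<in> X" and xm: "(\<lambda>\<omega>. x \<omega> - u n \<omega>) \<in> X" using X_add X_diff x uX by auto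
    have hF: "(\<lambda>_. 1/2 :: real) \<in> borel_measurable F" by simp
    have "AE \<omega> in M. \<rho> (\<lambda>\<omega>. 1/2 * (x \<omega> + u n \<omega>) + (1 - 1/2) * (x \<omega> - u n \<omega>)) \<omega> \<le>
        1/2 * \<rho> (\<lambda>\<omega>. x \<omega> + u n \<omega>) \<omega> + (1 - 1/2) * \<rho> (\<lambda>\<omega>. x \<omega> - u n \<omega>) \<omega>"
      by (rule \<rho>_convex[OF hF xp xm]) simp
    moreover have "(\<lambda>\<omega>. 1/2 * (x \<omega> + u n \<omega>) + (1 - 1/2) * (x \<omega> - u n \<omega>)) = x" by (auto simp: field_simps)
    moreover have "AE \<omega> in M. \<rho> (\<lambda>\<omega>. x \<omega> + u n \<omega>) \<omega> \<le> \<rho> (xs n) \<omega>"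
    proof (rule \<rho>_mono[OF xs xp])
      from AEG show "AE \<omega> in M. xs n \<omega> \<le> x \<omega> + u n \<omega>"
      proof eventually_elim
      case (elim \<omega>)
      have "f n \<omega> \<le> u n \<omega>" by (rule fu) simp
      then show ?case using elim by (simp add: f_def)
    qed
    qed
    ultimately show ?thesis by auto
  qed
  have upper: "AE \<omega> in M. \<rho> (xs n) \<omega> \<le> \<rho> (\<lambda>\<omega>. x \<omega> - u n \<omega>) \<omega>" for n
  proof (rule \<rho>_mono[OF X_diff[OF x uX] xs])
    from AEG show "AE \<omega> in M. x \<omega> - u n \<omega> \<le> xs n \<omega>"
    proof eventually_elim
      case (elim \<omega>)
      have "f n \<omega> \<le> u n \<omega>" by (rule fu) simp
      then show ?case using elim by (simp add: f_def)
    qed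
  qed
  have "AE \<omega> in M. \<forall>n. 2 * \<rho> x \<omega> - \<rho> (\<lambda>\<omega>. x \<omega> - u n \<omega>) \<omega> \<le> \<rho> (xs n) \<omega>"
    "AE \<omega> in M. \<forall>n. \<rho> (xs n) \<omega> \<le> \<rho> (\<lambda>\<omega>. x \<omega> - u n \<omega>) \<omega>"
    unfolding AE_all_countable using lower upper by blast+
  moreover have "AE \<omega> in M. (\<lambda>n. \<rho> (\<lambda>\<omega>. x \<omega> - u n \<omega>) \<omega>) \<longlonglongrightarrow> \<rho> x \<omega>"
    by (rule attained_imp_continuous_from_below[OF att x uX _ u0 ulim]) (rule udec)
  ultimately show "AE \<omega> in M. (\<lambda>n. \<rho> (xs n) \<omega>) \<longlonglongrightarrow> \<rho> x \<omega>"
  proof eventually_elim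
    case (elim \<omega>)
    have "(\<lambda>n. 2 * \<rho> x \<omega> - \<rho> (\<lambda>\<omega>. x \<omega> - u n \<omega>) \<omega>) \<longlonglongrightarrow> 2 * \<rho> x \<omega> - \<rho> x \<omega>"
      by (intro tendsto_intros elim(3))
    then have "(\<lambda>n. 2 * \<rho> x \<omega> - \<rho> (\<lambda>\<omega>. x \<omega> - u n \<omega>) \<omega>) \<longlonglongrightarrow> \<rho> x \<omega>" by simp
    from tendsto_sandwich[OF always_eventually[OF elim(1)] always_eventually[OF elim(2)] this elim(3)]
    show ?case .
  qed
qed

end

subsection \<open>Compactness implies attained representation\<close>

context conditional_risk
begin

lemma Y_stable: "stable_set M F Y"
proof (rule stable_setI)
  show "Y \<noteq> {}" using Y_F[of "\<lambda>_. 0"] by auto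
  show "Y \<subseteq> borel_measurable M" using Y_measurable by blast
qed (rule Y_local)

text \<open>The arbitrary relation \<open>R\<close> covers the sublevel sets of the conjugate and
  the sets of near-maximizers alike.\<close>

lemma local_on_fenchel:
  assumes x: "x \<in> X"
  shows "local_on Y (\<lambda>y \<omega>. R \<omega> (\<alpha> y \<omega>) (pr x y \<omega>))"
  unfolding local_on_def
proof (intro ballI impI)
  fix y z A assume yz: "y \<in> Y" "z \<in> Y" and A: "A \<in> sets F" and eq: "AE \<omega> in M. \<omega> \<in> A \<longrightarrow> y \<omega> = z \<omega>"
  have "AE \<omega> in M. \<omega> \<in> A \<longrightarrow> pr x y \<omega> = pr x z \<omega>" by (rule pr_local[OF x x yz A _ eq]) simp
  with \<alpha>_local[OF yz A eq]
  show "AE \<omega> in M. \<omega> \<in> A \<longrightarrow> R \<omega> (\<alpha> y \<omega>) (pr x y \<omega>) \<longrightarrow> R \<omega> (\<alpha> z \<omega>) (pr x z \<omega>)"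
    by eventually_elim simp
qed

lemma sublevel_stable:
  assumes "sublevel M Y \<alpha> \<eta> \<noteq> {}"
  shows "stable_set M F (sublevel M Y \<alpha> \<eta>)"
proof -
  have zero: "(\<lambda>_. 0) \<in> X" by (rule X_F) simp
  show ?thesis
    using assms stable_set_Collect[OF Y_stable local_on_fenchel[OF zero, of "\<lambda>\<omega> r _. r \<le> ereal (\<eta> \<omega>)"]]
    unfolding sublevel_def by blast
qed

text \<open>\<open>D\<close> is stable and the representing family is local, so a maximizing
  sequence can be glued to one density that is nearly maximal at almost every outcome.\<close>

lemma representable_approx:
  assumes rep: "representable M F X \<rho>" and x: "x \<in> X" and \<epsilon> [measurable]: "\<epsilon> \<in> borel_measurable F" and pos: "AE \<omega> in M. 0 < \<epsilon> \<omega>"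
  shows "\<exists>y\<in>D. AE \<omega> in M. \<alpha> y \<omega> \<le> ereal (pr x y \<omega> - \<rho> x \<omega> + \<epsilon> \<omega>)"
proof -
  have [measurable]: "\<rho> x \<in> borel_measurable F" by (rule \<rho>_F[OF x])
  have Dne: "D \<noteq> {}" using D_stable unfolding stable_set_def by blast
  have "AE \<omega> in M. ereal (\<rho> x \<omega>) \<le> ess_sup M F (rep_family x ` D) \<omega>"
    using rep x unfolding representable_iff by blast
  with pos have less: "AE \<omega> in M. ereal (\<rho> x \<omega> - \<epsilon> \<omega>) < ess_sup M F (rep_family x ` D) \<omega>"
  proof eventually_elim
    case (elim \<omega>)
    then have "ereal (\<rho> x \<omega> - \<epsilon> \<omega>) < ereal (\<rho> x \<omega>)" by simp
    then show ?case using elim(2) by (rule less_le_trans)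
  qed
  obtain y where y: "y \<in> D" and gt: "AE \<omega> in M. ereal (\<rho> x \<omega> - \<epsilon> \<omega>) < rep_family x y \<omega>"
  proof (rule less_ess_sup_glue[OF Dne _ _ _ less])
    show "rep_family x y \<in> borel_measurable F" if "y \<in> D" for y using rep_family_F that by blast
    fix a and j :: "nat \<Rightarrow> 'a \<Rightarrow> real"
    assume a: "event_partition M F a" and j: "\<And>k. j k \<in> D"
    define z where "z = glue a j"
    have zM: "z \<in> borel_measurable M" unfolding z_def
      by (rule glue_measurable_M[OF a]) (use D_Y[OF j] Y_measurable in blast)
    have zj: "AE \<omega> in M. \<omega> \<in> a k \<longrightarrow> z \<omega> = j k \<omega>" for k unfolding z_def by (rule glue_eq[OF a])
    have zD: "z \<in> D" by (rule stable_setD[OF D_stable a j zM zj])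
    have "AE \<omega> in M. \<omega> \<in> a k \<longrightarrow> rep_family x (j k) \<omega> \<le> rep_family x z \<omega>" for k
    proof -
      have "AE \<omega> in M. \<omega> \<in> a k \<longrightarrow> pr x z \<omega> = pr x (j k) \<omega>"
        by (rule pr_local[OF x x D_Y[OF zD] D_Y[OF j] partition_sets[OF a] _ zj]) simp
      with rep_family_eq[OF x D_Y[OF zD]] rep_family_eq[OF x D_Y[OF j[of k]]]
        \<alpha>_local[OF D_Y[OF zD] D_Y[OF j] partition_sets[OF a] zj, of k]
      show ?thesis 
      proof eventually_elim
        case (elim \<omega>)
        show ?case
        proof
          assume \<omega>: "\<omega> \<in> a k"
          have "rep_family x z \<omega> = rep_family x (j k) \<omega>" unfolding elim(1,2) using elim(3,4) \<omega> by simp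
          then show "rep_family x (j k) \<omega> \<le> rep_family x z \<omega>" by simp
        qed
      qed
    qed
    with zD show "\<exists>i\<in>D. \<forall>k. AE \<omega> in M. \<omega> \<in> a k \<longrightarrow> rep_family x (j k) \<omega> \<le> rep_family x i \<omega>" by blast
  qed measurable
  from gt rep_family_eq[OF x D_Y[OF y]] \<alpha>_not_MInf[OF D_Y[OF y]]
  have "AE \<omega> in M. \<alpha> y \<omega> \<le> ereal (pr x y \<omega> - \<rho> x \<omega> + \<epsilon> \<omega>)"
  proof eventually_elim
    case (elim \<omega>)
    then show ?case by (cases "\<alpha> y \<omega>") auto
  qed
  with y show ?thesis by blast
qed

lemma stably_inf_compact_imp_attained:
  assumes rep: "representable M F X \<rho>"
    and comp: "stably_inf_compact M F Y (stable_weak_topology M F Y X) \<alpha>"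
  shows "attains_representation M F X \<rho>"
  unfolding attains_representation_def
proof
  fix x assume x: "x \<in> X"
  have x2: "(\<lambda>\<omega>. 2 * x \<omega>) \<in> X" by (rule X_cmult[OF x])
  \<comment> \<open>Near-maximality with tolerance at most 1 gives \<alpha> y \<le> E[x y | F] -
    \<rho> x + 1, and testing at 2 x gives 2 E[x y | F] - \<rho> (2 x) \<le> \<alpha> y. Eliminating
    the pairing leaves this level; the constant is twice the largest tolerance.\<close>
  define \<eta> where "\<eta> \<omega> = \<rho> (\<lambda>\<omega>. 2 * x \<omega>) \<omega> - 2 * \<rho> x \<omega> + 2" for \<omega>
  have \<eta>F: "\<eta> \<in> borel_measurable F" unfolding \<eta>_def using \<rho>_F[OF x] \<rho>_F[OF x2] by measurable
  define S where "S = sublevel M Y \<alpha> \<eta>"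
  define E :: "('a \<Rightarrow> real) set" where "E = {\<epsilon> \<in> borel_measurable F. AE \<omega> in M. 0 < \<epsilon> \<omega> \<and> \<epsilon> \<omega> \<le> 1}"
  define P where "P \<epsilon> y \<omega> \<longleftrightarrow> \<alpha> y \<omega> \<le> ereal (pr x y \<omega> - \<rho> x \<omega> + \<epsilon> \<omega>)" for \<epsilon> y \<omega>
  define B where "B \<epsilon> = {y \<in> D. AE \<omega> in M. P \<epsilon> y \<omega>}" for \<epsilon>
  define \<B> where "\<B> = B ` E"
  have P: "local_on D (P \<epsilon>)" for \<epsilon>
    using local_on_subset[OF local_on_fenchel[OF x, of "\<lambda>\<omega> r s. r \<le> ereal (s - \<rho> x \<omega> + \<epsilon> \<omega>)"], of D] D_Y
    unfolding P_def by blast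
  have Bne: "B \<epsilon> \<noteq> {}" if "\<epsilon> \<in> E" for \<epsilon>
  proof -
    have "\<epsilon> \<in> borel_measurable F" "AE \<omega> in M. 0 < \<epsilon> \<omega>" using that unfolding E_def by (auto elim: eventually_mono)
    from representable_approx[OF rep x this] show ?thesis unfolding B_def P_def by blast
  qed
  have BS: "B \<epsilon> \<subseteq> S" if \<epsilon>: "\<epsilon> \<in> E" for \<epsilon>
  proof
    fix y assume y: "y \<in> B \<epsilon>"
    then have yD: "y \<in> D" and yP: "AE \<omega> in M. P \<epsilon> y \<omega>" unfolding B_def by auto
    have e1: "AE \<omega> in M. \<epsilon> \<omega> \<le> 1" using \<epsilon> unfolding E_def by (auto elim: eventually_mono)
    from yP e1 young[OF x2 D_Y[OF yD]] pr_cmult[OF x D_Y[OF yD], of 2] have "AE \<omega> in M. \<alpha> y \<omega> \<le> ereal (\<eta> \<omega>)"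
    proof eventually_elim
      case (elim \<omega>)
      obtain r where r: "\<alpha> y \<omega> = ereal r" using elim(1,3) unfolding P_def by (cases "\<alpha> y \<omega>") auto
      then show ?case using elim unfolding P_def \<eta>_def by simp
    qed
    then show "y \<in> S" unfolding S_def sublevel_def using D_Y[OF yD] by blast
  qed
  have Bstable: "stable_set M F (B \<epsilon>)" if "\<epsilon> \<in> E" for \<epsilon>
    using stable_set_Collect[OF D_stable P] Bne[OF that] unfolding B_def by blast
  have one: "(\<lambda>_. 1) \<in> E" unfolding E_def by simp
  have "stable_filter_base_on M F S \<B>"
    unfolding stable_filter_base_on_def
  proof (intro conjI ballI)
    show "filter_base_on S \<B>"
      unfolding filter_base_on_def
    proof (intro conjI ballI)
      show "\<B> \<noteq> {}" unfolding \<B>_def using one by blast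
      show "C \<noteq> {}" "C \<subseteq> S" if "C \<in> \<B>" for C using that Bne BS unfolding \<B>_def by blast+
      fix C C' assume "C \<in> \<B>" "C' \<in> \<B>"
      then obtain \<epsilon> \<epsilon>' where e: "\<epsilon> \<in> E" "\<epsilon>' \<in> E" "C = B \<epsilon>" "C' = B \<epsilon>'" unfolding \<B>_def by blast
      define \<delta> where "\<delta> \<omega> = min (\<epsilon> \<omega>) (\<epsilon>' \<omega>)" for \<omega>
      have [measurable]: "\<epsilon> \<in> borel_measurable F" "\<epsilon>' \<in> borel_measurable F" using e unfolding E_def by auto
      have "\<delta> \<in> borel_measurable F" unfolding \<delta>_def by measurable
      moreover have "AE \<omega> in M. 0 < \<epsilon> \<omega> \<and> \<epsilon> \<omega> \<le> 1" "AE \<omega> in M. 0 < \<epsilon>' \<omega> \<and> \<epsilon>' \<omega> \<le> 1" using e unfolding E_def by auto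
      then have "AE \<omega> in M. 0 < \<delta> \<omega> \<and> \<delta> \<omega> \<le> 1" unfolding \<delta>_def by eventually_elim auto
      ultimately have \<delta>: "\<delta> \<in> E" unfolding E_def by blast
      have mono: "P \<delta> y \<omega> \<Longrightarrow> P \<epsilon> y \<omega> \<and> P \<epsilon>' y \<omega>" for y \<omega>
        unfolding P_def \<delta>_def by (cases "\<alpha> y \<omega>") auto
      have "B \<delta> \<subseteq> C \<inter> C'"
      proof
        fix y assume "y \<in> B \<delta>"
        then have yD: "y \<in> D" and yP: "AE \<omega> in M. P \<delta> y \<omega>" unfolding B_def by auto
        from yP have "AE \<omega> in M. P \<epsilon> y \<omega>" by eventually_elim (use mono in blast)
        moreover from yP have "AE \<omega> in M. P \<epsilon>' y \<omega>" by eventually_elim (use mono in blast)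
        ultimately show "y \<in> C \<inter> C'" using yD unfolding e B_def by blast
      qed
      with \<delta> show "\<exists>D\<in>\<B>. D \<subseteq> C \<inter> C'" unfolding \<B>_def by blast
    qed
    show "stable_set M F C" if "C \<in> \<B>" for C using that Bstable unfolding \<B>_def by blast
    show "stable_collection M F \<B>"
      unfolding stable_collection_def
    proof (intro conjI ballI allI impI)
      show "C \<noteq> {}" "C \<subseteq> L0 M" if "C \<in> \<B>" for C
        using that Bstable unfolding \<B>_def stable_set_def by blast+
      fix a and C :: "nat \<Rightarrow> ('a \<Rightarrow> real) set"
      assume "event_partition M F a \<and> (\<forall>k. C k \<in> \<B>)"
      then have a: "event_partition M F a" and C: "\<And>k. \<exists>\<epsilon>. \<epsilon> \<in> E \<and> C k = B \<epsilon>" unfolding \<B>_def by blast+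
      from choice[OF allI[OF C]] obtain e where "\<forall>k. e k \<in> E \<and> C k = B (e k)" ..
      then have e: "e k \<in> E" and C: "C k = B (e k)" for k by auto
      have eF: "e k \<in> borel_measurable F" and ep: "AE \<omega> in M. 0 < e k \<omega> \<and> e k \<omega> \<le> 1" for k
        using e[of k] unfolding E_def by auto
      \<comment> \<open>Gluing the tolerances turns a concatenation of sets of the base into a set
        of the base.\<close>
      define \<delta> where "\<delta> = glue a e"
      have de: "AE \<omega> in M. \<omega> \<in> a k \<longrightarrow> \<delta> \<omega> = e k \<omega>" for k unfolding \<delta>_def by (rule glue_eq[OF a])
      have "AE \<omega> in M. 0 < \<delta> \<omega> \<and> \<delta> \<omega> \<le> 1"
      proof (rule partition_AE[OF a])
        show "AE \<omega> in M. \<omega> \<in> a k \<longrightarrow> 0 < \<delta> \<omega> \<and> \<delta> \<omega> \<le> 1" for k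
          using de[of k] ep[of k] by eventually_elim auto
      qed
      moreover have "\<delta> \<in> borel_measurable F" unfolding \<delta>_def by (rule glue_measurable_F[OF a eF])
      ultimately have \<delta>: "\<delta> \<in> E" unfolding E_def by blast
      have "concat_sets M a C = B \<delta>"
        unfolding C B_def
      proof (rule concat_sets_Collect[OF D_stable a P P])
        show "AE \<omega> in M. \<omega> \<in> a k \<longrightarrow> P (e k) y \<omega> = P \<delta> y \<omega>" for k y
          using de[of k] by eventually_elim (simp add: P_def)
        show "{y \<in> D. AE \<omega> in M. P (e k) y \<omega>} \<noteq> {}" for k using Bne[OF e, of k] unfolding B_def .
      qed
      with \<delta> show "concat_sets M a C \<in> \<B>" unfolding \<B>_def by blast
    qed
  qed
  moreover have "S \<noteq> {}" using Bne[OF one] BS[OF one] by blast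
  then have "stably_compact M F (stable_weak_topology M F Y X) S"
    using comp \<eta>F unfolding stably_inf_compact_def S_def by blast
  ultimately obtain y where yS: "y \<in> S" and cl: "cluster_point (stable_weak_topology M F Y X) \<B> y"
    unfolding stably_compact_def by blast
  have yY: "y \<in> Y" and y\<eta>: "AE \<omega> in M. \<alpha> y \<omega> \<le> ereal (\<eta> \<omega>)" using yS unfolding S_def sublevel_def by auto
  have yD: "y \<in> D" by (rule \<alpha>_finite_imp_D[OF yY y\<eta>])
  \<comment> \<open>One error comes from near-maximality of \<open>y'\<close>, and one each from
    exchanging \<open>y'\<close> for \<open>y\<close> in the pairings with x and with z.\<close>
  have "AE \<omega> in M. pr z y \<omega> - \<rho> z \<omega> \<le> pr x y \<omega> - \<rho> x \<omega> + 3 * (1 / real (Suc n))" if z: "z \<in> X" for z n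
  proof -
    define \<epsilon> where "\<epsilon> = (\<lambda>_::'a. 1 / real (Suc n))"
    have eE: "\<epsilon> \<in> E" unfolding E_def \<epsilon>_def by simp
    have W: "YX.weak_data (\<lambda>_. {x, z}) trivial_partition \<epsilon>"
      by (rule YX.weak_data_single) (use x z in \<open>auto simp: \<epsilon>_def\<close>)
    have "y \<in> stable_weak_topology M F Y X closure_of (B \<epsilon>)"
      using cl eE unfolding cluster_point_def \<B>_def by blast
    from YX.closure_of_imp_close[OF this yY W] obtain y' where y': "y' \<in> B \<epsilon>"
      and yy: "YX.close (\<lambda>_. {x, z}) trivial_partition \<epsilon> y y'"
      by blast
    have y'D: "y' \<in> D" and y'P: "AE \<omega> in M. P \<epsilon> y' \<omega>" using y' unfolding B_def by auto
    have "AE \<omega> in M. \<bar>YX.pr y' x \<omega> - YX.pr y x \<omega>\<bar> < \<epsilon> \<omega>" "AE \<omega> in M. \<bar>YX.pr y' z \<omega> - YX.pr y z \<omega>\<bar> < \<epsilon> \<omega>"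
      by (rule YX.close_singleD[OF yy _ yY D_Y[OF y'D]]; use x z in simp)+
    then have "AE \<omega> in M. \<bar>pr x y' \<omega> - pr x y \<omega>\<bar> < 1 / real (Suc n)" "AE \<omega> in M. \<bar>pr z y' \<omega> - pr z y \<omega>\<bar> < 1 / real (Suc n)"
      unfolding \<epsilon>_def by (simp_all add: mult.commute)
    with y'P young[OF z D_Y[OF y'D]] show ?thesis
    proof eventually_elim
      case (elim \<omega>)
      have "ereal (pr z y' \<omega> - \<rho> z \<omega>) \<le> ereal (pr x y' \<omega> - \<rho> x \<omega> + 1 / real (Suc n))"
        using elim(1,2) unfolding P_def \<epsilon>_def by (rule order_trans[rotated])
      then have "pr z y' \<omega> - \<rho> z \<omega> \<le> pr x y' \<omega> - \<rho> x \<omega> + 1 / real (Suc n)" by (simp only: ereal_less_eq)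
      with elim(3,4) show ?case by linarith
    qed
  qed
  then have all: "AE \<omega> in M. \<forall>n. pr z y \<omega> - \<rho> z \<omega> \<le> pr x y \<omega> - \<rho> x \<omega> + 3 * (1 / real (Suc n))" if "z \<in> X" for z
    using that unfolding AE_all_countable by blast
  have "AE \<omega> in M. \<alpha> y \<omega> \<le> ereal (pr x y \<omega> - \<rho> x \<omega>)"
  proof (rule \<alpha>_least[OF yY])
    show "(\<lambda>\<omega>. ereal (pr x y \<omega> - \<rho> x \<omega>)) \<in> borel_measurable F" using \<rho>_F[OF x] by measurable
    fix z assume "z \<in> X"
    from all[OF this] show "AE \<omega> in M. ereal (pr z y \<omega> - \<rho> z \<omega>) \<le> ereal (pr x y \<omega> - \<rho> x \<omega>)"
    proof eventually_elim
      case (elim \<omega>)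
      have "(\<lambda>n. pr x y \<omega> - \<rho> x \<omega> + 3 * (1 / real (Suc n))) \<longlonglongrightarrow> pr x y \<omega> - \<rho> x \<omega> + 3 * 0"
        by (intro tendsto_intros LIMSEQ_Suc[OF lim_1_over_n])
      from LIMSEQ_le_const[OF this] elim have "pr z y \<omega> - \<rho> z \<omega> \<le> pr x y \<omega> - \<rho> x \<omega> + 3 * 0" by blast
      then show ?case by simp
    qed
  qed
  with young[OF x yY] cond_exp_ext_pr[OF x yY]
  have "AE \<omega> in M. ereal (\<rho> x \<omega>) = cond_exp_ext M F (\<lambda>\<omega>. x \<omega> * y \<omega>) \<omega> - \<alpha> y \<omega>"
  proof eventually_elim
    case (elim \<omega>)
    then have "\<alpha> y \<omega> = ereal (pr x y \<omega> - \<rho> x \<omega>)" by (intro antisym)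
    with elim(2) show ?case by simp
  qed
  with yD show "\<exists>y\<in>D. AE \<omega> in M. ereal (\<rho> x \<omega>) = cond_exp_ext M F (\<lambda>\<omega>. x \<omega> * y \<omega>) \<omega> - \<alpha> y \<omega>" by blast
qed

end

subsection \<open>Maximal stable filters\<close>

context finite_measure_subalgebra
begin

text \<open>Upward closure ranges over stable subsets of \<open>S\<close> only, because every member
  has to be stable.\<close>

definition stable_filter :: "('a \<Rightarrow> real) set \<Rightarrow> ('a \<Rightarrow> real) set set \<Rightarrow> bool" where
  "stable_filter S \<B> \<longleftrightarrow> stable_filter_base_on M F S \<B> \<and>
     (\<forall>B\<in>\<B>. \<forall>C. stable_set M F C \<and> B \<subseteq> C \<and> C \<subseteq> S \<longrightarrow> C \<in> \<B>)"

lemma stable_filterD: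
  assumes "stable_filter S \<B>"
  shows "B \<in> \<B> \<Longrightarrow> stable_set M F B" and "B \<in> \<B> \<Longrightarrow> B \<subseteq> S" and "\<B> \<noteq> {}"
    and "B \<in> \<B> \<Longrightarrow> C \<in> \<B> \<Longrightarrow> \<exists>D\<in>\<B>. D \<subseteq> B \<inter> C"
    and "event_partition M F a \<Longrightarrow> (\<And>k. G k \<in> \<B>) \<Longrightarrow> concat_sets M a G \<in> \<B>"
    and "B \<in> \<B> \<Longrightarrow> stable_set M F C \<Longrightarrow> B \<subseteq> C \<Longrightarrow> C \<subseteq> S \<Longrightarrow> C \<in> \<B>"
proof -
  note d = assms[unfolded stable_filter_def stable_filter_base_on_def]
  have base: "filter_base_on S \<B>" and coll: "stable_collection M F \<B>" and st: "\<forall>B\<in>\<B>. stable_set M F B"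
    and up: "\<forall>B\<in>\<B>. \<forall>C. stable_set M F C \<and> B \<subseteq> C \<and> C \<subseteq> S \<longrightarrow> C \<in> \<B>"
    using conjunct1[OF conjunct1[OF d]] conjunct1[OF conjunct2[OF conjunct1[OF d]]]
      conjunct2[OF conjunct2[OF conjunct1[OF d]]] conjunct2[OF d] by - assumption+
  show "B \<in> \<B> \<Longrightarrow> stable_set M F B" using st by blast
  show "B \<in> \<B> \<Longrightarrow> B \<subseteq> S" "\<B> \<noteq> {}" "B \<in> \<B> \<Longrightarrow> C \<in> \<B> \<Longrightarrow> \<exists>D\<in>\<B>. D \<subseteq> B \<inter> C"
    using base unfolding filter_base_on_def by simp_all
  show "event_partition M F a \<Longrightarrow> (\<And>k. G k \<in> \<B>) \<Longrightarrow> concat_sets M a G \<in> \<B>"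
    using coll unfolding stable_collection_def by simp
  show "B \<in> \<B> \<Longrightarrow> stable_set M F C \<Longrightarrow> B \<subseteq> C \<Longrightarrow> C \<subseteq> S \<Longrightarrow> C \<in> \<B>" using up by simp
qed

text \<open>For a directed family of stable sets this is the stable filter it generates:
  concatenations of members are formed before supersets are taken.\<close>

definition stable_hull :: "('a \<Rightarrow> real) set \<Rightarrow> ('a \<Rightarrow> real) set set \<Rightarrow> ('a \<Rightarrow> real) set set" where
  "stable_hull S \<G> = {C. stable_set M F C \<and> C \<subseteq> S \<and>
     (\<exists>a G. event_partition M F a \<and> (\<forall>k. G k \<in> \<G>) \<and> concat_sets M a G \<subseteq> C)}"

lemma stable_hullI:
  assumes "G \<in> \<G>" "stable_set M F G" "stable_set M F C" "G \<subseteq> C" "C \<subseteq> S"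
  shows "C \<in> stable_hull S \<G>"
proof -
  have a: "event_partition M F trivial_partition" by (rule partition_trivial)
  have "concat_sets M trivial_partition (\<lambda>_. G) \<subseteq> G"
    by (rule concat_sets_subset[OF a assms(2)]) simp
  then have "concat_sets M trivial_partition (\<lambda>_. G) \<subseteq> C"
    using assms(4) by (rule order_trans)
  with a assms(1) have "\<exists>a G. event_partition M F a \<and> (\<forall>k. G k \<in> \<G>) \<and> concat_sets M a G \<subseteq> C"
    by (intro exI conjI allI)
  with assms(3,5) show ?thesis unfolding stable_hull_def by (intro CollectI conjI)
qed

lemma stable_hull_filter:
  assumes S: "stable_set M F S" and ne: "\<G> \<noteq> {}" and G: "\<And>B. B \<in> \<G> \<Longrightarrow> stable_set M F B"
    and GS: "\<And>B. B \<in> \<G> \<Longrightarrow> B \<subseteq> S"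
    and dir: "\<And>B C. B \<in> \<G> \<Longrightarrow> C \<in> \<G> \<Longrightarrow> \<exists>D\<in>\<G>. D \<subseteq> B \<inter> C"
  shows "stable_filter S (stable_hull S \<G>)"
  unfolding stable_filter_def stable_filter_base_on_def
proof (intro conjI ballI allI impI)
  show "filter_base_on S (stable_hull S \<G>)"
    unfolding filter_base_on_def
  proof (intro conjI ballI)
    obtain B where "B \<in> \<G>" using ne by blast
    then have "B \<in> stable_hull S \<G>" using stable_hullI G GS by blast
    then show "stable_hull S \<G> \<noteq> {}" by blast
    show "C \<noteq> {}" "C \<subseteq> S" if "C \<in> stable_hull S \<G>" for C
      using that stable_set_nonempty unfolding stable_hull_def by blast+
    fix C C' assume C: "C \<in> stable_hull S \<G>" "C' \<in> stable_hull S \<G>"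
    then obtain a g where a: "event_partition M F a" "\<forall>k. g k \<in> \<G>" "concat_sets M a g \<subseteq> C"
      unfolding stable_hull_def by blast
    from C obtain b h where b: "event_partition M F b" "\<forall>k. h k \<in> \<G>" "concat_sets M b h \<subseteq> C'"
      unfolding stable_hull_def by blast
    \<comment> \<open>Concatenations along different partitions are compared on the common
      refinement, where directedness supplies a set below each pair.\<close>
    have "\<exists>D. D \<in> \<G> \<and> D \<subseteq> g i \<inter> h j" for i j using dir a(2) b(2) by blast
    then obtain D where D: "\<And>i j. D i j \<in> \<G>" "\<And>i j. D i j \<subseteq> g i \<inter> h j" by metis
    define c where "c n = a (fst (prod_decode n)) \<inter> b (snd (prod_decode n))" for n
    define E where "E n = D (fst (prod_decode n)) (snd (prod_decode n))" for n
    have c: "event_partition M F c" using partition_refine[OF a(1), of "\<lambda>_. b"] b(1) unfolding c_def by simp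
    have sub: "concat_sets M c E \<subseteq> C \<inter> C'"
    proof
      fix z assume "z \<in> concat_sets M c E"
      from concat_setsE[OF c this] obtain x where x: "z \<in> borel_measurable M" "\<And>k. x k \<in> E k"
        "\<And>k. AE \<omega> in M. \<omega> \<in> c k \<longrightarrow> z \<omega> = x k \<omega>" by metis
      define r where "r i j = x (prod_encode (i, j))" for i j
      have r: "r i j \<in> D i j" for i j using x(2)[of "prod_encode (i, j)"] unfolding r_def E_def by simp
      have rM: "r i j \<in> borel_measurable M" for i j by (rule stable_setM[OF G[OF D(1)] r])
      have eq: "AE \<omega> in M. \<omega> \<in> a i \<and> \<omega> \<in> b j \<longrightarrow> z \<omega> = r i j \<omega>" for i j
        using x(3)[of "prod_encode (i, j)"] unfolding r_def c_def by simp
      have eq': "AE \<omega> in M. \<omega> \<in> b j \<and> \<omega> \<in> a i \<longrightarrow> z \<omega> = r i j \<omega>" for i j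
        using eq[of i j] by eventually_elim simp
      have rg: "r i j \<in> g i" and rh: "r i j \<in> h j" for i j using r D(2) by blast+
      have "z \<in> concat_sets M a (\<lambda>i. concat_sets M b (\<lambda>_. g i))"
        by (rule concat_sets_refine[OF a(1) b(1) rg rM x(1) eq])
      moreover have "concat_sets M b (\<lambda>_. g i) \<subseteq> g i" for i
        by (rule concat_sets_subset[OF b(1) G]) (use a(2) in auto)
      ultimately have zg: "z \<in> concat_sets M a g" using concat_sets_mono[THEN subsetD] by meson
      have "z \<in> concat_sets M b (\<lambda>j. concat_sets M a (\<lambda>_. h j))"
        by (rule concat_sets_refine[OF b(1) a(1), of "\<lambda>j i. r i j", OF rh rM x(1) eq'])
      moreover have "concat_sets M a (\<lambda>_. h j) \<subseteq> h j" for j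
        by (rule concat_sets_subset[OF a(1) G]) (use b(2) in auto)
      ultimately have "z \<in> concat_sets M b h" using concat_sets_mono[THEN subsetD] by meson
      with zg a(3) b(3) show "z \<in> C \<inter> C'" by blast
    qed
    have ED: "E n \<in> \<G>" for n unfolding E_def by (rule D(1))
    have "stable_set M F (concat_sets M c E)" by (rule concat_sets_stable[OF c G[OF ED]])
    moreover have "concat_sets M c E \<subseteq> S" by (rule concat_sets_subset[OF c S GS[OF ED]])
    ultimately have "concat_sets M c E \<in> stable_hull S \<G>" using c ED unfolding stable_hull_def by blast
    with sub show "\<exists>D\<in>stable_hull S \<G>. D \<subseteq> C \<inter> C'" by blast
  qed
  show "stable_set M F B" if "B \<in> stable_hull S \<G>" for B using that unfolding stable_hull_def by blast
  show "C \<in> stable_hull S \<G>" if "B \<in> stable_hull S \<G>" "stable_set M F C \<and> B \<subseteq> C \<and> C \<subseteq> S" for B C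
    using that unfolding stable_hull_def by blast
  show "stable_collection M F (stable_hull S \<G>)"
    unfolding stable_collection_def
  proof (intro conjI ballI allI impI)
    show "C \<noteq> {}" "C \<subseteq> L0 M" if "C \<in> stable_hull S \<G>" for C
      using that unfolding stable_hull_def stable_set_def by blast+
    fix a and C :: "nat \<Rightarrow> ('a \<Rightarrow> real) set"
    assume "event_partition M F a \<and> (\<forall>k. C k \<in> stable_hull S \<G>)"
    then have a: "event_partition M F a" and C: "C k \<in> stable_hull S \<G>" for k by blast+
    have Cs: "stable_set M F (C k)" "C k \<subseteq> S" for k using C[of k] unfolding stable_hull_def by blast+
    \<comment> \<open>Partition and family are packed into a pair, so that both are chosen together
      for each k.\<close>
    have "\<exists>bg. event_partition M F (fst bg) \<and> (\<forall>j. snd bg j \<in> \<G>) \<and> concat_sets M (fst bg) (snd bg) \<subseteq> C k" for k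
      using C[of k] unfolding stable_hull_def by auto
    from choice[OF allI[OF this]] obtain bg where bg: "\<forall>k. event_partition M F (fst (bg k)) \<and>
      (\<forall>j. snd (bg k) j \<in> \<G>) \<and> concat_sets M (fst (bg k)) (snd (bg k)) \<subseteq> C k" ..
    define b g where "b k = fst (bg k)" and "g k = snd (bg k)" for k
    have b: "event_partition M F (b k)" and g: "g k j \<in> \<G>" and bC: "concat_sets M (b k) (g k) \<subseteq> C k" for k j
      using bg unfolding b_def g_def by blast+
    define c where "c n = a (fst (prod_decode n)) \<inter> b (fst (prod_decode n)) (snd (prod_decode n))" for n
    define E where "E n = g (fst (prod_decode n)) (snd (prod_decode n))" for n
    have c: "event_partition M F c" using partition_refine[OF a b] unfolding c_def .
    have "concat_sets M c E \<subseteq> concat_sets M a C"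
    proof
      fix z assume "z \<in> concat_sets M c E"
      from concat_setsE[OF c this] obtain x where x: "z \<in> borel_measurable M" "\<And>k. x k \<in> E k"
        "\<And>k. AE \<omega> in M. \<omega> \<in> c k \<longrightarrow> z \<omega> = x k \<omega>" by metis
      define r where "r i j = x (prod_encode (i, j))" for i j
      have r: "r i j \<in> g i j" for i j using x(2)[of "prod_encode (i, j)"] unfolding r_def E_def by simp
      have rM: "r i j \<in> borel_measurable M" for i j by (rule stable_setM[OF G[OF g] r])
      have eq: "AE \<omega> in M. \<omega> \<in> a i \<and> \<omega> \<in> b i j \<longrightarrow> z \<omega> = r i j \<omega>" for i j
        using x(3)[of "prod_encode (i, j)"] unfolding r_def c_def by simp
      have "z \<in> concat_sets M a (\<lambda>i. concat_sets M (b i) (g i))"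
        by (rule concat_sets_refine[OF a b r rM x(1) eq])
      then show "z \<in> concat_sets M a C" by (rule concat_sets_mono[OF bC, THEN subsetD])
    qed
    moreover have "E n \<in> \<G>" for n unfolding E_def by (rule g)
    moreover have "stable_set M F (concat_sets M a C)" by (rule concat_sets_stable[OF a Cs(1)])
    moreover have "concat_sets M a C \<subseteq> S" by (rule concat_sets_subset[OF a S Cs(2)])
    ultimately show "concat_sets M a C \<in> stable_hull S \<G>" using c unfolding stable_hull_def by blast
  qed
qed

definition maximal_stable_filter :: "('a \<Rightarrow> real) set \<Rightarrow> ('a \<Rightarrow> real) set set \<Rightarrow> bool" where
  "maximal_stable_filter S \<B> \<longleftrightarrow> stable_filter S \<B> \<and> (\<forall>\<B>'. stable_filter S \<B>' \<and> \<B> \<subseteq> \<B>' \<longrightarrow> \<B>' = \<B>)"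

text \<open>Zorn's lemma. The union of a chain is directed but need not be closed under countable
  concatenation, which may draw on infinitely many filters of the chain; its stable hull is the
  upper bound.\<close>

lemma ex_maximal_stable_filter:
  assumes S: "stable_set M F S" and base: "stable_filter_base_on M F S \<B>\<^sub>0"
  shows "\<exists>\<B>. maximal_stable_filter S \<B> \<and> \<B>\<^sub>0 \<subseteq> \<B>"
proof -
  have B0: "\<B>\<^sub>0 \<noteq> {}" "\<And>B. B \<in> \<B>\<^sub>0 \<Longrightarrow> stable_set M F B" "\<And>B. B \<in> \<B>\<^sub>0 \<Longrightarrow> B \<subseteq> S"
    "\<And>B C. B \<in> \<B>\<^sub>0 \<Longrightarrow> C \<in> \<B>\<^sub>0 \<Longrightarrow> \<exists>D\<in>\<B>\<^sub>0. D \<subseteq> B \<inter> C"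
    using base unfolding stable_filter_base_on_def filter_base_on_def by blast+
  define \<A> where "\<A> = {\<B>. stable_filter S \<B> \<and> \<B>\<^sub>0 \<subseteq> \<B>}"
  have "\<exists>\<B>\<in>\<A>. \<forall>\<B>'\<in>\<A>. \<B> \<subseteq> \<B>' \<longrightarrow> \<B>' = \<B>"
  proof (rule subset_Zorn)
    fix \<C> assume chain: "subset.chain \<A> \<C>"
    show "\<exists>\<U>\<in>\<A>. \<forall>\<B>\<in>\<C>. \<B> \<subseteq> \<U>"
    proof (cases "\<C> = {}")
      \<comment> \<open>The empty chain is bounded by the hull of the given base.\<close>
      case True
      have "stable_filter S (stable_hull S \<B>\<^sub>0)" by (rule stable_hull_filter[OF S B0])
      moreover have "\<B>\<^sub>0 \<subseteq> stable_hull S \<B>\<^sub>0"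
      proof
        fix B assume B: "B \<in> \<B>\<^sub>0"
        show "B \<in> stable_hull S \<B>\<^sub>0" by (rule stable_hullI[OF B B0(2)[OF B] B0(2)[OF B] subset_refl B0(3)[OF B]])
      qed
      ultimately have "stable_hull S \<B>\<^sub>0 \<in> \<A>" unfolding \<A>_def by simp
      then show ?thesis using True by blast
    next
      case False
      have f: "stable_filter S \<B>" if "\<B> \<in> \<C>" for \<B>
      proof -
        have "\<B> \<in> \<A>" using chain that unfolding subset.chain_def by (elim conjE) (rule subsetD)
        then show ?thesis unfolding \<A>_def by simp
      qed
      have comp: "\<B> \<subseteq> \<B>' \<or> \<B>' \<subseteq> \<B>" if "\<B> \<in> \<C>" "\<B>' \<in> \<C>" for \<B> \<B>'
        using chain that unfolding subset.chain_def by blast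
      have U: "stable_set M F B" "B \<subseteq> S" if "B \<in> \<Union>\<C>" for B
        using that stable_filterD(1,2)[OF f] by blast+
      have "stable_filter S (stable_hull S (\<Union>\<C>))"
      proof (rule stable_hull_filter[OF S _ U])
        show "\<Union>\<C> \<noteq> {}" using False stable_filterD(3)[OF f] by blast
        fix B C assume "B \<in> \<Union>\<C>" "C \<in> \<Union>\<C>"
        then obtain \<B>1 \<B>2 where "\<B>1 \<in> \<C>" "B \<in> \<B>1" "\<B>2 \<in> \<C>" "C \<in> \<B>2" by blast
        then obtain \<B> where \<B>: "\<B> \<in> \<C>" "B \<in> \<B>" "C \<in> \<B>" using comp[of \<B>1 \<B>2] by blast
        from stable_filterD(4)[OF f[OF \<B>(1)] \<B>(2,3)] \<B>(1) show "\<exists>D\<in>\<Union>\<C>. D \<subseteq> B \<inter> C" by blast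
      qed
      moreover have sub: "\<Union>\<C> \<subseteq> stable_hull S (\<Union>\<C>)"
      proof
        fix B assume B: "B \<in> \<Union>\<C>"
        show "B \<in> stable_hull S (\<Union>\<C>)" by (rule stable_hullI[OF B U(1)[OF B] U(1)[OF B] subset_refl U(2)[OF B]])
      qed
      moreover have "\<B>\<^sub>0 \<subseteq> \<Union>\<C>"
      proof -
        obtain \<B> where \<B>: "\<B> \<in> \<C>" using False by blast
        then have "\<B> \<in> \<A>" using chain unfolding subset.chain_def by (elim conjE) (rule subsetD)
        then have "\<B>\<^sub>0 \<subseteq> \<B>" unfolding \<A>_def by simp
        then show ?thesis using \<B> by blast
      qed
      ultimately have "stable_filter S (stable_hull S (\<Union>\<C>)) \<and> \<B>\<^sub>0 \<subseteq> stable_hull S (\<Union>\<C>)" by blast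
      then have "stable_hull S (\<Union>\<C>) \<in> \<A>" unfolding \<A>_def by (rule CollectI)
      moreover have "\<forall>\<B>\<in>\<C>. \<B> \<subseteq> stable_hull S (\<Union>\<C>)" using sub by blast
      ultimately show ?thesis by blast
    qed
  qed
  then obtain \<B> where B: "\<B> \<in> \<A>" and m: "\<forall>\<B>'\<in>\<A>. \<B> \<subseteq> \<B>' \<longrightarrow> \<B>' = \<B>" by (rule bexE)
  have Bf: "stable_filter S \<B>" "\<B>\<^sub>0 \<subseteq> \<B>" using B unfolding \<A>_def by simp_all
  have "\<B>' = \<B>" if "stable_filter S \<B>'" "\<B> \<subseteq> \<B>'" for \<B>'
  proof -
    have "\<B>' \<in> \<A>" unfolding \<A>_def using that(1) order_trans[OF Bf(2) that(2)] by simp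
    then show ?thesis using m that(2) by simp
  qed
  with Bf(1) have "maximal_stable_filter S \<B>" unfolding maximal_stable_filter_def by simp
  with Bf(2) show ?thesis by (intro exI[of _ \<B>] conjI)
qed

text \<open>The working form of maximality: the hull of a directed family finer than the filter is a
  filter above it and hence equal to it.\<close>

lemma maximal_stable_filter_refine:
  assumes S: "stable_set M F S" and max: "maximal_stable_filter S \<B>"
    and G: "\<And>B. B \<in> \<G> \<Longrightarrow> stable_set M F B" "\<And>B. B \<in> \<G> \<Longrightarrow> B \<subseteq> S"
      "\<And>B C. B \<in> \<G> \<Longrightarrow> C \<in> \<G> \<Longrightarrow> \<exists>D\<in>\<G>. D \<subseteq> B \<inter> C"
    and finer: "\<And>B. B \<in> \<B> \<Longrightarrow> \<exists>C\<in>\<G>. C \<subseteq> B"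
  shows "\<G> \<subseteq> \<B>"
proof -
  have f: "stable_filter S \<B>" using max unfolding maximal_stable_filter_def by blast
  have ne: "\<G> \<noteq> {}" using stable_filterD(3)[OF f] finer by blast
  have "stable_filter S (stable_hull S \<G>)" by (rule stable_hull_filter[OF S ne G])
  moreover have "\<B> \<subseteq> stable_hull S \<G>"
  proof
    fix B assume B: "B \<in> \<B>"
    obtain C where C: "C \<in> \<G>" "C \<subseteq> B" using finer[OF B] by blast
    show "B \<in> stable_hull S \<G>"
      by (rule stable_hullI[OF C(1) G(1)[OF C(1)] stable_filterD(1)[OF f B] C(2) stable_filterD(2)[OF f B]])
  qed
  ultimately have "stable_hull S \<G> = \<B>" using max unfolding maximal_stable_filter_def by blast
  moreover have "\<G> \<subseteq> stable_hull S \<G>"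
  proof
    fix B assume B: "B \<in> \<G>"
    show "B \<in> stable_hull S \<G>" by (rule stable_hullI[OF B G(1)[OF B] G(1)[OF B] subset_refl G(2)[OF B]])
  qed
  ultimately show ?thesis by blast
qed

text \<open>Takes the place of convergence along an ultrafilter. \<open>L\<close> is the essential
  infimum, over the filter, of the essential suprema of h. On some set of the filter h stays below L
  + \<epsilon>, and every set of the filter has an element with h above L - \<epsilon>. Hence the
  sets of elements within \<epsilon> of \<open>L\<close> are nonempty, refine the filter and belong
  to it.\<close>

lemma maximal_stable_filter_limit:
  fixes h :: "('a \<Rightarrow> real) \<Rightarrow> 'a \<Rightarrow> real"
  assumes S: "stable_set M F S" and max: "maximal_stable_filter S \<B>"
    and hF: "\<And>y. y \<in> S \<Longrightarrow> h y \<in> borel_measurable F"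
    and loc: "\<And>y z A. y \<in> S \<Longrightarrow> z \<in> S \<Longrightarrow> A \<in> sets F \<Longrightarrow> AE \<omega> in M. \<omega> \<in> A \<longrightarrow> y \<omega> = z \<omega> \<Longrightarrow>
        AE \<omega> in M. \<omega> \<in> A \<longrightarrow> h y \<omega> = h z \<omega>"
    and g [measurable]: "g \<in> borel_measurable F" and bd: "\<And>y. y \<in> S \<Longrightarrow> AE \<omega> in M. \<bar>h y \<omega>\<bar> \<le> g \<omega>"
  shows "\<exists>L\<in>borel_measurable F. \<forall>\<epsilon>\<in>borel_measurable F. (AE \<omega> in M. 0 < \<epsilon> \<omega>) \<longrightarrow>
      (\<exists>B\<in>\<B>. \<forall>y\<in>B. AE \<omega> in M. \<bar>h y \<omega> - L \<omega>\<bar> < \<epsilon> \<omega>)"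
proof -
  have f: "stable_filter S \<B>" using max unfolding maximal_stable_filter_def by blast
  note filt = stable_filterD[OF f]
  define H where "H B = (\<lambda>y \<omega>. ereal (h y \<omega>)) ` B" for B
  have HF: "H B \<subseteq> borel_measurable F" if "B \<in> \<B>" for B
    unfolding H_def using hF filt(2)[OF that] by (intro image_subsetI borel_measurable_ereal) blast
  define s where "s B = ess_sup M F (H B)" for B
  have sF [measurable]: "s B \<in> borel_measurable F" if "B \<in> \<B>" for B
    unfolding s_def by (rule ess_sup_measurable[OF HF[OF that]])
  have hs: "AE \<omega> in M. ereal (h y \<omega>) \<le> s B \<omega>" if "B \<in> \<B>" "y \<in> B" for B y
    unfolding s_def by (rule ess_sup_upper[OF HF[OF that(1)]]) (use that(2) in \<open>auto simp: H_def\<close>)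
  have sg: "AE \<omega> in M. s B \<omega> \<le> ereal (g \<omega>)" if B: "B \<in> \<B>" for B
    unfolding s_def
  proof (rule ess_sup_least[OF HF[OF B]])
    fix k assume "k \<in> H B"
    then obtain y where y: "y \<in> B" "k = (\<lambda>\<omega>. ereal (h y \<omega>))" unfolding H_def by blast
    have "y \<in> S" using y(1) filt(2)[OF B] by blast
    from bd[OF this] show "AE \<omega> in M. k \<omega> \<le> ereal (g \<omega>)" unfolding y(2) by eventually_elim simp
  qed measurable
  have sg': "AE \<omega> in M. ereal (- g \<omega>) \<le> s B \<omega>" if B: "B \<in> \<B>" for B
  proof -
    obtain y where y: "y \<in> B" using stable_set_nonempty[OF filt(1)[OF B]] by blast
    then have "y \<in> S" using filt(2)[OF B] by blast
    from bd[OF this] hs[OF B y] show ?thesis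
    proof eventually_elim
      case (elim \<omega>)
      then have "ereal (- g \<omega>) \<le> ereal (h y \<omega>)" by simp
      then show ?case using elim(2) by (rule order_trans)
    qed
  qed
  \<comment> \<open>Negation expresses the essential infimum over the filter as an essential
    supremum.\<close>
  define T where "T = (\<lambda>B \<omega>. - s B \<omega>) ` \<B>"
  have TF: "T \<subseteq> borel_measurable F" unfolding T_def using sF by (intro image_subsetI) measurable
  define t where "t = ess_sup M F T"
  have tF [measurable]: "t \<in> borel_measurable F" unfolding t_def by (rule ess_sup_measurable[OF TF])
  have st: "AE \<omega> in M. - s B \<omega> \<le> t \<omega>" if "B \<in> \<B>" for B
    unfolding t_def by (rule ess_sup_upper[OF TF]) (use that in \<open>auto simp: T_def\<close>)
  have tg: "AE \<omega> in M. t \<omega> \<le> ereal (g \<omega>)"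
    unfolding t_def
  proof (rule ess_sup_least[OF TF])
    fix k assume "k \<in> T"
    then obtain B where B: "B \<in> \<B>" "k = (\<lambda>\<omega>. - s B \<omega>)" unfolding T_def by blast
    from sg'[OF B(1)] show "AE \<omega> in M. k \<omega> \<le> ereal (g \<omega>)"
      unfolding B(2) by eventually_elim (metis ereal_uminus_le_reorder uminus_ereal.simps(1))
  qed measurable
  obtain B0 where B0: "B0 \<in> \<B>" using filt(3) by blast
  define L where "L \<omega> = - real_of_ereal (t \<omega>)" for \<omega>
  have LF [measurable]: "L \<in> borel_measurable F" unfolding L_def by measurable
  have tL: "AE \<omega> in M. t \<omega> = ereal (- L \<omega>)"
    using tg st[OF B0] sg[OF B0]
  proof eventually_elim
    case (elim \<omega>)
    then show ?case unfolding L_def by (cases "t \<omega>"; cases "s B0 \<omega>") auto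
  qed
  have Ls: "AE \<omega> in M. ereal (L \<omega>) \<le> s B \<omega>" if "B \<in> \<B>" for B
    using st[OF that] tL
  proof eventually_elim
    case (elim \<omega>)
    then show ?case by (cases "s B \<omega>") auto
  qed
  \<comment> \<open>Closure of the filter under concatenation yields one set that undercuts L +
    \<epsilon> at almost every outcome.\<close>
  have small: "\<exists>B\<in>\<B>. AE \<omega> in M. s B \<omega> < ereal (L \<omega> + \<epsilon> \<omega>)"
    if [measurable]: "\<epsilon> \<in> borel_measurable F" and pos: "AE \<omega> in M. 0 < \<epsilon> \<omega>" for \<epsilon>
  proof -
    have less: "AE \<omega> in M. ereal (- L \<omega> - \<epsilon> \<omega>) < ess_sup M F ((\<lambda>B \<omega>. - s B \<omega>) ` \<B>) \<omega>"
      using tL pos unfolding t_def T_def by eventually_elim simp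
    obtain B where B: "B \<in> \<B>" "AE \<omega> in M. ereal (- L \<omega> - \<epsilon> \<omega>) < - s B \<omega>"
    proof (rule less_ess_sup_glue[OF filt(3) _ _ _ less])
      show "(\<lambda>\<omega>. - s B \<omega>) \<in> borel_measurable F" if "B \<in> \<B>" for B using sF[OF that] by measurable
      fix a and j :: "nat \<Rightarrow> ('a \<Rightarrow> real) set"
      assume a: "event_partition M F a" and j: "\<And>k. j k \<in> \<B>"
      have C: "concat_sets M a j \<in> \<B>" by (rule filt(5)[OF a j])
      have "AE \<omega> in M. \<omega> \<in> a k \<longrightarrow> - s (j k) \<omega> \<le> - s (concat_sets M a j) \<omega>" for k
      proof -
        have "AE \<omega> in M. \<omega> \<in> a k \<longrightarrow> s (concat_sets M a j) \<omega> \<le> s (j k) \<omega>"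
          unfolding s_def[of "concat_sets M a j"]
        proof (rule ess_sup_least_on[OF HF[OF C] sF[OF j] partition_sets[OF a]])
          fix w assume "w \<in> H (concat_sets M a j)"
          then obtain y where y: "y \<in> concat_sets M a j" "w = (\<lambda>\<omega>. ereal (h y \<omega>))" unfolding H_def by blast
          from concat_setsE[OF a y(1)] obtain x where x: "\<And>k. x k \<in> j k" "\<And>k. AE \<omega> in M. \<omega> \<in> a k \<longrightarrow> y \<omega> = x k \<omega>"
            by metis
          have yS: "y \<in> S" using y(1) filt(2)[OF C] by blast
          have xS: "x k \<in> S" using x(1) filt(2)[OF j] by blast
          from loc[OF yS xS partition_sets[OF a] x(2)] hs[OF j x(1), of k]
          show "AE \<omega> in M. \<omega> \<in> a k \<longrightarrow> w \<omega> \<le> s (j k) \<omega>"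
            unfolding y(2) by eventually_elim simp
        qed
        then show ?thesis by eventually_elim simp
      qed
      with C show "\<exists>i\<in>\<B>. \<forall>k. AE \<omega> in M. \<omega> \<in> a k \<longrightarrow> - s (j k) \<omega> \<le> - s i \<omega>" by blast
    qed measurable
    from B(2) have "AE \<omega> in M. s B \<omega> < ereal (L \<omega> + \<epsilon> \<omega>)"
    proof eventually_elim
      case (elim \<omega>)
      then show ?case by (cases "s B \<omega>") auto
    qed
    with B(1) show ?thesis by blast
  qed
  \<comment> \<open>Here the gluing takes place inside the stable set \<open>B\<close>.\<close>
  have large: "\<exists>y\<in>B. AE \<omega> in M. L \<omega> - \<epsilon> \<omega> < h y \<omega>"
    if B: "B \<in> \<B>" and [measurable]: "\<epsilon> \<in> borel_measurable F" and pos: "AE \<omega> in M. 0 < \<epsilon> \<omega>" for B \<epsilon>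
  proof -
    have BS: "y \<in> S" if "y \<in> B" for y using that filt(2)[OF B] by blast
    have less: "AE \<omega> in M. ereal (L \<omega> - \<epsilon> \<omega>) < ess_sup M F ((\<lambda>y \<omega>. ereal (h y \<omega>)) ` B) \<omega>"
      using Ls[OF B] pos unfolding s_def H_def
    proof eventually_elim
      case (elim \<omega>)
      have "ereal (L \<omega> - \<epsilon> \<omega>) < ereal (L \<omega>)" using elim(2) by simp
      then show ?case using elim(1) by (rule less_le_trans)
    qed
    obtain y where y: "y \<in> B" "AE \<omega> in M. ereal (L \<omega> - \<epsilon> \<omega>) < ereal (h y \<omega>)"
    proof (rule less_ess_sup_glue[OF stable_set_nonempty[OF filt(1)[OF B]] _ _ _ less])
      show "(\<lambda>\<omega>. ereal (h y \<omega>)) \<in> borel_measurable F" if "y \<in> B" for y using hF[OF BS[OF that]] by measurable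
      fix a and j :: "nat \<Rightarrow> 'a \<Rightarrow> real"
      assume a: "event_partition M F a" and j: "\<And>k. j k \<in> B"
      have ja: "AE \<omega> in M. \<omega> \<in> a k \<longrightarrow> glue a j \<omega> = j k \<omega>" for k by (rule glue_eq[OF a])
      have z: "glue a j \<in> B"
        by (rule stable_setD[OF filt(1)[OF B] a j glue_measurable_M[OF a stable_setM[OF filt(1)[OF B] j]] ja])
      have "AE \<omega> in M. \<omega> \<in> a k \<longrightarrow> ereal (h (j k) \<omega>) \<le> ereal (h (glue a j) \<omega>)" for k
        using loc[OF BS[OF z] BS[OF j[of k]] partition_sets[OF a] ja[of k]] by eventually_elim simp
      with z show "\<exists>i\<in>B. \<forall>k. AE \<omega> in M. \<omega> \<in> a k \<longrightarrow> ereal (h (j k) \<omega>) \<le> ereal (h i \<omega>)" by blast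
    qed measurable
    from y(2) have "AE \<omega> in M. L \<omega> - \<epsilon> \<omega> < h y \<omega>" by eventually_elim simp
    with y(1) show ?thesis by blast
  qed
  define E :: "('a \<Rightarrow> real) set" where "E = {\<epsilon> \<in> borel_measurable F. AE \<omega> in M. 0 < \<epsilon> \<omega>}"
  define R where "R \<epsilon> y \<omega> \<longleftrightarrow> \<bar>h y \<omega> - L \<omega>\<bar> < \<epsilon> \<omega>" for \<epsilon> y \<omega>
  define Q where "Q B \<epsilon> = {y \<in> B. AE \<omega> in M. R \<epsilon> y \<omega>}" for B \<epsilon>
  define \<G> where "\<G> = {Q B \<epsilon> | B \<epsilon>. B \<in> \<B> \<and> \<epsilon> \<in> E}"
  have locR: "local_on B (R \<epsilon>)" if B: "B \<in> \<B>" for B \<epsilon>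
    unfolding local_on_def
  proof (intro ballI impI)
    fix y z A assume "y \<in> B" "z \<in> B" and A: "A \<in> sets F" "AE \<omega> in M. \<omega> \<in> A \<longrightarrow> y \<omega> = z \<omega>"
    then have "y \<in> S" "z \<in> S" using filt(2)[OF B] by auto
    from loc[OF this A] show "AE \<omega> in M. \<omega> \<in> A \<longrightarrow> R \<epsilon> y \<omega> \<longrightarrow> R \<epsilon> z \<omega>"
      unfolding R_def by eventually_elim simp
  qed
  have Qne: "Q B \<epsilon> \<noteq> {}" if B: "B \<in> \<B>" and e: "\<epsilon> \<in> E" for B \<epsilon>
  proof -
    have e': "\<epsilon> \<in> borel_measurable F" "AE \<omega> in M. 0 < \<epsilon> \<omega>" using e unfolding E_def by auto
    obtain B' where B': "B' \<in> \<B>" "AE \<omega> in M. s B' \<omega> < ereal (L \<omega> + \<epsilon> \<omega>)" using small[OF e'] by blast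
    \<comment> \<open>The lower bound is sought inside a smaller set of the filter on which the
      upper bound already holds.\<close>
    obtain C where C: "C \<in> \<B>" "C \<subseteq> B \<inter> B'" using filt(4)[OF B B'(1)] by blast
    obtain y where y: "y \<in> C" "AE \<omega> in M. L \<omega> - \<epsilon> \<omega> < h y \<omega>" using large[OF C(1) e'] by blast
    have "y \<in> B'" using y(1) C(2) by blast
    from hs[OF B'(1) this] B'(2) y(2) have "AE \<omega> in M. R \<epsilon> y \<omega>"
    proof eventually_elim
      case (elim \<omega>)
      from elim(1,2) have "ereal (h y \<omega>) < ereal (L \<omega> + \<epsilon> \<omega>)" by (rule le_less_trans)
      then show ?case using elim(3) unfolding R_def by (simp add: abs_less_iff)
    qed
    then show ?thesis using y(1) C(2) unfolding Q_def by blast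
  qed
  have "\<G> \<subseteq> \<B>"
  proof (rule maximal_stable_filter_refine[OF S max])
    have GD: "\<exists>B \<epsilon>. C = Q B \<epsilon> \<and> B \<in> \<B> \<and> \<epsilon> \<in> E" if "C \<in> \<G>" for C
      using that unfolding \<G>_def by (rule CollectD)
    show "stable_set M F C" if C: "C \<in> \<G>" for C
    proof -
      obtain B \<epsilon> where "C = Q B \<epsilon>" "B \<in> \<B>" "\<epsilon> \<in> E" using GD[OF C] by (elim exE conjE) (rule that)
      then show ?thesis
        using stable_set_Collect[OF filt(1) locR, of B \<epsilon>] Qne[of B \<epsilon>] unfolding Q_def by simp
    qed
    show "C \<subseteq> S" if C: "C \<in> \<G>" for C
    proof -
      obtain B \<epsilon> where "C = Q B \<epsilon>" "B \<in> \<B>" using GD[OF C] by (elim exE conjE) (rule that)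
      then show ?thesis using filt(2)[of B] unfolding Q_def by blast
    qed
    show "\<exists>C\<in>\<G>. C \<subseteq> B" if "B \<in> \<B>" for B
    proof -
      have one: "(\<lambda>_. 1) \<in> E" unfolding E_def by simp
      have "Q B (\<lambda>_. 1) \<in> \<G>" unfolding \<G>_def
        using that one by (intro CollectI exI[of _ B] exI[of _ "\<lambda>_. 1"] conjI refl)
      moreover have "Q B (\<lambda>_. 1) \<subseteq> B" unfolding Q_def by blast
      ultimately show ?thesis by blast
    qed
    fix C C' assume "C \<in> \<G>" "C' \<in> \<G>"
    from GD[OF this(1)] GD[OF this(2)] obtain B \<epsilon> B' \<epsilon>'
      where C: "C = Q B \<epsilon>" "B \<in> \<B>" "\<epsilon> \<in> E" "C' = Q B' \<epsilon>'" "B' \<in> \<B>" "\<epsilon>' \<in> E"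
      by (elim exE conjE) (rule that)
    obtain D where D: "D \<in> \<B>" "D \<subseteq> B \<inter> B'" using filt(4)[OF C(2,5)] by blast
    define \<delta> where "\<delta> \<omega> = min (\<epsilon> \<omega>) (\<epsilon>' \<omega>)" for \<omega>
    have [measurable]: "\<epsilon> \<in> borel_measurable F" "\<epsilon>' \<in> borel_measurable F" and
      p: "AE \<omega> in M. 0 < \<epsilon> \<omega>" "AE \<omega> in M. 0 < \<epsilon>' \<omega>" using C(3,6) unfolding E_def by auto
    have "\<delta> \<in> borel_measurable F" unfolding \<delta>_def by measurable
    moreover from p have "AE \<omega> in M. 0 < \<delta> \<omega>" unfolding \<delta>_def by eventually_elim auto
    ultimately have \<delta>: "\<delta> \<in> E" unfolding E_def by blast
    have "Q D \<delta> \<subseteq> C \<inter> C'"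
    proof
      fix y assume "y \<in> Q D \<delta>"
      then have y: "y \<in> D" "AE \<omega> in M. R \<delta> y \<omega>" unfolding Q_def by auto
      from y(2) have "AE \<omega> in M. R \<epsilon> y \<omega>" by eventually_elim (simp add: R_def \<delta>_def)
      moreover from y(2) have "AE \<omega> in M. R \<epsilon>' y \<omega>" by eventually_elim (simp add: R_def \<delta>_def)
      ultimately show "y \<in> C \<inter> C'" using y(1) D(2) unfolding C Q_def by blast
    qed
    moreover have "Q D \<delta> \<in> \<G>" unfolding \<G>_def
      using D(1) \<delta> by (intro CollectI exI[of _ D] exI[of _ \<delta>] conjI refl)
    ultimately show "\<exists>D\<in>\<G>. D \<subseteq> C \<inter> C'" by blast
  qed
  moreover have "Q B0 \<epsilon> \<in> \<G>" if "\<epsilon> \<in> E" for \<epsilon>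
    unfolding \<G>_def using B0 that by (intro CollectI exI[of _ B0] exI[of _ \<epsilon>] conjI refl)
  ultimately have QB: "Q B0 \<epsilon> \<in> \<B>" if "\<epsilon> \<in> E" for \<epsilon> using that by blast
  have "\<exists>B\<in>\<B>. \<forall>y\<in>B. AE \<omega> in M. \<bar>h y \<omega> - L \<omega>\<bar> < \<epsilon> \<omega>" if e: "\<epsilon> \<in> borel_measurable F" "AE \<omega> in M. 0 < \<epsilon> \<omega>" for \<epsilon>
  proof (rule bexI[OF _ QB])
    show "\<epsilon> \<in> E" using e unfolding E_def by simp
    show "\<forall>y\<in>Q B0 \<epsilon>. AE \<omega> in M. \<bar>h y \<omega> - L \<omega>\<bar> < \<epsilon> \<omega>" unfolding Q_def R_def by simp
  qed
  with LF show ?thesis by (intro bexI[of _ L] ballI impI)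
qed

end

subsection \<open>The Lebesgue property implies compactness\<close>

context conditional_risk
begin

text \<open>A conditional Riesz representation. Minus the integral of L on indicators is a measure
  by continuity along decreasing sequences. Its Radon-Nikodym density, with the sign reversed,
  represents L on indicators by \<open>F\<close>-linearity, then on nonnegative elements by monotone
  approximation, then on \<open>X\<close>.\<close>

lemma functional_representation:
  fixes L :: "('a \<Rightarrow> real) \<Rightarrow> 'a \<Rightarrow> real"
  assumes LF: "\<And>x. x \<in> X \<Longrightarrow> L x \<in> borel_measurable F"
    and lin: "\<And>\<eta> x z. \<eta> \<in> borel_measurable F \<Longrightarrow> x \<in> X \<Longrightarrow> z \<in> X \<Longrightarrow>
        AE \<omega> in M. L (\<lambda>\<omega>. \<eta> \<omega> * x \<omega> + z \<omega>) \<omega> = \<eta> \<omega> * L x \<omega> + L z \<omega>"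
    and neg: "\<And>x. x \<in> X \<Longrightarrow> AE \<omega> in M. 0 \<le> x \<omega> \<Longrightarrow> AE \<omega> in M. L x \<omega> \<le> 0"
    and one: "AE \<omega> in M. L (\<lambda>_. 1) \<omega> = -1"
    and cont: "\<And>u. (\<And>n. u n \<in> X) \<Longrightarrow> (\<And>n. AE \<omega> in M. 0 \<le> u (Suc n) \<omega> \<and> u (Suc n) \<omega> \<le> u n \<omega>) \<Longrightarrow>
        AE \<omega> in M. (\<lambda>n. u n \<omega>) \<longlonglongrightarrow> 0 \<Longrightarrow> AE \<omega> in M. (\<lambda>n. L (u n) \<omega>) \<longlonglongrightarrow> 0"
  shows "\<exists>y\<in>Y. \<forall>x\<in>X. AE \<omega> in M. pr x y \<omega> = L x \<omega>"
proof -
  have zeroX: "(\<lambda>_. 0) \<in> X" by (rule X_F) simp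
  have oneX: "(\<lambda>_. 1) \<in> X" by (rule X_F) simp
  have cF: "(\<lambda>_. c) \<in> borel_measurable F" for c :: real by simp
  have L0: "AE \<omega> in M. L (\<lambda>_. 0) \<omega> = 0"
    using lin[OF cF[of 1] zeroX zeroX] by eventually_elim simp
  have Lmult: "AE \<omega> in M. L (\<lambda>\<omega>. \<eta> \<omega> * x \<omega>) \<omega> = \<eta> \<omega> * L x \<omega>" if "\<eta> \<in> borel_measurable F" "x \<in> X" for \<eta> x
    using lin[OF that zeroX] L0 by eventually_elim simp
  have Ladd: "AE \<omega> in M. L (\<lambda>\<omega>. x \<omega> + z \<omega>) \<omega> = L x \<omega> + L z \<omega>" if "x \<in> X" "z \<in> X" for x z
    using lin[OF cF[of 1] that] by simp
  have Ldiff: "AE \<omega> in M. L (\<lambda>\<omega>. x \<omega> - z \<omega>) \<omega> = L x \<omega> - L z \<omega>" if "x \<in> X" "z \<in> X" for x z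
    using lin[OF cF[of "-1"] that(2,1)] by simp
  have Lcong: "AE \<omega> in M. L x \<omega> = L z \<omega>" if x: "x \<in> X" and z: "z \<in> X" and eq: "AE \<omega> in M. x \<omega> = z \<omega>" for x z
  proof -
    have "AE \<omega> in M. L (\<lambda>\<omega>. x \<omega> - z \<omega>) \<omega> \<le> 0"
      by (rule neg[OF X_diff[OF x z]]) (use eq in eventually_elim, simp)
    moreover have "AE \<omega> in M. L (\<lambda>\<omega>. z \<omega> - x \<omega>) \<omega> \<le> 0"
      by (rule neg[OF X_diff[OF z x]]) (use eq in eventually_elim, simp)
    ultimately show ?thesis using Ldiff[OF x z] Ldiff[OF z x] by eventually_elim simp
  qed
  have ind: "indicator A \<in> X" if "A \<in> sets M" for A
    by (rule X_solid[OF oneX]) (use that in \<open>auto simp: indicator_def\<close>)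
  \<comment> \<open>L is nonpositive on nonnegative elements, so the minus sign gives a measure. The
    normalization at 1 keeps L on indicators within [-1, 0] and thus integrable.\<close>
  define l where "l A = - (\<integral>\<omega>. L (indicator A) \<omega> \<partial>M)" for A
  have lM: "L (indicator A) \<in> borel_measurable M" if "A \<in> sets M" for A
    by (rule L0_subalgebra[OF LF[OF ind[OF that]]])
  have lneg: "AE \<omega> in M. L (indicator A) \<omega> \<le> 0" if "A \<in> sets M" for A
    by (rule neg[OF ind[OF that]]) (simp add: indicator_def)
  have lge: "AE \<omega> in M. - 1 \<le> L (indicator A) \<omega>" if A: "A \<in> sets M" for A
  proof -
    have "AE \<omega> in M. L (\<lambda>\<omega>. 1 - indicator A \<omega>) \<omega> \<le> 0"
      by (rule neg[OF X_diff[OF oneX ind[OF A]]]) (simp add: indicator_def)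
    with Ldiff[OF oneX ind[OF A]] one show ?thesis by eventually_elim simp
  qed
  have lint: "integrable M (L (indicator A))" if A: "A \<in> sets M" for A
  proof (rule integrable_const_bound[of _ 1])
    from lneg[OF A] lge[OF A] show "AE \<omega> in M. norm (L (indicator A) \<omega>) \<le> 1" by eventually_elim simp
  qed (rule lM[OF A])
  have lnn: "0 \<le> l A" if A: "A \<in> sets M" for A
  proof -
    from lneg[OF A] have "AE \<omega> in M. 0 \<le> - L (indicator A) \<omega>" by eventually_elim simp
    from integral_nonneg_AE[OF this] show ?thesis unfolding l_def by simp
  qed
  define N where "N = measure_of (space M) (sets M) (\<lambda>A. ennreal (l A))"
  have spN: "space N = space M" and seN: "sets N = sets M" unfolding N_def by (simp_all add: sets.space_closed)
  have ladd: "l (A \<union> B) = l A + l B" if A: "A \<in> sets M" and B: "B \<in> sets M" and disj: "A \<inter> B = {}" for A B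
  proof -
    have "(\<lambda>\<omega>. indicator A \<omega> + indicator B \<omega> :: real) = indicator (A \<union> B)"
      using disj by (auto simp: indicator_def fun_eq_iff)
    with Ladd[OF ind[OF A] ind[OF B]] have "AE \<omega> in M. L (indicator (A \<union> B)) \<omega> = L (indicator A) \<omega> + L (indicator B) \<omega>" by simp
    then have "(\<integral>\<omega>. L (indicator (A \<union> B)) \<omega> \<partial>M) = (\<integral>\<omega>. L (indicator A) \<omega> + L (indicator B) \<omega> \<partial>M)"
      by (intro integral_cong_AE) (use lM A B in auto)
    then show ?thesis unfolding l_def using lint[OF A] lint[OF B] by simp
  qed
  have lempty: "l {} = 0"
  proof -
    have "(\<integral>\<omega>. L (indicator {}) \<omega> \<partial>M) = (\<integral>\<omega>. 0 \<partial>M)"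
      by (rule integral_cong_AE) (use L0 lM[of "{}"] in \<open>auto simp: indicator_def[abs_def]\<close>)
    then show ?thesis unfolding l_def by simp
  qed
  \<comment> \<open>For a finite additive set function it is enough to show continuity at the empty
    set, which is \<open>cont\<close> applied to indicators.\<close>
  have ca: "countably_additive (sets M) (\<lambda>A. ennreal (l A))"
  proof (rule sets.empty_continuous_imp_countably_additive)
    show "positive (sets M) (\<lambda>A. ennreal (l A))" unfolding positive_def using lempty by simp
    show "additive (sets M) (\<lambda>A. ennreal (l A))"
      unfolding additive_def using ladd lnn by (simp add: ennreal_plus)
    show "\<forall>A\<in>sets M. ennreal (l A) \<noteq> \<infinity>" by simp
    fix A :: "nat \<Rightarrow> 'a set" assume A: "range A \<subseteq> sets M" "decseq A" "(\<Inter>i. A i) = {}"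
    have Ai: "A i \<in> sets M" for i using A(1) by blast
    have "AE \<omega> in M. (\<lambda>n. L (indicator (A n)) \<omega>) \<longlonglongrightarrow> 0"
    proof (rule cont[OF ind[OF Ai]])
      show "AE \<omega> in M. 0 \<le> (indicator (A (Suc n)) \<omega> :: real) \<and> indicator (A (Suc n)) \<omega> \<le> (indicator (A n) \<omega> :: real)" for n
        using decseqD[OF A(2), of n "Suc n"] by (intro AE_I2) (auto simp: indicator_def)
      show "AE \<omega> in M. (\<lambda>n. indicator (A n) \<omega> :: real) \<longlonglongrightarrow> 0"
      proof (rule AE_I2)
        fix \<omega>
        have "(\<lambda>n. indicator (A n) \<omega> :: real) \<longlonglongrightarrow> indicator (\<Inter>i. A i) \<omega>"
          by (rule LIMSEQ_indicator_decseq[OF A(2)])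
        then show "(\<lambda>n. indicator (A n) \<omega> :: real) \<longlonglongrightarrow> 0" using A(3) by simp
      qed
    qed
    then have "(\<lambda>n. \<integral>\<omega>. L (indicator (A n)) \<omega> \<partial>M) \<longlonglongrightarrow> (\<integral>\<omega>. 0 \<partial>M)"
    proof (rule integral_dominated_convergence[rotated 3])
      show "AE \<omega> in M. norm (L (indicator (A n)) \<omega>) \<le> 1" for n
        using lneg[OF Ai[of n]] lge[OF Ai[of n]] by eventually_elim simp
    qed (use lM[OF Ai] in auto)
    then have "(\<lambda>n. l (A n)) \<longlonglongrightarrow> - 0" unfolding l_def by (intro tendsto_minus) simp
    then have "(\<lambda>n. ennreal (l (A n))) \<longlonglongrightarrow> ennreal 0" by (intro tendsto_ennrealI) simp
    then show "(\<lambda>n. ennreal (l (A n))) \<longlonglongrightarrow> 0" by simp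
  qed
  have emN: "emeasure N A = ennreal (l A)" if "A \<in> sets M" for A
    unfolding N_def by (rule emeasure_measure_of_sigma[OF sets.sigma_algebra_axioms _ ca that])
      (use lempty in \<open>simp add: positive_def\<close>)
  have "absolutely_continuous M N"
    unfolding absolutely_continuous_def
  proof
    fix A assume A: "A \<in> null_sets M"
    then have As: "A \<in> sets M" by auto
    have "AE \<omega> in M. (indicator A \<omega> :: real) = 0" using AE_not_in[OF A] by eventually_elim simp
    from Lcong[OF ind[OF As] zeroX this] L0 have "AE \<omega> in M. L (indicator A) \<omega> = 0" by eventually_elim simp
    then have "(\<integral>\<omega>. L (indicator A) \<omega> \<partial>M) = (\<integral>\<omega>. 0 \<partial>M)" by (intro integral_cong_AE lM[OF As]) auto
    then show "A \<in> null_sets N" using emN[OF As] As seN unfolding l_def by (intro null_setsI) auto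
  qed
  then obtain f where f [measurable]: "f \<in> borel_measurable M" and fN: "density M f = N"
    using Radon_Nikodym seN by blast
  have fint: "(\<integral>\<^sup>+\<omega>. f \<omega> * indicator A \<omega> \<partial>M) = ennreal (l A)" if "A \<in> sets M" for A
    using emN[OF that] emeasure_density[OF f that] fN by simp
  have ffin: "AE \<omega> in M. f \<omega> \<noteq> \<infinity>"
  proof (rule nn_integral_PInf_AE[OF f])
    have "(\<integral>\<^sup>+\<omega>. f \<omega> * indicator (space M) \<omega> \<partial>M) = (\<integral>\<^sup>+\<omega>. f \<omega> \<partial>M)" by (intro nn_integral_cong) simp
    then show "(\<integral>\<^sup>+\<omega>. f \<omega> \<partial>M) \<noteq> \<infinity>" using fint[of "space M"] by simp
  qed
  \<comment> \<open>Formulated with \<open>nn_cond_exp\<close>, since conditional integrability of u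
    f is a consequence. Membership in \<open>X\<close> is a premise inside the induction; solidity
    passes it on to summands and approximants.\<close>
  have key: "u \<in> X \<longrightarrow> (AE \<omega> in M. nn_cond_exp M F (\<lambda>\<omega>. ennreal (u \<omega>) * f \<omega>) \<omega> = ennreal (- L u \<omega>))"
    if "u \<in> borel_measurable M" "\<And>\<omega>. 0 \<le> u \<omega>" for u
    using that
  proof (induction u rule: borel_measurable_induct_real)
    case (set A)
    note A = set
    show ?case
    proof
      have [measurable]: "A \<in> sets M" by (rule A)
      have [measurable]: "L (indicator A) \<in> borel_measurable F" by (rule LF[OF ind[OF A]])
      have "AE \<omega> in M. ennreal (- L (indicator A) \<omega>) = nn_cond_exp M F (\<lambda>\<omega>. ennreal (indicator A \<omega>) * f \<omega>) \<omega>"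
      proof (rule nn_cond_exp_charact)
        fix C assume C: "C \<in> sets F"
        have CM [measurable]: "C \<in> sets M" by (rule sets_subalgebra[OF C])
        have AC: "A \<inter> C \<in> sets M" by measurable
        \<comment> \<open>By \<open>F\<close>-linearity the test event \<open>C\<close> is absorbed
          into the indicator, and the density is evaluated on A \<inter> C.\<close>
        have eq: "(\<lambda>\<omega>. indicator C \<omega> * indicator A \<omega> :: real) = indicator (A \<inter> C)" by (auto simp: indicator_def)
        have "indicator C \<in> borel_measurable F" using C by measurable
        from Lmult[OF this ind[OF A]]
        have Leq: "AE \<omega> in M. L (indicator (A \<inter> C)) \<omega> = indicator C \<omega> * L (indicator A) \<omega>" unfolding eq .
        have "(\<integral>\<^sup>+\<omega>\<in>C. (ennreal (indicator A \<omega>) * f \<omega>) \<partial>M) = (\<integral>\<^sup>+\<omega>. f \<omega> * indicator (A \<inter> C) \<omega> \<partial>M)"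
          by (intro nn_integral_cong) (auto simp: indicator_def)
        also have "\<dots> = ennreal (l (A \<inter> C))" by (rule fint[OF AC])
        also have "\<dots> = (\<integral>\<^sup>+\<omega>. ennreal (- L (indicator (A \<inter> C)) \<omega>) \<partial>M)"
        proof -
          have "AE \<omega> in M. 0 \<le> - L (indicator (A \<inter> C)) \<omega>" using lneg[OF AC] by eventually_elim simp
          from nn_integral_eq_integral[OF integrable_minus[OF lint[OF AC]] this] show ?thesis unfolding l_def by simp
        qed
        also have "\<dots> = (\<integral>\<^sup>+\<omega>\<in>C. ennreal (- L (indicator A) \<omega>) \<partial>M)"
          by (rule nn_integral_cong_AE) (use Leq in eventually_elim, simp add: indicator_def)
        finally show "(\<integral>\<^sup>+\<omega>\<in>C. (ennreal (indicator A \<omega>) * f \<omega>) \<partial>M) = (\<integral>\<^sup>+\<omega>\<in>C. ennreal (- L (indicator A) \<omega>) \<partial>M)" .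
      qed measurable
      then show "AE \<omega> in M. nn_cond_exp M F (\<lambda>\<omega>. ennreal (indicator A \<omega>) * f \<omega>) \<omega> = ennreal (- L (indicator A) \<omega>)"
        by eventually_elim simp
    qed
  next
    case (mult u c)
    show ?case
    proof
      assume cu: "(\<lambda>\<omega>. c * u \<omega>) \<in> X"
      show "AE \<omega> in M. nn_cond_exp M F (\<lambda>\<omega>. ennreal (c * u \<omega>) * f \<omega>) \<omega> = ennreal (- L (\<lambda>\<omega>. c * u \<omega>) \<omega>)"
      proof (cases "c = 0")
        case True
        then show ?thesis using nn_cond_exp_const_0 L0 by simp (auto elim: eventually_elim2)
      next
        case False
        then have u: "u \<in> X" using X_cmult[OF cu, of "1 / c"] by simp
        have [measurable]: "u \<in> borel_measurable M" by fact
        have "AE \<omega> in M. ennreal c * nn_cond_exp M F (\<lambda>\<omega>. ennreal (u \<omega>) * f \<omega>) \<omega>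
            = nn_cond_exp M F (\<lambda>\<omega>. ennreal c * (ennreal (u \<omega>) * f \<omega>)) \<omega>"
          by (rule nn_cond_exp_prod) measurable
        moreover have "(\<lambda>\<omega>. ennreal c * (ennreal (u \<omega>) * f \<omega>)) = (\<lambda>\<omega>. ennreal (c * u \<omega>) * f \<omega>)"
          using mult(1,3) by (simp add: ennreal_mult mult.assoc)
        ultimately have 1: "AE \<omega> in M. ennreal c * nn_cond_exp M F (\<lambda>\<omega>. ennreal (u \<omega>) * f \<omega>) \<omega>
            = nn_cond_exp M F (\<lambda>\<omega>. ennreal (c * u \<omega>) * f \<omega>) \<omega>" by simp
        have 2: "AE \<omega> in M. L (\<lambda>\<omega>. c * u \<omega>) \<omega> = c * L u \<omega>" using Lmult[of "\<lambda>_. c", OF _ u] by simp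
        have 3: "AE \<omega> in M. nn_cond_exp M F (\<lambda>\<omega>. ennreal (u \<omega>) * f \<omega>) \<omega> = ennreal (- L u \<omega>)" using mult.IH u by blast
        have 4: "AE \<omega> in M. L u \<omega> \<le> 0" by (rule neg[OF u]) (use mult(3) in simp)
        from 1 2 3 4 show ?thesis
        proof eventually_elim
          case (elim \<omega>)
          have "nn_cond_exp M F (\<lambda>\<omega>. ennreal (c * u \<omega>) * f \<omega>) \<omega> = ennreal c * ennreal (- L u \<omega>)"
            using elim(1,3) by simp
          also have "\<dots> = ennreal (c * (- L u \<omega>))" using elim(4) mult(1) by (intro ennreal_mult[symmetric]) auto
          finally show ?case using elim(2) by simp
        qed
      qed
    qed
  next
    case (add u v)
    show ?case
    proof
      assume uv: "(\<lambda>\<omega>. v \<omega> + u \<omega>) \<in> X"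
      have [measurable]: "u \<in> borel_measurable M" "v \<in> borel_measurable M" by fact+
      have u: "u \<in> X" by (rule X_solid[OF uv]) (use add in auto)
      have v: "v \<in> X" by (rule X_solid[OF uv]) (use add in auto)
      have 1: "AE \<omega> in M. nn_cond_exp M F (\<lambda>\<omega>. ennreal (v \<omega>) * f \<omega>) \<omega> + nn_cond_exp M F (\<lambda>\<omega>. ennreal (u \<omega>) * f \<omega>) \<omega>
         = nn_cond_exp M F (\<lambda>\<omega>. ennreal (v \<omega>) * f \<omega> + ennreal (u \<omega>) * f \<omega>) \<omega>"
        by (rule nn_cond_exp_sum) measurable
      have e: "(\<lambda>\<omega>. ennreal (v \<omega>) * f \<omega> + ennreal (u \<omega>) * f \<omega>) = (\<lambda>\<omega>. ennreal (v \<omega> + u \<omega>) * f \<omega>)"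
        using add.hyps(2,4) by (simp add: ennreal_plus distrib_right)
      have 2: "AE \<omega> in M. nn_cond_exp M F (\<lambda>\<omega>. ennreal (u \<omega>) * f \<omega>) \<omega> = ennreal (- L u \<omega>)" using add.IH(1) u by blast
      have 3: "AE \<omega> in M. nn_cond_exp M F (\<lambda>\<omega>. ennreal (v \<omega>) * f \<omega>) \<omega> = ennreal (- L v \<omega>)" using add.IH(2) v by blast
      have 4: "AE \<omega> in M. L u \<omega> \<le> 0" by (rule neg[OF u]) (use add in simp)
      have 5: "AE \<omega> in M. L v \<omega> \<le> 0" by (rule neg[OF v]) (use add in simp)
      from 1[unfolded e] 2 3 4 5 Ladd[OF v u]
      show "AE \<omega> in M. nn_cond_exp M F (\<lambda>\<omega>. ennreal (v \<omega> + u \<omega>) * f \<omega>) \<omega> = ennreal (- L (\<lambda>\<omega>. v \<omega> + u \<omega>) \<omega>)"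
      proof eventually_elim
        case (elim \<omega>)
        have "nn_cond_exp M F (\<lambda>\<omega>. ennreal (v \<omega> + u \<omega>) * f \<omega>) \<omega> = ennreal (- L v \<omega>) + ennreal (- L u \<omega>)"
          using elim(1-3) by simp
        also have "\<dots> = ennreal (- L v \<omega> + - L u \<omega>)" using elim(4,5) by (intro ennreal_plus[symmetric]) auto
        finally show ?case using elim(6) by simp
      qed
    qed
  next
    case (seq U)
    note [measurable] = seq.hyps(1)
    have um [measurable]: "u \<in> borel_measurable M" and unn: "\<And>\<omega>. 0 \<le> u \<omega>" using that by auto
    show ?case
    proof
      assume u: "u \<in> X"
      have Uu: "U i \<omega> \<le> u \<omega>" if "\<omega> \<in> space M" for i \<omega>
        by (rule incseq_le[OF _ seq.hyps(4)[OF that]]) (use seq.hyps(3) in \<open>auto simp: incseq_def le_fun_def\<close>)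
      have UX: "U i \<in> X" for i
        by (rule X_solid[OF u]) (use Uu unn seq.hyps(2) in auto)
      \<comment> \<open>The remainders u - U n decrease to 0, the situation covered by
        \<open>cont\<close>.\<close>
      have "AE \<omega> in M. (\<lambda>n. L (\<lambda>\<omega>. u \<omega> - U n \<omega>) \<omega>) \<longlonglongrightarrow> 0"
      proof (rule cont)
        show "(\<lambda>\<omega>. u \<omega> - U n \<omega>) \<in> X" for n by (rule X_diff[OF u UX])
        show "AE \<omega> in M. 0 \<le> u \<omega> - U (Suc n) \<omega> \<and> u \<omega> - U (Suc n) \<omega> \<le> u \<omega> - U n \<omega>" for n
          using Uu incseqD[OF seq.hyps(3), of n "Suc n"] by (intro AE_I2) (auto simp: le_fun_def)
        show "AE \<omega> in M. (\<lambda>n. u \<omega> - U n \<omega>) \<longlonglongrightarrow> 0"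
        proof (rule AE_I2)
          fix \<omega> assume "\<omega> \<in> space M"
          from tendsto_diff[OF tendsto_const seq.hyps(4)[OF this], of "u \<omega>"] show "(\<lambda>n. u \<omega> - U n \<omega>) \<longlonglongrightarrow> 0" by simp
        qed
      qed
      moreover have "AE \<omega> in M. \<forall>n. L (\<lambda>\<omega>. u \<omega> - U n \<omega>) \<omega> = L u \<omega> - L (U n) \<omega>"
        unfolding AE_all_countable using Ldiff[OF u UX] by blast
      ultimately have lim: "AE \<omega> in M. (\<lambda>n. ennreal (- L (U n) \<omega>)) \<longlonglongrightarrow> ennreal (- L u \<omega>)"
      proof eventually_elim
        case (elim \<omega>)
        then have "(\<lambda>n. L u \<omega> - L (U n) \<omega>) \<longlonglongrightarrow> 0" by simp
        from tendsto_diff[OF this tendsto_const, of "L u \<omega>"] have "(\<lambda>n. - L (U n) \<omega>) \<longlonglongrightarrow> - L u \<omega>" by simp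
        then show ?case by (rule tendsto_ennrealI)
      qed
      define V where "V n \<omega> = ennreal (U n \<omega>) * f \<omega>" for n \<omega>
      have VM [measurable]: "V n \<in> borel_measurable M" for n unfolding V_def by measurable
      have Vinc: "V n \<omega> \<le> V (Suc n) \<omega>" for n \<omega>
        unfolding V_def using incseqD[OF seq.hyps(3), of n "Suc n"]
        by (intro mult_right_mono ennreal_leI) (auto simp: le_fun_def)
      have VSUP: "(SUP n. V n \<omega>) = ennreal (u \<omega>) * f \<omega>" if "\<omega> \<in> space M" for \<omega>
      proof -
        have "(\<lambda>n. ennreal (U n \<omega>)) \<longlonglongrightarrow> ennreal (u \<omega>)" by (rule tendsto_ennrealI[OF seq.hyps(4)[OF that]])
        moreover have "(\<lambda>n. ennreal (U n \<omega>)) \<longlonglongrightarrow> (SUP n. ennreal (U n \<omega>))"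
          using seq.hyps(3) by (intro LIMSEQ_SUP) (auto simp: incseq_def le_fun_def intro: ennreal_leI)
        ultimately have "(SUP n. ennreal (U n \<omega>)) = ennreal (u \<omega>)" by (rule LIMSEQ_unique[rotated])
        then show ?thesis unfolding V_def by (simp add: SUP_mult_right_ennreal[symmetric])
      qed
      have 1: "AE \<omega> in M. (SUP n. nn_cond_exp M F (V n) \<omega>) = nn_cond_exp M F (\<lambda>\<omega>. SUP n. V n \<omega>) \<omega>"
        by (rule nn_cond_exp_monotone_convergence[of V, OF VM Vinc])
      have 2: "AE \<omega> in M. nn_cond_exp M F (\<lambda>\<omega>. SUP n. V n \<omega>) \<omega> = nn_cond_exp M F (\<lambda>\<omega>. ennreal (u \<omega>) * f \<omega>) \<omega>"
        by (rule nn_cond_exp_cong) (use VSUP in auto)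
      have 3: "AE \<omega> in M. \<forall>n. nn_cond_exp M F (V n) \<omega> = ennreal (- L (U n) \<omega>)"
        unfolding AE_all_countable V_def using seq.IH UX by blast
      have 4: "AE \<omega> in M. \<forall>n. nn_cond_exp M F (V n) \<omega> \<le> nn_cond_exp M F (V (Suc n)) \<omega>"
        unfolding AE_all_countable by (intro allI nn_cond_exp_mono) (use Vinc in auto)
      from 1 2 3 4 lim show "AE \<omega> in M. nn_cond_exp M F (\<lambda>\<omega>. ennreal (u \<omega>) * f \<omega>) \<omega> = ennreal (- L u \<omega>)"
      proof eventually_elim
        case (elim \<omega>)
        have "(\<lambda>n. nn_cond_exp M F (V n) \<omega>) \<longlonglongrightarrow> (SUP n. nn_cond_exp M F (V n) \<omega>)"
          by (rule LIMSEQ_SUP) (use elim(4) in \<open>auto intro: incseq_SucI\<close>)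
        moreover have "(\<lambda>n. nn_cond_exp M F (V n) \<omega>) \<longlonglongrightarrow> ennreal (- L u \<omega>)" using elim(3,5) by simp
        ultimately have "(SUP n. nn_cond_exp M F (V n) \<omega>) = ennreal (- L u \<omega>)" by (rule LIMSEQ_unique)
        then show ?case using elim(1,2) by simp
      qed
    qed
  qed
  \<comment> \<open>The density is finite almost everywhere, so passing to the reals changes it on a
    null set only; the sign is restored.\<close>
  define y where "y \<omega> = - enn2real (f \<omega>)" for \<omega>
  have yM [measurable]: "y \<in> borel_measurable M" unfolding y_def by measurable
  have yneg: "y \<omega> \<le> 0" for \<omega> unfolding y_def by simp
  have nn: "AE \<omega> in M. nn_cond_exp M F (\<lambda>\<omega>. ennreal (x \<omega> * - y \<omega>)) \<omega> = ennreal (- L x \<omega>)"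
    if x: "x \<in> X" and x0: "\<And>\<omega>. 0 \<le> x \<omega>" for x
  proof -
    have [measurable]: "x \<in> borel_measurable M" by (rule X_measurable[OF x])
    have "AE \<omega> in M. nn_cond_exp M F (\<lambda>\<omega>. ennreal (x \<omega> * - y \<omega>)) \<omega> = nn_cond_exp M F (\<lambda>\<omega>. ennreal (x \<omega>) * f \<omega>) \<omega>"
    proof (rule nn_cond_exp_cong)
      from ffin show "AE \<omega> in M. ennreal (x \<omega> * - y \<omega>) = ennreal (x \<omega>) * f \<omega>"
        by eventually_elim (use x0 in \<open>simp add: y_def ennreal_mult less_top\<close>)
    qed measurable
    moreover have "AE \<omega> in M. nn_cond_exp M F (\<lambda>\<omega>. ennreal (x \<omega>) * f \<omega>) \<omega> = ennreal (- L x \<omega>)"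
      using key[OF _ x0] x by simp
    ultimately show ?thesis by eventually_elim simp
  qed
  have L1: "(\<lambda>\<omega>. x \<omega> * y \<omega>) \<in> L1_cond M F" if x: "x \<in> X" for x
  proof -
    have [measurable]: "x \<in> borel_measurable M" by (rule X_measurable[OF x])
    \<comment> \<open>The formula for |x| shows that E[|x y| | F] is finite, hence that y lies in
      the dual.\<close>
    have ax: "(\<lambda>\<omega>. \<bar>x \<omega>\<bar>) \<in> X" by (rule X_solid[OF x]) auto
    have "(\<lambda>\<omega>. ennreal \<bar>x \<omega> * y \<omega>\<bar>) = (\<lambda>\<omega>. ennreal (\<bar>x \<omega>\<bar> * - y \<omega>))"
      using yneg by (simp add: abs_mult abs_of_nonpos)
    with nn[OF ax] have "AE \<omega> in M. nn_cond_exp M F (\<lambda>\<omega>. ennreal \<bar>x \<omega> * y \<omega>\<bar>) \<omega> = ennreal (- L (\<lambda>\<omega>. \<bar>x \<omega>\<bar>) \<omega>)" by simp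
    then have "AE \<omega> in M. nn_cond_exp M F (\<lambda>\<omega>. ennreal \<bar>x \<omega> * y \<omega>\<bar>) \<omega> < \<infinity>" by eventually_elim simp
    then show ?thesis unfolding L1_cond_iff by simp
  qed
  then have yY: "y \<in> Y" unfolding koethe_dual_def using yM by blast
  have pos: "AE \<omega> in M. pr x y \<omega> = L x \<omega>" if x: "x \<in> X" and x0: "\<And>\<omega>. 0 \<le> x \<omega>" for x
  proof -
    have L1': "(\<lambda>\<omega>. x \<omega> * - y \<omega>) \<in> L1_cond M F" using L1_cond_uminus[OF L1[OF x]] by simp
    have p: "AE \<omega> in M. 0 \<le> x \<omega> * - y \<omega>" using x0 yneg by (simp add: mult_nonneg_nonpos)
    have "AE \<omega> in M. L x \<omega> \<le> 0" by (rule neg[OF x]) (use x0 in simp)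
    moreover have "AE \<omega> in M. 0 \<le> ce (\<lambda>\<omega>. x \<omega> * - y \<omega>) \<omega>"
      by (rule real_cond_exp_pos[OF p L1_condD[OF L1']])
    moreover have "AE \<omega> in M. ce (\<lambda>\<omega>. - (x \<omega> * y \<omega>)) \<omega> = - pr x y \<omega>" by (rule ce_uminus[OF L1[OF x]])
    ultimately show ?thesis using nn[OF x x0] nn_cond_exp_eq_ce[OF L1' p]
      by eventually_elim simp
  qed
  have "AE \<omega> in M. pr x y \<omega> = L x \<omega>" if x: "x \<in> X" for x
  proof -
    have [measurable]: "x \<in> borel_measurable M" by (rule X_measurable[OF x])
    have xp: "(\<lambda>\<omega>. max (x \<omega>) 0) \<in> X" by (rule X_solid[OF x]) auto
    have xm: "(\<lambda>\<omega>. max (- x \<omega>) 0) \<in> X" by (rule X_solid[OF x]) auto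
    have eq: "max (x \<omega>) 0 - max (- x \<omega>) 0 = x \<omega>" for \<omega> by simp
    have "AE \<omega> in M. pr (\<lambda>\<omega>. max (x \<omega>) 0) y \<omega> = L (\<lambda>\<omega>. max (x \<omega>) 0) \<omega>"
      and "AE \<omega> in M. pr (\<lambda>\<omega>. max (- x \<omega>) 0) y \<omega> = L (\<lambda>\<omega>. max (- x \<omega>) 0) \<omega>"
      by (rule pos[OF xp], simp, rule pos[OF xm], simp)
    with Ldiff[OF xp xm, unfolded eq] XY.pr_diff[OF xp xm yY, unfolded eq] show ?thesis
      by eventually_elim simp
  qed
  with yY show ?thesis by blast
qed

lemma lebesgue_imp_stably_inf_compact:
  assumes leb: "lebesgue_property M X \<rho>"
  shows "stably_inf_compact M F Y (stable_weak_topology M F Y X) \<alpha>"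
  unfolding stably_inf_compact_def
proof (intro ballI impI)
  fix \<eta> :: "'a \<Rightarrow> real" assume \<eta> [measurable]: "\<eta> \<in> borel_measurable F" and ne: "sublevel M Y \<alpha> \<eta> \<noteq> {}"
  define S where "S = sublevel M Y \<alpha> \<eta>"
  have S: "stable_set M F S" unfolding S_def by (rule sublevel_stable[OF ne])
  have SY: "y \<in> Y" and S\<alpha>: "AE \<omega> in M. \<alpha> y \<omega> \<le> ereal (\<eta> \<omega>)" if "y \<in> S" for y
    using that unfolding S_def sublevel_def by auto
  have SD: "y \<in> D" if "y \<in> S" for y by (rule \<alpha>_finite_imp_D[OF SY[OF that] S\<alpha>[OF that]])
  \<comment> \<open>A bound common to the whole sublevel set. For x and -x together it bounds the
    pairing on both sides, and it is inherited by the limit \<open>L\<close>.\<close>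
  have prS: "AE \<omega> in M. pr x y \<omega> \<le> \<rho> x \<omega> + \<eta> \<omega>" if x: "x \<in> X" and y: "y \<in> S" for x y
    using young[OF x SY[OF y]] S\<alpha>[OF y]
  proof eventually_elim
    case (elim \<omega>)
    then have "ereal (pr x y \<omega> - \<rho> x \<omega>) \<le> ereal (\<eta> \<omega>)" by (rule order_trans)
    then show ?case by simp
  qed
  have "\<exists>y\<in>S. cluster_point (stable_weak_topology M F Y X) \<B>\<^sub>0 y" if base: "stable_filter_base_on M F S \<B>\<^sub>0" for \<B>\<^sub>0
  proof -
    obtain \<B> where max: "maximal_stable_filter S \<B>" and B0: "\<B>\<^sub>0 \<subseteq> \<B>"
      using ex_maximal_stable_filter[OF S base] by blast
    have filt: "stable_filter S \<B>" using max unfolding maximal_stable_filter_def by (rule conjunct1)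
    note BS = stable_filterD(2)[OF filt]
    have "\<exists>L\<in>borel_measurable F. \<forall>\<epsilon>\<in>borel_measurable F. (AE \<omega> in M. 0 < \<epsilon> \<omega>) \<longrightarrow>
        (\<exists>B\<in>\<B>. \<forall>y\<in>B. AE \<omega> in M. \<bar>pr x y \<omega> - L \<omega>\<bar> < \<epsilon> \<omega>)" if x: "x \<in> X" for x
    proof (rule maximal_stable_filter_limit[OF S max, of "pr x" "\<lambda>\<omega>. \<bar>\<rho> x \<omega>\<bar> + \<bar>\<rho> (\<lambda>\<omega>. -1 * x \<omega>) \<omega>\<bar> + \<bar>\<eta> \<omega>\<bar>"])
      have mx: "(\<lambda>\<omega>. -1 * x \<omega>) \<in> X" by (rule X_cmult[OF x])
      show "pr x y \<in> borel_measurable F" for y by measurable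
      show "AE \<omega> in M. \<omega> \<in> A \<longrightarrow> pr x y \<omega> = pr x z \<omega>"
        if "y \<in> S" "z \<in> S" "A \<in> sets F" "AE \<omega> in M. \<omega> \<in> A \<longrightarrow> y \<omega> = z \<omega>" for y z A
        by (rule pr_local[OF x x SY[OF that(1)] SY[OF that(2)] that(3) _ that(4)]) simp
      have [measurable]: "\<rho> x \<in> borel_measurable F" "\<rho> (\<lambda>\<omega>. -1 * x \<omega>) \<in> borel_measurable F"
        using \<rho>_F x mx by auto
      show "(\<lambda>\<omega>. \<bar>\<rho> x \<omega>\<bar> + \<bar>\<rho> (\<lambda>\<omega>. -1 * x \<omega>) \<omega>\<bar> + \<bar>\<eta> \<omega>\<bar>) \<in> borel_measurable F" by measurable
      show "AE \<omega> in M. \<bar>pr x y \<omega>\<bar> \<le> \<bar>\<rho> x \<omega>\<bar> + \<bar>\<rho> (\<lambda>\<omega>. -1 * x \<omega>) \<omega>\<bar> + \<bar>\<eta> \<omega>\<bar>" if y: "y \<in> S" for y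
        using prS[OF x y] prS[OF mx y] pr_cmult[OF x SY[OF y], of "-1"] by eventually_elim linarith
    qed
    then have "\<forall>x\<in>X. \<exists>L. L \<in> borel_measurable F \<and> (\<forall>\<epsilon>\<in>borel_measurable F. (AE \<omega> in M. 0 < \<epsilon> \<omega>) \<longrightarrow>
        (\<exists>B\<in>\<B>. \<forall>y\<in>B. AE \<omega> in M. \<bar>pr x y \<omega> - L \<omega>\<bar> < \<epsilon> \<omega>))"
      by (intro ballI) (unfold Bex_def)
    from bchoice[OF this] obtain L where L: "\<forall>x\<in>X. L x \<in> borel_measurable F \<and> (\<forall>\<epsilon>\<in>borel_measurable F. (AE \<omega> in M. 0 < \<epsilon> \<omega>) \<longrightarrow>
        (\<exists>B\<in>\<B>. \<forall>y\<in>B. AE \<omega> in M. \<bar>pr x y \<omega> - L x \<omega>\<bar> < \<epsilon> \<omega>))" ..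
    have LF: "L x \<in> borel_measurable F" if "x \<in> X" for x using L[THEN bspec, OF that] by (rule conjunct1)
    have Llim: "\<exists>B\<in>\<B>. \<forall>y\<in>B. AE \<omega> in M. \<bar>pr x y \<omega> - L x \<omega>\<bar> < \<epsilon> \<omega>"
      if "x \<in> X" "\<epsilon> \<in> borel_measurable F" "AE \<omega> in M. 0 < \<epsilon> \<omega>" for x \<epsilon>
      using L[THEN bspec, OF that(1), THEN conjunct2, THEN bspec, OF that(2)] that(3) by (rule mp)
    have Lfin: "\<exists>B\<in>\<B>. \<forall>y\<in>B. \<forall>x\<in>G. AE \<omega> in M. \<bar>pr x y \<omega> - L x \<omega>\<bar> < \<epsilon> \<omega>"
      if "finite G" "G \<subseteq> X" and e: "\<epsilon> \<in> borel_measurable F" "AE \<omega> in M. 0 < \<epsilon> \<omega>" for G \<epsilon>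
      using that(1,2)
    proof (induction G)
      case empty
      obtain B where "B \<in> \<B>" using stable_filterD(3)[OF filt] by blast
      then show ?case by (intro bexI[of _ B]) simp_all
    next
      case (insert x G)
      then obtain B where B: "B \<in> \<B>" "\<forall>y\<in>B. \<forall>x\<in>G. AE \<omega> in M. \<bar>pr x y \<omega> - L x \<omega>\<bar> < \<epsilon> \<omega>" by auto
      have "x \<in> X" using insert by simp
      from Llim[OF this e] obtain B' where B': "B' \<in> \<B>" "\<forall>y\<in>B'. AE \<omega> in M. \<bar>pr x y \<omega> - L x \<omega>\<bar> < \<epsilon> \<omega>" by (rule bexE)
      from stable_filterD(4)[OF filt B(1) B'(1)] obtain C where C: "C \<in> \<B>" "C \<subseteq> B \<inter> B'" by (rule bexE)
      have "\<forall>y\<in>C. \<forall>z\<in>insert x G. AE \<omega> in M. \<bar>pr z y \<omega> - L z \<omega>\<bar> < \<epsilon> \<omega>"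
      proof (intro ballI)
        fix y z assume "y \<in> C" "z \<in> insert x G"
        moreover have "y \<in> B" "y \<in> B'" using C(2) \<open>y \<in> C\<close> by auto
        ultimately show "AE \<omega> in M. \<bar>pr z y \<omega> - L z \<omega>\<bar> < \<epsilon> \<omega>"
          using B(2)[THEN bspec, of y, THEN bspec, of z] B'(2)[THEN bspec, of y] by (cases "z = x") auto
      qed
      with C(1) show ?case by (intro bexI[of _ C])
    qed
    \<comment> \<open>One element of \<open>S\<close> approximates \<open>L\<close> at finitely many
      points simultaneously, so identities among these points pass to the limit.\<close>
    have approx: "\<exists>y\<in>S. \<forall>x\<in>G. AE \<omega> in M. \<bar>pr x y \<omega> - L x \<omega>\<bar> < 1 / real (Suc n)"
      if G: "finite G" "G \<subseteq> X" for G n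
    proof -
      have "(\<lambda>_. 1 / real (Suc n)) \<in> borel_measurable F" by simp
      moreover have "AE \<omega> in M. 0 < 1 / real (Suc n)" by simp
      ultimately obtain B where B: "B \<in> \<B>" "\<forall>y\<in>B. \<forall>x\<in>G. AE \<omega> in M. \<bar>pr x y \<omega> - L x \<omega>\<bar> < 1 / real (Suc n)"
        using Lfin[OF G] by (elim bexE[rotated]) blast
      obtain y where y: "y \<in> B" using stable_set_nonempty[OF stable_filterD(1)[OF filt B(1)]] by blast
      then have "y \<in> S" using BS[OF B(1)] by blast
      with B(2)[THEN bspec, OF y] show ?thesis by (intro bexI[of _ y])
    qed
    have squeeze: "r \<le> s" if "\<And>n. r \<le> s + c * (1 / real (Suc n))" for r s c :: real
    proof -
      have "(\<lambda>n. s + c * (1 / real (Suc n))) \<longlonglongrightarrow> s + c * 0"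
        by (intro tendsto_intros LIMSEQ_Suc[OF lim_1_over_n])
      from LIMSEQ_le_const[OF this, of r] that show ?thesis by auto
    qed
    have Lle: "AE \<omega> in M. L x \<omega> \<le> \<theta> \<omega>"
      if x: "x \<in> X" and le: "\<And>y. y \<in> S \<Longrightarrow> AE \<omega> in M. pr x y \<omega> \<le> \<theta> \<omega>" for x \<theta>
    proof -
      have "AE \<omega> in M. L x \<omega> \<le> \<theta> \<omega> + 1 * (1 / real (Suc n))" for n
      proof -
        obtain y where y: "y \<in> S" "AE \<omega> in M. \<bar>pr x y \<omega> - L x \<omega>\<bar> < 1 / real (Suc n)"
          using approx[of "{x}" n] x by auto
        from le[OF y(1)] y(2) show ?thesis by eventually_elim linarith
      qed
      then have "AE \<omega> in M. \<forall>n. L x \<omega> \<le> \<theta> \<omega> + 1 * (1 / real (Suc n))" unfolding AE_all_countable by blast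
      then show ?thesis by eventually_elim (rule squeeze, blast)
    qed
    have Lge: "AE \<omega> in M. \<theta> \<omega> \<le> L x \<omega>"
      if x: "x \<in> X" and le: "\<And>y. y \<in> S \<Longrightarrow> AE \<omega> in M. \<theta> \<omega> \<le> pr x y \<omega>" for x \<theta>
    proof -
      have "AE \<omega> in M. \<theta> \<omega> \<le> L x \<omega> + 1 * (1 / real (Suc n))" for n
      proof -
        obtain y where y: "y \<in> S" "AE \<omega> in M. \<bar>pr x y \<omega> - L x \<omega>\<bar> < 1 / real (Suc n)"
          using approx[of "{x}" n] x by auto
        from le[OF y(1)] y(2) show ?thesis by eventually_elim linarith
      qed
      then have "AE \<omega> in M. \<forall>n. \<theta> \<omega> \<le> L x \<omega> + 1 * (1 / real (Suc n))" unfolding AE_all_countable by blast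
      then show ?thesis by eventually_elim (rule squeeze, blast)
    qed
    have L\<rho>: "AE \<omega> in M. L x \<omega> \<le> \<rho> x \<omega> + \<eta> \<omega>" if x: "x \<in> X" for x by (rule Lle[OF x prS[OF x]])
    have oneX: "(\<lambda>_. 1) \<in> X" by (rule X_F) simp
    have lin: "AE \<omega> in M. L (\<lambda>\<omega>. \<zeta> \<omega> * x \<omega> + z \<omega>) \<omega> = \<zeta> \<omega> * L x \<omega> + L z \<omega>"
      if \<zeta>: "\<zeta> \<in> borel_measurable F" and x: "x \<in> X" and z: "z \<in> X" for \<zeta> x z
    proof -
      have \<zeta>x: "(\<lambda>\<omega>. \<zeta> \<omega> * x \<omega>) \<in> X" by (rule X_mult[OF \<zeta> x])
      have w: "(\<lambda>\<omega>. \<zeta> \<omega> * x \<omega> + z \<omega>) \<in> X" by (rule X_add[OF \<zeta>x z])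
      define w where "w = (\<lambda>\<omega>. \<zeta> \<omega> * x \<omega> + z \<omega>)"
      \<comment> \<open>The term with \<zeta> contributes |\<zeta>|/(n+1), the two others 1/(n+1)
        each.\<close>
      have "AE \<omega> in M. \<bar>L w \<omega> - (\<zeta> \<omega> * L x \<omega> + L z \<omega>)\<bar> \<le> 0 + (\<bar>\<zeta> \<omega>\<bar> + 2) * (1 / real (Suc n))" for n
      proof -
        have "\<exists>y\<in>S. \<forall>v\<in>{x, z, w}. AE \<omega> in M. \<bar>pr v y \<omega> - L v \<omega>\<bar> < 1 / real (Suc n)"
          by (rule approx) (use x z w in \<open>simp_all add: w_def\<close>)
        then obtain y where y: "y \<in> S" and "\<forall>v\<in>{x, z, w}. AE \<omega> in M. \<bar>pr v y \<omega> - L v \<omega>\<bar> < 1 / real (Suc n)" by (rule bexE)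
        then have 1: "AE \<omega> in M. \<bar>pr x y \<omega> - L x \<omega>\<bar> < 1 / real (Suc n)" "AE \<omega> in M. \<bar>pr z y \<omega> - L z \<omega>\<bar> < 1 / real (Suc n)"
          "AE \<omega> in M. \<bar>pr w y \<omega> - L w \<omega>\<bar> < 1 / real (Suc n)" by simp_all
        have 2: "AE \<omega> in M. pr w y \<omega> = \<zeta> \<omega> * pr x y \<omega> + pr z y \<omega>"
          unfolding w_def using pr_add[OF \<zeta>x z SY[OF y]] pr_mult[OF \<zeta> x SY[OF y]] by eventually_elim simp
        from 1 2 show ?thesis
        proof eventually_elim
          case (elim \<omega>)
          have "\<bar>\<zeta> \<omega> * (pr x y \<omega> - L x \<omega>)\<bar> \<le> \<bar>\<zeta> \<omega>\<bar> * (1 / real (Suc n))"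
            unfolding abs_mult using elim(1) by (intro mult_left_mono) auto
          moreover have "L w \<omega> - (\<zeta> \<omega> * L x \<omega> + L z \<omega>) = - (pr w y \<omega> - L w \<omega>) + \<zeta> \<omega> * (pr x y \<omega> - L x \<omega>) + (pr z y \<omega> - L z \<omega>)"
            using elim(4) by (simp add: algebra_simps)
          moreover have "(\<bar>\<zeta> \<omega>\<bar> + 2) * (1 / real (Suc n)) = \<bar>\<zeta> \<omega>\<bar> * (1 / real (Suc n)) + 2 * (1 / real (Suc n))"
            by (rule distrib_right)
          ultimately show ?case using elim(2,3) by linarith
        qed
      qed
      then have "AE \<omega> in M. \<forall>n. \<bar>L w \<omega> - (\<zeta> \<omega> * L x \<omega> + L z \<omega>)\<bar> \<le> 0 + (\<bar>\<zeta> \<omega>\<bar> + 2) * (1 / real (Suc n))"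
        unfolding AE_all_countable by blast
      then have "AE \<omega> in M. L w \<omega> = \<zeta> \<omega> * L x \<omega> + L z \<omega>"
      proof eventually_elim
        case (elim \<omega>)
        have "\<bar>L w \<omega> - (\<zeta> \<omega> * L x \<omega> + L z \<omega>)\<bar> \<le> 0" by (rule squeeze) (use elim in blast)
        then show ?case by simp
      qed
      then show ?thesis unfolding w_def .
    qed
    have neg: "AE \<omega> in M. L x \<omega> \<le> 0" if x: "x \<in> X" and x0: "AE \<omega> in M. 0 \<le> x \<omega>" for x
    proof (rule Lle[OF x])
      fix y assume y: "y \<in> S"
      have "AE \<omega> in M. y \<omega> \<le> 0" using SD[OF y] by (simp add: D_iff)
      with x0 have "AE \<omega> in M. x \<omega> * y \<omega> \<le> 0" by eventually_elim (rule mult_nonneg_nonpos)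
      from ce_mono[OF XY_L1[OF x SY[OF y]] L1_cond_F this]
      have "AE \<omega> in M. pr x y \<omega> \<le> ce (\<lambda>_. 0) \<omega>" by simp
      moreover have "AE \<omega> in M. ce (\<lambda>_. 0) \<omega> = 0" by (rule ce_F) simp
      ultimately show "AE \<omega> in M. pr x y \<omega> \<le> 0" by eventually_elim linarith
    qed
    have one: "AE \<omega> in M. L (\<lambda>_. 1) \<omega> = -1"
    proof -
      have eq: "AE \<omega> in M. pr (\<lambda>_. 1) y \<omega> = -1" if "y \<in> S" for y
        using SD[OF that] by (simp add: D_iff)
      have "AE \<omega> in M. L (\<lambda>_. 1) \<omega> \<le> -1"
      proof (rule Lle[OF oneX])
        fix y assume "y \<in> S"
        from eq[OF this] show "AE \<omega> in M. pr (\<lambda>_. 1) y \<omega> \<le> -1" by eventually_elim linarith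
      qed
      moreover have "AE \<omega> in M. -1 \<le> L (\<lambda>_. 1) \<omega>"
      proof (rule Lge[OF oneX])
        fix y assume "y \<in> S"
        from eq[OF this] show "AE \<omega> in M. -1 \<le> pr (\<lambda>_. 1) y \<omega>" by eventually_elim linarith
      qed
      ultimately show ?thesis by eventually_elim simp
    qed
    \<comment> \<open>The bound on \<open>L\<close> at -k u_n reads -k L (u_n) \<le> \<rho> (-k u_n)
      + \<eta>, and the Lebesgue property sends \<rho> (-k u_n) to \<rho> 0. Dividing by a large k
      makes the bound small.\<close>
    have cont: "AE \<omega> in M. (\<lambda>n. L (u n) \<omega>) \<longlonglongrightarrow> 0"
      if u: "\<And>n. u n \<in> X" and dec: "\<And>n. AE \<omega> in M. 0 \<le> u (Suc n) \<omega> \<and> u (Suc n) \<omega> \<le> u n \<omega>"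
        and lim: "AE \<omega> in M. (\<lambda>n. u n \<omega>) \<longlonglongrightarrow> 0" for u
    proof -
      have zeroX: "(\<lambda>_. 0) \<in> X" by (rule X_F) simp
      have dec': "AE \<omega> in M. \<forall>n. 0 \<le> u (Suc n) \<omega> \<and> u (Suc n) \<omega> \<le> u n \<omega>"
        unfolding AE_all_countable using dec by blast
      have bd: "AE \<omega> in M. \<forall>n. 0 \<le> u n \<omega> \<and> u n \<omega> \<le> u 0 \<omega>"
        using dec'
      proof eventually_elim
        case (elim \<omega>)
        have "u n \<omega> \<le> u 0 \<omega>" for n
          by (induction n) (use elim in \<open>auto intro: order_trans\<close>)
        moreover have "0 \<le> u n \<omega>" for n
        proof (cases n)
          case 0
          have "0 \<le> u (Suc 0) \<omega>" "u (Suc 0) \<omega> \<le> u 0 \<omega>" using elim by blast+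
          then show ?thesis using 0 by simp
        qed (use elim in blast)
        ultimately show ?case by blast
      qed
      have conv: "AE \<omega> in M. (\<lambda>n. \<rho> (\<lambda>\<omega>. - real k * u n \<omega>) \<omega>) \<longlonglongrightarrow> \<rho> (\<lambda>_. 0) \<omega>" for k :: nat
      proof -
        have X1: "(\<lambda>\<omega>. - real k * u n \<omega>) \<in> X" for n by (rule X_cmult[OF u])
        have X2: "(\<lambda>\<omega>. real k * u 0 \<omega>) \<in> X" by (rule X_cmult[OF u])
        have l: "AE \<omega> in M. (\<lambda>n. - real k * u n \<omega>) \<longlonglongrightarrow> 0"
          using lim
        proof eventually_elim
          case (elim \<omega>)
          from tendsto_mult_right_zero[OF this, of "- real k"] show ?case .
        qed
        have b: "AE \<omega> in M. \<bar>- real k * u n \<omega>\<bar> \<le> real k * u 0 \<omega>" for n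
          using bd
        proof eventually_elim
          case (elim \<omega>)
          then have "0 \<le> u n \<omega>" "u n \<omega> \<le> u 0 \<omega>" by blast+
          then show ?case by (simp add: abs_mult mult_left_mono)
        qed
        show ?thesis
          using leb[unfolded lebesgue_property_def, THEN spec, of "\<lambda>n \<omega>. - real k * u n \<omega>", THEN spec, of "\<lambda>_. 0",
              THEN spec, of "\<lambda>\<omega>. real k * u 0 \<omega>", THEN mp]
          using X1 X2 zeroX l b by blast
      qed
      have "AE \<omega> in M. \<forall>k n. - (real k * L (u n) \<omega>) \<le> \<rho> (\<lambda>\<omega>. - real k * u n \<omega>) \<omega> + \<eta> \<omega>"
        unfolding AE_all_countable
      proof (intro allI)
        fix k n :: nat
        have cF: "(\<lambda>_. - real k) \<in> borel_measurable F" and c1: "(\<lambda>_. 1::real) \<in> borel_measurable F" by simp_all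
        have "AE \<omega> in M. L (\<lambda>_. 0) \<omega> = 0" using lin[OF c1 zeroX zeroX] by eventually_elim simp
        with lin[OF cF u[of n] zeroX] L\<rho>[OF X_cmult[OF u[of n], of "- real k"]]
        show "AE \<omega> in M. - (real k * L (u n) \<omega>) \<le> \<rho> (\<lambda>\<omega>. - real k * u n \<omega>) \<omega> + \<eta> \<omega>"
          by eventually_elim simp
      qed
      moreover have "AE \<omega> in M. \<forall>k. (\<lambda>n. \<rho> (\<lambda>\<omega>. - real k * u n \<omega>) \<omega>) \<longlonglongrightarrow> \<rho> (\<lambda>_. 0) \<omega>"
        unfolding AE_all_countable using conv by blast
      moreover have "AE \<omega> in M. L (u n) \<omega> \<le> 0" for n
        by (rule neg[OF u]) (use bd in eventually_elim, blast)
      then have "AE \<omega> in M. \<forall>n. L (u n) \<omega> \<le> 0" unfolding AE_all_countable by blast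
      ultimately show ?thesis
      proof eventually_elim
        case (elim \<omega>)
        show ?case
        proof (rule LIMSEQ_I)
          fix r :: real assume r: "0 < r"
          \<comment> \<open>The summand 1 is the deviation allowed between \<rho> (-k u_n) and
            \<rho> 0.\<close>
          obtain k :: nat where k: "\<rho> (\<lambda>_. 0) \<omega> + 1 + \<eta> \<omega> < real k * r"
            using reals_Archimedean3[OF r] by blast
          obtain no where no: "\<And>n. n \<ge> no \<Longrightarrow> norm (\<rho> (\<lambda>\<omega>. - real k * u n \<omega>) \<omega> - \<rho> (\<lambda>_. 0) \<omega>) < 1"
            using LIMSEQ_D[OF elim(2)[THEN spec, of k], of 1] by auto
          have "norm (L (u n) \<omega> - 0) < r" if "n \<ge> no" for n
          proof -
            have "- (real k * L (u n) \<omega>) \<le> \<rho> (\<lambda>\<omega>. - real k * u n \<omega>) \<omega> + \<eta> \<omega>" using elim(1) by blast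
            with no[OF that] k have "real k * (- L (u n) \<omega>) < real k * r"
              unfolding mult_minus_right real_norm_def by linarith
            then have "- L (u n) \<omega> < r" by (rule mult_left_less_imp_less) simp
            moreover have "L (u n) \<omega> \<le> 0" using elim(3) by blast
            ultimately show ?thesis by simp
          qed
          then show "\<exists>no. \<forall>n\<ge>no. norm (L (u n) \<omega> - 0) < r" by blast
        qed
      qed
    qed
    from functional_representation[OF LF lin neg one cont]
    obtain y where y: "y \<in> Y" and yL': "\<forall>x\<in>X. AE \<omega> in M. pr x y \<omega> = L x \<omega>" by (rule bexE)
    note yL = yL'[THEN bspec]
    have "AE \<omega> in M. \<alpha> y \<omega> \<le> ereal (\<eta> \<omega>)"
    proof (rule \<alpha>_least[OF y])
      fix x assume x: "x \<in> X"
      from yL[OF x] L\<rho>[OF x] show "AE \<omega> in M. ereal (pr x y \<omega> - \<rho> x \<omega>) \<le> ereal (\<eta> \<omega>)" by eventually_elim simp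
    qed measurable
    then have yS: "y \<in> S" using y unfolding S_def sublevel_def by simp
    have Xne: "X \<noteq> {}" using oneX by blast
    have "y \<in> stable_weak_topology M F Y X closure_of C" if C: "C \<in> \<B>\<^sub>0" for C
      unfolding in_closure_of
    proof (intro conjI allI impI)
      show "y \<in> topspace (stable_weak_topology M F Y X)" unfolding YX.topspace_stable_weak[OF Xne] by (rule y)
      fix W assume "y \<in> W \<and> openin (stable_weak_topology M F Y X) W"
      then have W: "openin (stable_weak_topology M F Y X) W" "y \<in> W" by simp_all
      from YX.open_contains_basic[OF W] obtain Fs a \<epsilon> where wd: "YX.weak_data Fs a \<epsilon>"
        and sub: "\<forall>z'\<in>Y. YX.close Fs a \<epsilon> y z' \<longrightarrow> z' \<in> W" by (elim exE conjE) (rule that)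
      have Fs: "finite (Fs k)" "Fs k \<subseteq> X" for k using wd unfolding YX.weak_data_def by auto
      have a: "event_partition M F a" and e: "\<epsilon> \<in> borel_measurable F" "AE \<omega> in M. 0 < \<epsilon> \<omega>"
        using wd unfolding YX.weak_data_def by auto
      \<comment> \<open>The neighbourhood tests another finite set on each member of the partition.
        Concatenating the sets of the filter that belong to these finite sets gives a set of the
        filter, which therefore meets \<open>C\<close>.\<close>
      have "\<exists>B. B \<in> \<B> \<and> (\<forall>y\<in>B. \<forall>x\<in>Fs k. AE \<omega> in M. \<bar>pr x y \<omega> - L x \<omega>\<bar> < \<epsilon> \<omega>)" for k
        using Lfin[OF Fs e, of k] unfolding Bex_def .
      from choice[OF allI[OF this]] obtain B
        where B': "\<forall>k. B k \<in> \<B> \<and> (\<forall>y\<in>B k. \<forall>x\<in>Fs k. AE \<omega> in M. \<bar>pr x y \<omega> - L x \<omega>\<bar> < \<epsilon> \<omega>)" ..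
      have B: "B k \<in> \<B>" for k using B'[THEN spec] by (rule conjunct1)
      have Bl: "AE \<omega> in M. \<bar>pr x y \<omega> - L x \<omega>\<bar> < \<epsilon> \<omega>" if "y \<in> B k" "x \<in> Fs k" for k x y
        using B'[THEN spec, THEN conjunct2, THEN bspec, OF that(1), THEN bspec, OF that(2)] .
      have "concat_sets M a B \<in> \<B>" by (rule stable_filterD(5)[OF filt a B])
      moreover have "C \<in> \<B>" using C B0 by blast
      ultimately obtain E where E: "E \<in> \<B>" "E \<subseteq> concat_sets M a B \<inter> C"
        using stable_filterD(4)[OF filt] by (elim bexE[rotated]) blast
      obtain z where zE: "z \<in> E" using stable_set_nonempty[OF stable_filterD(1)[OF filt E(1)]] by blast
      then have zC: "z \<in> C" and "z \<in> concat_sets M a B" using E(2) by auto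
      from concat_setsE[OF a this(2)] obtain b where b: "\<And>k. b k \<in> B k"
        and zb: "\<And>k. AE \<omega> in M. \<omega> \<in> a k \<longrightarrow> z \<omega> = b k \<omega>" by metis
      have zY: "z \<in> Y" using zE BS[OF E(1)] SY by blast
      have bY: "b k \<in> Y" for k using b[of k] BS[OF B[of k]] SY by blast
      have "YX.close Fs a \<epsilon> y z"
        unfolding YX.close_iff[OF wd y zY]
      proof (intro allI ballI)
        fix k x assume x: "x \<in> Fs k"
        then have xX: "x \<in> X" using Fs by blast
        have "AE \<omega> in M. \<omega> \<in> a k \<longrightarrow> pr x z \<omega> = pr x (b k) \<omega>"
          by (rule pr_local[OF xX xX zY bY partition_sets[OF a] _ zb]) simp
        with Bl[OF b x] yL[OF xX]
        show "AE \<omega> in M. \<omega> \<in> a k \<longrightarrow> \<bar>YX.pr z x \<omega> - YX.pr y x \<omega>\<bar> < \<epsilon> \<omega>"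
          unfolding mult.commute[of _ "x _"] by eventually_elim simp
      qed
      then have "z \<in> W" using sub zY by blast
      with zC show "\<exists>z. z \<in> C \<and> z \<in> W" by blast
    qed
    with yS show ?thesis unfolding cluster_point_def by blast
  qed
  with S show "stably_compact M F (stable_weak_topology M F Y X) (sublevel M Y \<alpha> \<eta>)"
    unfolding stably_compact_def S_def by blast
qed

end

theorem theorem3p3:
  fixes M F :: "'a measure" and X :: "('a \<Rightarrow> real) set" and \<rho> :: "('a \<Rightarrow> real) \<Rightarrow> 'a \<Rightarrow> real"
  assumes "prob_space M" and "subalgebra M F"
    and "model_module M F X" and "cond_risk_measure M F X \<rho>"
  shows "(representable M F X \<rho> \<longleftrightarrow>
            lower_semicont M F X (stable_weak_topology M F X (koethe_dual M F X))
              (\<lambda>x \<omega>. ereal (\<rho> x \<omega>))) \<and>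
         (representable M F X \<rho> \<longrightarrow>
            (attains_representation M F X \<rho> \<longleftrightarrow> lebesgue_property M X \<rho>) \<and>
            (lebesgue_property M X \<rho> \<longleftrightarrow>
               stably_inf_compact M F (koethe_dual M F X)
                 (stable_weak_topology M F (koethe_dual M F X) X) (fenchel M F X \<rho>)))"
proof -
  interpret prob_space M by fact
  interpret conditional_risk M F X \<rho> by unfold_locales fact+
  show ?thesis
    using representable_imp_lower_semicont lower_semicont_imp_representable
      attained_imp_lebesgue lebesgue_imp_stably_inf_compact stably_inf_compact_imp_attained
    by blast
qed

end
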